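(* The bialgebra $((\mathrm{Sym}\,L)[\mathrm h],*_{\mathrm h},\Delta_{\mathrm h})$ is a Hopf algebra over $\mathbf k[\mathrm h]$ whose antipode is the $\mathbf k[\mathrm h]$-linear map given by $$S(P_1\&P_2\&\cdots\&P_m)=(-1)^mP_1\&P_2\&\cdots\&P_m,$$ where each $P_i\in L$ is a necklace (a cyclic monomial or a vertex idempotent). In particular $S^2=\mathrm{Id}$.
   Context: Let $\mathbf k$ be a field of characteristic $0$ and $Q$ a quiver with vertex set $I$. Tensor products are over $\mathbf k[\mathrm h]$. The double $\overline Q$ has edges $e,e^*$ for $e\in Q$, with $e^*$ the reverse of $e$, $(e^* )^*=e$; $*$ is edge reversal. $L$ is the $\mathbf k$-space with basis the cyclic paths (necklaces) in $\overline Q$ up to rotation, including the trivial path (vertex idempotent) at each vertex. $\mathrm{Sym}\,L$ (product $\&$) has basis the collections $P=P_1\&\cdots\&P_k\&v_1\&\cdots\&v_q$, $P_i=a_{i1}\cdots a_{il_i}$ necklaces of positive length, $v_s\in I$. Abstract edges: $X=\{(i,j):1\le i\le k,1\le j\le l_i\}$, $\mathrm{pr}_X(i,j)=a_{ij}$, $(i,j)+1=(i,j+1)$ with $j$ modulo $l_i$. **Cutting and gluing.** Let $J\subset X$ with involution $\phi:J\to J$ such that $\mathrm{pr}_X\circ\phi=*\circ\mathrm{pr}_X$. Let $f(x)=x+1$ for $x\notin J$, $f(x)=\phi(x)+1$ for $x\in J$. The glued collection $R_1\&\cdots\&R_m$ has one member per orbit of $f$ (the necklace of the edges of the orbit not in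 $J$ in order, or the trivial path at the start vertex of any edge of the orbit if the orbit lies in $J$), together with the original trivial paths. $g(x)$ is the index of the member given by the $f$-orbit of $x$. **Product.** $P*_{\mathrm h}R=\sum_{(I_X,I_Y,\phi)}\frac{\mathrm h^{\#I_X}}{2^{\#I_X}}(-1)^{\#(I_Y\cap\mathrm{pr}_Y^{-1}(Q))}PR_{I_X,I_Y,\phi}$, over subsets $I_X,I_Y$ of the abstract edges $X,Y$ of $P,R$ and bijections $\phi:I_X\to I_Y$ with $\mathrm{pr}_Y\circ\phi=*\circ\mathrm{pr}_X$; $PR_{I_X,I_Y,\phi}$ is $P\&R$ cut and glued along $I_X\sqcup I_Y$ with $\phi$ extended to an involution; extend $\mathbf k[\mathrm h]$-bilinearly. **Coproduct.** $\Delta_{\mathrm h}(P)=\sum_{(J,\phi)}\frac{\mathrm h^{\#J/2}}{2^{\#J/2}}\sum_{\mathbf c\in\{1,2\}^m}s(\mathbf c,J,\phi)R_1^{c_1}\&\cdots\&R_m^{c_m}$ over all pairs $(J,\phi)$ consisting of a subset $J\subset X$ and an involution $\phi:J\to J$ with $\mathrm{pr}_X\circ\phi=*\circ\mathrm{pr}_X$, where $R^1=R\otimes1$, $R^2=1\otimes R$, $(A\otimes B)\&(A'\otimes B')=(A\&A')\otimes(B\&B')$, and, writing $J=\{x_1,\phi(x_1),\dots,x_N,\phi(x_N)\}$ with $\mathrm{pr}_X(x_i)\in Q$, $s(\mathbf c,J,\phi)=\prod_is_i$ with $s_i=1,0,-1$ according as $c_{g(x_i)}<,=,>c_{g(x_i+1)}$;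 extend $\mathbf k[\mathrm h]$-linearly. The unit is the empty collection; the counit sends the empty collection to $1$ and every other collection to $0$. *)

theory Defs
  imports
    "HOL-Computational_Algebra.Polynomial"
    "HOL-Library.Multiset"
    "HOL-Library.FuncSet"
    "HOL-Library.Poly_Mapping"
    "HOL-Combinatorics.Orbits"
    "Graph_Theory.Arc_Walk"
begin

section \<open>Free modules, and Hopf algebras on them\<close>

text \<open>
  The free module over a commutative ring with basis \<open>B\<close> is the set \<open>free_mod B\<close> of finitely
  supported functions whose support lies in \<open>B\<close>. Its tensor square is \<open>free_mod (B \<times> B)\<close>,
  with \<open>tensor p q\<close> as the pure tensors.
\<close>

definition free_mod :: "'b set \<Rightarrow> ('b \<Rightarrow>\<^sub>0 'r::comm_ring_1) set" where
  "free_mod B = {p. Poly_Mapping.keys p \<subseteq> B}"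

abbreviation basis_vec :: "'b \<Rightarrow> ('b \<Rightarrow>\<^sub>0 'r::comm_ring_1)" where
  "basis_vec b \<equiv> Poly_Mapping.single b 1"

definition scl :: "'r::comm_ring_1 \<Rightarrow> ('b \<Rightarrow>\<^sub>0 'r) \<Rightarrow> ('b \<Rightarrow>\<^sub>0 'r)" where
  "scl r p = Poly_Mapping.map ((*) r) p"

definition lin_ext :: "('b \<Rightarrow> ('c \<Rightarrow>\<^sub>0 'r)) \<Rightarrow> ('b \<Rightarrow>\<^sub>0 'r::comm_ring_1) \<Rightarrow> ('c \<Rightarrow>\<^sub>0 'r)" where
  "lin_ext F p = (\<Sum>b\<in>Poly_Mapping.keys p. scl (Poly_Mapping.lookup p b) (F b))"

definition bilin_ext ::
  "('a \<Rightarrow> 'b \<Rightarrow> ('c \<Rightarrow>\<^sub>0 'r)) \<Rightarrow> ('a \<Rightarrow>\<^sub>0 'r::comm_ring_1) \<Rightarrow> ('b \<Rightarrow>\<^sub>0 'r) \<Rightarrow> ('c \<Rightarrow>\<^sub>0 'r)" where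
  "bilin_ext F p q = lin_ext (\<lambda>a. lin_ext (F a) q) p"

definition tensor :: "('a \<Rightarrow>\<^sub>0 'r::comm_ring_1) \<Rightarrow> ('b \<Rightarrow>\<^sub>0 'r) \<Rightarrow> ('a \<times> 'b \<Rightarrow>\<^sub>0 'r)" where
  "tensor = bilin_ext (\<lambda>a b. basis_vec (a, b))"

definition tensor_map ::
  "(('a \<Rightarrow>\<^sub>0 'r) \<Rightarrow> ('c \<Rightarrow>\<^sub>0 'r)) \<Rightarrow> (('b \<Rightarrow>\<^sub>0 'r) \<Rightarrow> ('d \<Rightarrow>\<^sub>0 'r)) \<Rightarrow>
    ('a \<times> 'b \<Rightarrow>\<^sub>0 'r::comm_ring_1) \<Rightarrow> ('c \<times> 'd \<Rightarrow>\<^sub>0 'r)" where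
  "tensor_map F G = lin_ext (\<lambda>(a, b). tensor (F (basis_vec a)) (G (basis_vec b)))"

definition tensor_assoc :: "(('a \<times> 'b) \<times> 'c \<Rightarrow>\<^sub>0 'r::comm_ring_1) \<Rightarrow> ('a \<times> 'b \<times> 'c \<Rightarrow>\<^sub>0 'r)" where
  "tensor_assoc = lin_ext (\<lambda>((a, b), c). basis_vec (a, b, c))"

definition mult_map ::
  "(('b \<Rightarrow>\<^sub>0 'r) \<Rightarrow> ('b \<Rightarrow>\<^sub>0 'r) \<Rightarrow> ('b \<Rightarrow>\<^sub>0 'r)) \<Rightarrow> ('b \<times> 'b \<Rightarrow>\<^sub>0 'r::comm_ring_1) \<Rightarrow> ('b \<Rightarrow>\<^sub>0 'r)" where
  "mult_map mul = lin_ext (\<lambda>(a, b). mul (basis_vec a) (basis_vec b))"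

definition tensor_mult ::
  "(('b \<Rightarrow>\<^sub>0 'r) \<Rightarrow> ('b \<Rightarrow>\<^sub>0 'r) \<Rightarrow> ('b \<Rightarrow>\<^sub>0 'r)) \<Rightarrow>
    ('b \<times> 'b \<Rightarrow>\<^sub>0 'r::comm_ring_1) \<Rightarrow> ('b \<times> 'b \<Rightarrow>\<^sub>0 'r) \<Rightarrow> ('b \<times> 'b \<Rightarrow>\<^sub>0 'r)" where
  "tensor_mult mul = bilin_ext (\<lambda>(a, b) (c, d).
     tensor (mul (basis_vec a) (basis_vec c)) (mul (basis_vec b) (basis_vec d)))"

locale free_algebra_on =
  fixes B :: "'b set"
    and mul :: "('b \<Rightarrow>\<^sub>0 'r::comm_ring_1) \<Rightarrow> ('b \<Rightarrow>\<^sub>0 'r) \<Rightarrow> ('b \<Rightarrow>\<^sub>0 'r)"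
    and un :: "'b \<Rightarrow>\<^sub>0 'r"
  assumes mul_closed: "\<lbrakk>p \<in> free_mod B; q \<in> free_mod B\<rbrakk> \<Longrightarrow> mul p q \<in> free_mod B"
    and mul_add_left: "\<lbrakk>p \<in> free_mod B; q \<in> free_mod B; s \<in> free_mod B\<rbrakk> \<Longrightarrow>
          mul (p + q) s = mul p s + mul q s"
    and mul_add_right: "\<lbrakk>p \<in> free_mod B; q \<in> free_mod B; s \<in> free_mod B\<rbrakk> \<Longrightarrow>
          mul p (q + s) = mul p q + mul p s"
    and mul_scl_left: "\<lbrakk>p \<in> free_mod B; q \<in> free_mod B\<rbrakk> \<Longrightarrow> mul (scl r p) q = scl r (mul p q)"
    and mul_scl_right: "\<lbrakk>p \<in> free_mod B; q \<in> free_mod B\<rbrakk> \<Longrightarrow> mul p (scl r q) = scl r (mul p q)"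
    and mul_assoc: "\<lbrakk>p \<in> free_mod B; q \<in> free_mod B; s \<in> free_mod B\<rbrakk> \<Longrightarrow>
          mul (mul p q) s = mul p (mul q s)"
    and un_closed: "un \<in> free_mod B"
    and mul_un_left: "p \<in> free_mod B \<Longrightarrow> mul un p = p"
    and mul_un_right: "p \<in> free_mod B \<Longrightarrow> mul p un = p"

locale free_coalgebra_on =
  fixes B :: "'b set"
    and cop :: "('b \<Rightarrow>\<^sub>0 'r::comm_ring_1) \<Rightarrow> ('b \<times> 'b \<Rightarrow>\<^sub>0 'r)"
    and cou :: "('b \<Rightarrow>\<^sub>0 'r) \<Rightarrow> 'r"
  assumes cop_closed: "p \<in> free_mod B \<Longrightarrow> cop p \<in> free_mod (B \<times> B)"
    and cop_add: "\<lbrakk>p \<in> free_mod B; q \<in> free_mod B\<rbrakk> \<Longrightarrow> cop (p + q) = cop p + cop q"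
    and cop_scl: "p \<in> free_mod B \<Longrightarrow> cop (scl r p) = scl r (cop p)"
    and cou_add: "\<lbrakk>p \<in> free_mod B; q \<in> free_mod B\<rbrakk> \<Longrightarrow> cou (p + q) = cou p + cou q"
    and cou_scl: "p \<in> free_mod B \<Longrightarrow> cou (scl r p) = r * cou p"
    and coassoc: "p \<in> free_mod B \<Longrightarrow>
          tensor_assoc (tensor_map cop id (cop p)) = tensor_map id cop (cop p)"
    and cou_left: "p \<in> free_mod B \<Longrightarrow>
          lin_ext (\<lambda>(a, b). scl (cou (basis_vec a)) (basis_vec b)) (cop p) = p"
    and cou_right: "p \<in> free_mod B \<Longrightarrow>
          lin_ext (\<lambda>(a, b). scl (cou (basis_vec b)) (basis_vec a)) (cop p) = p"

locale free_bialgebra_on =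
  free_algebra_on B mul un + free_coalgebra_on B cop cou
  for B :: "'b set"
    and mul :: "('b \<Rightarrow>\<^sub>0 'r::comm_ring_1) \<Rightarrow> ('b \<Rightarrow>\<^sub>0 'r) \<Rightarrow> ('b \<Rightarrow>\<^sub>0 'r)"
    and un :: "'b \<Rightarrow>\<^sub>0 'r"
    and cop :: "('b \<Rightarrow>\<^sub>0 'r) \<Rightarrow> ('b \<times> 'b \<Rightarrow>\<^sub>0 'r)"
    and cou :: "('b \<Rightarrow>\<^sub>0 'r) \<Rightarrow> 'r" +
  assumes cop_mul: "\<lbrakk>p \<in> free_mod B; q \<in> free_mod B\<rbrakk> \<Longrightarrow>
            cop (mul p q) = tensor_mult mul (cop p) (cop q)"
    and cop_un: "cop un = tensor un un"
    and cou_mul: "\<lbrakk>p \<in> free_mod B; q \<in> free_mod B\<rbrakk> \<Longrightarrow> cou (mul p q) = cou p * cou q"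
    and cou_un: "cou un = 1"

locale free_hopf_algebra_on =
  free_bialgebra_on B mul un cop cou
  for B :: "'b set"
    and mul :: "('b \<Rightarrow>\<^sub>0 'r::comm_ring_1) \<Rightarrow> ('b \<Rightarrow>\<^sub>0 'r) \<Rightarrow> ('b \<Rightarrow>\<^sub>0 'r)"
    and un :: "'b \<Rightarrow>\<^sub>0 'r"
    and cop :: "('b \<Rightarrow>\<^sub>0 'r) \<Rightarrow> ('b \<times> 'b \<Rightarrow>\<^sub>0 'r)"
    and cou :: "('b \<Rightarrow>\<^sub>0 'r) \<Rightarrow> 'r" +
  fixes antip :: "('b \<Rightarrow>\<^sub>0 'r) \<Rightarrow> ('b \<Rightarrow>\<^sub>0 'r)"
  assumes antip_closed: "p \<in> free_mod B \<Longrightarrow> antip p \<in> free_mod B"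
    and antip_add: "\<lbrakk>p \<in> free_mod B; q \<in> free_mod B\<rbrakk> \<Longrightarrow> antip (p + q) = antip p + antip q"
    and antip_scl: "p \<in> free_mod B \<Longrightarrow> antip (scl r p) = scl r (antip p)"
    and antip_left: "p \<in> free_mod B \<Longrightarrow>
          mult_map mul (tensor_map antip id (cop p)) = scl (cou p) un"
    and antip_right: "p \<in> free_mod B \<Longrightarrow>
          mult_map mul (tensor_map id antip (cop p)) = scl (cou p) un"


section \<open>The double of a quiver, and necklaces\<close>

text \<open>A quiver is a \<open>pre_digraph\<close> satisfying \<open>wf_digraph\<close>; vertices and arcs may be infinite in
  number, and loops and multiple arcs are allowed.\<close>

datatype 'e darc = Fwd 'e | Rev 'e

primrec star :: "'e darc \<Rightarrow> 'e darc" where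
  "star (Fwd e) = Rev e"
| "star (Rev e) = Fwd e"

definition double :: "('v, 'e) pre_digraph \<Rightarrow> ('v, 'e darc) pre_digraph" where
  "double Q = \<lparr> verts = verts Q, arcs = Fwd ` arcs Q \<union> Rev ` arcs Q,
     tail = case_darc (tail Q) (head Q), head = case_darc (head Q) (tail Q) \<rparr>"

datatype ('v, 'a) cpath = Triv 'v | Cycle "'a list"

primrec arcs_of :: "('v, 'a) cpath \<Rightarrow> 'a list" where
  "arcs_of (Triv v) = []"
| "arcs_of (Cycle p) = p"

inductive rotated :: "('v, 'a) cpath \<Rightarrow> ('v, 'a) cpath \<Rightarrow> bool" where
  "rotated (Triv v) (Triv v)"
| "rotated (Cycle p) (Cycle (rotate n p))"

lemma equivp_rotated: "equivp (rotated :: ('v, 'a) cpath \<Rightarrow> _)"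
proof (rule equivpI)
  show "reflp (rotated :: ('v, 'a) cpath \<Rightarrow> _)"
  proof (rule reflpI)
    fix x :: "('v, 'a) cpath"
    show "rotated x x"
      using rotated.intros(1) rotated.intros(2)[of _ 0] by (cases x) auto
  qed
  show "symp (rotated :: ('v, 'a) cpath \<Rightarrow> _)"
  proof (rule sympI)
    fix x y :: "('v, 'a) cpath"
    assume "rotated x y"
    then show "rotated y x"
    proof cases
      case (2 p n)
      have "rotate (length p - n mod length p) (rotate n p) = p"
      proof (cases "p = []")
        case False
        then have "n mod length p < length p" by simp
        then have "rotate (length p - n mod length p) (rotate (n mod length p) p) = rotate (length p) p"
          by (simp add: rotate_rotate)
        then show ?thesis by (simp add: rotate_conv_mod[of n p, symmetric])
      qed simp
      then show ?thesis using 2 rotated.intros(2)[of "rotate n p"] by metis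
    qed (auto intro: rotated.intros)
  qed
  show "transp (rotated :: ('v, 'a) cpath \<Rightarrow> _)"
  proof (rule transpI)
    fix x y z :: "('v, 'a) cpath"
    assume "rotated x y" "rotated y z"
    then show "rotated x z"
      by (elim rotated.cases) (auto simp: rotate_rotate intro: rotated.intros)
  qed
qed

quotient_type ('v, 'a) necklace = "('v, 'a) cpath" / rotated
  by (rule equivp_rotated)

text \<open>\<open>awalk u p u\<close> says that \<open>p\<close> is a path from \<open>u\<close> to \<open>u\<close>; consecutive arcs of a path \<open>a\<^sub>1 a\<^sub>2 \<dots>\<close>
  satisfy \<open>head a\<^sub>i = tail a\<^sub>i\<^sub>+\<^sub>1\<close>.\<close>

definition cyclic_path :: "('v, 'e) pre_digraph \<Rightarrow> ('v, 'e darc) cpath \<Rightarrow> bool" where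
  "cyclic_path Q c \<longleftrightarrow> (case c of
       Triv v \<Rightarrow> v \<in> verts Q
     | Cycle p \<Rightarrow> p \<noteq> [] \<and> (\<exists>u. pre_digraph.awalk (double Q) u p u))"

definition necklaces :: "('v, 'e) pre_digraph \<Rightarrow> ('v, 'e darc) necklace set" where
  "necklaces Q = abs_necklace ` {c. cyclic_path Q c}"

type_synonym ('v, 'e) collection = "('v, 'e darc) necklace multiset"

text \<open>The basis of \<open>Sym L\<close>. Hence \<open>(Sym L)[h]\<close> is \<open>free_mod (collections Q)\<close> with coefficients in
  \<open>'k poly\<close>, the indeterminate of \<open>'k poly\<close> being \<open>h\<close>.\<close>

definition collections :: "('v, 'e) pre_digraph \<Rightarrow> ('v, 'e) collection set" where
  "collections Q = {P. set_mset P \<subseteq> necklaces Q}"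


section \<open>Cutting and gluing\<close>

text \<open>Abstract edges need an order of the necklaces in a collection and a starting point on each of
  them. An arbitrary such presentation is fixed; the product and coproduct below do not depend on
  it. Indices start at 0.\<close>

definition presentation :: "('v, 'e) collection \<Rightarrow> ('v, 'e darc) cpath list" where
  "presentation P = (SOME xs. mset (map abs_necklace xs) = P)"

definition abstract_edges :: "('v, 'a) cpath list \<Rightarrow> (nat \<times> nat) set" where
  "abstract_edges xs = {(i, j). i < length xs \<and> j < length (arcs_of (xs ! i))}"

definition pr :: "('v, 'a) cpath list \<Rightarrow> nat \<times> nat \<Rightarrow> 'a" where
  "pr xs = (\<lambda>(i, j). arcs_of (xs ! i) ! j)"

definition next_edge :: "('v, 'a) cpath list \<Rightarrow> nat \<times> nat \<Rightarrow> nat \<times> nat" where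
  "next_edge xs = (\<lambda>(i, j). (i, Suc j mod length (arcs_of (xs ! i))))"

definition glue_step ::
  "('v, 'a) cpath list \<Rightarrow> (nat \<times> nat) set \<Rightarrow> (nat \<times> nat \<Rightarrow> nat \<times> nat) \<Rightarrow> nat \<times> nat \<Rightarrow> nat \<times> nat" where
  "glue_step xs J \<phi> x = (if x \<in> J then next_edge xs (\<phi> x) else next_edge xs x)"

text \<open>Members of the glued collection are indexed by \<open>Inl W\<close> for an orbit \<open>W\<close> of \<open>glue_step\<close>, and by
  \<open>Inr i\<close> for an original trivial path at position \<open>i\<close>.\<close>

type_synonym member_index = "(nat \<times> nat) set + nat"

definition members ::
  "('v, 'a) cpath list \<Rightarrow> (nat \<times> nat) set \<Rightarrow> (nat \<times> nat \<Rightarrow> nat \<times> nat) \<Rightarrow> member_index set" where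
  "members xs J \<phi> =
     Inl ` (orbit (glue_step xs J \<phi>) ` abstract_edges xs) \<union>
     Inr ` {i. i < length xs \<and> (\<exists>v. xs ! i = Triv v)}"

definition member_of ::
  "('v, 'a) cpath list \<Rightarrow> (nat \<times> nat) set \<Rightarrow> (nat \<times> nat \<Rightarrow> nat \<times> nat) \<Rightarrow> nat \<times> nat \<Rightarrow> member_index" where
  "member_of xs J \<phi> x = Inl (orbit (glue_step xs J \<phi>) x)"

definition orbit_necklace ::
  "('v, 'e) pre_digraph \<Rightarrow> ('v, 'e darc) cpath list \<Rightarrow> (nat \<times> nat) set \<Rightarrow>
    (nat \<times> nat \<Rightarrow> nat \<times> nat) \<Rightarrow> (nat \<times> nat) set \<Rightarrow> ('v, 'e darc) necklace" where
  "orbit_necklace Q xs J \<phi> W =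
     (let x = (SOME x. x \<in> W);
          ys = filter (\<lambda>y. y \<notin> J) (map (\<lambda>n. (glue_step xs J \<phi> ^^ n) x) [0..<card W])
      in abs_necklace
           (if ys = [] then Triv (tail (double Q) (pr xs x)) else Cycle (map (pr xs) ys)))"

definition glued_necklace ::
  "('v, 'e) pre_digraph \<Rightarrow> ('v, 'e darc) cpath list \<Rightarrow> (nat \<times> nat) set \<Rightarrow>
    (nat \<times> nat \<Rightarrow> nat \<times> nat) \<Rightarrow> member_index \<Rightarrow> ('v, 'e darc) necklace" where
  "glued_necklace Q xs J \<phi> r =
     (case r of Inl W \<Rightarrow> orbit_necklace Q xs J \<phi> W | Inr i \<Rightarrow> abs_necklace (xs ! i))"

definition glued_collection ::
  "('v, 'e) pre_digraph \<Rightarrow> ('v, 'e darc) cpath list \<Rightarrow> (nat \<times> nat) set \<Rightarrow>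
    (nat \<times> nat \<Rightarrow> nat \<times> nat) \<Rightarrow> member_index set \<Rightarrow> ('v, 'e) collection" where
  "glued_collection Q xs J \<phi> M = image_mset (glued_necklace Q xs J \<phi>) (mset_set M)"


section \<open>The Hopf algebra structure\<close>

text \<open>\<open>half_h n\<close> is \<open>h\<^sup>n / 2\<^sup>n\<close>.\<close>

definition half_h :: "nat \<Rightarrow> 'k::field_char_0 poly" where
  "half_h n = monom (1 / 2 ^ n) n"

text \<open>The abstract edges of \<open>P\<close> and \<open>R\<close> are those of the concatenated presentation with first index
  below, respectively at least, the number of necklaces in \<open>P\<close>. Functions are taken extensional, so
  that each triple \<open>(A, B, \<phi>)\<close> is counted once.\<close>

definition contractions ::
  "('v, 'e darc) cpath list \<Rightarrow> ('v, 'e darc) cpath list \<Rightarrow>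
    ((nat \<times> nat) set \<times> (nat \<times> nat) set \<times> (nat \<times> nat \<Rightarrow> nat \<times> nat)) set" where
  "contractions xs ys = {(A, B, \<phi>).
     A \<subseteq> {(i, j) \<in> abstract_edges (xs @ ys). i < length xs} \<and>
     B \<subseteq> {(i, j) \<in> abstract_edges (xs @ ys). length xs \<le> i} \<and>
     \<phi> \<in> A \<rightarrow>\<^sub>E B \<and> bij_betw \<phi> A B \<and>
     (\<forall>x\<in>A. pr (xs @ ys) (\<phi> x) = star (pr (xs @ ys) x))}"

definition to_involution ::
  "(nat \<times> nat) set \<Rightarrow> (nat \<times> nat \<Rightarrow> nat \<times> nat) \<Rightarrow> nat \<times> nat \<Rightarrow> nat \<times> nat" where
  "to_involution A \<phi> x = (if x \<in> A then \<phi> x else inv_into A \<phi> x)"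

definition star_h_basis ::
  "('v, 'e) pre_digraph \<Rightarrow> ('v, 'e) collection \<Rightarrow> ('v, 'e) collection \<Rightarrow>
    (('v, 'e) collection \<Rightarrow>\<^sub>0 'k::field_char_0 poly)" where
  "star_h_basis Q P R =
     (let xs = presentation P; ys = presentation R; zs = xs @ ys in
      \<Sum>(A, B, \<phi>) \<in> contractions xs ys.
        scl (half_h (card A) * (- 1) ^ card {y \<in> B. pr zs y \<in> Fwd ` arcs Q})
          (basis_vec (glued_collection Q zs (A \<union> B) (to_involution A \<phi>)
                        (members zs (A \<union> B) (to_involution A \<phi>)))))"

definition star_h ::
  "('v, 'e) pre_digraph \<Rightarrow> (('v, 'e) collection \<Rightarrow>\<^sub>0 'k::field_char_0 poly) \<Rightarrow>
    (('v, 'e) collection \<Rightarrow>\<^sub>0 'k poly) \<Rightarrow> (('v, 'e) collection \<Rightarrow>\<^sub>0 'k poly)" where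
  "star_h Q = bilin_ext (star_h_basis Q)"

definition self_contractions ::
  "('v, 'e darc) cpath list \<Rightarrow> ((nat \<times> nat) set \<times> (nat \<times> nat \<Rightarrow> nat \<times> nat)) set" where
  "self_contractions xs = {(J, \<phi>).
     J \<subseteq> abstract_edges xs \<and> \<phi> \<in> J \<rightarrow>\<^sub>E J \<and>
     (\<forall>x\<in>J. \<phi> (\<phi> x) = x \<and> pr xs (\<phi> x) = star (pr xs x))}"

definition colour_sign ::
  "('v, 'e) pre_digraph \<Rightarrow> ('v, 'e darc) cpath list \<Rightarrow> (nat \<times> nat) set \<Rightarrow>
    (nat \<times> nat \<Rightarrow> nat \<times> nat) \<Rightarrow> (member_index \<Rightarrow> nat) \<Rightarrow> 'r::comm_ring_1" where
  "colour_sign Q xs J \<phi> c =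
     (\<Prod>x \<in> {x \<in> J. pr xs x \<in> Fwd ` arcs Q}.
        let a = c (member_of xs J \<phi> x); b = c (member_of xs J \<phi> (next_edge xs x))
        in if a < b then 1 else if a = b then 0 else - 1)"

definition Delta_h_basis ::
  "('v, 'e) pre_digraph \<Rightarrow> ('v, 'e) collection \<Rightarrow>
    (('v, 'e) collection \<times> ('v, 'e) collection \<Rightarrow>\<^sub>0 'k::field_char_0 poly)" where
  "Delta_h_basis Q P =
     (let xs = presentation P in
      \<Sum>(J, \<phi>) \<in> self_contractions xs.
        scl (half_h (card J div 2))
          (\<Sum>c \<in> members xs J \<phi> \<rightarrow>\<^sub>E {1, 2}.
             scl (colour_sign Q xs J \<phi> c)
               (basis_vec (glued_collection Q xs J \<phi> {r \<in> members xs J \<phi>. c r = 1},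
                           glued_collection Q xs J \<phi> {r \<in> members xs J \<phi>. c r = 2}))))"

definition Delta_h ::
  "('v, 'e) pre_digraph \<Rightarrow> (('v, 'e) collection \<Rightarrow>\<^sub>0 'k::field_char_0 poly) \<Rightarrow>
    (('v, 'e) collection \<times> ('v, 'e) collection \<Rightarrow>\<^sub>0 'k poly)" where
  "Delta_h Q = lin_ext (Delta_h_basis Q)"

definition unit_h :: "('v, 'e) collection \<Rightarrow>\<^sub>0 'k::field_char_0 poly" where
  "unit_h = basis_vec {#}"

definition counit_h :: "(('v, 'e) collection \<Rightarrow>\<^sub>0 'k::field_char_0 poly) \<Rightarrow> 'k poly" where
  "counit_h p = (\<Sum>P\<in>Poly_Mapping.keys p. Poly_Mapping.lookup p P * (if P = {#} then 1 else 0))"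

definition antipode_h ::
  "(('v, 'e) collection \<Rightarrow>\<^sub>0 'k::field_char_0 poly) \<Rightarrow> (('v, 'e) collection \<Rightarrow>\<^sub>0 'k poly)" where
  "antipode_h = lin_ext (\<lambda>P. scl ((- 1) ^ size P) (basis_vec P))"

end

theory Submission imports Defs begin

text \<open>A configuration is a permutation \<open>f\<close> of a finite set \<open>X\<close> whose points carry a vertex and possibly
  an arc of the double; the cycles of \<open>f\<close> spell the members of a collection. Points without an arc
  are transparent: a cycle of such points is a trivial path, and on any other cycle they can be
  deleted. Contracting along an involution \<open>\<theta>\<close> that
  matches opposite arcs replaces \<open>f\<close> by \<open>f \<circ> \<theta>\<close> and makes the matched points transparent. Product and
  coproduct become sums over such matchings: each matched pair contributes \<open>h/2\<close> times the sign of the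
  colour change along it, where the colours are the factors of the product, respectively the tensor
  factors of the coproduct. Contracting twice is contracting once with the two weights of each pair
  added, so the associativity laws express that the signs of 2-colourings add up to those of a
  3-colouring. In the antipode identity the terms with a given set of contracted pairs cancel under an
  exchange of the two colours.\<close>

section \<open>Linear extension\<close>

text \<open>The obstacle that shapes the proof is \<open>presentation\<close>: it is an arbitrary
  choice, and the presentation chosen for a glued collection has nothing to do with the gluing that
  produced it, so the operations cannot be iterated on their definitions. Hence
  \<open>star_h_basis_coll\<close> and \<open>Delta_h_basis_coll\<close>: every configuration of a
  collection, whatever its transparent points, computes the product and the coproduct. Two facts
  give this: the state sums do not change when a transparent point is deleted from a longer cycle,
  and a configuration without such points is determined by its collection up to isomorphism. Signs
  vanish on equal colours, so the sums can run over all matchings, and a restriction on the pairs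
  becomes a property of the weight. For the two associativity laws the weights agree pair by pair.
  For the compatibility of product and coproduct they do not: pairs that change both colours need a
  count along cycles. In the antipode the number of cycles itself enters, and it is controlled
  through the sign of a permutation.\<close>

lemma lookup_scl [simp]: "Poly_Mapping.lookup (scl r p) k = r * Poly_Mapping.lookup p k"
  by (simp add: scl_def Poly_Mapping.map.rep_eq when_def)

lemma scl_add_right: "scl r (p + q) = scl r p + scl r q"
  by (rule poly_mapping_eqI) (simp add: lookup_add algebra_simps)

lemma scl_add_left: "scl (r + s) p = scl r p + scl s p"
  by (rule poly_mapping_eqI) (simp add: lookup_add algebra_simps)

lemma scl_scl [simp]: "scl r (scl s p) = scl (r * s) p"
  by (rule poly_mapping_eqI) (simp add: algebra_simps)

lemma scl_zero_left [simp]: "scl 0 p = 0"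
  by (rule poly_mapping_eqI) simp

lemma scl_zero_right [simp]: "scl r 0 = 0"
  by (rule poly_mapping_eqI) simp

lemma scl_one [simp]: "scl 1 p = p"
  by (rule poly_mapping_eqI) simp

lemma scl_sum: "scl r (sum f A) = (\<Sum>a\<in>A. scl r (f a))"
  by (rule poly_mapping_eqI) (simp add: lookup_sum sum_distrib_left)

lemma scl_sum_left: "scl (sum f A) p = (\<Sum>a\<in>A. scl (f a) p)"
  by (rule poly_mapping_eqI) (simp add: lookup_sum sum_distrib_right)

text \<open>Linearity on the whole type of finitely supported functions. The maps to be compared are
  linear extensions and so linear everywhere; \<open>B\<close> enters only through the basis vectors
  on which they are compared.\<close>

definition klinear :: "(('a \<Rightarrow>\<^sub>0 'r::comm_ring_1) \<Rightarrow> ('b \<Rightarrow>\<^sub>0 'r)) \<Rightarrow> bool" where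
  "klinear L \<longleftrightarrow> (\<forall>p q. L (p + q) = L p + L q) \<and> (\<forall>r p. L (scl r p) = scl r (L p))"

lemma klinearD: "klinear L \<Longrightarrow> L (p + q) = L p + L q" "klinear L \<Longrightarrow> L (scl r p) = scl r (L p)"
  by (auto simp: klinear_def)

lemma klinear_0: "klinear L \<Longrightarrow> L 0 = 0"
  using klinearD(2)[of L 0 0] by simp

lemma klinear_sum: "klinear L \<Longrightarrow> L (sum f A) = (\<Sum>a\<in>A. L (f a))"
  by (induction A rule: infinite_finite_induct) (auto simp: klinear_0 klinearD)

lemma lin_ext_superset:
  assumes "finite A" "Poly_Mapping.keys p \<subseteq> A"
  shows "lin_ext F p = (\<Sum>b\<in>A. scl (Poly_Mapping.lookup p b) (F b))"
  unfolding lin_ext_def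
  by (rule sum.mono_neutral_left) (use assms in \<open>auto simp: in_keys_iff\<close>)

lemma klinear_lin_ext: "klinear (lin_ext F)"
  unfolding klinear_def
proof (intro conjI allI)
  fix p q :: "'a \<Rightarrow>\<^sub>0 'b"
  let ?A = "Poly_Mapping.keys p \<union> Poly_Mapping.keys q"
  have "Poly_Mapping.keys (p + q) \<subseteq> ?A" by (rule Poly_Mapping.keys_add)
  then show "lin_ext F (p + q) = lin_ext F p + lin_ext F q"
    by (simp add: lin_ext_superset[of ?A] lookup_add scl_add_left sum.distrib)
next
  fix r and p :: "'a \<Rightarrow>\<^sub>0 'b"
  have "Poly_Mapping.keys (scl r p) \<subseteq> Poly_Mapping.keys p" by (auto simp: in_keys_iff)
  then show "lin_ext F (scl r p) = scl r (lin_ext F p)"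
    by (simp add: lin_ext_superset[of "Poly_Mapping.keys p"] scl_sum)
qed

lemmas lin_ext_add = klinearD(1)[OF klinear_lin_ext]
lemmas lin_ext_scl = klinearD(2)[OF klinear_lin_ext]
lemmas lin_ext_sum = klinear_sum[OF klinear_lin_ext]

lemma lin_ext_basis [simp]: "lin_ext F (basis_vec b) = F b"
  by (simp add: lin_ext_superset[of "{b}"])

lemma lin_ext_fun_add: "lin_ext (\<lambda>b. F b + G b) p = lin_ext F p + lin_ext G p"
  by (simp add: lin_ext_def scl_add_right sum.distrib)

lemma lin_ext_fun_scl: "lin_ext (\<lambda>b. scl r (F b)) p = scl r (lin_ext F p)"
  by (simp add: lin_ext_def scl_sum mult.commute)

lemma basis_expansion: "p = (\<Sum>b\<in>Poly_Mapping.keys p. scl (Poly_Mapping.lookup p b) (basis_vec b))"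
  by (rule poly_mapping_eqI)
    (auto simp: lookup_sum lookup_single when_def if_distrib[where f="\<lambda>x. _ * x"] sum.delta'
      in_keys_iff cong: if_cong)

text \<open>Every Hopf axiom is an equation between maps linear in each argument, so it needs proof
  only on basis vectors from \<open>B\<close>, where the combinatorial statements live.\<close>

lemma klinear_basis_eqI:
  assumes "klinear L" "klinear M" "p \<in> free_mod B" "\<And>b. b \<in> B \<Longrightarrow> L (basis_vec b) = M (basis_vec b)"
  shows "L p = M p"
proof -
  have "N p = (\<Sum>b\<in>Poly_Mapping.keys p. scl (Poly_Mapping.lookup p b) (N (basis_vec b)))"
    if "klinear N" for N :: "('a \<Rightarrow>\<^sub>0 'b) \<Rightarrow> ('c \<Rightarrow>\<^sub>0 'b)"
    by (subst basis_expansion[of p]) (simp add: klinear_sum[OF that] klinearD[OF that])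
  note eq = this[OF assms(1)] this[OF assms(2)]
  have "L (basis_vec b) = M (basis_vec b)" if "b \<in> Poly_Mapping.keys p" for b
    using assms(3,4) that unfolding free_mod_def by blast
  then show ?thesis
    unfolding eq by (intro sum.cong) auto
qed

lemma klinear_compose: "klinear L \<Longrightarrow> klinear M \<Longrightarrow> klinear (\<lambda>p. L (M p))"
  by (simp add: klinear_def)

lemma klinear_id: "klinear id" "klinear (\<lambda>p. p)"
  by (simp_all add: klinear_def)

lemma zero_in_free_mod: "0 \<in> free_mod B"
  by (simp add: free_mod_def)

lemma add_in_free_mod: "p \<in> free_mod B \<Longrightarrow> q \<in> free_mod B \<Longrightarrow> p + q \<in> free_mod B"
  using Poly_Mapping.keys_add[of p q] by (auto simp: free_mod_def)

lemma scl_in_free_mod: "p \<in> free_mod B \<Longrightarrow> scl r p \<in> free_mod B"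
proof -
  have "Poly_Mapping.keys (scl r p) \<subseteq> Poly_Mapping.keys p" by (auto simp: in_keys_iff)
  then show "p \<in> free_mod B \<Longrightarrow> scl r p \<in> free_mod B" unfolding free_mod_def by blast
qed

lemma sum_in_free_mod: "(\<And>a. a \<in> A \<Longrightarrow> f a \<in> free_mod B) \<Longrightarrow> sum f A \<in> free_mod B"
  by (induction A rule: infinite_finite_induct) (auto simp: zero_in_free_mod add_in_free_mod)

lemma basis_in_free_mod: "b \<in> B \<Longrightarrow> basis_vec b \<in> free_mod B"
  by (auto simp: free_mod_def)

lemma lin_ext_in_free_mod:
  "p \<in> free_mod B \<Longrightarrow> (\<And>b. b \<in> B \<Longrightarrow> F b \<in> free_mod C) \<Longrightarrow> lin_ext F p \<in> free_mod C"
  unfolding lin_ext_def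
  by (rule sum_in_free_mod, rule scl_in_free_mod) (auto simp: free_mod_def)

lemma klinear_bilin_ext_left: "klinear (\<lambda>p. bilin_ext F p q)"
  unfolding bilin_ext_def by (rule klinear_lin_ext)

lemma klinear_bilin_ext_right: "klinear (bilin_ext F p)"
  unfolding bilin_ext_def klinear_def
  by (simp add: lin_ext_add lin_ext_scl lin_ext_fun_add lin_ext_fun_scl)

lemma bilin_ext_basis [simp]: "bilin_ext F (basis_vec a) (basis_vec b) = F a b"
  by (simp add: bilin_ext_def)

lemma bilin_ext_in_free_mod:
  "p \<in> free_mod A \<Longrightarrow> q \<in> free_mod B \<Longrightarrow> (\<And>a b. a \<in> A \<Longrightarrow> b \<in> B \<Longrightarrow> F a b \<in> free_mod C)
    \<Longrightarrow> bilin_ext F p q \<in> free_mod C"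
  unfolding bilin_ext_def by (intro lin_ext_in_free_mod)

lemma klinear_tensor_map: "klinear (tensor_map F G)"
  unfolding tensor_map_def by (rule klinear_lin_ext)

lemma klinear_tensor_assoc: "klinear tensor_assoc"
  unfolding tensor_assoc_def by (rule klinear_lin_ext)

lemma klinear_mult_map: "klinear (mult_map mul)"
  unfolding mult_map_def by (rule klinear_lin_ext)

lemma tensor_basis [simp]: "tensor (basis_vec a) (basis_vec b) = basis_vec (a, b)"
  by (simp add: tensor_def)

lemma klinear_tensor: "klinear (\<lambda>p. tensor p q)" "klinear (tensor p)"
  unfolding tensor_def by (rule klinear_bilin_ext_left klinear_bilin_ext_right)+

lemma klinear_tensor_mult: "klinear (\<lambda>p. tensor_mult mul p q)" "klinear (tensor_mult mul p)"
  unfolding tensor_mult_def by (rule klinear_bilin_ext_left klinear_bilin_ext_right)+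

text \<open>The counit takes values in the ring, not in a free module. Multiplying a fixed vector
  \<open>v\<close> by it gives a linear extension, to which \<open>klinear\<close> applies.\<close>

lemma klinear_counit: "klinear (\<lambda>p. scl (\<Sum>b\<in>Poly_Mapping.keys p. Poly_Mapping.lookup p b * e b) v)"
proof -
  have "(\<lambda>p. scl (\<Sum>b\<in>Poly_Mapping.keys p. Poly_Mapping.lookup p b * e b) v)
      = lin_ext (\<lambda>b. scl (e b) v)"
    by (simp add: fun_eq_iff lin_ext_def scl_sum_left)
  then show ?thesis by (simp add: klinear_lin_ext)
qed

text \<open>Turns the axioms, which concern all of \<open>free_mod B\<close>, into statements about
  single basis elements, by multilinearity.\<close>

lemma free_hopf_algebra_on_basisI:
  fixes m :: "'b \<Rightarrow> 'b \<Rightarrow> ('b \<Rightarrow>\<^sub>0 'r::comm_ring_1)"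
    and D :: "'b \<Rightarrow> ('b \<times> 'b \<Rightarrow>\<^sub>0 'r)" and e :: "'b \<Rightarrow> 'r" and S :: "'b \<Rightarrow> ('b \<Rightarrow>\<^sub>0 'r)"
  defines "mul \<equiv> bilin_ext m" and "cop \<equiv> lin_ext D" and "antip \<equiv> lin_ext S"
    and "cou \<equiv> \<lambda>p. \<Sum>b\<in>Poly_Mapping.keys p. Poly_Mapping.lookup p b * e b"
  assumes u: "u \<in> B"
    and m_closed: "\<And>a b. a \<in> B \<Longrightarrow> b \<in> B \<Longrightarrow> m a b \<in> free_mod B"
    and m_assoc: "\<And>a b c. a \<in> B \<Longrightarrow> b \<in> B \<Longrightarrow> c \<in> B \<Longrightarrow>
        mul (m a b) (basis_vec c) = mul (basis_vec a) (m b c)"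
    and m_unit: "\<And>a. a \<in> B \<Longrightarrow> m u a = basis_vec a" "\<And>a. a \<in> B \<Longrightarrow> m a u = basis_vec a"
    and D_closed: "\<And>a. a \<in> B \<Longrightarrow> D a \<in> free_mod (B \<times> B)"
    and D_coassoc: "\<And>a. a \<in> B \<Longrightarrow>
        tensor_assoc (tensor_map cop id (D a)) = tensor_map id cop (D a)"
    and D_counit: "\<And>a. a \<in> B \<Longrightarrow> lin_ext (\<lambda>(x, y). scl (e x) (basis_vec y)) (D a) = basis_vec a"
      "\<And>a. a \<in> B \<Longrightarrow> lin_ext (\<lambda>(x, y). scl (e y) (basis_vec x)) (D a) = basis_vec a"
    and D_mult: "\<And>a b. a \<in> B \<Longrightarrow> b \<in> B \<Longrightarrow> cop (m a b) = tensor_mult mul (D a) (D b)"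
    and D_unit: "D u = basis_vec (u, u)"
    and e_mult: "\<And>a b. a \<in> B \<Longrightarrow> b \<in> B \<Longrightarrow> cou (m a b) = e a * e b"
    and e_unit: "e u = 1"
    and S_closed: "\<And>a. a \<in> B \<Longrightarrow> S a \<in> free_mod B"
    and S_left: "\<And>a. a \<in> B \<Longrightarrow> mult_map mul (tensor_map antip id (D a)) = scl (e a) (basis_vec u)"
    and S_right: "\<And>a. a \<in> B \<Longrightarrow> mult_map mul (tensor_map id antip (D a)) = scl (e a) (basis_vec u)"
  shows "free_hopf_algebra_on B mul (basis_vec u) cop cou antip"
proof -
  have lin: "klinear cop" "klinear antip" "\<And>q. klinear (\<lambda>p. mul p q)" "\<And>p. klinear (mul p)"
    unfolding mul_def cop_def antip_def
    by (rule klinear_lin_ext klinear_bilin_ext_left klinear_bilin_ext_right)+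
  have cou_lin: "klinear (\<lambda>p. scl (cou p) v)" for v :: "'x \<Rightarrow>\<^sub>0 'r"
    unfolding cou_def by (rule klinear_counit)
  \<comment> \<open>A free module of rank one, with basis \<open>unit\<close>, makes linearity
    statements available for the scalar-valued counit; \<open>lookup\<close> at \<open>()\<close>
    gets the scalar back.\<close>
  have cou_lookup: "cou p = Poly_Mapping.lookup (scl (cou p) (basis_vec ())) ()" for p
    by simp
  have cou_add: "cou (p + q) = cou p + cou q" for p q
    using klinearD(1)[OF cou_lin, of p q "basis_vec ()"] cou_lookup
    by (metis lookup_add)
  have cou_scl: "cou (scl r p) = r * cou p" for r p
    using klinearD(2)[OF cou_lin, of r p "basis_vec ()"] cou_lookup
    by (metis lookup_scl)
  have cou_basis: "cou (basis_vec b) = e b" for b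
    by (simp add: cou_def)
  have basis [simp]: "mul (basis_vec a) (basis_vec b) = m a b" "cop (basis_vec a) = D a"
    "antip (basis_vec a) = S a" for a b
    by (simp_all add: mul_def cop_def antip_def)
  note lins = klinearD[OF lin(1)] klinearD[OF lin(2)] klinearD[OF lin(3)] klinearD[OF lin(4)]
    klinearD[OF klinear_tensor_assoc] klinearD[OF klinear_tensor_map] klinearD[OF klinear_mult_map]
    klinearD[OF klinear_tensor_mult(1)] klinearD[OF klinear_tensor_mult(2)] lin_ext_add lin_ext_scl
    cou_add cou_scl scl_add_left scl_add_right
  note basis_eqI = klinear_basis_eqI[where B=B]
  \<comment> \<open>The arguments are reduced to basis vectors one at a time, the later ones staying
    arbitrary meanwhile.\<close>
  have assoc: "mul (mul p q) s = mul p (mul q s)"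
    if "p \<in> free_mod B" "q \<in> free_mod B" "s \<in> free_mod B" for p q s
  proof (rule basis_eqI[OF _ _ that(1)])
    fix a assume a: "a \<in> B"
    show "mul (mul (basis_vec a) q) s = mul (basis_vec a) (mul q s)"
    proof (rule basis_eqI[OF _ _ that(2)])
      fix b assume b: "b \<in> B"
      show "mul (mul (basis_vec a) (basis_vec b)) s = mul (basis_vec a) (mul (basis_vec b) s)"
        by (rule basis_eqI[OF _ _ that(3)]) (simp_all add: klinear_def lins a b m_assoc)
    qed (simp_all add: klinear_def lins)
  qed (simp_all add: klinear_def lins)
  show ?thesis
  proof (unfold_locales, goal_cases)
    case (1 p q)
    then show ?case unfolding mul_def by (intro bilin_ext_in_free_mod m_closed)
  next
    case (6 p q s)
    then show ?case by (rule assoc)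
  next
    case 7
    then show ?case using u by (rule basis_in_free_mod)
  next
    case (8 p)
    show ?case
      using basis_eqI[OF lin(4) klinear_id(2) 8, of "basis_vec u"] m_unit by simp
  next
    case (9 p)
    show ?case
      using basis_eqI[OF lin(3) klinear_id(2) 9, of "basis_vec u"] m_unit by simp
  next
    case (10 p)
    then show ?case unfolding cop_def by (intro lin_ext_in_free_mod D_closed)
  next
    case (15 p)
    show ?case
    proof (rule basis_eqI[OF _ _ 15])
      fix a assume "a \<in> B"
      then show "tensor_assoc (tensor_map cop id (cop (basis_vec a))) = tensor_map id cop (cop (basis_vec a))"
        by (simp only: basis D_coassoc)
    qed (simp_all add: klinear_def lins)
  next
    case (16 p)
    show ?case
      by (rule basis_eqI[OF _ _ 16])
        (simp_all add: klinear_def lins D_counit cou_basis)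
  next
    case (17 p)
    show ?case
      by (rule basis_eqI[OF _ _ 17])
        (simp_all add: klinear_def lins D_counit cou_basis)
  next
    case (18 p q)
    show ?case
    proof (rule basis_eqI[OF _ _ 18(1)])
      fix a assume a: "a \<in> B"
      show "cop (mul (basis_vec a) q) = tensor_mult mul (cop (basis_vec a)) (cop q)"
        by (rule basis_eqI[OF _ _ 18(2)])
          (simp_all add: klinear_def lins a D_mult)
    qed (simp_all add: klinear_def lins)
  next
    case 19
    then show ?case by (simp add: D_unit)
  next
    case (20 p q)
    have "scl (cou (mul p q)) (basis_vec ()) = scl (cou p * cou q) (basis_vec ())"
    proof (rule basis_eqI[OF _ _ 20(1)])
      fix a assume a: "a \<in> B"
      show "scl (cou (mul (basis_vec a) q)) (basis_vec ())
          = scl (cou (basis_vec a) * cou q) (basis_vec ())"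
        by (rule basis_eqI[OF _ _ 20(2)])
          (simp_all add: klinear_def lins a e_mult cou_basis algebra_simps)
    qed (simp_all add: klinear_def lins algebra_simps)
    then show ?case
      by (metis lookup_scl lookup_single_eq mult.right_neutral mult.commute)
  next
    case 21
    then show ?case by (simp add: cou_basis e_unit)
  next
    case (22 p)
    then show ?case unfolding antip_def by (intro lin_ext_in_free_mod S_closed)
  next
    case (25 p)
    show ?case
    proof (rule basis_eqI[OF _ _ 25])
      fix a assume "a \<in> B"
      then show "mult_map mul (tensor_map antip id (cop (basis_vec a))) = scl (cou (basis_vec a)) (basis_vec u)"
        by (simp only: basis S_left cou_basis)
    qed (simp_all add: klinear_def lins mult.commute)
  next
    case (26 p)
    show ?case
    proof (rule basis_eqI[OF _ _ 26])
      fix a assume "a \<in> B"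
      then show "mult_map mul (tensor_map id antip (cop (basis_vec a))) = scl (cou (basis_vec a)) (basis_vec u)"
        by (simp only: basis S_right cou_basis)
    qed (simp_all add: klinear_def lins mult.commute)
  \<comment> \<open>What remains are the additivity and homogeneity axioms.\<close>
  qed (simp_all add: lins)
qed

section \<open>Orbits of a permutation of a finite set\<close>

text \<open>Nothing is asked of \<open>f\<close> outside \<open>X\<close>, so the same
  \<open>f\<close> serves for every union of its cycles, in particular for colour classes.\<close>

definition perm_on :: "('x \<Rightarrow> 'x) \<Rightarrow> 'x set \<Rightarrow> bool" where
  "perm_on f X \<longleftrightarrow> finite X \<and> bij_betw f X X"

lemma perm_on_in: "perm_on f X \<Longrightarrow> x \<in> X \<Longrightarrow> f x \<in> X"
  by (auto simp: perm_on_def bij_betw_def)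

lemma perm_on_inj: "perm_on f X \<Longrightarrow> x \<in> X \<Longrightarrow> y \<in> X \<Longrightarrow> f x = f y \<longleftrightarrow> x = y"
  by (auto simp: perm_on_def bij_betw_def inj_on_def)

lemma perm_on_surj: "perm_on f X \<Longrightarrow> x \<in> X \<Longrightarrow> \<exists>y\<in>X. f y = x"
  unfolding perm_on_def bij_betw_def by (metis imageE)

lemma perm_onI:
  assumes "finite X" "\<And>x. x \<in> X \<Longrightarrow> f x \<in> X"
    "\<And>x y. x \<in> X \<Longrightarrow> y \<in> X \<Longrightarrow> f x = f y \<Longrightarrow> x = y"
  shows "perm_on f X"
proof -
  have inj: "inj_on f X" using assms(3) by (auto simp: inj_on_def)
  moreover have "f ` X = X"
    using assms(1,2) inj by (intro endo_inj_surj) auto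
  ultimately show ?thesis using assms(1) by (simp add: perm_on_def bij_betw_def)
qed

lemma perm_on_subset:
  assumes "perm_on f X" "Y \<subseteq> X" "\<And>y. y \<in> Y \<Longrightarrow> f y \<in> Y"
  shows "perm_on f Y"
proof (rule perm_onI)
  show "finite Y" using assms by (auto simp: perm_on_def intro: finite_subset)
  show "x = y" if "x \<in> Y" "y \<in> Y" "f x = f y" for x y
    using that assms(2) perm_on_inj[OF assms(1), of x y] by blast
qed (rule assms(3))

text \<open>The library's results on orbits want a permutation that is the identity outside
  \<open>X\<close>. Restriction provides it without changing the orbits of points of
  \<open>X\<close>.\<close>

lemma perm_on_restrict: "perm_on f X \<Longrightarrow> perm_restrict f X permutes X"
  unfolding perm_on_def
  by (intro bij_imp_permutes) (auto simp: perm_restrict_def cong: bij_betw_cong)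

lemma orbit_perm_restrict:
  assumes "perm_on f X" "x \<in> X"
  shows "orbit (perm_restrict f X) x = orbit f x"
  by (rule orbit_cong0[of _ X])
    (use assms perm_on_in[OF assms(1)] in \<open>auto simp: perm_restrict_def\<close>)

context
  fixes f :: "'x \<Rightarrow> 'x" and X
  assumes p: "perm_on f X"
begin

lemma permutation_perm_restrict: "permutation (perm_restrict f X)"
  using perm_on_restrict[OF p] p by (auto simp: perm_on_def permutation_permutes)

lemma self_in_orbit: "x \<in> X \<Longrightarrow> x \<in> orbit f x"
  using permutation_self_in_orbit[OF permutation_perm_restrict] orbit_perm_restrict[OF p] by metis

lemma orbit_subset_perm_on: "x \<in> X \<Longrightarrow> orbit f x \<subseteq> X"
  using permutes_orbit_subset[OF perm_on_restrict[OF p]] orbit_perm_restrict[OF p] by metis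

lemma orbit_eq_of_mem:
  assumes "x \<in> X" "y \<in> orbit f x"
  shows "orbit f y = orbit f x"
proof -
  have y: "y \<in> X" using assms orbit_subset_perm_on by blast
  have "cyclic_on (perm_restrict f X) (orbit (perm_restrict f X) x)"
    by (rule cyclic_on_orbit'[OF permutation_perm_restrict])
  then have "orbit (perm_restrict f X) y = orbit (perm_restrict f X) x"
    using assms orbit_perm_restrict[OF p assms(1)] by (metis orbit_cyclic_eq3)
  then show ?thesis
    using orbit_perm_restrict[OF p] assms(1) y by simp
qed

lemma orbit_step_eq: "x \<in> X \<Longrightarrow> orbit f (f x) = orbit f x"
  by (rule orbit_eq_of_mem) (auto intro: orbit.base)

lemma finite_orbit_perm_on: "x \<in> X \<Longrightarrow> finite (orbit f x)"
  using orbit_subset_perm_on p by (auto simp: perm_on_def intro: finite_subset)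

lemma orbits_disjoint:
  "x \<in> X \<Longrightarrow> y \<in> X \<Longrightarrow> orbit f x \<noteq> orbit f y \<Longrightarrow> orbit f x \<inter> orbit f y = {}"
  using orbit_eq_of_mem by blast

end

definition iterates :: "('x \<Rightarrow> 'x) \<Rightarrow> 'x \<Rightarrow> 'x list" where
  "iterates f x = map (\<lambda>n. (f ^^ n) x) [0..<card (orbit f x)]"

text \<open>Recognises a cycle: a list without repetitions through which \<open>f\<close> steps
  cyclically is one full period. Cycles given explicitly or changed locally are computed this
  way.\<close>

lemma iterates_eqI:
  assumes "distinct xs" "xs \<noteq> []" "xs ! 0 = x"
    and step: "\<And>i. i < length xs \<Longrightarrow> f (xs ! i) = xs ! (Suc i mod length xs)"
  shows "iterates f x = xs" "orbit f x = set xs"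
proof -
  let ?n = "length xs"
  have pow: "(f ^^ k) x = xs ! (k mod ?n)" for k
  proof (induction k)
    case (Suc k)
    then show ?case using step[of "k mod ?n"] assms(2) by (simp add: mod_Suc_eq)
  qed (use assms in simp)
  have "orbit f x = (\<lambda>k. xs ! (k mod ?n)) ` {0<..}"
    unfolding orbit_altdef pow by auto
  also have "\<dots> = set xs"
  proof (intro equalityI subsetI)
    fix y assume "y \<in> set xs"
    then obtain i where "i < ?n" "y = xs ! i" by (auto simp: in_set_conv_nth)
    \<comment> \<open>\<open>orbit\<close> collects positive powers only, so the index is shifted by
      one period to reach the starting point as well.\<close>
    then show "y \<in> (\<lambda>k. xs ! (k mod ?n)) ` {0<..}"
      by (intro image_eqI[of _ _ "i + ?n"]) auto
  qed (use assms(2) in auto)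
  finally show o: "orbit f x = set xs" .
  show "iterates f x = xs"
    using assms(1) by (auto simp: iterates_def o distinct_card pow intro: nth_equalityI)
qed

context
  fixes f :: "'x \<Rightarrow> 'x" and X and x
  assumes p: "perm_on f X" and x: "x \<in> X"
begin

lemma card_orbit_pos: "card (orbit f x) > 0"
  using self_in_orbit[OF p x] finite_orbit_perm_on[OF p x] by (auto simp: card_gt_0_iff)

text \<open>\<open>funpow_dist1\<close> is the library's period of \<open>x\<close>; its properties
  carry over to the number of points of the orbit.\<close>

lemma card_orbit_dist: "card (orbit f x) = funpow_dist1 f x x"
  using orbit_conv_funpow_dist1[OF self_in_orbit[OF p x]]
    inj_on_funpow_dist1[OF self_in_orbit[OF p x]] by (simp add: card_image)

lemma funpow_card_orbit: "(f ^^ card (orbit f x)) x = x"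
  unfolding card_orbit_dist by (rule funpow_dist1_prop[OF self_in_orbit[OF p x]])

lemma set_iterates: "set (iterates f x) = orbit f x"
  unfolding iterates_def card_orbit_dist set_map set_upt
  using orbit_conv_funpow_dist1[OF self_in_orbit[OF p x]] by simp

lemma distinct_iterates: "distinct (iterates f x)"
  unfolding iterates_def card_orbit_dist distinct_map set_upt
  using inj_on_funpow_dist1[OF self_in_orbit[OF p x]] by simp

lemma length_iterates: "length (iterates f x) = card (orbit f x)"
  by (simp add: iterates_def)

lemma nth_iterates: "n < card (orbit f x) \<Longrightarrow> iterates f x ! n = (f ^^ n) x"
  by (simp add: iterates_def)

lemma step_iterates:
  assumes "i < length (iterates f x)"
  shows "f (iterates f x ! i) = iterates f x ! (Suc i mod length (iterates f x))"
proof (cases "Suc i < card (orbit f x)")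
  case False
  then have "Suc i = card (orbit f x)" using assms by (simp add: length_iterates)
  then have "f ((f ^^ i) x) = x" using funpow_card_orbit by (metis comp_apply funpow.simps(2))
  then show ?thesis
    using \<open>Suc i = _\<close> card_orbit_pos by (simp add: length_iterates nth_iterates)
qed (use assms in \<open>simp add: length_iterates nth_iterates\<close>)

lemma iterates_step: "iterates f (f x) = rotate1 (iterates f x)"
proof (rule iterates_eqI(1))
  let ?xs = "iterates f x"
  have ne: "?xs \<noteq> []" using card_orbit_pos by (simp flip: length_greater_0_conv add: length_iterates)
  show "distinct (rotate1 ?xs)" using distinct_iterates by simp
  show "rotate1 ?xs \<noteq> []" using ne by simp
  show "rotate1 ?xs ! 0 = f x"
    using ne step_iterates[of 0] nth_iterates[of 0] card_orbit_pos
    by (subst nth_rotate1) (auto simp: length_iterates)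
  fix i assume "i < length (rotate1 ?xs)"
  then show "f (rotate1 ?xs ! i) = rotate1 ?xs ! (Suc i mod length (rotate1 ?xs))"
    using ne by (auto simp: nth_rotate1 step_iterates mod_Suc_eq)
qed

end

text \<open>Another starting point on the same cycle rotates the list of points, which is what
  necklaces, as words up to rotation, absorb.\<close>

lemma iterates_funpow:
  assumes "perm_on f X" "x \<in> X"
  shows "iterates f ((f ^^ n) x) = rotate n (iterates f x)"
proof (induction n)
  case (Suc n)
  have "(f ^^ n) x \<in> X" using assms by (induction n) (auto intro: perm_on_in)
  then show ?case using Suc iterates_step[OF assms(1)] by simp
qed simp

text \<open>Cuts \<open>x\<close> out of its cycle by sending its predecessor to \<open>f x\<close>.
  It is applied when \<open>f x \<noteq> x\<close>; for a fixed point a whole cycle, hence a member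
  of the collection, would be lost.\<close>

definition bypass :: "'x \<Rightarrow> ('x \<Rightarrow> 'x) \<Rightarrow> 'x \<Rightarrow> 'x" where
  "bypass x f y = (if f y = x then f x else f y)"

lemma perm_on_bypass:
  assumes p: "perm_on f X" and x: "x \<in> X" "f x \<noteq> x"
  shows "perm_on (bypass x f) (X - {x})"
proof (rule perm_onI)
  fix y z assume "y \<in> X - {x}" "z \<in> X - {x}" "bypass x f y = bypass x f z"
  then show "y = z"
    using x perm_on_inj[OF p] by (auto simp: bypass_def split: if_splits)
qed (use p x perm_on_in[OF p] in \<open>auto simp: perm_on_def bypass_def\<close>)

text \<open>The list of the cycle from \<open>x\<close> on continues with \<open>f x\<close>, so
  dropping its head leaves a list of the shortened cycle that starts at \<open>f x\<close>.\<close>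

lemma iterates_bypass:
  assumes p: "perm_on f X" and x: "x \<in> X" "f x \<noteq> x"
  shows "iterates (bypass x f) (f x) = tl (iterates f x)"
    and "orbit (bypass x f) (f x) = orbit f x - {x}"
proof -
  let ?xs = "iterates f x" let ?n = "card (orbit f x)"
  have n: "?n \<ge> 2"
  proof -
    have "{x, f x} \<subseteq> orbit f x" using self_in_orbit[OF p x(1)] orbit.base by fastforce
    then have "card {x, f x} \<le> ?n" using finite_orbit_perm_on[OF p x(1)] by (rule card_mono[rotated])
    then show ?thesis using x(2) by (simp split: if_splits)
  qed
  have len: "length ?xs = ?n" by (rule length_iterates[OF p x(1)])
  have d: "distinct ?xs" by (rule distinct_iterates[OF p x(1)])
  have x0: "?xs ! 0 = x" using n nth_iterates[OF p x(1), of 0] by simp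
  have x1: "?xs ! 1 = f x" using n nth_iterates[OF p x(1), of 1] by simp
  have 1: "tl ?xs \<noteq> []" using n len by (cases ?xs) auto
  have 2: "tl ?xs ! 0 = f x" using n x1 len by (simp add: nth_tl)
  have 3: "bypass x f (tl ?xs ! i) = tl ?xs ! (Suc i mod length (tl ?xs))" if i: "i < length (tl ?xs)" for i
  proof -
    have s: "f (?xs ! Suc i) = ?xs ! (Suc (Suc i) mod ?n)"
      using step_iterates[OF p x(1), of "Suc i"] i len by simp
    show ?thesis
    proof (cases "Suc (Suc i) = ?n")
      \<comment> \<open>The last point of the list is the predecessor of \<open>x\<close>, the only
        point of the cycle that \<open>bypass\<close> redirects.\<close>
      case True
      then have "Suc i = length (tl ?xs)" using len by simp
      then have "Suc i mod length (tl ?xs) = 0" by simp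
      then show ?thesis using s x0 x1 True i len n by (simp add: bypass_def nth_tl)
    next
      case False
      then have *: "Suc (Suc i) < ?n" using i len by simp
      then have "?xs ! Suc (Suc i) \<noteq> ?xs ! 0" using d len n by (subst nth_eq_iff_index_eq) auto
      then show ?thesis using s x0 * i len by (simp add: bypass_def nth_tl)
    qed
  qed
  have 4: "distinct (tl ?xs)" using d by (rule distinct_tl)
  show "iterates (bypass x f) (f x) = tl ?xs" by (rule iterates_eqI(1)[OF 4 1 2 3])
  have "orbit (bypass x f) (f x) = set (tl ?xs)" by (rule iterates_eqI(2)[OF 4 1 2 3])
  also have "\<dots> = set ?xs - {x}"
    using d x0 n len by (cases ?xs) auto
  finally show "orbit (bypass x f) (f x) = orbit f x - {x}"
    by (simp add: set_iterates[OF p x(1)])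
qed

lemma iterates_bypass_other:
  assumes p: "perm_on f X" and x: "x \<in> X" and y: "y \<in> X" "x \<notin> orbit f y"
  shows "iterates (bypass x f) y = iterates f y" and "orbit (bypass x f) y = orbit f y"
proof -
  let ?ys = "iterates f y"
  have 1: "?ys \<noteq> []"
    using card_orbit_pos[OF p y(1)] length_iterates[OF p y(1)] by (metis length_greater_0_conv)
  have 2: "?ys ! 0 = y"
    using card_orbit_pos[OF p y(1)] nth_iterates[OF p y(1), of 0] by simp
  have 3: "bypass x f (?ys ! i) = ?ys ! (Suc i mod length ?ys)" if i: "i < length ?ys" for i
  proof -
    have "?ys ! (Suc i mod length ?ys) \<in> set ?ys" using i by (intro nth_mem mod_less_divisor) auto
    then have "f (?ys ! i) \<noteq> x"
      using y(2) step_iterates[OF p y(1) i] set_iterates[OF p y(1)] by auto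
    then show ?thesis using step_iterates[OF p y(1) i] by (simp add: bypass_def)
  qed
  show "iterates (bypass x f) y = ?ys" "orbit (bypass x f) y = orbit f y"
    using iterates_eqI[OF distinct_iterates[OF p y(1)] 1 2 3] set_iterates[OF p y(1)] by auto
qed

text \<open>As \<open>f x \<noteq> x\<close>, the orbit of \<open>x\<close> survives the deletion,
  represented by \<open>f x\<close>; the other orbits are untouched. So the number of orbits is
  preserved.\<close>

lemma orbits_bypass:
  assumes p: "perm_on f X" and x: "x \<in> X" "f x \<noteq> x"
  shows "bij_betw (\<lambda>W. W - {x}) (orbit f ` X) (orbit (bypass x f) ` (X - {x}))"
    and "\<And>y. y \<in> X - {x} \<Longrightarrow> orbit (bypass x f) y = orbit f y - {x}"
proof -
  show eq: "orbit (bypass x f) y = orbit f y - {x}" if y: "y \<in> X - {x}" for y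
  proof (cases "x \<in> orbit f y")
    case True
    then have o: "orbit f x = orbit f y" using orbit_eq_of_mem[OF p] y by blast
    then have "y \<in> orbit f x - {x}" using self_in_orbit[OF p] y by blast
    then have "y \<in> orbit (bypass x f) (f x)" using iterates_bypass(2)[OF p x] by simp
    moreover have "f x \<in> X - {x}" using p x perm_on_in by fastforce
    ultimately have "orbit (bypass x f) y = orbit (bypass x f) (f x)"
      using orbit_eq_of_mem[OF perm_on_bypass[OF p x]] by blast
    then show ?thesis using o iterates_bypass(2)[OF p x] by simp
  next
    case False
    then show ?thesis using iterates_bypass_other[OF p x(1)] y by auto
  qed
  have fx: "f x \<in> X - {x}" "orbit f (f x) = orbit f x"
    using p x perm_on_in orbit_step_eq by fastforce+
  show "bij_betw (\<lambda>W. W - {x}) (orbit f ` X) (orbit (bypass x f) ` (X - {x}))"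
    unfolding bij_betw_def
  proof
    show "inj_on (\<lambda>W. W - {x}) (orbit f ` X)"
    proof (rule inj_onI, clarify)
      fix y z assume yz: "y \<in> X" "z \<in> X" "orbit f y - {x} = orbit f z - {x}"
      show "orbit f y = orbit f z"
      proof (rule ccontr)
        assume "orbit f y \<noteq> orbit f z"
        then have d: "orbit f y \<inter> orbit f z = {}" by (rule orbits_disjoint[OF p yz(1,2)])
        \<comment> \<open>Disjoint orbits with the same remainder have empty remainder, so both lie
          in \<open>{x}\<close>.\<close>
        then have "orbit f y - {x} = {}" "orbit f z - {x} = {}" using yz(3) by auto
        then have "orbit f y \<subseteq> {x}" "orbit f z \<subseteq> {x}" by auto
        then have "y = x" "z = x"
          using self_in_orbit[OF p yz(1)] self_in_orbit[OF p yz(2)] by blast+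
        then show False using \<open>orbit f y \<noteq> orbit f z\<close> by simp
      qed
    qed
    have "orbit f x \<in> orbit f ` (X - {x})" using fx by (intro image_eqI[of _ _ "f x"]) auto
    then have "orbit f ` X = orbit f ` (X - {x})"
      using x(1) by auto
    then show "(\<lambda>W. W - {x}) ` orbit f ` X = orbit (bypass x f) ` (X - {x})"
      by (auto simp: image_image eq)
  qed
qed

section \<open>Collections of necklaces carried by a permutation\<close>

definition visible_arcs :: "('x \<Rightarrow> 'v \<times> 'a option) \<Rightarrow> 'x list \<Rightarrow> 'a list" where
  "visible_arcs lab xs = List.map_filter (\<lambda>x. snd (lab x)) xs"

text \<open>The vertex of the label is read only on a cycle without arcs, which stands for a trivial
  path.\<close>

definition neck :: "('x \<Rightarrow> 'x) \<Rightarrow> ('x \<Rightarrow> 'v \<times> 'a option) \<Rightarrow> 'x \<Rightarrow> ('v, 'a) necklace" where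
  "neck f lab x = abs_necklace (let as = visible_arcs lab (iterates f x)
     in if as = [] then Triv (fst (lab x)) else Cycle as)"

definition coll :: "('x \<Rightarrow> 'x) \<Rightarrow> ('x \<Rightarrow> 'v \<times> 'a option) \<Rightarrow> 'x set \<Rightarrow> ('v, 'a) necklace multiset" where
  "coll f lab X = image_mset (\<lambda>W. neck f lab (SOME x. x \<in> W)) (mset_set (orbit f ` X))"

text \<open>Makes \<open>neck\<close> the same at all points of a transparent cycle, the only place
  where vertices are read.\<close>

definition coherent :: "('x \<Rightarrow> 'x) \<Rightarrow> ('x \<Rightarrow> 'v \<times> 'a option) \<Rightarrow> 'x set \<Rightarrow> bool" where
  "coherent f lab X \<longleftrightarrow> (\<forall>x\<in>X. snd (lab x) = None \<longrightarrow> fst (lab (f x)) = fst (lab x))"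

lemma visible_arcs_simps [simp]:
  "visible_arcs lab [] = []"
  "visible_arcs lab (x # xs) = (case snd (lab x) of None \<Rightarrow> visible_arcs lab xs | Some a \<Rightarrow> a # visible_arcs lab xs)"
  "visible_arcs lab (xs @ ys) = visible_arcs lab xs @ visible_arcs lab ys"
  by (induction xs) (auto simp: visible_arcs_def map_filter_simps split: option.splits)

lemma visible_arcs_empty_iff: "visible_arcs lab xs = [] \<longleftrightarrow> (\<forall>x\<in>set xs. snd (lab x) = None)"
  by (induction xs) (auto split: option.splits)

lemma visible_arcs_cong: "(\<And>x. x \<in> set xs \<Longrightarrow> snd (lab x) = snd (lab' x)) \<Longrightarrow> visible_arcs lab xs = visible_arcs lab' xs"
  by (induction xs) (auto split: option.splits)

lemma visible_arcs_map: "visible_arcs lab (map g xs) = visible_arcs (lab \<circ> g) xs"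
  by (induction xs) (auto split: option.splits)

lemma abs_necklace_rotate1:
  "abs_necklace (Cycle (rotate1 xs) :: ('v, 'a) cpath) = abs_necklace (Cycle xs)"
proof -
  have "rotated (Cycle xs) (Cycle (rotate1 xs) :: ('v, 'a) cpath)"
    using rotated.intros(2)[of xs 1] by simp
  then have "rotated (Cycle (rotate1 xs)) (Cycle xs :: ('v, 'a) cpath)"
    by (rule equivp_symp[OF equivp_rotated])
  then show ?thesis by (simp add: necklace.abs_eq_iff)
qed

context
  fixes f :: "'x \<Rightarrow> 'x" and lab :: "'x \<Rightarrow> 'v \<times> 'a option" and X
  assumes p: "perm_on f X" and coh: "coherent f lab X"
begin

text \<open>Moving on by one point rotates the list of points by one. The word of arcs is then
  rotated by one letter or, if \<open>x\<close> is transparent, stays as it is.\<close>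

lemma neck_step:
  assumes x: "x \<in> X"
  shows "neck f lab (f x) = neck f lab x"
proof -
  let ?xs = "iterates f x"
  have ne: "?xs \<noteq> []"
    using card_orbit_pos[OF p x] length_iterates[OF p x] by (metis length_greater_0_conv less_irrefl)
  then obtain ys where xs: "?xs = x # ys"
    using nth_iterates[OF p x, of 0] card_orbit_pos[OF p x] by (cases ?xs) auto
  show ?thesis
  proof (cases "visible_arcs lab ?xs = []")
    case True
    then have "snd (lab x) = None" using xs by (simp split: option.splits)
    moreover have "visible_arcs lab (rotate1 ?xs) = []"
      using True by (simp add: visible_arcs_empty_iff)
    ultimately show ?thesis
      using coh x True by (simp add: neck_def iterates_step[OF p x] coherent_def Let_def)
  next
    case False
    then have *: "visible_arcs lab (rotate1 ?xs) \<noteq> []" by (simp add: visible_arcs_empty_iff)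
    have "visible_arcs lab (rotate1 ?xs) \<in> {visible_arcs lab ?xs, rotate1 (visible_arcs lab ?xs)}"
      using xs by (auto split: option.splits)
    then show ?thesis
      using False * by (auto simp: neck_def iterates_step[OF p x] Let_def abs_necklace_rotate1)
  qed
qed

lemma neck_orbit:
  assumes "x \<in> X" "y \<in> orbit f x"
  shows "neck f lab y = neck f lab x"
  using assms(2)
proof induction
  case (step y)
  then have "y \<in> X" using orbit_subset_perm_on[OF p assms(1)] by blast
  then show ?case using step neck_step by simp
qed (use assms neck_step in auto)

lemma neck_some_orbit: "x \<in> X \<Longrightarrow> neck f lab (SOME y. y \<in> orbit f x) = neck f lab x"
  by (rule neck_orbit, assumption, rule someI) (rule self_in_orbit[OF p])

end

text \<open>A transparent point contributes no letter, and coherence hands its vertex on to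
  \<open>f x\<close> in case the whole cycle is transparent; \<open>f x \<noteq> x\<close> keeps the
  cycle from disappearing.\<close>

lemma coll_bypass:
  assumes p: "perm_on f X" and coh: "coherent f lab X"
    and x: "x \<in> X" "f x \<noteq> x" "snd (lab x) = None"
  shows "coherent (bypass x f) lab (X - {x})"
    and "coll (bypass x f) lab (X - {x}) = coll f lab X"
proof -
  have fx: "f x \<in> X - {x}" using x p perm_on_in by fastforce
  show coh': "coherent (bypass x f) lab (X - {x})"
    unfolding coherent_def
  proof (intro ballI impI)
    fix y assume y: "y \<in> X - {x}" "snd (lab y) = None"
    then show "fst (lab (bypass x f y)) = fst (lab y)"
      using coh x by (auto simp: bypass_def coherent_def)
  qed
  note p' = perm_on_bypass[OF p x(1,2)]
  have neck: "neck (bypass x f) lab y = neck f lab y" if y: "y \<in> X - {x}" for y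
  proof (cases "x \<in> orbit f y")
    case False
    then show ?thesis using iterates_bypass_other[OF p x(1)] y by (simp add: neck_def)
  next
    case True
    then have o: "orbit f x = orbit f y" using orbit_eq_of_mem[OF p] y by blast
    then have yo: "y \<in> orbit f x" using self_in_orbit[OF p] y by blast
    then have "y \<in> orbit (bypass x f) (f x)" using iterates_bypass(2)[OF p x(1,2)] y by simp
    then have "neck (bypass x f) lab y = neck (bypass x f) lab (f x)"
      by (rule neck_orbit[OF p' coh' fx])
    \<comment> \<open>Started at \<open>f x\<close> and at \<open>x\<close>, the two lists of points
      differ only by the leading transparent \<open>x\<close>.\<close>
    also have "\<dots> = neck f lab x"
    proof -
      obtain ys where xs: "iterates f x = x # ys"
        using nth_iterates[OF p x(1), of 0] card_orbit_pos[OF p x(1)] length_iterates[OF p x(1)]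
        by (cases "iterates f x") auto
      then show ?thesis
        using coh x by (simp add: neck_def iterates_bypass(1)[OF p x(1,2)] coherent_def Let_def)
    qed
    also have "\<dots> = neck f lab y" using neck_orbit[OF p coh x(1) yo] by simp
    finally show ?thesis .
  qed
  let ?o = "orbit f ` X" let ?o' = "orbit (bypass x f) ` (X - {x})"
  have "coll (bypass x f) lab (X - {x})
      = image_mset (\<lambda>W. neck (bypass x f) lab (SOME x. x \<in> W)) (image_mset (\<lambda>W. W - {x}) (mset_set ?o))"
    unfolding coll_def
    using orbits_bypass(1)[OF p x(1,2)]
    by (simp add: bij_betw_def image_mset_mset_set)
  also have "\<dots> = coll f lab X"
    unfolding coll_def multiset.map_comp
  proof (rule image_mset_cong)
    fix W assume "W \<in># mset_set ?o"
    then have W: "W \<in> ?o" using p by (simp add: perm_on_def)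
    then obtain y where y: "y \<in> X - {x}" "W = orbit f y"
      using fx orbit_step_eq[OF p x(1)] by (metis Diff_iff empty_iff imageE insert_iff)
    have "(SOME z. z \<in> W - {x}) \<in> W - {x}"
      unfolding some_in_eq using y self_in_orbit[OF p, of y] by auto
    then have *: "(SOME z. z \<in> W - {x}) \<in> X - {x}" "(SOME z. z \<in> W - {x}) \<in> orbit f y"
      using y orbit_subset_perm_on[OF p] by auto
    show "((\<lambda>W. neck (bypass x f) lab (SOME x. x \<in> W)) \<circ> (\<lambda>W. W - {x})) W = neck f lab (SOME x. x \<in> W)"
      using neck[OF *(1)] neck_orbit[OF p coh _ *(2)] neck_some_orbit[OF p coh] y by simp
  qed
  finally show "coll (bypass x f) lab (X - {x}) = coll f lab X" .
qed

lemma size_coll: "size (coll f lab X) = card (orbit f ` X)"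
  by (simp add: coll_def)

lemma coll_eq_empty_iff: "finite X \<Longrightarrow> coll f lab X = {#} \<longleftrightarrow> X = {}"
  by (simp add: coll_def mset_set_empty_iff)

lemma coll_empty [simp]: "coll f lab {} = {#}"
  by (simp add: coll_def)

text \<open>Orbits, lists of points and labels are carried over by \<open>b\<close>. With the
  identity for \<open>b\<close> it also allows \<open>f\<close> and \<open>lab\<close> to be changed
  outside \<open>X\<close>.\<close>

lemma coll_iso:
  assumes p: "perm_on f X" and coh: "coherent f lab X"
    and b: "bij_betw b X Y" and fg: "\<And>x. x \<in> X \<Longrightarrow> b (f x) = g (b x)"
    and lab: "\<And>x. x \<in> X \<Longrightarrow> lab' (b x) = lab x"
  shows "perm_on g Y" "coherent g lab' Y" "coll g lab' Y = coll f lab X"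
proof -
  have inj: "inj_on b X" and im: "b ` X = Y" using b by (auto simp: bij_betw_def)
  show pg: "perm_on g Y"
  proof (rule perm_onI)
    show "finite Y" using p im by (auto simp: perm_on_def)
    show "g y \<in> Y" if "y \<in> Y" for y using that im fg perm_on_in[OF p] by (metis imageE imageI)
    show "y = z" if yz: "y \<in> Y" "z \<in> Y" "g y = g z" for y z
    proof -
      obtain u v where uv: "u \<in> X" "v \<in> X" "y = b u" "z = b v" using yz im by auto
      then have "b (f u) = b (f v)" using yz fg by simp
      then have "f u = f v" using inj uv perm_on_in[OF p] by (auto dest: inj_onD)
      then show ?thesis using uv perm_on_inj[OF p] by simp
    qed
  qed
  show cg: "coherent g lab' Y"
    unfolding coherent_def
  proof (intro ballI impI)
    fix y assume "y \<in> Y" "snd (lab' y) = None"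
    moreover from this obtain x where "x \<in> X" "y = b x" using im by auto
    ultimately show "fst (lab' (g y)) = fst (lab' y)"
      using coh lab[of x] lab[of "f x"] perm_on_in[OF p, of x] fg[of x] by (simp add: coherent_def)
  qed
  have it: "iterates g (b x) = map b (iterates f x)" "orbit g (b x) = b ` orbit f x" if x: "x \<in> X" for x
  proof -
    let ?xs = "iterates f x"
    have sub: "set ?xs \<subseteq> X" using set_iterates[OF p x] orbit_subset_perm_on[OF p x] by simp
    have pos: "?xs \<noteq> []"
      using card_orbit_pos[OF p x] length_iterates[OF p x] by (metis length_greater_0_conv less_irrefl)
    have 1: "distinct (map b ?xs)"
      using distinct_iterates[OF p x] inj sub by (auto simp: distinct_map intro: inj_on_subset)
    have 2: "map b ?xs \<noteq> []" using pos by simp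
    have 3: "map b ?xs ! 0 = b x"
      using pos nth_iterates[OF p x, of 0] card_orbit_pos[OF p x] by simp
    have 4: "g (map b ?xs ! i) = map b ?xs ! (Suc i mod length (map b ?xs))" if "i < length (map b ?xs)" for i
    proof -
      have i: "i < length ?xs" "?xs ! i \<in> X" using that sub nth_mem by (auto simp: subset_iff)
      moreover have "Suc i mod length ?xs < length ?xs" using pos by simp
      ultimately show ?thesis using step_iterates[OF p x i(1)] fg[OF i(2)] by (simp add: nth_map)
    qed
    show "iterates g (b x) = map b ?xs" "orbit g (b x) = b ` orbit f x"
      using iterates_eqI[OF 1 2 3 4] set_iterates[OF p x] by auto
  qed
  have neck: "neck g lab' (b x) = neck f lab x" if x: "x \<in> X" for x
  proof -
    have "set (iterates f x) \<subseteq> X" using set_iterates[OF p x] orbit_subset_perm_on[OF p x] by simp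
    then have "visible_arcs (lab' \<circ> b) (iterates f x) = visible_arcs lab (iterates f x)"
      using lab by (intro visible_arcs_cong) auto
    then show ?thesis using x lab by (simp add: neck_def it visible_arcs_map Let_def)
  qed
  have ob: "orbit g ` Y = (`) b ` (orbit f ` X)"
    using im it(2) by (auto simp: image_image)
  have "inj_on ((`) b) (orbit f ` X)"
    using inj orbit_subset_perm_on[OF p] by (auto simp: inj_on_def inj_on_image_eq_iff)
  then have "mset_set (orbit g ` Y) = image_mset ((`) b) (mset_set (orbit f ` X))"
    by (simp add: ob image_mset_mset_set)
  then have "coll g lab' Y = image_mset ((\<lambda>W. neck g lab' (SOME x. x \<in> W)) \<circ> (`) b) (mset_set (orbit f ` X))"
    by (simp add: coll_def multiset.map_comp)
  also have "\<dots> = coll f lab X"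
    unfolding coll_def
  proof (rule image_mset_cong)
    fix W assume "W \<in># mset_set (orbit f ` X)"
    then obtain x where x: "x \<in> X" "W = orbit f x" using p by (auto simp: perm_on_def)
    have "b x \<in> Y" using x im by auto
    then show "((\<lambda>W. neck g lab' (SOME x. x \<in> W)) \<circ> (`) b) W = neck f lab (SOME x. x \<in> W)"
      using neck[OF x(1)] neck_some_orbit[OF p coh x(1)] neck_some_orbit[OF pg cg] x
      by (simp flip: it(2)[OF x(1)])
  qed
  finally show "coll g lab' Y = coll f lab X" .
qed

lemma coll_cong:
  assumes "perm_on f X" "coherent f lab X" "\<And>x. x \<in> X \<Longrightarrow> f x = g x" "\<And>x. x \<in> X \<Longrightarrow> lab x = lab' x"
  shows "coll f lab X = coll g lab' X"
  using coll_iso(3)[OF assms(1,2), of "\<lambda>x. x" X g lab'] assms by (simp add: bij_betw_def)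

section \<open>Presentations of collections\<close>

text \<open>Elements are matched greedily: removing an element and a partner with the same value
  leaves equal multisets.\<close>

lemma image_mset_set_eq_bij:
  assumes "finite A" "finite B" "image_mset u (mset_set A) = image_mset v (mset_set B)"
  shows "\<exists>h. bij_betw h A B \<and> (\<forall>a\<in>A. v (h a) = u a)"
  using assms
proof (induction A arbitrary: B rule: finite_induct)
  case empty
  then have "B = {}" by (simp add: mset_set_empty_iff)
  then show ?case by (simp add: bij_betw_def)
next
  case (insert a A)
  have "u a \<in># image_mset v (mset_set B)"
    using insert by (metis finite_insert finite_set_mset_mset_set image_eqI insertI1 set_image_mset)
  then obtain b where b: "b \<in> B" "v b = u a" using insert by auto
  have "mset_set B = add_mset b (mset_set (B - {b}))"
    using b insert by (simp add: mset_set.remove)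
  then have "image_mset u (mset_set A) = image_mset v (mset_set (B - {b}))"
    using insert b by simp
  then obtain h where h: "bij_betw h A (B - {b})" "\<forall>a\<in>A. v (h a) = u a"
    using insert.IH[of "B - {b}"] insert by auto
  let ?h = "h(a := b)"
  have "bij_betw ?h A (B - {b})"
    using h(1) insert(2) by (subst bij_betw_cong[of A _ h]) auto
  then have "bij_betw ?h (A \<union> {a}) ((B - {b}) \<union> {?h a})"
    using insert(2) by (intro notIn_Un_bij_betw) auto
  moreover have "(B - {b}) \<union> {?h a} = B" using b by auto
  ultimately have "bij_betw ?h (insert a A) B" by simp
  moreover have "\<forall>x\<in>insert a A. v (?h x) = u x" using h b insert by auto
  ultimately show ?case by blast
qed

text \<open>No transparent point can be deleted any more: each is a cycle of its own, a trivial
  path. The other points are exactly the letters of the necklaces.\<close>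

definition reduced :: "('x \<Rightarrow> 'x) \<Rightarrow> ('x \<Rightarrow> 'v \<times> 'a option) \<Rightarrow> 'x set \<Rightarrow> bool" where
  "reduced f lab X \<longleftrightarrow> (\<forall>x\<in>X. snd (lab x) = None \<longrightarrow> f x = x)"

text \<open>At a point with an arc the vertex is a function of the arc, so equal arcs give equal
  labels.\<close>

definition tail_labelled :: "('a \<Rightarrow> 'v) \<Rightarrow> ('x \<Rightarrow> 'v \<times> 'a option) \<Rightarrow> 'x set \<Rightarrow> bool" where
  "tail_labelled t lab X \<longleftrightarrow> (\<forall>x\<in>X. \<forall>a. snd (lab x) = Some a \<longrightarrow> fst (lab x) = t a)"

lemma reduced_coherent: "reduced f lab X \<Longrightarrow> coherent f lab X"
  by (auto simp: reduced_def coherent_def)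

text \<open>A transparent point of a reduced configuration is fixed and so shares its cycle with no
  other point.\<close>

lemma reduced_visible_orbit:
  assumes p: "perm_on f X" and r: "reduced f lab X" and x: "x \<in> X" "snd (lab x) \<noteq> None"
    and z: "z \<in> orbit f x"
  shows "snd (lab z) \<noteq> None"
proof
  assume n: "snd (lab z) = None"
  have "z \<in> X" using z orbit_subset_perm_on[OF p x(1)] by auto
  then have "f z = z" using r n by (auto simp: reduced_def)
  then have "orbit f z = {z}" by (simp add: orbit_eq_singleton_iff)
  then have "orbit f x = {z}" using orbit_eq_of_mem[OF p x(1) z] by simp
  then show False using self_in_orbit[OF p x(1)] n x(2) by auto
qed

lemma visible_arcs_all:
  "(\<And>x. x \<in> set xs \<Longrightarrow> snd (lab x) \<noteq> None) \<Longrightarrow> visible_arcs lab xs = map (\<lambda>x. the (snd (lab x))) xs"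
  by (induction xs) (auto split: option.splits)

lemma Union_orbits:
  assumes p: "perm_on f X"
  shows "\<Union> (orbit f ` X) = X"
proof (intro equalityI UN_least subsetI)
  fix x assume "x \<in> X"
  then have "x \<in> X" "x \<in> orbit f x" by (auto simp: self_in_orbit[OF p])
  then show "x \<in> \<Union> (orbit f ` X)" by blast
next
  fix x y assume "x \<in> X" "y \<in> orbit f x"
  then show "y \<in> X" using orbit_subset_perm_on[OF p, of x] by blast
qed

text \<open>In a reduced configuration the points of a cycle correspond to the letters of its word,
  or to a single trivial path. Words of equal necklaces are rotations of each other, and matching
  letters by position is the isomorphism.\<close>

lemma orbit_iso_of_neck_eq:
  fixes lab :: "'x \<Rightarrow> 'v \<times> 'a option" and lab' :: "'y \<Rightarrow> 'v \<times> 'a option"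
  assumes p: "perm_on f X" "perm_on g Y" and r: "reduced f lab X" "reduced g lab' Y"
    and t: "tail_labelled t lab X" "tail_labelled t lab' Y"
    and x: "x \<in> X" and y: "y \<in> Y" and eq: "neck f lab x = neck g lab' y"
  shows "\<exists>b. bij_betw b (orbit f x) (orbit g y) \<and>
    (\<forall>z\<in>orbit f x. b (f z) = g (b z) \<and> lab' (b z) = lab z)"
proof -
  have vis_iff: "visible_arcs l (iterates k z) = [] \<longleftrightarrow> snd (l z) = None"
    if "perm_on k Z" "reduced k l Z" "z \<in> Z" for k l z and Z :: "'z set"
  proof -
    have "z \<in> orbit k z" by (rule self_in_orbit[OF that(1,3)])
    moreover have "snd (l z') = None" if n: "snd (l z) = None" "z' \<in> orbit k z" for z'
    proof -
      have "k z = z" using \<open>reduced k l Z\<close> \<open>z \<in> Z\<close> n by (simp add: reduced_def)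
      then have "orbit k z = {z}" by (simp add: orbit_eq_singleton_iff)
      then show ?thesis using n by simp
    qed
    ultimately show ?thesis
      using set_iterates[OF that(1,3)] by (auto simp: visible_arcs_empty_iff)
  qed
  note vx = vis_iff[OF p(1) r(1) x] and vy = vis_iff[OF p(2) r(2) y]
  have rot: "rotated (if snd (lab x) = None then Triv (fst (lab x)) else Cycle (visible_arcs lab (iterates f x)))
     (if snd (lab' y) = None then Triv (fst (lab' y)) else Cycle (visible_arcs lab' (iterates g y)))"
    using eq by (simp add: neck_def Let_def vx vy necklace.abs_eq_iff)
  show ?thesis
  proof (cases "snd (lab x)")
    case None
    then have n: "snd (lab' y) = None" "fst (lab x) = fst (lab' y)"
      using rot by (auto elim: rotated.cases split: if_splits)
    then have "f x = x" "g y = y" using None r x y by (auto simp: reduced_def)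
    moreover from this have "orbit f x = {x}" "orbit g y = {y}" by (simp_all add: orbit_eq_singleton_iff)
    moreover have "lab' y = lab x" using n None by (simp add: prod_eq_iff)
    ultimately show ?thesis by (intro exI[of _ "\<lambda>_. y"]) (auto simp: bij_betw_def)
  next
    case (Some a)
    then have sx: "snd (lab x) \<noteq> None" by simp
    then have sy: "snd (lab' y) \<noteq> None"
      and rot': "rotated (Cycle (visible_arcs lab (iterates f x)) :: ('v, 'a) cpath) (Cycle (visible_arcs lab' (iterates g y)))"
      using rot by (auto elim: rotated.cases split: if_splits)
    then obtain n where n: "visible_arcs lab' (iterates g y) = rotate n (visible_arcs lab (iterates f x))"
      by (auto elim: rotated.cases)
    let ?xs = "rotate n (iterates f x)" let ?ys = "iterates g y"
    have set_xs: "set ?xs = orbit f x" using set_iterates[OF p(1) x] by simp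
    have set_ys: "set ?ys = orbit g y" by (rule set_iterates[OF p(2) y])
    have vis: "visible_arcs lab (iterates f x) = map (\<lambda>x. the (snd (lab x))) (iterates f x)"
      "visible_arcs lab' ?ys = map (\<lambda>x. the (snd (lab' x))) ?ys"
      using reduced_visible_orbit[OF p(1) r(1) x sx] reduced_visible_orbit[OF p(2) r(2) y sy] set_ys set_xs
      by (auto intro!: visible_arcs_all)
    then have maps: "map (\<lambda>x. the (snd (lab' x))) ?ys = map (\<lambda>x. the (snd (lab x))) ?xs"
      using n by (simp add: rotate_map)
    then have len: "length ?ys = length ?xs" by (metis length_map)
    have d: "distinct ?xs" "distinct ?ys"
      using distinct_iterates[OF p(1) x] distinct_iterates[OF p(2) y] by auto
    \<comment> \<open>Starting \<open>n\<close> steps later rotates the list of points, so that the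
      lists on both sides spell the same word.\<close>
    define x' where "x' = (f ^^ n) x"
    have x': "x' \<in> X" unfolding x'_def using x by (induction n) (auto intro: perm_on_in[OF p(1)])
    have it: "iterates f x' = ?xs" unfolding x'_def by (rule iterates_funpow[OF p(1) x])
    define b where "b z = the (map_of (zip ?xs ?ys) z)" for z
    have b: "b (?xs ! i) = ?ys ! i" if "i < length ?ys" for i
      using map_of_zip_nth[OF len[symmetric] d(1) that] by (simp add: b_def)
    have "bij_betw b (set ?xs) (set ?ys)"
      unfolding bij_betw_def
    proof
      show "inj_on b (set ?xs)"
      proof (rule inj_onI)
        fix u v assume "u \<in> set ?xs" "v \<in> set ?xs" and e: "b u = b v"
        then obtain i j where "i < length ?ys" "u = ?xs ! i" "j < length ?ys" "v = ?xs ! j"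
          unfolding in_set_conv_nth len by blast
        then show "u = v" using e d(2) b by (simp add: nth_eq_iff_index_eq)
      qed
      have "set zs = (\<lambda>i. zs ! i) ` {..<length zs}" for zs :: "'z list"
        by (auto simp: in_set_conv_nth)
      from this[of ?ys] this[of ?xs, folded len] show "b ` set ?xs = set ?ys"
        using b by (simp add: image_image)
    qed
    moreover have "b (f z) = g (b z) \<and> lab' (b z) = lab z" if zs: "z \<in> set ?xs" for z
    proof -
      obtain i where i: "i < length ?ys" "z = ?xs ! i" using zs unfolding in_set_conv_nth len by blast
      have "f z = ?xs ! (Suc i mod length ?xs)"
        using step_iterates[OF p(1) x', of i] i unfolding it len by simp
      moreover have "g (?ys ! i) = ?ys ! (Suc i mod length ?ys)"
        using step_iterates[OF p(2) y i(1)] .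
      moreover have "Suc i mod length ?ys < length ?ys" using i(1) by (intro mod_less_divisor) linarith
      ultimately have 1: "b (f z) = g (b z)"
        using b i len by simp
      have zX: "z \<in> X" "b z \<in> Y"
        using i b set_xs set_ys zs orbit_subset_perm_on[OF p(1) x] orbit_subset_perm_on[OF p(2) y]
          nth_mem[OF i(1)] by auto
      obtain c where c: "snd (lab z) = Some c"
        using reduced_visible_orbit[OF p(1) r(1) x sx] zs set_xs by blast
      obtain c' where c': "snd (lab' (b z)) = Some c'"
        using reduced_visible_orbit[OF p(2) r(2) y sy] b[OF i(1)] i nth_mem[OF i(1)] set_ys by (metis not_None_eq)
      have "the (snd (lab' (?ys ! i))) = the (snd (lab (?xs ! i)))"
        using arg_cong[OF maps, of "\<lambda>l. l ! i"] i(1) len by simp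
      then have "c' = c" using c c' b[OF i(1)] i(2) by simp
      then have "lab' (b z) = lab z"
        using c c' t zX by (auto simp: tail_labelled_def prod_eq_iff)
      then show ?thesis using 1 by blast
    qed
    ultimately show ?thesis unfolding set_xs set_ys by blast
  qed
qed

text \<open>Equality of the multisets matches cycles with equal necklaces; the isomorphisms of
  single cycles are then put together.\<close>

lemma iso_of_coll_eq:
  assumes p: "perm_on f X" "perm_on g Y" and r: "reduced f lab X" "reduced g lab' Y"
    and t: "tail_labelled t lab X" "tail_labelled t lab' Y"
    and eq: "coll f lab X = coll g lab' Y"
  shows "\<exists>b. bij_betw b X Y \<and> (\<forall>x\<in>X. b (f x) = g (b x) \<and> lab' (b x) = lab x)"
proof -
  note coh = reduced_coherent[OF r(1)] reduced_coherent[OF r(2)]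
  have fin: "finite (orbit f ` X)" "finite (orbit g ` Y)" using p by (auto simp: perm_on_def)
  obtain h where h: "bij_betw h (orbit f ` X) (orbit g ` Y)"
    "\<And>W. W \<in> orbit f ` X \<Longrightarrow> neck g lab' (SOME y. y \<in> h W) = neck f lab (SOME x. x \<in> W)"
    using image_mset_set_eq_bij[OF fin eq[unfolded coll_def]] by blast
  have "\<exists>b. bij_betw b W (h W) \<and> (\<forall>z\<in>W. b (f z) = g (b z) \<and> lab' (b z) = lab z)"
    if W: "W \<in> orbit f ` X" for W
  proof -
    obtain x where x: "x \<in> X" "W = orbit f x" using W by auto
    have "h W \<in> orbit g ` Y" using h(1) W by (auto simp: bij_betw_def)
    then obtain y where y: "y \<in> Y" "h W = orbit g y" by auto
    have "neck f lab x = neck g lab' y"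
      using h(2)[OF W] x y neck_some_orbit[OF p(1) coh(1) x(1)] neck_some_orbit[OF p(2) coh(2) y(1)] by simp
    then show ?thesis using orbit_iso_of_neck_eq[OF p r t x(1) y(1)] x y by simp
  qed
  then obtain B where B: "\<And>W. W \<in> orbit f ` X \<Longrightarrow> bij_betw (B W) W (h W)"
    "\<And>W z. W \<in> orbit f ` X \<Longrightarrow> z \<in> W \<Longrightarrow> B W (f z) = g (B W z) \<and> lab' (B W z) = lab z"
    by metis
  define b where "b x = B (orbit f x) x" for x
  have bW: "b z = B (orbit f x) z" if "x \<in> X" "z \<in> orbit f x" for x z
    using orbit_eq_of_mem[OF p(1) that] by (simp add: b_def)
  have UX: "\<Union> (orbit f ` X) = X" by (rule Union_orbits[OF p(1)])
  have hX: "h ` (orbit f ` X) = orbit g ` Y" using h(1) by (simp add: bij_betw_def)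
  have UY: "\<Union> (h ` (orbit f ` X)) = Y" unfolding hX by (rule Union_orbits[OF p(2)])
  \<comment> \<open>Points of different orbits stay apart because \<open>h\<close> separates orbits
    and distinct orbits of \<open>g\<close> are disjoint.\<close>
  have inj: "inj_on b X"
  proof (rule inj_onI)
    fix u v assume u: "u \<in> X" and v: "v \<in> X" and e: "b u = b v"
    have su: "u \<in> orbit f u" "v \<in> orbit f v" using self_in_orbit[OF p(1)] u v by metis+
    have "b u \<in> h (orbit f u)" "b v \<in> h (orbit f v)"
      unfolding b_def by (rule bij_betwE[OF B(1), rule_format]; use u v su in simp)+
    moreover have "h (orbit f u) \<in> orbit g ` Y" "h (orbit f v) \<in> orbit g ` Y"
      using u v by (auto simp flip: hX)
    then obtain y z where "y \<in> Y" "h (orbit f u) = orbit g y" "z \<in> Y" "h (orbit f v) = orbit g z"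
      by (elim imageE) metis
    ultimately have "h (orbit f u) = h (orbit f v)"
      using e orbits_disjoint[OF p(2), of y z] by (metis IntI empty_iff)
    then have o: "orbit f u = orbit f v"
      using h(1) u v by (auto simp: bij_betw_def dest: inj_onD)
    have "inj_on (B (orbit f u)) (orbit f u)" using B(1) u by (auto simp: bij_betw_def)
    then show "u = v" using e o su by (auto simp: b_def dest: inj_onD)
  qed
  have "b ` X = (\<Union>W\<in>orbit f ` X. b ` W)" by (subst UX[symmetric]) (rule image_Union)
  also have "\<dots> = (\<Union>W\<in>orbit f ` X. h W)"
  proof (rule SUP_cong)
    fix W assume W: "W \<in> orbit f ` X"
    then obtain x where x: "x \<in> X" "W = orbit f x" by auto
    have "b ` W = B W ` W" using bW x by (intro image_cong) auto
    then show "b ` W = h W" using B(1)[OF W] by (simp add: bij_betw_def)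
  qed simp
  finally have im: "b ` X = Y" using UY by simp
  have "b (f x) = g (b x) \<and> lab' (b x) = lab x" if x: "x \<in> X" for x
  proof -
    have "b (f x) = B (orbit f x) (f x)" using bW[OF x] by (simp add: orbit.base)
    then show ?thesis using B(2)[of "orbit f x" x] x self_in_orbit[OF p(1) x] by (simp add: b_def)
  qed
  then show ?thesis using inj im by (auto simp: bij_betw_def)
qed

section \<open>Well-formed configurations\<close>

lemma star_star [simp]: "star (star a) = a"
  by (cases a) auto

lemma star_neq: "star a \<noteq> a" "a \<noteq> star a"
  by (cases a; simp)+

lemma double_simps [simp]:
  "verts (double Q) = verts Q"
  "tail (double Q) (star a) = head (double Q) a"
  "head (double Q) (star a) = tail (double Q) a"
  by (cases a; simp add: double_def)+

text \<open>The condition under which cycles spell closed walks in the double: the next point sits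
  at the head of the arc, or at the same vertex if the point is transparent. Finiteness of
  \<open>X\<close> comes with \<open>perm_on\<close>.\<close>

definition wfc :: "('v, 'e) pre_digraph \<Rightarrow> ('x \<Rightarrow> 'x) \<Rightarrow> ('x \<Rightarrow> 'v \<times> 'e darc option) \<Rightarrow> 'x set \<Rightarrow> bool" where
  "wfc Q f lab X \<longleftrightarrow> perm_on f X \<and> (\<forall>x\<in>X. fst (lab x) \<in> verts Q \<and>
     (case snd (lab x) of
        None \<Rightarrow> fst (lab (f x)) = fst (lab x)
      | Some a \<Rightarrow> a \<in> arcs (double Q) \<and> fst (lab x) = tail (double Q) a \<and> fst (lab (f x)) = head (double Q) a))"

lemma wfc_perm_on: "wfc Q f lab X \<Longrightarrow> perm_on f X"
  by (simp add: wfc_def)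

lemma wfc_finite: "wfc Q f lab X \<Longrightarrow> finite X"
  by (simp add: wfc_def perm_on_def)

lemma wfc_coherent: "wfc Q f lab X \<Longrightarrow> coherent f lab X"
  by (auto simp: wfc_def coherent_def)

lemma wfc_tail_labelled: "wfc Q f lab X \<Longrightarrow> tail_labelled (tail (double Q)) lab X"
  unfolding wfc_def tail_labelled_def by (intro ballI allI impI) (drule conjunct2, drule bspec, auto)

lemma wfcD:
  assumes "wfc Q f lab X" "x \<in> X"
  shows "fst (lab x) \<in> verts Q"
    and "snd (lab x) = None \<Longrightarrow> fst (lab (f x)) = fst (lab x)"
    and "snd (lab x) = Some a \<Longrightarrow> a \<in> arcs (double Q) \<and> fst (lab x) = tail (double Q) a \<and> fst (lab (f x)) = head (double Q) a"
  using assms by (auto simp: wfc_def split: option.splits)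

lemma wfc_subset:
  assumes "wfc Q f lab X" "Y \<subseteq> X" "\<And>y. y \<in> Y \<Longrightarrow> f y \<in> Y"
  shows "wfc Q f lab Y"
  using assms perm_on_subset[of f X Y] by (auto simp: wfc_def)

lemma wfc_bypass:
  assumes w: "wfc Q f lab X" and x: "x \<in> X" "f x \<noteq> x" "snd (lab x) = None"
  shows "wfc Q (bypass x f) lab (X - {x})"
  unfolding wfc_def
proof (intro conjI ballI)
  show "perm_on (bypass x f) (X - {x})" by (rule perm_on_bypass[OF wfc_perm_on[OF w] x(1,2)])
  fix y assume y: "y \<in> X - {x}"
  then show "fst (lab y) \<in> verts Q" using wfcD[OF w] by auto
  have "fst (lab (bypass x f y)) = fst (lab (f y))"
    using wfcD(2)[OF w x(1) x(3)] by (simp add: bypass_def)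
  then show "case snd (lab y) of
        None \<Rightarrow> fst (lab (bypass x f y)) = fst (lab y)
      | Some a \<Rightarrow> a \<in> arcs (double Q) \<and> fst (lab y) = tail (double Q) a \<and> fst (lab (bypass x f y)) = head (double Q) a"
    using wfcD(2,3)[OF w, of y] y by (auto split: option.splits)
qed

lemma cas_append: "pre_digraph.cas G u (p @ q) v \<longleftrightarrow> (\<exists>w. pre_digraph.cas G u p w \<and> pre_digraph.cas G w q v)"
  by (induction p arbitrary: u) (auto simp: pre_digraph.cas.simps)

lemma neck_in_necklaces:
  assumes w: "wfc Q f lab X" and x: "x \<in> X"
  shows "neck f lab x \<in> necklaces Q"
proof -
  note p = wfc_perm_on[OF w]
  have pow: "(f ^^ n) x \<in> X" for n using x by (induction n) (auto intro: perm_on_in[OF p])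
  \<comment> \<open>The first \<open>k\<close> points of the cycle spell a walk to the vertex of the
    point after them; a full period closes it.\<close>
  have cas: "pre_digraph.cas (double Q) (fst (lab x)) (visible_arcs lab (map (\<lambda>n. (f ^^ n) x) [0..<k]))
      (fst (lab ((f ^^ k) x)))" for k
  proof (induction k)
    case (Suc k)
    then show ?case
      using wfcD[OF w pow[of k]]
      by (cases "snd (lab ((f ^^ k) x))") (auto simp: cas_append pre_digraph.cas.simps)
  qed (simp add: pre_digraph.cas.simps)
  let ?as = "visible_arcs lab (iterates f x)"
  have "pre_digraph.cas (double Q) (fst (lab x)) ?as (fst (lab x))"
    using cas[of "card (orbit f x)"] funpow_card_orbit[OF p x] by (simp add: iterates_def)
  moreover have "set ?as \<subseteq> arcs (double Q)"
  proof -
    have "set (visible_arcs lab xs) \<subseteq> arcs (double Q)" if "set xs \<subseteq> X" for xs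
      using that wfcD(3)[OF w] by (induction xs) (auto split: option.splits)
    then show ?thesis using set_iterates[OF p x] orbit_subset_perm_on[OF p x] by simp
  qed
  ultimately have "cyclic_path Q (if ?as = [] then Triv (fst (lab x)) else Cycle ?as)"
    using wfcD(1)[OF w x] by (auto simp: cyclic_path_def pre_digraph.awalk_def)
  then show ?thesis unfolding neck_def necklaces_def Let_def by blast
qed

lemma coll_in_collections:
  assumes w: "wfc Q f lab X"
  shows "coll f lab X \<in> collections Q"
proof -
  note p = wfc_perm_on[OF w]
  have "neck f lab (SOME x. x \<in> orbit f y) \<in> necklaces Q" if "y \<in> X" for y
    using neck_some_orbit[OF p wfc_coherent[OF w] that] neck_in_necklaces[OF w that] by simp
  then show ?thesis using p by (auto simp: collections_def coll_def perm_on_def)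
qed

text \<open>Deleting transparent points one by one ends in a reduced configuration, so a property
  that can be pulled back along one deletion needs proof only there.\<close>

lemma wfc_induct [consumes 1, case_names bypass reduced]:
  assumes w: "wfc Q f lab X"
    and step: "\<And>f X x. wfc Q f lab X \<Longrightarrow> x \<in> X \<Longrightarrow> f x \<noteq> x \<Longrightarrow> snd (lab x) = None \<Longrightarrow>
        P (bypass x f) (X - {x}) \<Longrightarrow> P f X"
    and base: "\<And>f X. wfc Q f lab X \<Longrightarrow> reduced f lab X \<Longrightarrow> P f X"
  shows "P f X"
  using w
proof (induction "card X" arbitrary: f X rule: less_induct)
  case less
  show ?case
  proof (cases "reduced f lab X")
    case True
    then show ?thesis by (rule base[OF less.prems])
  next
    case False
    then obtain x where x: "x \<in> X" "f x \<noteq> x" "snd (lab x) = None" by (auto simp: reduced_def)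
    have "card (X - {x}) < card X" by (rule card_Diff1_less[OF wfc_finite[OF less.prems] x(1)])
    then show ?thesis by (intro step[OF less.prems x] less.hyps wfc_bypass[OF less.prems x])
  qed
qed

section \<open>The configuration of a presentation\<close>

text \<open>The lower bound 1 is for trivial paths: they have no abstract edge but receive the
  single transparent point \<open>(i, 0)\<close>, so that every member of a collection is a cycle of
  points.\<close>

definition row_length :: "('v, 'a) cpath list \<Rightarrow> nat \<Rightarrow> nat" where
  "row_length xs i = max 1 (length (arcs_of (xs ! i)))"

definition points :: "('v, 'a) cpath list \<Rightarrow> (nat \<times> nat) set" where
  "points xs = (SIGMA i:{..<length xs}. {..<row_length xs i})"

definition succ_point :: "('v, 'a) cpath list \<Rightarrow> nat \<times> nat \<Rightarrow> nat \<times> nat" where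
  "succ_point xs = (\<lambda>(i, j). (i, Suc j mod row_length xs i))"

definition point_label :: "('v, 'e) pre_digraph \<Rightarrow> ('v, 'e darc) cpath list \<Rightarrow> nat \<times> nat \<Rightarrow> 'v \<times> 'e darc option" where
  "point_label Q xs = (\<lambda>(i, j). case xs ! i of Triv v \<Rightarrow> (v, None) | Cycle p \<Rightarrow> (tail (double Q) (p ! j), Some (p ! j)))"

lemma row_length_pos [simp]: "row_length xs i > 0"
  by (simp add: row_length_def)

lemma perm_on_points: "perm_on (succ_point xs) (points xs)"
proof (rule perm_onI)
  show "finite (points xs)" by (simp add: points_def)
  show "succ_point xs x \<in> points xs" if "x \<in> points xs" for x
    using that by (auto simp: points_def succ_point_def)
  show "x = y" if "x \<in> points xs" "y \<in> points xs" "succ_point xs x = succ_point xs y" for x y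
    using that by (auto simp: points_def succ_point_def mod_Suc split: if_splits)
qed

lemma iterates_points:
  shows "iterates (succ_point xs) (i, 0) = map (Pair i) [0..<row_length xs i]"
    and "orbit (succ_point xs) (i, 0) = {i} \<times> {..<row_length xs i}"
proof -
  let ?l = "map (Pair i) [0..<row_length xs i]"
  have 1: "distinct ?l" by (simp add: distinct_map inj_on_def)
  have 2: "?l \<noteq> []" by simp
  have 3: "?l ! 0 = (i, 0)" by simp
  have 4: "succ_point xs (?l ! k) = ?l ! (Suc k mod length ?l)" if "k < length ?l" for k
    using that by (simp add: succ_point_def)
  show "iterates (succ_point xs) (i, 0) = ?l" by (rule iterates_eqI(1)[OF 1 2 3 4])
  have "orbit (succ_point xs) (i, 0) = set ?l" by (rule iterates_eqI(2)[OF 1 2 3 4])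
  then show "orbit (succ_point xs) (i, 0) = {i} \<times> {..<row_length xs i}" by auto
qed

lemma orbit_points:
  assumes "(i, j) \<in> points xs"
  shows "orbit (succ_point xs) (i, j) = {i} \<times> {..<row_length xs i}"
proof -
  have "(i, 0) \<in> points xs" "(i, j) \<in> orbit (succ_point xs) (i, 0)"
    using assms by (simp_all add: points_def iterates_points)
  from orbit_eq_of_mem[OF perm_on_points this] show ?thesis by (simp only: iterates_points(2))
qed

lemma wfc_points:
  assumes "\<And>c. c \<in> set xs \<Longrightarrow> cyclic_path Q c" and wf: "wf_digraph Q"
  shows "wfc Q (succ_point xs) (point_label Q xs) (points xs)"
  unfolding wfc_def
proof (intro conjI perm_on_points ballI)
  fix x assume "x \<in> points xs"
  then obtain i j where x: "x = (i, j)" "i < length xs" "j < row_length xs i" by (auto simp: points_def)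
  have c: "cyclic_path Q (xs ! i)" using assms(1) x by auto
  have "fst (point_label Q xs x) \<in> verts Q \<and>
     (case snd (point_label Q xs x) of
        None \<Rightarrow> fst (point_label Q xs (succ_point xs x)) = fst (point_label Q xs x)
      | Some a \<Rightarrow> a \<in> arcs (double Q) \<and> fst (point_label Q xs x) = tail (double Q) a \<and>
          fst (point_label Q xs (succ_point xs x)) = head (double Q) a)"
  proof (cases "xs ! i")
    case (Triv v)
    then show ?thesis using x c by (simp add: point_label_def succ_point_def cyclic_path_def)
  next
    case (Cycle p)
    then obtain u where u: "p \<noteq> []" "set p \<subseteq> arcs (double Q)" "pre_digraph.cas (double Q) u p u"
      using c by (auto simp: cyclic_path_def pre_digraph.awalk_def)
    have len: "row_length xs i = length p" using u Cycle by (simp add: row_length_def max_def Suc_le_eq)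
    then have j: "j < length p" using x by simp
    have arc: "p ! j \<in> arcs (double Q)" using u j by auto
    then have "tail (double Q) (p ! j) \<in> verts Q"
      using wf unfolding wf_digraph_def double_def by auto
    \<comment> \<open>Consecutive arcs meet, as splitting the walk around them shows; after the last
      arc both ends are the base vertex \<open>u\<close>.\<close>
    moreover have "tail (double Q) (p ! (Suc j mod length p)) = head (double Q) (p ! j)"
    proof (cases "Suc j < length p")
      case True
      then have "p = take j p @ [p ! j, p ! Suc j] @ drop (Suc (Suc j)) p"
        by (metis Cons_nth_drop_Suc Suc_lessD append_Cons append_Nil append_take_drop_id)
      then have "pre_digraph.cas (double Q) u (take j p @ [p ! j, p ! Suc j] @ drop (Suc (Suc j)) p) u"
        using u(3) by simp
      then show ?thesis using True by (auto simp: cas_append pre_digraph.cas.simps)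
    next
      case False
      then have j': "Suc j = length p" using j by simp
      then have "p = take j p @ [p ! j]" using take_Suc_conv_app_nth[OF j] by simp
      then have "pre_digraph.cas (double Q) u (take j p @ [p ! j]) u" using u(3) by simp
      then have h: "head (double Q) (p ! j) = u" by (auto simp: cas_append pre_digraph.cas.simps)
      have "tail (double Q) (p ! 0) = u" using u by (cases p) (auto simp: pre_digraph.cas.simps)
      then show ?thesis using h j' by simp
    qed
    ultimately show ?thesis using x Cycle arc len by (simp add: point_label_def succ_point_def)
  qed
  then show "fst (point_label Q xs x) \<in> verts Q"
    "case snd (point_label Q xs x) of
        None \<Rightarrow> fst (point_label Q xs (succ_point xs x)) = fst (point_label Q xs x)
      | Some a \<Rightarrow> a \<in> arcs (double Q) \<and> fst (point_label Q xs x) = tail (double Q) a \<and>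
          fst (point_label Q xs (succ_point xs x)) = head (double Q) a" by blast+
qed

lemma neck_points:
  assumes c: "cyclic_path Q (xs ! i)" and "i < length xs"
  shows "neck (succ_point xs) (point_label Q xs) (i, 0) = abs_necklace (xs ! i)"
proof (cases "xs ! i")
  case (Triv v)
  then show ?thesis
    by (simp add: neck_def iterates_points row_length_def point_label_def)
next
  case (Cycle p)
  then have p: "p \<noteq> []" using c by (simp add: cyclic_path_def)
  then have len: "row_length xs i = length p" using Cycle by (simp add: row_length_def max_def Suc_le_eq)
  have "visible_arcs (point_label Q xs) (map (Pair i) ns) = map ((!) p) ns" for ns
    by (induction ns) (auto simp: point_label_def Cycle)
  then show ?thesis
    using Cycle p by (simp add: neck_def iterates_points len map_nth)
qed

lemma reduced_points: "reduced (succ_point xs) (point_label Q xs) (points xs)"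
  unfolding reduced_def
proof (intro ballI impI)
  fix x assume x: "x \<in> points xs" "snd (point_label Q xs x) = None"
  obtain i j where ij: "x = (i, j)" by (cases x)
  obtain v where "xs ! i = Triv v" using x(2) by (cases "xs ! i") (simp_all add: ij point_label_def)
  then show "succ_point xs x = x"
    using x(1) by (simp add: ij points_def succ_point_def row_length_def)
qed

text \<open>Selecting rows is what separates the factors inside a concatenated presentation.\<close>

lemma coll_points:
  assumes "\<And>c. c \<in> set xs \<Longrightarrow> cyclic_path Q c" and wf: "wf_digraph Q" and I: "I \<subseteq> {..<length xs}"
  shows "coll (succ_point xs) (point_label Q xs) {x \<in> points xs. fst x \<in> I}
    = image_mset (\<lambda>i. abs_necklace (xs ! i)) (mset_set I)"
proof -
  let ?f = "succ_point xs" and ?l = "point_label Q xs"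
  note w = wfc_points[OF assms(1) wf, of xs, simplified]
  have im: "orbit ?f ` {x \<in> points xs. fst x \<in> I} = (\<lambda>i. {i} \<times> {..<row_length xs i}) ` I"
  proof (intro equalityI subsetI)
    fix W assume "W \<in> orbit ?f ` {x \<in> points xs. fst x \<in> I}"
    then show "W \<in> (\<lambda>i. {i} \<times> {..<row_length xs i}) ` I" using orbit_points[of _ _ xs] by auto
  next
    fix W assume "W \<in> (\<lambda>i. {i} \<times> {..<row_length xs i}) ` I"
    then obtain i where "i \<in> I" "W = orbit ?f (i, 0)" by (auto simp: iterates_points)
    moreover from this have "(i, 0) \<in> {x \<in> points xs. fst x \<in> I}" using I by (auto simp: points_def)
    ultimately show "W \<in> orbit ?f ` {x \<in> points xs. fst x \<in> I}" by blast
  qed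
  have inj: "inj_on (\<lambda>i. {i} \<times> {..<row_length xs i}) I"
  proof (rule inj_onI)
    fix i k assume e: "{i} \<times> {..<row_length xs i} = {k} \<times> {..<row_length xs k}"
    have "(i, 0) \<in> {i} \<times> {..<row_length xs i}" by simp
    then show "i = k" unfolding e by simp
  qed
  have "coll ?f ?l {x \<in> points xs. fst x \<in> I}
    = image_mset ((\<lambda>W. neck ?f ?l (SOME x. x \<in> W)) \<circ> (\<lambda>i. {i} \<times> {..<row_length xs i})) (mset_set I)"
    unfolding coll_def im using inj by (simp flip: image_mset_mset_set multiset.map_comp)
  also have "\<dots> = image_mset (\<lambda>i. abs_necklace (xs ! i)) (mset_set I)"
  proof (rule image_mset_cong)
    fix i assume "i \<in># mset_set I"
    then have i: "i < length xs" using I by (cases "finite I") auto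
    then have "(i, 0) \<in> points xs" by (simp add: points_def)
    then show "((\<lambda>W. neck ?f ?l (SOME x. x \<in> W)) \<circ> (\<lambda>i. {i} \<times> {..<row_length xs i})) i = abs_necklace (xs ! i)"
      using neck_some_orbit[OF wfc_perm_on[OF w] wfc_coherent[OF w], of "(i, 0)"] neck_points[OF assms(1) i] i assms(1)
      by (simp add: iterates_points)
  qed
  finally show ?thesis .
qed

text \<open>Rotation moves the base point of the closed walk to the vertex \<open>v\<close> reached
  after \<open>k\<close> arcs.\<close>

lemma cyclic_path_rotated:
  assumes wf: "wf_digraph Q" and "rotated c c'" "cyclic_path Q c"
  shows "cyclic_path Q c'"
  using assms(2)
proof cases
  case (2 p n)
  then obtain u where u: "p \<noteq> []" "set p \<subseteq> arcs (double Q)" "pre_digraph.cas (double Q) u p u" "u \<in> verts Q"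
    using assms(3) by (auto simp: cyclic_path_def pre_digraph.awalk_def)
  define k where "k = n mod length p"
  have k: "k < length p" using u by (simp add: k_def)
  have rot: "rotate n p = drop k p @ take k p" by (simp add: k_def rotate_drop_take)
  obtain v where v: "pre_digraph.cas (double Q) u (take k p) v" "pre_digraph.cas (double Q) v (drop k p) u"
    using u(3) cas_append[of "double Q" u "take k p" "drop k p" u] by auto
  \<comment> \<open>\<open>awalk\<close> wants its start to be a vertex: \<open>v\<close> is the
    tail of the first arc of \<open>drop k p\<close>, which is nonempty as
    \<open>k < length p\<close>.\<close>
  have "v \<in> verts Q"
  proof -
    obtain a as where a: "drop k p = a # as" using k by (cases "drop k p") auto
    then have "a \<in> arcs (double Q)" using u(2) by (metis in_set_dropD list.set_intros(1) subsetD)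
    moreover have "tail (double Q) a = v" using v(2) a by (simp add: pre_digraph.cas.simps)
    ultimately show ?thesis using wf unfolding wf_digraph_def double_def by auto
  qed
  moreover have "pre_digraph.cas (double Q) v (drop k p @ take k p) v"
    using v unfolding cas_append by blast
  moreover have "set (drop k p @ take k p) \<subseteq> arcs (double Q)"
    using u(2) by (metis append_take_drop_id set_append Un_commute)
  ultimately show ?thesis
    using 2 u(1) k by (auto simp: cyclic_path_def pre_digraph.awalk_def rot)
qed (use assms in auto)

text \<open>Lists of representatives exist, so \<open>SOME\<close> yields one. Its entries are known
  only up to rotation, hence the appeal to \<open>cyclic_path_rotated\<close>.\<close>

lemma presentation_props:
  assumes "P \<in> collections Q" and wf: "wf_digraph Q"
  shows "mset (map abs_necklace (presentation P)) = P" "\<And>c. c \<in> set (presentation P) \<Longrightarrow> cyclic_path Q c"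
proof -
  obtain ns where ns: "mset ns = P" using ex_mset by blast
  have "mset (map abs_necklace (map rep_necklace ns)) = P"
    using ns by (simp add: comp_def Quotient_abs_rep[OF Quotient_necklace])
  then show 1: "mset (map abs_necklace (presentation P)) = P"
    unfolding presentation_def by (rule someI)
  fix c assume "c \<in> set (presentation P)"
  then have "abs_necklace c \<in># P" by (subst 1[symmetric]) simp
  then have "abs_necklace c \<in> necklaces Q" using assms by (auto simp: collections_def)
  then obtain c' where "cyclic_path Q c'" "abs_necklace c = abs_necklace c'" by (auto simp: necklaces_def)
  then have "rotated c' c"
    using equivp_symp[OF equivp_rotated, of c c'] by (simp add: necklace.abs_eq_iff)
  then show "cyclic_path Q c" using cyclic_path_rotated[OF wf] \<open>cyclic_path Q c'\<close> by blast
qed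

section \<open>Matchings and gluing\<close>

text \<open>A pair \<open>(J, \<phi>)\<close> of the definitions becomes one total involution with
  \<open>J\<close> as its set of moved points. This loses nothing, since no arc is its own reverse
  and so \<open>\<phi>\<close> has no fixed point in \<open>J\<close>.\<close>

definition matchings :: "('x \<Rightarrow> 'v \<times> 'e darc option) \<Rightarrow> 'x set \<Rightarrow> ('x \<Rightarrow> 'x) set" where
  "matchings lab X = {\<theta>. (\<forall>x. x \<notin> X \<longrightarrow> \<theta> x = x) \<and> (\<forall>x. \<theta> (\<theta> x) = x) \<and>
     (\<forall>x\<in>X. \<theta> x \<noteq> x \<longrightarrow> (\<exists>a. snd (lab x) = Some a \<and> snd (lab (\<theta> x)) = Some (star a)))}"

text \<open>Matched points stay, as transparent points with their vertex, so that the set of points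
  is the same before and after a contraction; deleting them is left to
  \<open>bypass\<close>.\<close>

definition cut_label :: "('x \<Rightarrow> 'x) \<Rightarrow> ('x \<Rightarrow> 'v \<times> 'a option) \<Rightarrow> 'x \<Rightarrow> 'v \<times> 'a option" where
  "cut_label \<theta> lab x = (fst (lab x), if \<theta> x = x then snd (lab x) else None)"

definition is_fwd :: "('x \<Rightarrow> 'v \<times> 'e darc option) \<Rightarrow> 'x \<Rightarrow> bool" where
  "is_fwd lab x \<longleftrightarrow> (\<exists>e. snd (lab x) = Some (Fwd e))"

text \<open>Opposite arcs are matched, so each pair has exactly one forward point. It represents the
  pair and fixes the order of the arguments of the sign.\<close>

definition fwd_points :: "('x \<Rightarrow> 'v \<times> 'e darc option) \<Rightarrow> 'x set \<Rightarrow> ('x \<Rightarrow> 'x) \<Rightarrow> 'x set" where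
  "fwd_points lab X \<theta> = {x \<in> X. \<theta> x \<noteq> x \<and> is_fwd lab x}"

text \<open>The sign rule \<open>s\<close> is a parameter because successive contractions lead to
  sums of sign rules.\<close>

definition wt :: "('x \<Rightarrow> 'x \<Rightarrow> 'k::field_char_0 poly) \<Rightarrow> ('x \<Rightarrow> 'v \<times> 'e darc option) \<Rightarrow> 'x set \<Rightarrow> ('x \<Rightarrow> 'x) \<Rightarrow> 'k poly" where
  "wt s lab X \<theta> = (\<Prod>x\<in>fwd_points lab X \<theta>. half_h 1 * s x (\<theta> x))"

text \<open>With the factors as colours this is the sign in the product, with the colours of the
  glued members the sign in the coproduct. Its vanishing on equal colours discards the unwanted
  pairs.\<close>

definition sg :: "('x \<Rightarrow> nat) \<Rightarrow> 'x \<Rightarrow> 'x \<Rightarrow> 'r::comm_ring_1" where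
  "sg c x y = (if c x < c y then 1 else if c x = c y then 0 else - 1)"

lemma matchingsD:
  assumes "\<theta> \<in> matchings lab X"
  shows "x \<notin> X \<Longrightarrow> \<theta> x = x" "\<theta> (\<theta> x) = x"
    "\<theta> x \<noteq> x \<Longrightarrow> x \<in> X \<and> \<theta> x \<in> X \<and> (\<exists>a. snd (lab x) = Some a \<and> snd (lab (\<theta> x)) = Some (star a))"
    "x \<in> X \<Longrightarrow> \<theta> x \<in> X"
proof -
  have out: "\<And>x. x \<notin> X \<Longrightarrow> \<theta> x = x" and inv: "\<And>x. \<theta> (\<theta> x) = x"
    and lab: "\<And>x. x \<in> X \<Longrightarrow> \<theta> x \<noteq> x \<Longrightarrow> \<exists>a. snd (lab x) = Some a \<and> snd (lab (\<theta> x)) = Some (star a)"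
    using assms unfolding matchings_def by auto
  show "x \<notin> X \<Longrightarrow> \<theta> x = x" "\<theta> (\<theta> x) = x" by (fact out inv)+
  show 4: "x \<in> X \<Longrightarrow> \<theta> x \<in> X" using out[of "\<theta> x"] inv[of x] by metis
  show "\<theta> x \<noteq> x \<Longrightarrow> x \<in> X \<and> \<theta> x \<in> X \<and> (\<exists>a. snd (lab x) = Some a \<and> snd (lab (\<theta> x)) = Some (star a))"
    using out[of x] 4 lab[of x] by blast
qed

lemma matching_moved:
  assumes "\<theta> \<in> matchings lab X" "\<theta> x \<noteq> x"
  obtains a where "x \<in> X" "\<theta> x \<in> X" "snd (lab x) = Some a" "snd (lab (\<theta> x)) = Some (star a)"
  using matchingsD(3)[OF assms] by blast

lemma matching_None: "\<theta> \<in> matchings lab X \<Longrightarrow> snd (lab x) = None \<Longrightarrow> \<theta> x = x"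
  using matchingsD(3) by fastforce

lemma matching_inj: "\<theta> \<in> matchings lab X \<Longrightarrow> \<theta> x = \<theta> y \<longleftrightarrow> x = y"
  using matchingsD(2) by metis

lemma is_fwd_partner:
  assumes "\<theta> \<in> matchings lab X" "\<theta> x \<noteq> x"
  shows "is_fwd lab (\<theta> x) \<longleftrightarrow> \<not> is_fwd lab x"
proof -
  obtain a where "snd (lab x) = Some a" "snd (lab (\<theta> x)) = Some (star a)"
    by (rule matching_moved[OF assms])
  then show ?thesis by (cases a) (auto simp: is_fwd_def)
qed

lemma perm_on_matching: "\<theta> \<in> matchings lab X \<Longrightarrow> finite X \<Longrightarrow> perm_on \<theta> X"
  by (rule perm_onI) (simp_all add: matchingsD(4) matching_inj)

lemma finite_matchings:
  assumes "finite X"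
  shows "finite (matchings lab X)"
proof -
  have "\<theta> permutes X" if "\<theta> \<in> matchings lab X" for \<theta>
    using matchingsD[OF that] unfolding permutes_def by metis
  then have "matchings lab X \<subseteq> {p. p permutes X}" by blast
  then show ?thesis using finite_permutations[OF assms] by (rule finite_subset)
qed

lemma id_matching: "(\<lambda>x. x) \<in> matchings lab X"
  by (simp add: matchings_def)

lemma perm_on_glue:
  assumes "perm_on f X" "\<theta> \<in> matchings lab X"
  shows "perm_on (f \<circ> \<theta>) X"
  using assms perm_on_matching[OF assms(2)] by (auto simp: perm_on_def intro: bij_betw_trans)

text \<open>After a matched point with arc \<open>a\<close> comes \<open>f (\<theta> x)\<close>, at
  the head of \<open>star a\<close>, which is the tail of \<open>a\<close>. So the vertex does not
  change there, as a transparent point requires.\<close>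

lemma wfc_glue:
  assumes w: "wfc Q f lab X" and \<theta>: "\<theta> \<in> matchings lab X"
  shows "wfc Q (f \<circ> \<theta>) (cut_label \<theta> lab) X"
  unfolding wfc_def
proof (intro conjI ballI)
  show "perm_on (f \<circ> \<theta>) X" by (rule perm_on_glue[OF wfc_perm_on[OF w] \<theta>])
  fix x assume x: "x \<in> X"
  show "fst (cut_label \<theta> lab x) \<in> verts Q" using wfcD(1)[OF w x] by (simp add: cut_label_def)
  show "case snd (cut_label \<theta> lab x) of
        None \<Rightarrow> fst (cut_label \<theta> lab ((f \<circ> \<theta>) x)) = fst (cut_label \<theta> lab x)
      | Some a \<Rightarrow> a \<in> arcs (double Q) \<and> fst (cut_label \<theta> lab x) = tail (double Q) a \<and>
          fst (cut_label \<theta> lab ((f \<circ> \<theta>) x)) = head (double Q) a"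
  proof (cases "\<theta> x = x")
    case True
    then show ?thesis using wfcD(2,3)[OF w x] by (auto simp: cut_label_def split: option.split)
  next
    case False
    then obtain a where a: "\<theta> x \<in> X" "snd (lab x) = Some a" "snd (lab (\<theta> x)) = Some (star a)"
      by (rule matching_moved[OF \<theta>])
    have "fst (lab (f (\<theta> x))) = head (double Q) (star a)" "fst (lab x) = tail (double Q) a"
      using wfcD(3)[OF w x a(2)] wfcD(3)[OF w a(1,3)] by simp_all
    then show ?thesis using False by (simp add: cut_label_def)
  qed
qed

lemma cut_moved: "snd (cut_label \<theta> lab x) = Some a \<longleftrightarrow> \<theta> x = x \<and> snd (lab x) = Some a"
  by (auto simp: cut_label_def)

lemma fst_cut [simp]: "fst (cut_label \<theta> lab x) = fst (lab x)"
  by (simp add: cut_label_def)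

text \<open>Points moved by \<open>\<theta>\<close> have become transparent and cannot be moved by
  \<open>\<theta>'\<close>: the two matchings have disjoint supports, commute, and compose to a
  matching.\<close>

lemma matchings_cut:
  assumes \<theta>: "\<theta> \<in> matchings lab X" and \<theta>': "\<theta>' \<in> matchings (cut_label \<theta> lab) X"
  shows "\<theta>' \<in> matchings lab X" "\<And>x. \<theta>' x \<noteq> x \<Longrightarrow> \<theta> x = x \<and> \<theta> (\<theta>' x) = \<theta>' x"
    "\<And>x. \<theta> x \<noteq> x \<Longrightarrow> \<theta>' x = x \<and> \<theta>' (\<theta> x) = \<theta> x"
    "\<theta> \<circ> \<theta>' \<in> matchings lab X" "cut_label \<theta>' (cut_label \<theta> lab) = cut_label (\<theta> \<circ> \<theta>') lab"
proof -
  show \<theta>'m: "\<theta>' \<in> matchings lab X"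
    using \<theta>' unfolding matchings_def mem_Collect_eq cut_moved by blast
  show 2: "\<theta> x = x \<and> \<theta> (\<theta>' x) = \<theta>' x" if m: "\<theta>' x \<noteq> x" for x
  proof -
    obtain a where "snd (cut_label \<theta> lab x) = Some a" "snd (cut_label \<theta> lab (\<theta>' x)) = Some (star a)"
      by (rule matching_moved[OF \<theta>' m])
    then show ?thesis by (simp add: cut_moved)
  qed
  show 3: "\<theta>' x = x \<and> \<theta>' (\<theta> x) = \<theta> x" if "\<theta> x \<noteq> x" for x
    using 2[of x] 2[of "\<theta> x"] matchingsD(2)[OF \<theta>, of x] that by metis
  have comm: "\<theta> (\<theta>' x) = \<theta>' (\<theta> x)" for x
    using 2[of x] 3[of x] by metis
  show "\<theta> \<circ> \<theta>' \<in> matchings lab X"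
    unfolding matchings_def mem_Collect_eq
  proof (intro conjI allI impI ballI)
    fix x
    show "x \<notin> X \<Longrightarrow> (\<theta> \<circ> \<theta>') x = x" using matchingsD(1)[OF \<theta>] matchingsD(1)[OF \<theta>'m] by simp
    show "(\<theta> \<circ> \<theta>') ((\<theta> \<circ> \<theta>') x) = x"
      using comm matchingsD(2)[OF \<theta>] matchingsD(2)[OF \<theta>'m] by simp
    show "\<exists>a. snd (lab x) = Some a \<and> snd (lab ((\<theta> \<circ> \<theta>') x)) = Some (star a)" if "(\<theta> \<circ> \<theta>') x \<noteq> x"
      using 2[of x] matchingsD(3)[OF \<theta>, of x] matchingsD(3)[OF \<theta>'m, of x] that by (cases "\<theta>' x = x") auto
  qed
  show "cut_label \<theta>' (cut_label \<theta> lab) = cut_label (\<theta> \<circ> \<theta>') lab"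
  proof
    fix x show "cut_label \<theta>' (cut_label \<theta> lab) x = cut_label (\<theta> \<circ> \<theta>') lab x"
      using 2[of x] by (auto simp: cut_label_def)
  qed
qed

text \<open>The submatching of \<open>\<tau>\<close> formed by the pairs that \<open>U\<close>
  represents; both members of a pair have to be moved, whence the two conditions.\<close>

definition part :: "('x \<Rightarrow> 'x) \<Rightarrow> 'x set \<Rightarrow> 'x \<Rightarrow> 'x" where
  "part \<tau> U x = (if x \<in> U \<or> \<tau> x \<in> U then \<tau> x else x)"

text \<open>The pairs of \<open>\<tau>\<close> outside \<open>U\<close> have not been cut by the
  first part, so they still form a matching for the cut labels.\<close>

lemma part_props:
  assumes \<tau>: "\<tau> \<in> matchings lab X" and U: "U \<subseteq> fwd_points lab X \<tau>"
  shows "part \<tau> U \<in> matchings lab X" "fwd_points lab X (part \<tau> U) = U"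
    "part \<tau> (fwd_points lab X \<tau> - U) \<in> matchings (cut_label (part \<tau> U) lab) X"
    "fwd_points (cut_label (part \<tau> U) lab) X (part \<tau> (fwd_points lab X \<tau> - U)) = fwd_points lab X \<tau> - U"
    "part \<tau> U \<circ> part \<tau> (fwd_points lab X \<tau> - U) = \<tau>"
proof -
  let ?F = "fwd_points lab X \<tau>" let ?V = "?F - U"
  note inv = matchingsD(2)[OF \<tau>]
  have F: "x \<in> ?F \<Longrightarrow> \<tau> x \<notin> ?F" for x
    using is_fwd_partner[OF \<tau>, of x] by (auto simp: fwd_points_def)
  have F': "\<tau> x \<noteq> x \<Longrightarrow> x \<in> ?F \<or> \<tau> x \<in> ?F" for x
    using is_fwd_partner[OF \<tau>, of x] matchingsD(3)[OF \<tau>, of x] inv[of x] by (auto simp: fwd_points_def)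
  have m: "part \<tau> W \<in> matchings lab X" for W
    unfolding matchings_def mem_Collect_eq
  proof (intro conjI allI impI ballI)
    fix x
    show "x \<notin> X \<Longrightarrow> part \<tau> W x = x" using matchingsD(1)[OF \<tau>] by (simp add: part_def)
    show "part \<tau> W (part \<tau> W x) = x" using inv by (simp add: part_def)
    show "\<exists>a. snd (lab x) = Some a \<and> snd (lab (part \<tau> W x)) = Some (star a)" if "part \<tau> W x \<noteq> x"
      using matchingsD(3)[OF \<tau>, of x] that by (auto simp: part_def split: if_splits)
  qed
  show "part \<tau> U \<in> matchings lab X" by (rule m)
  have fp: "fwd_points lab X (part \<tau> W) = W" if W: "W \<subseteq> ?F" for W
  proof (intro equalityI subsetI)
    fix x assume "x \<in> fwd_points lab X (part \<tau> W)"
    then have x: "x \<in> X" "\<tau> x \<noteq> x" "is_fwd lab x" "x \<in> W \<or> \<tau> x \<in> W"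
      by (auto simp: fwd_points_def part_def split: if_splits)
    then have "x \<in> ?F" by (simp add: fwd_points_def)
    then show "x \<in> W" using x(4) W F by auto
  next
    fix x assume "x \<in> W"
    then show "x \<in> fwd_points lab X (part \<tau> W)" using W by (auto simp: fwd_points_def part_def)
  qed
  show "fwd_points lab X (part \<tau> U) = U" by (rule fp[OF U])
  have disj: "part \<tau> U x = x" if "part \<tau> ?V x \<noteq> x" for x
    using that F[of x] F[of "\<tau> x"] U inv[of x] by (auto simp: part_def split: if_splits)
  have disj': "part \<tau> U (part \<tau> ?V x) = part \<tau> ?V x" if "part \<tau> ?V x \<noteq> x" for x
    by (rule disj) (use that matchingsD(2)[OF m] in metis)
  show 3: "part \<tau> ?V \<in> matchings (cut_label (part \<tau> U) lab) X"
    using m[of ?V] disj disj' unfolding matchings_def mem_Collect_eq cut_moved by metis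
  show "fwd_points (cut_label (part \<tau> U) lab) X (part \<tau> ?V) = ?V"
  proof -
    have "fwd_points (cut_label (part \<tau> U) lab) X (part \<tau> ?V) = fwd_points lab X (part \<tau> ?V)"
      using disj by (auto simp: fwd_points_def is_fwd_def cut_label_def)
    then show ?thesis using fp[of ?V] by simp
  qed
  show "part \<tau> U \<circ> part \<tau> ?V = \<tau>"
  proof
    fix x
    show "(part \<tau> U \<circ> part \<tau> ?V) x = \<tau> x"
    proof (cases "\<tau> x = x")
      case False
      then show ?thesis
        using F' [of x] disj'[of x] by (auto simp: part_def inv)
    qed (simp add: part_def)
  qed
qed

text \<open>Converse to \<open>part_props\<close>: two successive contractions are recovered from
  their composite and the set of pairs contracted first.\<close>

lemma part_of_comp:
  assumes \<theta>: "\<theta> \<in> matchings lab X" and \<theta>': "\<theta>' \<in> matchings (cut_label \<theta> lab) X"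
  shows "fwd_points lab X \<theta> \<subseteq> fwd_points lab X (\<theta> \<circ> \<theta>')"
    "part (\<theta> \<circ> \<theta>') (fwd_points lab X \<theta>) = \<theta>"
    "part (\<theta> \<circ> \<theta>') (fwd_points lab X (\<theta> \<circ> \<theta>') - fwd_points lab X \<theta>) = \<theta>'"
proof -
  note mc = matchings_cut[OF \<theta> \<theta>']
  note \<theta>'m = mc(1)
  have eq: "(\<theta> \<circ> \<theta>') x = (if \<theta> x \<noteq> x then \<theta> x else \<theta>' x)" for x
    using mc(2)[of x] mc(3)[of x] by (cases "\<theta>' x = x") auto
  have pt: "\<theta> x = x \<longleftrightarrow> \<theta> (\<theta> x) = \<theta> x" "\<theta>' x = x \<longleftrightarrow> \<theta>' (\<theta>' x) = \<theta>' x" for x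
    using matching_inj[OF \<theta>] matching_inj[OF \<theta>'m] by blast+
  show "fwd_points lab X \<theta> \<subseteq> fwd_points lab X (\<theta> \<circ> \<theta>')"
    using eq by (auto simp: fwd_points_def)
  have mem: "x \<in> fwd_points lab X k \<or> k x \<in> fwd_points lab X k \<longleftrightarrow> k x \<noteq> x"
    if "k \<in> matchings lab X" for k x
    using is_fwd_partner[OF that, of x] matchingsD[OF that, of x] by (auto simp: fwd_points_def)
  show "part (\<theta> \<circ> \<theta>') (fwd_points lab X \<theta>) = \<theta>"
  proof
    fix x show "part (\<theta> \<circ> \<theta>') (fwd_points lab X \<theta>) x = \<theta> x"
    proof (cases "\<theta> x = x")
      case True
      then have "x \<notin> fwd_points lab X \<theta>" "\<theta>' x \<notin> fwd_points lab X \<theta>"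
        using mc(2)[of x] True by (cases "\<theta>' x = x"; auto simp: fwd_points_def)+
      then show ?thesis using eq[of x] True by (auto simp: part_def)
    next
      case False
      then show ?thesis using mem[OF \<theta>, of x] eq[of x] by (auto simp: part_def)
    qed
  qed
  have diff: "fwd_points lab X (\<theta> \<circ> \<theta>') - fwd_points lab X \<theta> = fwd_points lab X \<theta>'"
  proof -
    have "(\<theta> \<circ> \<theta>') x \<noteq> x \<and> \<not> \<theta> x \<noteq> x \<longleftrightarrow> \<theta>' x \<noteq> x" for x
      using eq[of x] mc(2)[of x] by metis
    then show ?thesis unfolding fwd_points_def by blast
  qed
  show "part (\<theta> \<circ> \<theta>') (fwd_points lab X (\<theta> \<circ> \<theta>') - fwd_points lab X \<theta>) = \<theta>'"
    unfolding diff
  proof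
    fix x show "part (\<theta> \<circ> \<theta>') (fwd_points lab X \<theta>') x = \<theta>' x"
    proof (cases "\<theta>' x = x")
      case True
      then have "x \<notin> fwd_points lab X \<theta>'" "\<theta> x \<notin> fwd_points lab X \<theta>'"
        using mc(3)[of x] True by (cases "\<theta> x = x"; auto simp: fwd_points_def)+
      then show ?thesis using eq[of x] True by (auto simp: part_def)
    next
      case False
      then show ?thesis using mem[OF \<theta>'m, of x] eq[of x] mc(2)[of x] by (auto simp: part_def)
    qed
  qed
qed

text \<open>The inner index set depends on the outer one through the labels. Passing to the
  composite \<open>\<tau>\<close> and the set \<open>U\<close> of pairs contracted first makes it a
  sum over subsets.\<close>

lemma sum_nested_matchings:
  assumes fin: "finite X"
  shows "(\<Sum>\<theta>\<in>matchings lab X. \<Sum>\<theta>'\<in>matchings (cut_label \<theta> lab) X. G \<theta> \<theta>')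
    = (\<Sum>\<tau>\<in>matchings lab X. \<Sum>U\<in>Pow (fwd_points lab X \<tau>). G (part \<tau> U) (part \<tau> (fwd_points lab X \<tau> - U)))"
proof -
  have f2: "finite (fwd_points lab X \<tau>)" for \<tau> using fin by (simp add: fwd_points_def)
  have "(\<Sum>\<theta>\<in>matchings lab X. \<Sum>\<theta>'\<in>matchings (cut_label \<theta> lab) X. G \<theta> \<theta>')
     = (\<Sum>(\<theta>, \<theta>')\<in>(SIGMA \<theta>:matchings lab X. matchings (cut_label \<theta> lab) X). G \<theta> \<theta>')"
    by (rule sum.Sigma) (auto simp: finite_matchings[OF fin])
  also have "\<dots> = (\<Sum>(\<tau>, U)\<in>(SIGMA \<tau>:matchings lab X. Pow (fwd_points lab X \<tau>)). G (part \<tau> U) (part \<tau> (fwd_points lab X \<tau> - U)))"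
    by (rule sum.reindex_bij_witness[where j = "\<lambda>(\<theta>, \<theta>'). (\<theta> \<circ> \<theta>', fwd_points lab X \<theta>)"
          and i = "\<lambda>(\<tau>, U). (part \<tau> U, part \<tau> (fwd_points lab X \<tau> - U))"])
      (auto simp: part_of_comp part_props matchings_cut(4) dest: subsetD[OF part_of_comp(1)])
  also have "\<dots> = (\<Sum>\<tau>\<in>matchings lab X. \<Sum>U\<in>Pow (fwd_points lab X \<tau>). G (part \<tau> U) (part \<tau> (fwd_points lab X \<tau> - U)))"
    by (rule sum.Sigma[symmetric]) (auto simp: finite_matchings[OF fin] f2)
  finally show ?thesis .
qed

lemma wt_cong:
  assumes "\<And>x. x \<in> X \<Longrightarrow> \<theta> x \<noteq> x \<Longrightarrow> s x (\<theta> x) = s' x (\<theta> x)"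
  shows "wt s lab X \<theta> = wt s' lab X \<theta>"
  unfolding wt_def by (intro prod.cong) (auto simp: fwd_points_def assms)

text \<open>Both orders of the arguments have to vanish, because either member of the pair may be
  the forward one.\<close>

lemma wt_eq_0:
  assumes "finite X" "\<theta> \<in> matchings lab X" "\<theta> x \<noteq> x" "s x (\<theta> x) = 0" "s (\<theta> x) x = 0"
  shows "wt s lab X \<theta> = 0"
proof -
  have "\<exists>y\<in>fwd_points lab X \<theta>. s y (\<theta> y) = 0"
    using is_fwd_partner[OF assms(2,3)] matchingsD(2,3)[OF assms(2), of x] assms
    by (cases "is_fwd lab x") (auto simp: fwd_points_def intro: bexI[of _ x] bexI[of _ "\<theta> x"])
  then show ?thesis using assms(1) unfolding wt_def by (intro prod_zero) (auto simp: fwd_points_def)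
qed

lemma wt_part:
  assumes \<tau>: "\<tau> \<in> matchings lab X" and U: "U \<subseteq> fwd_points lab X \<tau>"
  shows "wt a lab X (part \<tau> U) = (\<Prod>x\<in>U. half_h 1 * a x (\<tau> x))"
    and "wt b (cut_label (part \<tau> U) lab) X (part \<tau> (fwd_points lab X \<tau> - U)) = (\<Prod>x\<in>fwd_points lab X \<tau> - U. half_h 1 * b x (\<tau> x))"
  unfolding wt_def part_props[OF \<tau> U] by (auto simp: part_def intro!: prod.cong)

text \<open>Contracting twice amounts to contracting once and distributing the contracted pairs over the
  two steps, so the weights of a pair in the two steps add up.\<close>

lemma sum_nested_matchings_wt:
  assumes fin: "finite X"
  shows "(\<Sum>\<theta>\<in>matchings lab X. \<Sum>\<theta>'\<in>matchings (cut_label \<theta> lab) X.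
      scl (wt a lab X \<theta> * wt b (cut_label \<theta> lab) X \<theta>') (H (\<theta> \<circ> \<theta>')))
    = (\<Sum>\<tau>\<in>matchings lab X. scl (wt (\<lambda>x y. a x y + b x y) lab X \<tau>) (H \<tau>))"
  unfolding sum_nested_matchings[OF fin]
proof (rule sum.cong[OF refl])
  fix \<tau> assume \<tau>: "\<tau> \<in> matchings lab X"
  let ?F = "fwd_points lab X \<tau>"
  have fF: "finite ?F" using fin by (simp add: fwd_points_def)
  have "(\<Sum>U\<in>Pow ?F. scl (wt a lab X (part \<tau> U) * wt b (cut_label (part \<tau> U) lab) X (part \<tau> (?F - U))) (H (part \<tau> U \<circ> part \<tau> (?F - U))))
     = (\<Sum>U\<in>Pow ?F. scl ((\<Prod>x\<in>U. half_h 1 * a x (\<tau> x)) * (\<Prod>x\<in>?F - U. half_h 1 * b x (\<tau> x))) (H \<tau>))"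
    by (intro sum.cong) (simp_all add: wt_part[OF \<tau>] part_props(5)[OF \<tau>])
  \<comment> \<open>A product over the pairs of sums of two terms expands into the sum over the
    subsets \<open>U\<close> on which the first term is taken.\<close>
  also have "\<dots> = scl (\<Prod>x\<in>?F. half_h 1 * a x (\<tau> x) + half_h 1 * b x (\<tau> x)) (H \<tau>)"
    by (simp add: prod_add[OF fF] scl_sum_left)
  also have "\<dots> = scl (wt (\<lambda>x y. a x y + b x y) lab X \<tau>) (H \<tau>)"
    by (simp add: wt_def distrib_left)
  finally show "(\<Sum>U\<in>Pow ?F. scl (wt a lab X (part \<tau> U) * wt b (cut_label (part \<tau> U) lab) X (part \<tau> (?F - U))) (H (part \<tau> U \<circ> part \<tau> (?F - U))))
     = scl (wt (\<lambda>x y. a x y + b x y) lab X \<tau>) (H \<tau>)" .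
qed

section \<open>Restriction and transport of matchings\<close>

lemma matchings_subset:
  assumes "Y \<subseteq> X"
  shows "matchings lab Y \<subseteq> matchings lab X"
proof
  fix \<theta> assume \<theta>: "\<theta> \<in> matchings lab Y"
  show "\<theta> \<in> matchings lab X"
    using matchingsD[OF \<theta>] assms unfolding matchings_def by blast
qed

lemma matching_restrict:
  assumes "\<theta> \<in> matchings lab X" "\<And>x. \<theta> x \<noteq> x \<Longrightarrow> x \<in> Y"
  shows "\<theta> \<in> matchings lab Y"
  using matchingsD[OF assms(1)] assms(2) unfolding matchings_def by blast

lemma wt_subset:
  assumes "Y \<subseteq> X" "\<theta> \<in> matchings lab Y"
  shows "wt s lab X \<theta> = wt s lab Y \<theta>"
proof -
  have "fwd_points lab X \<theta> = fwd_points lab Y \<theta>"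
    using assms(1) matchingsD(1)[OF assms(2)] by (auto simp: fwd_points_def)
  then show ?thesis by (simp add: wt_def)
qed

text \<open>A matching that moves a point outside \<open>Y\<close> contains a pair of sign 0 and
  drops out.\<close>

lemma sum_matchings_restrict:
  assumes fin: "finite X" and Y: "Y \<subseteq> X"
    and s: "\<And>x y. x \<in> X \<Longrightarrow> y \<in> X \<Longrightarrow> x \<notin> Y \<or> y \<notin> Y \<Longrightarrow> s x y = 0"
  shows "(\<Sum>\<theta>\<in>matchings lab X. scl (wt s lab X \<theta>) (H \<theta>)) = (\<Sum>\<theta>\<in>matchings lab Y. scl (wt s lab Y \<theta>) (H \<theta>))"
proof -
  have "(\<Sum>\<theta>\<in>matchings lab Y. scl (wt s lab Y \<theta>) (H \<theta>)) = (\<Sum>\<theta>\<in>matchings lab Y. scl (wt s lab X \<theta>) (H \<theta>))"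
    by (intro sum.cong) (simp_all add: wt_subset[OF Y])
  also have "\<dots> = (\<Sum>\<theta>\<in>matchings lab X. scl (wt s lab X \<theta>) (H \<theta>))"
  proof (rule sum.mono_neutral_left)
    show "\<forall>\<theta>\<in>matchings lab X - matchings lab Y. scl (wt s lab X \<theta>) (H \<theta>) = 0"
    proof
      fix \<theta> assume \<theta>: "\<theta> \<in> matchings lab X - matchings lab Y"
      then obtain x where x: "\<theta> x \<noteq> x" "x \<notin> Y" using matching_restrict by blast
      then have "x \<in> X" "\<theta> x \<in> X" using \<theta> matchingsD(3) by fastforce+
      then have "wt s lab X \<theta> = 0" using x \<theta> s by (intro wt_eq_0[OF fin]) auto
      then show "scl (wt s lab X \<theta>) (H \<theta>) = 0" by simp
    qed
  qed (use finite_matchings[OF fin] matchings_subset[OF Y] in auto)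
  finally show ?thesis ..
qed

definition conj_matching :: "('x \<Rightarrow> 'y) \<Rightarrow> 'x set \<Rightarrow> 'y set \<Rightarrow> ('x \<Rightarrow> 'x) \<Rightarrow> 'y \<Rightarrow> 'y" where
  "conj_matching b X Y \<theta> y = (if y \<in> Y then b (\<theta> (inv_into X b y)) else y)"

lemma conj_matching_apply:
  assumes "bij_betw b X Y" "x \<in> X"
  shows "conj_matching b X Y \<theta> (b x) = b (\<theta> x)"
  using assms by (auto simp: conj_matching_def bij_betw_def)

lemma conj_matching_in:
  assumes b: "bij_betw b X Y" and lab: "\<And>x. x \<in> X \<Longrightarrow> lab' (b x) = lab x" and \<theta>: "\<theta> \<in> matchings lab X"
  shows "conj_matching b X Y \<theta> \<in> matchings lab' Y"
  unfolding matchings_def mem_Collect_eq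
proof (intro conjI allI impI ballI)
  fix y
  show "y \<notin> Y \<Longrightarrow> conj_matching b X Y \<theta> y = y" by (simp add: conj_matching_def)
  show "conj_matching b X Y \<theta> (conj_matching b X Y \<theta> y) = y"
  proof (cases "y \<in> Y")
    case True
    then obtain x where x: "x \<in> X" "y = b x" using b unfolding bij_betw_def by blast
    then show ?thesis
      using conj_matching_apply[OF b, of _ \<theta>] matchingsD(2,4)[OF \<theta>, of x] by simp
  qed (simp add: conj_matching_def)
next
  fix y assume "y \<in> Y" and m: "conj_matching b X Y \<theta> y \<noteq> y"
  then obtain x where x: "x \<in> X" "y = b x" using b unfolding bij_betw_def by blast
  then have "\<theta> x \<noteq> x" using m conj_matching_apply[OF b, of x \<theta>] by auto
  then obtain a where "\<theta> x \<in> X" "snd (lab x) = Some a" "snd (lab (\<theta> x)) = Some (star a)"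
    by (rule matching_moved[OF \<theta>])
  then show "\<exists>a. snd (lab' y) = Some a \<and> snd (lab' (conj_matching b X Y \<theta> y)) = Some (star a)"
    using x lab conj_matching_apply[OF b, of x \<theta>] by simp
qed

lemma conj_matching_inverse:
  assumes b: "bij_betw b X Y" and \<theta>: "\<theta> \<in> matchings lab X"
  shows "conj_matching (inv_into X b) Y X (conj_matching b X Y \<theta>) = \<theta>"
proof
  fix x
  have inj: "inj_on b X" using b by (simp add: bij_betw_def)
  show "conj_matching (inv_into X b) Y X (conj_matching b X Y \<theta>) x = \<theta> x"
  proof (cases "x \<in> X")
    case True
    then have "b x \<in> Y" using b by (auto simp: bij_betw_def)
    then have "conj_matching (inv_into X b) Y X (conj_matching b X Y \<theta>) (inv_into X b (b x))
        = inv_into X b (conj_matching b X Y \<theta> (b x))"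
      by (rule conj_matching_apply[OF bij_betw_inv_into[OF b]])
    then show ?thesis
      using conj_matching_apply[OF b True] True matchingsD(4)[OF \<theta> True] inj by simp
  qed (simp add: conj_matching_def matchingsD(1)[OF \<theta>])
qed

lemma bij_betw_conj_matching:
  assumes b: "bij_betw b X Y" and lab: "\<And>x. x \<in> X \<Longrightarrow> lab' (b x) = lab x"
  shows "bij_betw (conj_matching b X Y) (matchings lab X) (matchings lab' Y)"
proof (rule bij_betw_byWitness[where f' = "conj_matching (inv_into X b) Y X"])
  have b': "bij_betw (inv_into X b) Y X" by (rule bij_betw_inv_into[OF b])
  have lab': "lab (inv_into X b y) = lab' y" if "y \<in> Y" for y
    using lab[of "inv_into X b y"] b that by (metis bij_betw_inv_into_right bij_betwE b')
  show "\<forall>\<theta>\<in>matchings lab X. conj_matching (inv_into X b) Y X (conj_matching b X Y \<theta>) = \<theta>"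
    using conj_matching_inverse[OF b] by blast
  show "conj_matching b X Y ` matchings lab X \<subseteq> matchings lab' Y"
    using conj_matching_in[where lab = lab and lab' = lab', OF b lab] by blast
  show "conj_matching (inv_into X b) Y X ` matchings lab' Y \<subseteq> matchings lab X"
    using conj_matching_in[where lab = lab' and lab' = lab, OF b' lab'] by blast
  show "\<forall>\<theta>\<in>matchings lab' Y. conj_matching b X Y (conj_matching (inv_into X b) Y X \<theta>) = \<theta>"
  proof
    fix \<theta> assume \<theta>: "\<theta> \<in> matchings lab' Y"
    \<comment> \<open>Applied to \<open>inv_into X b\<close>, the statement on inverses yields the
      inverse of that map in place of \<open>b\<close>; the two agree on \<open>X\<close>.\<close>
    have "conj_matching b X Y \<psi> y = conj_matching (inv_into Y (inv_into X b)) X Y \<psi> y" if "\<psi> \<in> matchings lab X" for \<psi> y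
    proof (cases "y \<in> Y")
      case True
      have "inv_into Y (inv_into X b) x = b x" if "x \<in> X" for x
        using inv_into_inv_into_eq[OF b that] .
      moreover have "inv_into X (inv_into Y (inv_into X b)) y = inv_into X b y"
        using inv_into_inv_into_eq[OF b' True] .
      moreover have "inv_into X b y \<in> X" using bij_betwE[OF b'] True by blast
      ultimately show ?thesis
        using True matchingsD(4)[OF that, of "inv_into X b y"] by (simp add: conj_matching_def)
    qed (simp add: conj_matching_def)
    then show "conj_matching b X Y (conj_matching (inv_into X b) Y X \<theta>) = \<theta>"
      using conj_matching_inverse[OF b' \<theta>] conj_matching_in[where lab = lab' and lab' = lab, OF b' lab' \<theta>] by auto
  qed
qed

lemma wt_conj_matching:
  assumes b: "bij_betw b X Y" and lab: "\<And>x. x \<in> X \<Longrightarrow> lab' (b x) = lab x" and \<theta>: "\<theta> \<in> matchings lab X"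
  shows "wt s lab' Y (conj_matching b X Y \<theta>) = wt (\<lambda>x y. s (b x) (b y)) lab X \<theta>"
proof -
  have inj: "inj_on b X" and im: "b ` X = Y" using b by (auto simp: bij_betw_def)
  have fw: "fwd_points lab' Y (conj_matching b X Y \<theta>) = b ` fwd_points lab X \<theta>"
  proof (intro equalityI subsetI)
    fix y assume y: "y \<in> fwd_points lab' Y (conj_matching b X Y \<theta>)"
    then obtain x where x: "x \<in> X" "y = b x" using im by (auto simp: fwd_points_def)
    then have "\<theta> x \<noteq> x" "is_fwd lab x"
      using y conj_matching_apply[OF b, of x \<theta>] lab by (auto simp: fwd_points_def is_fwd_def)
    then show "y \<in> b ` fwd_points lab X \<theta>" using x by (auto simp: fwd_points_def)
  next
    fix y assume "y \<in> b ` fwd_points lab X \<theta>"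
    then obtain x where x: "x \<in> X" "\<theta> x \<noteq> x" "is_fwd lab x" "y = b x" by (auto simp: fwd_points_def)
    then have "b (\<theta> x) \<noteq> b x" using inj matchingsD(4)[OF \<theta>] by (auto dest: inj_onD)
    then show "y \<in> fwd_points lab' Y (conj_matching b X Y \<theta>)"
      using x conj_matching_apply[OF b, of x \<theta>] lab im by (auto simp: fwd_points_def is_fwd_def)
  qed
  have "inj_on b (fwd_points lab X \<theta>)" using inj by (rule inj_on_subset) (auto simp: fwd_points_def)
  then show ?thesis
    unfolding wt_def fw
    by (simp add: prod.reindex) (rule prod.cong, auto simp: fwd_points_def conj_matching_apply[OF b])
qed

section \<open>State sums for the product and the coproduct\<close>

definition prod_sum :: "('x \<Rightarrow> 'x) \<Rightarrow> ('x \<Rightarrow> 'v \<times> 'e darc option) \<Rightarrow> ('x \<Rightarrow> nat) \<Rightarrow> 'x set \<Rightarrow>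
    (('v, 'e) collection \<Rightarrow>\<^sub>0 'k::field_char_0 poly)" where
  "prod_sum f lab e X = (\<Sum>\<theta>\<in>matchings lab X.
     scl (wt (sg e) lab X \<theta>) (basis_vec (coll (f \<circ> \<theta>) (cut_label \<theta> lab) X)))"

text \<open>Colourings of the glued members, written as colourings of the points that are constant
  along the cycles of \<open>g\<close>.\<close>

definition colourings :: "nat set \<Rightarrow> ('x \<Rightarrow> 'x) \<Rightarrow> 'x set \<Rightarrow> ('x \<Rightarrow> nat) set" where
  "colourings K g X = {c \<in> X \<rightarrow>\<^sub>E K. \<forall>x\<in>X. c (g x) = c x}"

definition cop_sum :: "('x \<Rightarrow> 'x) \<Rightarrow> ('x \<Rightarrow> 'v \<times> 'e darc option) \<Rightarrow> 'x set \<Rightarrow>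
    (('v, 'e) collection \<times> ('v, 'e) collection \<Rightarrow>\<^sub>0 'k::field_char_0 poly)" where
  "cop_sum f lab X = (\<Sum>\<theta>\<in>matchings lab X. \<Sum>c\<in>colourings {1, 2} (f \<circ> \<theta>) X.
     scl (wt (sg c) lab X \<theta>) (basis_vec
       (coll (f \<circ> \<theta>) (cut_label \<theta> lab) {x \<in> X. c x = 1}, coll (f \<circ> \<theta>) (cut_label \<theta> lab) {x \<in> X. c x = 2})))"

section \<open>State sums are unchanged when a transparent point is deleted\<close>

lemma bypass_glue: "\<theta> x = x \<Longrightarrow> bypass x f \<circ> \<theta> = bypass x (f \<circ> \<theta>)"
  by (simp add: fun_eq_iff bypass_def)

lemma matchings_remove_invisible:
  assumes "snd (lab x) = None"
  shows "matchings lab (X - {x}) = matchings lab X"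
proof
  show "matchings lab (X - {x}) \<subseteq> matchings lab X" by (rule matchings_subset) auto
  show "matchings lab X \<subseteq> matchings lab (X - {x})"
  proof
    fix \<theta> assume \<theta>: "\<theta> \<in> matchings lab X"
    show "\<theta> \<in> matchings lab (X - {x})"
      by (rule matching_restrict[OF \<theta>]) (use matchingsD(3)[OF \<theta>] matching_None[OF \<theta> assms] in auto)
  qed
qed

text \<open>A matching fixes the transparent point \<open>x\<close>, so deleting \<open>x\<close>
  commutes with gluing. The subset \<open>Y\<close> is meant for colour classes, which may or may
  not contain \<open>x\<close>.\<close>

lemma coll_glue_bypass:
  assumes w: "wfc Q f lab X" and x: "x \<in> X" "f x \<noteq> x" "snd (lab x) = None"
    and \<theta>: "\<theta> \<in> matchings lab X" and Y: "Y \<subseteq> X" "\<And>y. y \<in> Y \<Longrightarrow> f (\<theta> y) \<in> Y"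
  shows "coll (bypass x f \<circ> \<theta>) (cut_label \<theta> lab) (Y - {x}) = coll (f \<circ> \<theta>) (cut_label \<theta> lab) Y"
proof -
  have \<theta>x: "\<theta> x = x" by (rule matching_None[OF \<theta> x(3)])
  have wY: "wfc Q (f \<circ> \<theta>) (cut_label \<theta> lab) Y"
    by (rule wfc_subset[OF wfc_glue[OF w \<theta>] Y(1)]) (use Y(2) in auto)
  show ?thesis
  proof (cases "x \<in> Y")
    case True
    then show ?thesis
      unfolding bypass_glue[of \<theta> x f, OF \<theta>x]
      by (intro coll_bypass(2)[OF wfc_perm_on[OF wY] wfc_coherent[OF wY]])
        (use x \<theta>x in \<open>auto simp: cut_label_def\<close>)
  next
    case False
    have "(f \<circ> \<theta>) y = (bypass x f \<circ> \<theta>) y" if "y \<in> Y" for y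
      using Y(2)[OF that] False by (auto simp: bypass_def)
    then have "coll (f \<circ> \<theta>) (cut_label \<theta> lab) Y = coll (bypass x f \<circ> \<theta>) (cut_label \<theta> lab) Y"
      by (intro coll_cong[OF wfc_perm_on[OF wY] wfc_coherent[OF wY]]) auto
    then show ?thesis using False by simp
  qed
qed

lemma wt_remove_invisible:
  assumes "snd (lab x) = None" "\<theta> \<in> matchings lab X"
  shows "wt s lab (X - {x}) \<theta> = wt s lab X \<theta>"
proof -
  have "fwd_points lab (X - {x}) \<theta> = fwd_points lab X \<theta>"
    using assms matching_None[OF assms(2,1)] by (auto simp: fwd_points_def)
  then show ?thesis by (simp add: wt_def)
qed

lemma prod_sum_bypass:
  assumes w: "wfc Q f lab X" and x: "x \<in> X" "f x \<noteq> x" "snd (lab x) = None"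
  shows "prod_sum (bypass x f) lab e (X - {x}) = prod_sum f lab e X"
  unfolding prod_sum_def matchings_remove_invisible[where lab = lab, OF x(3)]
proof (rule sum.cong[OF refl])
  fix \<theta> assume \<theta>: "\<theta> \<in> matchings lab X"
  have "f (\<theta> y) \<in> X" if "y \<in> X" for y
    using perm_on_in[OF wfc_perm_on[OF w]] matchingsD(4)[OF \<theta> that] by blast
  then show "scl (wt (sg e) lab (X - {x}) \<theta>) (basis_vec (coll (bypass x f \<circ> \<theta>) (cut_label \<theta> lab) (X - {x})))
      = scl (wt (sg e) lab X \<theta>) (basis_vec (coll (f \<circ> \<theta>) (cut_label \<theta> lab) X))"
    using coll_glue_bypass[OF w x \<theta>, of X] by (simp add: wt_remove_invisible[where lab = lab, OF x(3) \<theta>])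
qed

text \<open>The colour of the deleted point is forced by that of its successor, so restriction loses
  nothing.\<close>

lemma colourings_bypass:
  assumes g: "perm_on g X" and x: "x \<in> X" "g x \<noteq> x"
  shows "bij_betw (\<lambda>c. restrict c (X - {x})) (colourings K g X) (colourings K (bypass x g) (X - {x}))"
proof (rule bij_betw_byWitness[where f' = "\<lambda>c. c(x := c (g x))"])
  have gx: "g x \<in> X" "g x \<noteq> x" using perm_on_in[OF g x(1)] x by auto
  show "\<forall>c\<in>colourings K g X. (restrict c (X - {x}))(x := restrict c (X - {x}) (g x)) = c"
    using gx x(1) by (auto simp: colourings_def fun_eq_iff PiE_def extensional_def)
  show "\<forall>c\<in>colourings K (bypass x g) (X - {x}). restrict (c(x := c (g x))) (X - {x}) = c"
    by (auto simp: colourings_def fun_eq_iff PiE_def extensional_def)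
  show "(\<lambda>c. restrict c (X - {x})) ` colourings K g X \<subseteq> colourings K (bypass x g) (X - {x})"
  proof clarify
    fix c assume c: "c \<in> colourings K g X"
    have "restrict c (X - {x}) (bypass x g y) = restrict c (X - {x}) y" if y: "y \<in> X - {x}" for y
    proof -
      have "bypass x g y \<in> X - {x}" using perm_on_in[OF perm_on_bypass[OF g x] y] .
      moreover have "c (bypass x g y) = c y"
        using c y x(1) by (auto simp: colourings_def bypass_def)
      ultimately show ?thesis using y by simp
    qed
    then show "restrict c (X - {x}) \<in> colourings K (bypass x g) (X - {x})"
      using c by (auto simp: colourings_def)
  qed
  show "(\<lambda>c. c(x := c (g x))) ` colourings K (bypass x g) (X - {x}) \<subseteq> colourings K g X"
  proof clarify
    fix c assume c: "c \<in> colourings K (bypass x g) (X - {x})"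
    let ?c = "c(x := c (g x))"
    have "?c (g y) = ?c y" if y: "y \<in> X" for y
    proof (cases "y = x")
      case False
      then have "c (bypass x g y) = c y" using c y by (auto simp: colourings_def)
      then show ?thesis using False by (auto simp: bypass_def split: if_splits)
    qed (use gx in simp)
    moreover have "?c \<in> X \<rightarrow>\<^sub>E K"
      using c gx x(1) by (auto simp: colourings_def PiE_def extensional_def)
    ultimately show "?c \<in> colourings K g X" by (simp add: colourings_def)
  qed
qed

lemma cop_sum_bypass:
  assumes w: "wfc Q f lab X" and x: "x \<in> X" "f x \<noteq> x" "snd (lab x) = None"
  shows "cop_sum (bypass x f) lab (X - {x}) = (cop_sum f lab X :: _ \<Rightarrow>\<^sub>0 'k::field_char_0 poly)"
  unfolding cop_sum_def matchings_remove_invisible[where lab = lab, OF x(3)]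
proof (rule sum.cong[OF refl])
  fix \<theta> assume \<theta>: "\<theta> \<in> matchings lab X"
  have \<theta>x: "\<theta> x = x" by (rule matching_None[OF \<theta> x(3)])
  let ?T = "\<lambda>g Z c. scl (wt (sg c) lab Z \<theta> :: 'k poly) (basis_vec
       (coll (g \<circ> \<theta>) (cut_label \<theta> lab) {x \<in> Z. c x = (1::nat)}, coll (g \<circ> \<theta>) (cut_label \<theta> lab) {x \<in> Z. c x = 2}))"
  have bij: "bij_betw (\<lambda>c. restrict c (X - {x})) (colourings {1, 2} (f \<circ> \<theta>) X) (colourings {1, 2} (bypass x f \<circ> \<theta>) (X - {x}))"
    unfolding bypass_glue[of \<theta> x f, OF \<theta>x]
    by (rule colourings_bypass[OF perm_on_glue[OF wfc_perm_on[OF w] \<theta>] x(1)]) (use x \<theta>x in simp)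
  have "sum (?T f X) (colourings {1, 2} (f \<circ> \<theta>) X)
      = (\<Sum>c\<in>colourings {1, 2} (f \<circ> \<theta>) X. ?T (bypass x f) (X - {x}) (restrict c (X - {x})))"
  proof (rule sum.cong[OF refl])
    fix c assume c: "c \<in> colourings {1, 2} (f \<circ> \<theta>) X"
    have sets: "{y \<in> X - {x}. restrict c (X - {x}) y = k} = {y \<in> X. c y = k} - {x}" for k by auto
    have inv: "f (\<theta> y) \<in> {y \<in> X. c y = k}" if "y \<in> {y \<in> X. c y = k}" for y k
      using that c perm_on_in[OF wfc_perm_on[OF w]] matchingsD(4)[OF \<theta>] by (auto simp: colourings_def)
    have colls: "coll (bypass x f \<circ> \<theta>) (cut_label \<theta> lab) ({y \<in> X. c y = k} - {x}) = coll (f \<circ> \<theta>) (cut_label \<theta> lab) {y \<in> X. c y = k}" for k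
      by (rule coll_glue_bypass[OF w x \<theta> _ inv]) auto
    have "wt (sg (restrict c (X - {x}))) lab (X - {x}) \<theta> = (wt (sg c) lab (X - {x}) \<theta> :: 'k poly)"
    proof (rule wt_cong)
      fix y assume y: "y \<in> X - {x}" "\<theta> y \<noteq> y"
      then have "\<theta> y \<in> X - {x}" using matchingsD(4)[OF \<theta>, of y] matching_inj[OF \<theta>, of x y] \<theta>x by auto
      then show "sg (restrict c (X - {x})) y (\<theta> y) = sg c y (\<theta> y)" using y by (simp add: sg_def)
    qed
    then show "?T f X c = ?T (bypass x f) (X - {x}) (restrict c (X - {x}))"
      unfolding sets colls wt_remove_invisible[where lab = lab, OF x(3) \<theta>] by simp
  qed
  also have "\<dots> = sum (?T (bypass x f) (X - {x})) (colourings {1, 2} (bypass x f \<circ> \<theta>) (X - {x}))"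
    by (rule sum.reindex_bij_betw[OF bij])
  finally show "sum (?T (bypass x f) (X - {x})) (colourings {1, 2} (bypass x f \<circ> \<theta>) (X - {x}))
      = sum (?T f X) (colourings {1, 2} (f \<circ> \<theta>) X)" ..
qed

section \<open>State sums are invariant under isomorphism\<close>

context
  fixes Q :: "('v, 'e) pre_digraph" and f :: "'x \<Rightarrow> 'x" and lab :: "'x \<Rightarrow> 'v \<times> 'e darc option" and X :: "'x set"
    and g :: "'y \<Rightarrow> 'y" and lab' :: "'y \<Rightarrow> 'v \<times> 'e darc option" and Y :: "'y set" and b :: "'x \<Rightarrow> 'y"
  assumes w: "wfc Q f lab X" and b: "bij_betw b X Y" and fg: "\<And>x. x \<in> X \<Longrightarrow> b (f x) = g (b x)"
    and lab: "\<And>x. x \<in> X \<Longrightarrow> lab' (b x) = lab x"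
begin

text \<open>Stated for a subset closed under the glued permutation, because the coproduct needs it
  for each colour class.\<close>

lemma coll_conj_matching:
  assumes \<theta>: "\<theta> \<in> matchings lab X" and Z: "Z \<subseteq> X" "\<And>z. z \<in> Z \<Longrightarrow> f (\<theta> z) \<in> Z"
  shows "coll (g \<circ> conj_matching b X Y \<theta>) (cut_label (conj_matching b X Y \<theta>) lab') (b ` Z)
    = coll (f \<circ> \<theta>) (cut_label \<theta> lab) Z"
proof -
  have wZ: "wfc Q (f \<circ> \<theta>) (cut_label \<theta> lab) Z"
    by (rule wfc_subset[OF wfc_glue[OF w \<theta>] Z(1)]) (use Z(2) in auto)
  have inj: "inj_on b X" using b by (simp add: bij_betw_def)
  show ?thesis
  proof (rule coll_iso(3)[OF wfc_perm_on[OF wZ] wfc_coherent[OF wZ]])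
    show "bij_betw b Z (b ` Z)" using inj Z(1) by (auto intro: inj_on_imp_bij_betw inj_on_subset)
    fix x assume "x \<in> Z"
    then have x: "x \<in> X" "\<theta> x \<in> X" using Z(1) matchingsD(4)[OF \<theta>] by auto
    then show "b ((f \<circ> \<theta>) x) = (g \<circ> conj_matching b X Y \<theta>) (b x)"
      by (simp add: conj_matching_apply[OF b] fg)
    show "cut_label (conj_matching b X Y \<theta>) lab' (b x) = cut_label \<theta> lab x"
      using x inj by (auto simp: cut_label_def conj_matching_apply[OF b] lab dest: inj_onD)
  qed
qed

lemma prod_sum_iso:
  assumes e: "\<And>x. x \<in> X \<Longrightarrow> e' (b x) = e x"
  shows "prod_sum g lab' e' Y = (prod_sum f lab e X :: _ \<Rightarrow>\<^sub>0 'k::field_char_0 poly)"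
proof -
  have "(prod_sum g lab' e' Y :: _ \<Rightarrow>\<^sub>0 'k poly) = (\<Sum>\<theta>\<in>matchings lab X.
      scl (wt (sg e') lab' Y (conj_matching b X Y \<theta>))
        (basis_vec (coll (g \<circ> conj_matching b X Y \<theta>) (cut_label (conj_matching b X Y \<theta>) lab') Y)))"
    unfolding prod_sum_def
    by (rule sum.reindex_bij_betw[symmetric], rule bij_betw_conj_matching[OF b], rule lab)
  also have "\<dots> = prod_sum f lab e X"
    unfolding prod_sum_def
  proof (rule sum.cong[OF refl])
    fix \<theta> assume \<theta>: "\<theta> \<in> matchings lab X"
    have "f (\<theta> z) \<in> X" if "z \<in> X" for z
      using perm_on_in[OF wfc_perm_on[OF w]] matchingsD(4)[OF \<theta> that] by blast
    then have "coll (g \<circ> conj_matching b X Y \<theta>) (cut_label (conj_matching b X Y \<theta>) lab') (b ` X) = coll (f \<circ> \<theta>) (cut_label \<theta> lab) X"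
      by (intro coll_conj_matching[OF \<theta>]) auto
    moreover have "b ` X = Y" using b by (simp add: bij_betw_def)
    moreover have "wt (sg e') lab' Y (conj_matching b X Y \<theta>) = (wt (sg e) lab X \<theta> :: 'k poly)"
      by (rule trans[OF wt_conj_matching[where lab = lab and lab' = lab', OF b lab \<theta>] wt_cong])
        (auto simp: sg_def e matchingsD(4)[OF \<theta>])
    ultimately show "scl (wt (sg e') lab' Y (conj_matching b X Y \<theta>) :: 'k poly)
        (basis_vec (coll (g \<circ> conj_matching b X Y \<theta>) (cut_label (conj_matching b X Y \<theta>) lab') Y))
      = scl (wt (sg e) lab X \<theta>) (basis_vec (coll (f \<circ> \<theta>) (cut_label \<theta> lab) X))" by simp
  qed
  finally show ?thesis .
qed

lemma cop_sum_iso: "cop_sum g lab' Y = (cop_sum f lab X :: _ \<Rightarrow>\<^sub>0 'k::field_char_0 poly)"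
proof -
  have inj: "inj_on b X" and im: "b ` X = Y" using b by (auto simp: bij_betw_def)
  let ?b' = "inv_into X b"
  have b'b: "x \<in> X \<Longrightarrow> ?b' (b x) = x" and bb': "y \<in> Y \<Longrightarrow> b (?b' y) = y \<and> ?b' y \<in> X" for x y
    using inj im by (auto simp: f_inv_into_f inv_into_into)
  let ?T = "\<lambda>\<theta> c. scl (wt (sg c) lab' Y \<theta> :: 'k poly) (basis_vec
       (coll (g \<circ> \<theta>) (cut_label \<theta> lab') {x \<in> Y. c x = (1::nat)}, coll (g \<circ> \<theta>) (cut_label \<theta> lab') {x \<in> Y. c x = 2}))"
  have "cop_sum g lab' Y = (\<Sum>\<theta>\<in>matchings lab X. sum (?T (conj_matching b X Y \<theta>)) (colourings {1, 2} (g \<circ> conj_matching b X Y \<theta>) Y))"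
    unfolding cop_sum_def
    by (rule sum.reindex_bij_betw[symmetric], rule bij_betw_conj_matching[OF b], rule lab)
  also have "\<dots> = cop_sum f lab X"
    unfolding cop_sum_def
  proof (rule sum.cong[OF refl])
    fix \<theta> assume \<theta>: "\<theta> \<in> matchings lab X"
    let ?\<psi> = "conj_matching b X Y \<theta>"
    have \<theta>X: "z \<in> X \<Longrightarrow> \<theta> z \<in> X" for z by (rule matchingsD(4)[OF \<theta>])
    have fX: "z \<in> X \<Longrightarrow> f z \<in> X" for z by (rule perm_on_in[OF wfc_perm_on[OF w]])
    have bX: "z \<in> X \<Longrightarrow> b z \<in> Y" for z using im by auto
    have gb: "g (?\<psi> (b z)) = b (f (\<theta> z))" if "z \<in> X" for z
      using that by (simp add: conj_matching_apply[OF b] fg \<theta>X)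
    show "sum (?T ?\<psi>) (colourings {1, 2} (g \<circ> ?\<psi>) Y)
      = (\<Sum>c\<in>colourings {1, 2} (f \<circ> \<theta>) X. scl (wt (sg c) lab X \<theta> :: 'k poly) (basis_vec
       (coll (f \<circ> \<theta>) (cut_label \<theta> lab) {x \<in> X. c x = 1}, coll (f \<circ> \<theta>) (cut_label \<theta> lab) {x \<in> X. c x = 2})))"
    \<comment> \<open>Colourings are carried over by composition with \<open>b\<close> and its
      inverse; \<open>restrict\<close> keeps them extensional.\<close>
    proof (rule sum.reindex_bij_witness[where j = "\<lambda>c. restrict (c \<circ> b) X" and i = "\<lambda>c. restrict (c \<circ> ?b') Y"])
      fix c assume c: "c \<in> colourings {1, 2} (g \<circ> ?\<psi>) Y"
      show "restrict (restrict (c \<circ> b) X \<circ> ?b') Y = c"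
        using c bb' by (auto simp: colourings_def fun_eq_iff PiE_def extensional_def)
      show "restrict (c \<circ> b) X \<in> colourings {1, 2} (f \<circ> \<theta>) X"
      proof -
        have "c (b (f (\<theta> z))) = c (b z)" if "z \<in> X" for z
          using c bX[OF that] gb[OF that] by (auto simp: colourings_def)
        moreover have "c (b z) \<in> {1, 2}" if "z \<in> X" for z
          using c bX[OF that] by (auto simp: colourings_def)
        ultimately show ?thesis using \<theta>X fX by (simp add: colourings_def)
      qed
      have sets: "{y \<in> Y. c y = k} = b ` {x \<in> X. restrict (c \<circ> b) X x = k}" for k
        using im by auto
      have "coll (g \<circ> ?\<psi>) (cut_label ?\<psi> lab') {y \<in> Y. c y = k}
         = coll (f \<circ> \<theta>) (cut_label \<theta> lab) {x \<in> X. restrict (c \<circ> b) X x = k}" for k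
        unfolding sets
      proof (rule coll_conj_matching[OF \<theta>])
        fix z assume z: "z \<in> {x \<in> X. restrict (c \<circ> b) X x = k}"
        then show "f (\<theta> z) \<in> {x \<in> X. restrict (c \<circ> b) X x = k}"
          using c bX[of z] gb[of z] \<theta>X fX by (auto simp: colourings_def)
      qed auto
      moreover have "wt (sg c) lab' Y ?\<psi> = (wt (sg (restrict (c \<circ> b) X)) lab X \<theta> :: 'k poly)"
        by (rule trans[OF wt_conj_matching[where lab = lab and lab' = lab', OF b lab \<theta>] wt_cong])
          (auto simp: sg_def \<theta>X)
      ultimately show "scl (wt (sg (restrict (c \<circ> b) X)) lab X \<theta> :: 'k poly) (basis_vec
         (coll (f \<circ> \<theta>) (cut_label \<theta> lab) {x \<in> X. restrict (c \<circ> b) X x = 1},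
          coll (f \<circ> \<theta>) (cut_label \<theta> lab) {x \<in> X. restrict (c \<circ> b) X x = 2})) = ?T ?\<psi> c" by simp
    next
      fix c assume c: "c \<in> colourings {1, 2} (f \<circ> \<theta>) X"
      show "restrict (restrict (c \<circ> ?b') Y \<circ> b) X = c"
        using c b'b bX by (auto simp: colourings_def fun_eq_iff PiE_def extensional_def)
      have "c (?b' (g (?\<psi> y))) = c (?b' y) \<and> g (?\<psi> y) \<in> Y" if y: "y \<in> Y" for y
      proof -
        have "g (?\<psi> y) = b (f (\<theta> (?b' y)))" using gb[of "?b' y"] bb'[OF y] by simp
        then show ?thesis using c bb'[OF y] \<theta>X fX bX b'b by (simp add: colourings_def)
      qed
      moreover have "c (?b' y) \<in> {1, 2}" if "y \<in> Y" for y
        using c bb'[OF that] by (auto simp: colourings_def)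
      ultimately show "restrict (c \<circ> ?b') Y \<in> colourings {1, 2} (g \<circ> ?\<psi>) Y"
        by (simp add: colourings_def)
    qed
  qed
  finally show ?thesis .
qed

end

section \<open>The defining sums as state sums\<close>

lemma half_h_power: "half_h 1 ^ n = (half_h n :: 'k::field_char_0 poly)"
  by (induction n) (auto simp: half_h_def mult_monom power_divide mult.commute one_pCons monom_0)

lemma wt_sg: "wt (sg c) lab X \<theta> = half_h (card (fwd_points lab X \<theta>)) * (\<Prod>x\<in>fwd_points lab X \<theta>. sg c x (\<theta> x))"
  by (simp only: wt_def prod.distrib prod_constant half_h_power)

text \<open>A pair has two members and one forward point, so \<open>card J div 2\<close> counts
  pairs.\<close>

lemma card_moved:
  assumes "finite X" and \<theta>: "\<theta> \<in> matchings lab X"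
  shows "card {x. \<theta> x \<noteq> x} = 2 * card (fwd_points lab X \<theta>)"
proof -
  let ?F = "fwd_points lab X \<theta>"
  have fin: "finite ?F" using assms(1) by (simp add: fwd_points_def)
  have "{x. \<theta> x \<noteq> x} = ?F \<union> \<theta> ` ?F"
  proof (intro equalityI subsetI)
    fix x assume "x \<in> {x. \<theta> x \<noteq> x}"
    then have m: "\<theta> x \<noteq> x" by simp
    show "x \<in> ?F \<union> \<theta> ` ?F"
    proof (cases "is_fwd lab x")
      case True
      then show ?thesis using matchingsD(3)[OF \<theta> m] m by (simp add: fwd_points_def)
    next
      case False
      then have "\<theta> x \<in> ?F"
        using is_fwd_partner[OF \<theta> m] matchingsD(3)[OF \<theta> m] m matchingsD(2)[OF \<theta>, of x]
        by (auto simp: fwd_points_def)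
      then show ?thesis using matchingsD(2)[OF \<theta>, of x] by (metis UnI2 imageI)
    qed
  next
    fix x assume "x \<in> ?F \<union> \<theta> ` ?F"
    then show "x \<in> {x. \<theta> x \<noteq> x}"
      using matching_inj[OF \<theta>] by (auto simp: fwd_points_def)
  qed
  moreover have "?F \<inter> \<theta> ` ?F = {}"
    using is_fwd_partner[OF \<theta>] by (auto simp: fwd_points_def)
  moreover have "card (\<theta> ` ?F) = card ?F"
    using matching_inj[OF \<theta>] by (intro card_image) (auto simp: inj_on_def)
  ultimately show ?thesis using fin by (simp add: card_Un_disjoint)
qed

text \<open>Extends \<open>member_of\<close> to all points: the point of a trivial path is no
  abstract edge and names the original member at its position.\<close>

definition member_at :: "('v, 'a) cpath list \<Rightarrow> (nat \<times> nat \<Rightarrow> nat \<times> nat) \<Rightarrow> nat \<times> nat \<Rightarrow> member_index" where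
  "member_at xs \<theta> x = (if x \<in> abstract_edges xs then Inl (orbit (succ_point xs \<circ> \<theta>) x) else Inr (fst x))"

lemma visible_arcs_eq_filter:
  assumes "\<And>x. x \<in> set zs \<Longrightarrow> snd (lab x) = (if P x then Some (u x) else None)"
  shows "visible_arcs lab zs = map u (filter P zs)"
  using assms by (induction zs) auto

section \<open>Gluing a presentation along a matching\<close>

context
  fixes Q :: "('v, 'e) pre_digraph" and xs :: "('v, 'e darc) cpath list"
  assumes wf: "wf_digraph Q" and cyc: "\<And>c. c \<in> set xs \<Longrightarrow> cyclic_path Q c"
begin

lemma abstract_edges_points:
  assumes "x \<in> abstract_edges xs"
  shows "x \<in> points xs" "point_label Q xs x = (tail (double Q) (pr xs x), Some (pr xs x))"
    "next_edge xs x = succ_point xs x" "succ_point xs x \<in> abstract_edges xs"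
proof -
  obtain i j where x: "x = (i, j)" "i < length xs" "j < length (arcs_of (xs ! i))"
    using assms by (auto simp: abstract_edges_def)
  then have r: "row_length xs i = length (arcs_of (xs ! i))" by (simp add: row_length_def max_def)
  show "x \<in> points xs" using x r by (simp add: points_def)
  show "next_edge xs x = succ_point xs x" using x r by (simp add: next_edge_def succ_point_def)
  have "Suc j mod length (arcs_of (xs ! i)) < length (arcs_of (xs ! i))" using x by (intro mod_less_divisor) linarith
  then show "succ_point xs x \<in> abstract_edges xs" using x r by (simp add: succ_point_def abstract_edges_def)
  show "point_label Q xs x = (tail (double Q) (pr xs x), Some (pr xs x))"
    using x by (cases "xs ! i") (auto simp: point_label_def pr_def)
qed

lemma trivial_points:
  assumes "x \<in> points xs" "x \<notin> abstract_edges xs"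
  shows "xs ! fst x = Triv (fst (point_label Q xs x))" "snd (point_label Q xs x) = None" "x = (fst x, 0)"
    "fst x < length xs" "succ_point xs x = x"
proof -
  obtain i j where x: "x = (i, j)" "i < length xs" "j < row_length xs i" using assms by (auto simp: points_def)
  have "length (arcs_of (xs ! i)) \<le> j" using assms(2) x by (auto simp: abstract_edges_def)
  moreover have "j < 1 \<or> j < length (arcs_of (xs ! i))"
    using x(3) unfolding row_length_def by (simp only: less_max_iff_disj)
  ultimately have l: "length (arcs_of (xs ! i)) = 0" "j = 0" by linarith+
  have "cyclic_path Q (xs ! i)" using cyc x by simp
  then obtain v where v: "xs ! i = Triv v" using l by (cases "xs ! i") (auto simp: cyclic_path_def)
  then show "xs ! fst x = Triv (fst (point_label Q xs x))" "snd (point_label Q xs x) = None" "x = (fst x, 0)" "fst x < length xs"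
    "succ_point xs x = x"
    using x l by (auto simp: point_label_def succ_point_def row_length_def)
qed

lemma trivial_points_iff:
  "xs ! i = Triv v \<Longrightarrow> i < length xs \<Longrightarrow> (i, 0) \<in> points xs \<and> (i, 0) \<notin> abstract_edges xs"
  by (auto simp: points_def abstract_edges_def)

lemma wfc_xs: "wfc Q (succ_point xs) (point_label Q xs) (points xs)"
  by (rule wfc_points[OF cyc wf])

context
  fixes \<theta> J \<phi>
  assumes \<theta>: "\<theta> \<in> matchings (point_label Q xs) (points xs)"
    and J: "J = {x. \<theta> x \<noteq> x}" and \<phi>: "\<And>x. x \<in> J \<Longrightarrow> \<phi> x = \<theta> x"
begin

lemma moved_abstract: "\<theta> x \<noteq> x \<Longrightarrow> x \<in> abstract_edges xs"
  using matchingsD(3)[OF \<theta>, of x] trivial_points(2)[of x] by fastforce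

lemma theta_abstract: "x \<in> abstract_edges xs \<Longrightarrow> \<theta> x \<in> abstract_edges xs"
  using moved_abstract[of "\<theta> x"] matchingsD(2)[OF \<theta>, of x] by metis

lemma perm_on_theta: "perm_on (succ_point xs \<circ> \<theta>) (points xs)"
  by (rule perm_on_glue[OF wfc_perm_on[OF wfc_xs] \<theta>])

lemma wfc_theta: "wfc Q (succ_point xs \<circ> \<theta>) (cut_label \<theta> (point_label Q xs)) (points xs)"
  by (rule wfc_glue[OF wfc_xs \<theta>])

text \<open>\<open>\<phi>\<close> is tied to \<open>\<theta>\<close> on \<open>J\<close> only, so
  that the results serve for both encodings: the restricted function of the coproduct and
  \<open>to_involution\<close> in the product.\<close>

lemma glue_step_eq: "x \<in> abstract_edges xs \<Longrightarrow> glue_step xs J \<phi> x = (succ_point xs \<circ> \<theta>) x"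
  using abstract_edges_points(3)[OF theta_abstract, of x] abstract_edges_points(3)[of x]
  by (auto simp: glue_step_def \<phi> J)

lemma step_abstract: "x \<in> abstract_edges xs \<Longrightarrow> (succ_point xs \<circ> \<theta>) x \<in> abstract_edges xs"
  using abstract_edges_points(4)[OF theta_abstract] by simp

lemma orbit_glue_step: "x \<in> abstract_edges xs \<Longrightarrow> orbit (glue_step xs J \<phi>) x = orbit (succ_point xs \<circ> \<theta>) x"
  by (rule orbit_cong0[of _ "abstract_edges xs"]) (auto simp: glue_step_eq simp del: o_apply intro: step_abstract)

lemma funpow_glue_step:
  assumes "x \<in> abstract_edges xs"
  shows "(glue_step xs J \<phi> ^^ n) x = ((succ_point xs \<circ> \<theta>) ^^ n) x \<and> ((succ_point xs \<circ> \<theta>) ^^ n) x \<in> abstract_edges xs"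
proof (induction n)
  case (Suc n)
  have "(glue_step xs J \<phi> ^^ Suc n) x = glue_step xs J \<phi> ((glue_step xs J \<phi> ^^ n) x)"
    "((succ_point xs \<circ> \<theta>) ^^ Suc n) x = (succ_point xs \<circ> \<theta>) (((succ_point xs \<circ> \<theta>) ^^ n) x)"
    by simp_all
  then show ?case using Suc glue_step_eq step_abstract by (simp del: o_apply funpow.simps)
qed (simp add: assms)

lemma orbit_abstract:
  assumes x: "x \<in> abstract_edges xs"
  shows "orbit (succ_point xs \<circ> \<theta>) x \<subseteq> abstract_edges xs"
proof
  fix y assume "y \<in> orbit (succ_point xs \<circ> \<theta>) x"
  then show "y \<in> abstract_edges xs" by induction (auto simp del: o_apply intro: step_abstract x)
qed

lemma orbit_trivial:
  assumes "x \<in> points xs" "x \<notin> abstract_edges xs"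
  shows "orbit (succ_point xs \<circ> \<theta>) x = {x}"
proof -
  have "\<theta> x = x" using moved_abstract[of x] assms(2) by blast
  then show ?thesis using trivial_points(5)[OF assms] by (simp add: orbit_eq_singleton_iff)
qed

text \<open>An orbit consists of abstract edges only, or it is the single point of a trivial path
  and is then determined by its row.\<close>

lemma member_at_eq_iff:
  assumes x: "x \<in> points xs" and y: "y \<in> points xs"
  shows "member_at xs \<theta> x = member_at xs \<theta> y \<longleftrightarrow> orbit (succ_point xs \<circ> \<theta>) x = orbit (succ_point xs \<circ> \<theta>) y"
proof -
  have self: "z \<in> points xs \<Longrightarrow> z \<in> orbit (succ_point xs \<circ> \<theta>) z" for z
    by (rule self_in_orbit[OF perm_on_theta])
  show ?thesis
  proof (cases "x \<in> abstract_edges xs"; cases "y \<in> abstract_edges xs")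
    assume "x \<in> abstract_edges xs" "y \<notin> abstract_edges xs"
    then show ?thesis using orbit_abstract[of x] self[OF y] by (auto simp: member_at_def)
  next
    assume "x \<notin> abstract_edges xs" "y \<in> abstract_edges xs"
    then show ?thesis using orbit_abstract[of y] self[OF x] by (auto simp: member_at_def)
  next
    assume n: "x \<notin> abstract_edges xs" "y \<notin> abstract_edges xs"
    then show ?thesis
      using trivial_points(3)[OF x n(1)] trivial_points(3)[OF y n(2)]
      by (auto simp: member_at_def orbit_trivial x y)
  qed (simp add: member_at_def)
qed

lemma members_eq: "members xs J \<phi> = member_at xs \<theta> ` points xs"
proof (intro equalityI subsetI)
  fix r assume "r \<in> members xs J \<phi>"
  then consider x where "x \<in> abstract_edges xs" "r = Inl (orbit (glue_step xs J \<phi>) x)"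
    | i v where "i < length xs" "xs ! i = Triv v" "r = Inr i"
    by (auto simp: members_def)
  then show "r \<in> member_at xs \<theta> ` points xs"
  proof cases
    case 1
    then show ?thesis
      using abstract_edges_points(1) orbit_glue_step by (intro image_eqI[of _ _ x]) (auto simp: member_at_def)
  next
    case 2
    then show ?thesis
      using trivial_points_iff[of i v] by (intro image_eqI[of _ _ "(i, 0)"]) (auto simp: member_at_def)
  qed
next
  fix r assume "r \<in> member_at xs \<theta> ` points xs"
  then obtain x where x: "x \<in> points xs" "r = member_at xs \<theta> x" by auto
  then show "r \<in> members xs J \<phi>"
    using trivial_points(1,4)[of x] by (auto simp: member_at_def members_def orbit_glue_step)
qed

lemma member_of_eq: "x \<in> abstract_edges xs \<Longrightarrow> member_of xs J \<phi> x = member_at xs \<theta> x"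
  by (simp add: member_of_def member_at_def orbit_glue_step)

lemma glued_necklace_eq:
  assumes x: "x \<in> points xs"
  shows "glued_necklace Q xs J \<phi> (member_at xs \<theta> x) = neck (succ_point xs \<circ> \<theta>) (cut_label \<theta> (point_label Q xs)) x"
proof (cases "x \<in> abstract_edges xs")
  case False
  have "iterates (succ_point xs \<circ> \<theta>) x = [x]"
    using orbit_trivial[OF x False] by (simp add: iterates_def)
  then show ?thesis
    using trivial_points[OF x False] False moved_abstract[of x]
    by (simp add: member_at_def glued_necklace_def neck_def cut_label_def)
next
  case True
  let ?W = "orbit (succ_point xs \<circ> \<theta>) x" let ?g = "succ_point xs \<circ> \<theta>" let ?l = "cut_label \<theta> (point_label Q xs)"
  \<comment> \<open>The starting point chosen in \<open>orbit_necklace\<close>. It may differ from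
    \<open>x\<close>, which \<open>neck_orbit\<close> makes up for at the end.\<close>
  define y where "y = (SOME y. y \<in> ?W)"
  have y: "y \<in> ?W" unfolding y_def some_in_eq using self_in_orbit[OF perm_on_theta x] by blast
  then have yA: "y \<in> abstract_edges xs" using orbit_abstract[OF True] by blast
  have yP: "y \<in> points xs" by (rule abstract_edges_points(1)[OF yA])
  have Wy: "orbit ?g y = ?W" by (rule orbit_eq_of_mem[OF perm_on_theta x y])
  have list: "map (\<lambda>n. (glue_step xs J \<phi> ^^ n) y) [0..<card ?W] = iterates ?g y"
    unfolding iterates_def Wy using funpow_glue_step[OF yA] by simp
  have sub: "set (iterates ?g y) \<subseteq> abstract_edges xs"
    using set_iterates[OF perm_on_theta yP] orbit_abstract[OF yA] by simp
  have vis: "visible_arcs ?l (iterates ?g y) = map (pr xs) (filter (\<lambda>z. z \<notin> J) (iterates ?g y))"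
    by (rule visible_arcs_eq_filter) (use sub abstract_edges_points(2) in \<open>auto simp: cut_label_def J\<close>)
  have "glued_necklace Q xs J \<phi> (member_at xs \<theta> x) = neck ?g ?l y"
    using True abstract_edges_points(2)[OF yA]
    by (simp add: member_at_def glued_necklace_def orbit_necklace_def flip: y_def)
      (simp add: neck_def vis list Let_def del: o_apply)
  also have "\<dots> = neck ?g ?l x"
    by (rule neck_orbit[OF perm_on_theta wfc_coherent[OF wfc_theta] x y])
  finally show ?thesis .
qed

text \<open>\<open>member_at\<close> is constant on orbits and separates them, so members and cycles
  correspond with the same multiplicities.\<close>

lemma glued_collection_eq:
  assumes Y: "Y \<subseteq> points xs"
  shows "glued_collection Q xs J \<phi> (member_at xs \<theta> ` Y) = coll (succ_point xs \<circ> \<theta>) (cut_label \<theta> (point_label Q xs)) Y"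
proof -
  let ?g = "succ_point xs \<circ> \<theta>" and ?m = "member_at xs \<theta>"
  let ?h = "\<lambda>W. ?m (SOME x. x \<in> W)"
  have some: "(SOME y. y \<in> orbit ?g x) \<in> points xs \<and> orbit ?g (SOME y. y \<in> orbit ?g x) = orbit ?g x"
    if x: "x \<in> points xs" for x
  proof -
    have "(SOME y. y \<in> orbit ?g x) \<in> orbit ?g x"
      unfolding some_in_eq using self_in_orbit[OF perm_on_theta x] by blast
    then show ?thesis using orbit_eq_of_mem[OF perm_on_theta x] orbit_subset_perm_on[OF perm_on_theta x] by blast
  qed
  have h: "?h (orbit ?g x) = ?m x" if "x \<in> Y" for x
    using member_at_eq_iff[of "SOME y. y \<in> orbit ?g x" x] some[of x] that Y by blast
  have inj: "inj_on ?h (orbit ?g ` Y)"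
  proof (rule inj_onI)
    fix V W assume "V \<in> orbit ?g ` Y" "W \<in> orbit ?g ` Y" and e: "?h V = ?h W"
    then obtain x y where "x \<in> Y" "V = orbit ?g x" "y \<in> Y" "W = orbit ?g y" by auto
    then show "V = W" using e h[of x] h[of y] member_at_eq_iff[of x y] Y by auto
  qed
  have im: "?h ` orbit ?g ` Y = ?m ` Y" unfolding image_image using h by (intro image_cong) auto
  have "glued_collection Q xs J \<phi> (?m ` Y) = image_mset (glued_necklace Q xs J \<phi> \<circ> ?h) (mset_set (orbit ?g ` Y))"
    unfolding glued_collection_def im[symmetric] using inj by (simp flip: image_mset_mset_set multiset.map_comp)
  also have "\<dots> = coll ?g (cut_label \<theta> (point_label Q xs)) Y"
    unfolding coll_def
  proof (rule image_mset_cong)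
    fix W assume "W \<in># mset_set (orbit ?g ` Y)"
    then obtain x where x: "x \<in> Y" "W = orbit ?g x" by (cases "finite (orbit ?g ` Y)") auto
    then show "(glued_necklace Q xs J \<phi> \<circ> ?h) W = neck ?g (cut_label \<theta> (point_label Q xs)) (SOME x. x \<in> W)"
      using some[of x] Y glued_necklace_eq[of "SOME y. y \<in> orbit ?g x"] by auto
  qed
  finally show ?thesis .
qed

lemma fwd_points_points:
  assumes "x \<in> points xs"
  shows "x \<in> fwd_points (point_label Q xs) (points xs) \<theta> \<longleftrightarrow> x \<in> J \<and> pr xs x \<in> Fwd ` arcs Q"
proof (cases "x \<in> J")
  case True
  then have xA: "x \<in> abstract_edges xs" using moved_abstract J by auto
  have "pr xs x \<in> arcs (double Q)"
    using wfcD(3)[OF wfc_xs assms, of "pr xs x"] abstract_edges_points(2)[OF xA] by simp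
  then show ?thesis
    using True J assms abstract_edges_points(2)[OF xA] by (auto simp: fwd_points_def is_fwd_def double_def)
qed (simp add: fwd_points_def J)

text \<open>The definition compares the members of \<open>x\<close> and of the next edge. The next
  edge is the image of \<open>\<theta> x\<close> under the glued permutation, hence lies in the
  orbit of \<open>\<theta> x\<close>: the sign compares the two members of the pair.\<close>

lemma colour_sign_eq:
  "colour_sign Q xs J \<phi> c = (\<Prod>x\<in>fwd_points (point_label Q xs) (points xs) \<theta>. sg (c \<circ> member_at xs \<theta>) x (\<theta> x))"
proof -
  have F: "{x \<in> J. pr xs x \<in> Fwd ` arcs Q} = fwd_points (point_label Q xs) (points xs) \<theta>"
  proof (rule set_eqI)
    fix x
    show "x \<in> {x \<in> J. pr xs x \<in> Fwd ` arcs Q} \<longleftrightarrow> x \<in> fwd_points (point_label Q xs) (points xs) \<theta>"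
    proof (cases "x \<in> points xs")
      case False
      then have "x \<notin> J" unfolding J using moved_abstract[of x] abstract_edges_points(1)[of x] by blast
      then show ?thesis using False by (simp add: fwd_points_def)
    qed (simp add: fwd_points_points)
  qed
  show ?thesis
    unfolding colour_sign_def F
  proof (rule prod.cong[OF refl])
    fix x assume "x \<in> fwd_points (point_label Q xs) (points xs) \<theta>"
    then have m: "\<theta> x \<noteq> x" by (simp add: fwd_points_def)
    then have xA: "x \<in> abstract_edges xs" "\<theta> x \<in> abstract_edges xs" using moved_abstract theta_abstract by auto
    then have n: "next_edge xs x = (succ_point xs \<circ> \<theta>) (\<theta> x)"
      using abstract_edges_points(3) matchingsD(2)[OF \<theta>] by simp
    have "member_at xs \<theta> (next_edge xs x) = member_at xs \<theta> (\<theta> x)"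
      unfolding n using xA step_abstract[of "\<theta> x"] orbit_step_eq[OF perm_on_theta abstract_edges_points(1)[OF xA(2)]]
      by (simp add: member_at_def del: o_apply)
    moreover have "next_edge xs x \<in> abstract_edges xs" unfolding n using xA step_abstract by blast
    ultimately show "(let a = c (member_of xs J \<phi> x); b = c (member_of xs J \<phi> (next_edge xs x))
        in if a < b then 1 else if a = b then 0 else - 1) = sg (c \<circ> member_at xs \<theta>) x (\<theta> x)"
      using xA by (simp add: member_of_eq sg_def)
  qed
qed

text \<open>Colourings of members are pulled back along \<open>member_at\<close>; the inverse reads
  the colour at a chosen point of each member, which is harmless as it is constant on
  orbits.\<close>

lemma bij_betw_colourings:
  "bij_betw (\<lambda>c. restrict (c \<circ> member_at xs \<theta>) (points xs)) (members xs J \<phi> \<rightarrow>\<^sub>E K) (colourings K (succ_point xs \<circ> \<theta>) (points xs))"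
proof (rule bij_betw_byWitness[where f' = "\<lambda>c. restrict (\<lambda>r. c (SOME x. x \<in> points xs \<and> member_at xs \<theta> x = r)) (members xs J \<phi>)"])
  let ?m = "member_at xs \<theta>" and ?X = "points xs" and ?g = "succ_point xs \<circ> \<theta>"
  have some: "(SOME y. y \<in> ?X \<and> ?m y = r) \<in> ?X \<and> ?m (SOME y. y \<in> ?X \<and> ?m y = r) = r" if "r \<in> members xs J \<phi>" for r
    using that unfolding members_eq by (intro someI_ex[of "\<lambda>y. y \<in> ?X \<and> ?m y = r"]) auto
  have step: "?m (?g x) = ?m x" "?g x \<in> ?X" if "x \<in> ?X" for x
    using member_at_eq_iff[of "?g x" x] orbit_step_eq[OF perm_on_theta that] perm_on_in[OF perm_on_theta that] that
    by blast+
  have const: "c y = c x" if "c \<in> colourings K ?g ?X" "x \<in> ?X" "y \<in> orbit ?g x" for c x y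
    using that(3)
  proof induction
    case (step y)
    have "y \<in> ?X" using step(1) orbit_subset_perm_on[OF perm_on_theta that(2)] by blast
    then show ?case using step that(1) by (simp add: colourings_def)
  qed (use that in \<open>simp add: colourings_def\<close>)
  show "\<forall>c\<in>members xs J \<phi> \<rightarrow>\<^sub>E K. restrict (\<lambda>r. restrict (c \<circ> ?m) ?X (SOME x. x \<in> ?X \<and> ?m x = r)) (members xs J \<phi>) = c"
  proof
    fix c assume c: "c \<in> members xs J \<phi> \<rightarrow>\<^sub>E K"
    show "restrict (\<lambda>r. restrict (c \<circ> ?m) ?X (SOME x. x \<in> ?X \<and> ?m x = r)) (members xs J \<phi>) = c"
    proof
      fix r show "restrict (\<lambda>r. restrict (c \<circ> ?m) ?X (SOME x. x \<in> ?X \<and> ?m x = r)) (members xs J \<phi>) r = c r"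
        using some[of r] c by (cases "r \<in> members xs J \<phi>") (auto simp: PiE_def extensional_def)
    qed
  qed
  show "\<forall>c\<in>colourings K ?g ?X. restrict (restrict (\<lambda>r. c (SOME x. x \<in> ?X \<and> ?m x = r)) (members xs J \<phi>) \<circ> ?m) ?X = c"
  proof
    fix c assume c: "c \<in> colourings K ?g ?X"
    show "restrict (restrict (\<lambda>r. c (SOME x. x \<in> ?X \<and> ?m x = r)) (members xs J \<phi>) \<circ> ?m) ?X = c"
    proof
      fix x show "restrict (restrict (\<lambda>r. c (SOME x. x \<in> ?X \<and> ?m x = r)) (members xs J \<phi>) \<circ> ?m) ?X x = c x"
      proof (cases "x \<in> ?X")
        case True
        let ?y = "SOME y. y \<in> ?X \<and> ?m y = ?m x"
        have mem: "?m x \<in> members xs J \<phi>" unfolding members_eq using True by blast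
        have "?y \<in> ?X" "orbit ?g ?y = orbit ?g x"
          using some[OF mem] member_at_eq_iff[of ?y x] True by blast+
        then have "c ?y = c x"
          using const[OF c True, of ?y] self_in_orbit[OF perm_on_theta, of ?y] by simp
        then show ?thesis using True mem by simp
      next
        case False
        have "c \<in> ?X \<rightarrow>\<^sub>E K" using c by (simp add: colourings_def)
        from PiE_arb[OF this False] False show ?thesis by simp
      qed
    qed
  qed
  show "(\<lambda>c. restrict (c \<circ> ?m) ?X) ` (members xs J \<phi> \<rightarrow>\<^sub>E K) \<subseteq> colourings K ?g ?X"
  proof clarify
    fix c assume c: "c \<in> members xs J \<phi> \<rightarrow>\<^sub>E K"
    have "?m x \<in> members xs J \<phi>" if "x \<in> ?X" for x unfolding members_eq using that by blast
    then show "restrict (c \<circ> ?m) ?X \<in> colourings K ?g ?X"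
      using c step by (auto simp: colourings_def simp del: o_apply) (auto simp: o_def)
  qed
  show "(\<lambda>c. restrict (\<lambda>r. c (SOME x. x \<in> ?X \<and> ?m x = r)) (members xs J \<phi>)) ` colourings K ?g ?X \<subseteq> members xs J \<phi> \<rightarrow>\<^sub>E K"
  proof clarify
    fix c assume c: "c \<in> colourings K ?g ?X"
    then have "c x \<in> K" if "x \<in> ?X" for x using that by (auto simp: colourings_def)
    then show "restrict (\<lambda>r. c (SOME x. x \<in> ?X \<and> ?m x = r)) (members xs J \<phi>) \<in> members xs J \<phi> \<rightarrow>\<^sub>E K"
      using some by auto
  qed
qed

end

lemma bij_betw_self_contractions:
  "bij_betw (\<lambda>\<theta>. ({x. \<theta> x \<noteq> x}, restrict \<theta> {x. \<theta> x \<noteq> x})) (matchings (point_label Q xs) (points xs)) (self_contractions xs)"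
proof (rule bij_betw_byWitness[where f' = "\<lambda>(J, \<phi>) x. if x \<in> J then \<phi> x else x"])
  let ?M = "matchings (point_label Q xs) (points xs)"
  show "\<forall>\<theta>\<in>?M. (\<lambda>(J, \<phi>) x. if x \<in> J then \<phi> x else x) ({x. \<theta> x \<noteq> x}, restrict \<theta> {x. \<theta> x \<noteq> x}) = \<theta>"
    by (auto simp: fun_eq_iff)
  \<comment> \<open>No arc is its own reverse, so \<open>\<phi>\<close> moves every point of
    \<open>J\<close>, and \<open>J\<close> can be recovered from the total involution.\<close>
  have ne: "\<phi> x \<noteq> x" if "(J, \<phi>) \<in> self_contractions xs" "x \<in> J" for J \<phi> x
  proof -
    have "pr xs (\<phi> x) = star (pr xs x)" using that by (simp add: self_contractions_def)
    then show ?thesis by (metis star_neq(1))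
  qed
  show "\<forall>p\<in>self_contractions xs. (\<lambda>\<theta>. ({x. \<theta> x \<noteq> x}, restrict \<theta> {x. \<theta> x \<noteq> x})) ((\<lambda>(J, \<phi>) x. if x \<in> J then \<phi> x else x) p) = p"
  proof (rule ballI)
    fix p assume "p \<in> self_contractions xs"
    then obtain J \<phi> where p: "p = (J, \<phi>)" and s: "(J, \<phi>) \<in> self_contractions xs" by (cases p) auto
    let ?\<theta> = "\<lambda>x. if x \<in> J then \<phi> x else x"
    have J: "{x. ?\<theta> x \<noteq> x} = J" using ne[OF s] by auto
    have "restrict ?\<theta> J = \<phi>"
      using s by (auto simp: self_contractions_def PiE_def extensional_def fun_eq_iff)
    then have "({x. ?\<theta> x \<noteq> x}, restrict ?\<theta> {x. ?\<theta> x \<noteq> x}) = (J, \<phi>)" unfolding J by simp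
    then show "(\<lambda>\<theta>. ({x. \<theta> x \<noteq> x}, restrict \<theta> {x. \<theta> x \<noteq> x})) ((\<lambda>(J, \<phi>) x. if x \<in> J then \<phi> x else x) p) = p"
      unfolding p split_conv .
  qed
  show "(\<lambda>\<theta>. ({x. \<theta> x \<noteq> x}, restrict \<theta> {x. \<theta> x \<noteq> x})) ` ?M \<subseteq> self_contractions xs"
  proof (rule image_subsetI)
    fix \<theta> assume \<theta>: "\<theta> \<in> ?M"
    have A: "x \<in> abstract_edges xs" if "\<theta> x \<noteq> x" for x
      by (rule moved_abstract[OF \<theta> refl _ that]) simp
    have A': "\<theta> (\<theta> x) \<noteq> \<theta> x" if "\<theta> x \<noteq> x" for x using that matching_inj[OF \<theta>] by blast
    have st: "pr xs (\<theta> x) = star (pr xs x)" if m: "\<theta> x \<noteq> x" for x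
    proof -
      obtain a where "snd (point_label Q xs x) = Some a" "snd (point_label Q xs (\<theta> x)) = Some (star a)"
        by (rule matching_moved[OF \<theta> m])
      then show ?thesis
        using abstract_edges_points(2)[OF A[OF m]] abstract_edges_points(2)[OF A[OF A'[OF m]]] by simp
    qed
    show "({x. \<theta> x \<noteq> x}, restrict \<theta> {x. \<theta> x \<noteq> x}) \<in> self_contractions xs"
      unfolding self_contractions_def using A A' st matchingsD(2)[OF \<theta>] by auto
  qed
  show "(\<lambda>(J, \<phi>) x. if x \<in> J then \<phi> x else x) ` self_contractions xs \<subseteq> ?M"
  proof (rule image_subsetI)
    fix p assume "p \<in> self_contractions xs"
    then obtain J \<phi> where p: "p = (J, \<phi>)" and s: "(J, \<phi>) \<in> self_contractions xs" by (cases p) auto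
    let ?\<theta> = "\<lambda>x. if x \<in> J then \<phi> x else x"
    have J: "J \<subseteq> abstract_edges xs" "\<And>x. x \<in> J \<Longrightarrow> \<phi> x \<in> J" "\<And>x. x \<in> J \<Longrightarrow> \<phi> (\<phi> x) = x"
      "\<And>x. x \<in> J \<Longrightarrow> pr xs (\<phi> x) = star (pr xs x)"
      using s by (auto simp: self_contractions_def)
    have "?\<theta> \<in> ?M"
      unfolding matchings_def mem_Collect_eq
    proof (intro conjI allI impI ballI)
      fix x
      show "x \<notin> points xs \<Longrightarrow> ?\<theta> x = x" using J(1) abstract_edges_points(1)[of x] by (metis subsetD)
      show "?\<theta> (?\<theta> x) = x" using J(2,3) by auto
      assume "?\<theta> x \<noteq> x"
      then have x: "x \<in> J" by (auto split: if_splits)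
      then have "x \<in> abstract_edges xs" "\<phi> x \<in> abstract_edges xs" using J(1) J(2)[OF x] by blast+
      then show "\<exists>a. snd (point_label Q xs x) = Some a \<and> snd (point_label Q xs (?\<theta> x)) = Some (star a)"
        using x J(4) abstract_edges_points(2) by simp
    qed
    then show "(\<lambda>(J, \<phi>) x. if x \<in> J then \<phi> x else x) p \<in> ?M" by (simp add: p)
  qed
qed

end

lemma Delta_h_basis_points:
  fixes Q :: "('v, 'e) pre_digraph"
  assumes wf: "wf_digraph Q" and P: "P \<in> collections Q"
  shows "(Delta_h_basis Q P :: _ \<Rightarrow>\<^sub>0 'k::field_char_0 poly)
    = cop_sum (succ_point (presentation P)) (point_label Q (presentation P)) (points (presentation P))"
proof -
  define xs where "xs = presentation P"
  have cyc: "\<And>c. c \<in> set xs \<Longrightarrow> cyclic_path Q c" unfolding xs_def by (rule presentation_props(2)[OF P wf])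
  let ?X = "points xs" and ?l = "point_label Q xs" and ?f = "succ_point xs"
  define T where "T J \<phi> = scl (half_h (card J div 2) :: 'k poly)
          (\<Sum>c \<in> members xs J \<phi> \<rightarrow>\<^sub>E {1, 2}.
             scl (colour_sign Q xs J \<phi> c)
               (basis_vec (glued_collection Q xs J \<phi> {r \<in> members xs J \<phi>. c r = (1::nat)},
                           glued_collection Q xs J \<phi> {r \<in> members xs J \<phi>. c r = 2})))" for J \<phi>
  have "(Delta_h_basis Q P :: _ \<Rightarrow>\<^sub>0 'k poly) = (\<Sum>(J, \<phi>) \<in> self_contractions xs. T J \<phi>)"
    by (simp add: Delta_h_basis_def xs_def T_def Let_def)
  also have "\<dots> = (\<Sum>\<theta>\<in>matchings ?l ?X. T {x. \<theta> x \<noteq> x} (restrict \<theta> {x. \<theta> x \<noteq> x}))"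
    by (subst sum.reindex_bij_betw[OF bij_betw_self_contractions[OF wf cyc], symmetric]) simp_all
  also have "\<dots> = cop_sum ?f ?l ?X"
    unfolding cop_sum_def
  proof (rule sum.cong[OF refl])
    fix \<theta> assume \<theta>: "\<theta> \<in> matchings ?l ?X"
    define J where "J = {x. \<theta> x \<noteq> x}"
    define \<phi> where "\<phi> = restrict \<theta> J"
    have \<phi>: "\<And>x. x \<in> J \<Longrightarrow> \<phi> x = \<theta> x" by (simp add: \<phi>_def)
    note ctx = wf cyc \<theta> J_def \<phi>
    let ?m = "member_at xs \<theta>"
    have mem: "members xs J \<phi> = ?m ` ?X" by (rule members_eq[OF ctx])
    have div: "card J div 2 = card (fwd_points ?l ?X \<theta>)"
    proof -
      have "finite ?X" by (simp add: points_def)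
      then have "card J = 2 * card (fwd_points ?l ?X \<theta>)" unfolding J_def using \<theta> by (rule card_moved)
      then show ?thesis by simp
    qed
    have "T J \<phi> = (\<Sum>c \<in> members xs J \<phi> \<rightarrow>\<^sub>E {1, 2}. scl (wt (sg (restrict (c \<circ> ?m) ?X)) ?l ?X \<theta>) (basis_vec
       (coll (?f \<circ> \<theta>) (cut_label \<theta> ?l) {x \<in> ?X. restrict (c \<circ> ?m) ?X x = 1},
        coll (?f \<circ> \<theta>) (cut_label \<theta> ?l) {x \<in> ?X. restrict (c \<circ> ?m) ?X x = 2})))"
      unfolding T_def scl_sum
    proof (rule sum.cong[OF refl])
      fix c :: "member_index \<Rightarrow> nat" assume c: "c \<in> members xs J \<phi> \<rightarrow>\<^sub>E {1, 2}"
      have sets: "{r \<in> members xs J \<phi>. c r = k} = ?m ` {x \<in> ?X. restrict (c \<circ> ?m) ?X x = k}" for k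
        unfolding mem by auto
      have gl: "glued_collection Q xs J \<phi> {r \<in> members xs J \<phi>. c r = k}
          = coll (?f \<circ> \<theta>) (cut_label \<theta> ?l) {x \<in> ?X. restrict (c \<circ> ?m) ?X x = k}" for k
        unfolding sets by (rule glued_collection_eq[OF ctx]) auto
      have "(\<Prod>x\<in>fwd_points ?l ?X \<theta>. sg (c \<circ> ?m) x (\<theta> x)) = (\<Prod>x\<in>fwd_points ?l ?X \<theta>. sg (restrict (c \<circ> ?m) ?X) x (\<theta> x) :: 'k poly)"
        by (rule prod.cong) (auto simp: sg_def fwd_points_def matchingsD(4)[OF \<theta>])
      note eq = this
      have "half_h (card J div 2) * colour_sign Q xs J \<phi> c = (wt (sg (restrict (c \<circ> ?m) ?X)) ?l ?X \<theta> :: 'k poly)"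
      proof -
        have "(colour_sign Q xs J \<phi> c :: 'k poly) = (\<Prod>x\<in>fwd_points ?l ?X \<theta>. sg (c \<circ> ?m) x (\<theta> x))"
          by (rule colour_sign_eq[OF ctx])
        with eq show ?thesis unfolding wt_sg div by simp
      qed
      then show "scl (half_h (card J div 2)) (scl (colour_sign Q xs J \<phi> c)
               (basis_vec (glued_collection Q xs J \<phi> {r \<in> members xs J \<phi>. c r = 1},
                           glued_collection Q xs J \<phi> {r \<in> members xs J \<phi>. c r = 2})))
        = scl (wt (sg (restrict (c \<circ> ?m) ?X)) ?l ?X \<theta> :: 'k poly) (basis_vec
       (coll (?f \<circ> \<theta>) (cut_label \<theta> ?l) {x \<in> ?X. restrict (c \<circ> ?m) ?X x = 1},
        coll (?f \<circ> \<theta>) (cut_label \<theta> ?l) {x \<in> ?X. restrict (c \<circ> ?m) ?X x = 2}))"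
        unfolding gl scl_scl by simp
    qed
    also have "\<dots> = (\<Sum>c\<in>colourings {1, 2} (?f \<circ> \<theta>) ?X. scl (wt (sg c) ?l ?X \<theta>) (basis_vec
       (coll (?f \<circ> \<theta>) (cut_label \<theta> ?l) {x \<in> ?X. c x = 1}, coll (?f \<circ> \<theta>) (cut_label \<theta> ?l) {x \<in> ?X. c x = 2})))"
      by (rule sum.reindex_bij_betw[OF bij_betw_colourings[OF ctx]])
    finally show "T {x. \<theta> x \<noteq> x} (restrict \<theta> {x. \<theta> x \<noteq> x}) = (\<Sum>c\<in>colourings {1, 2} (?f \<circ> \<theta>) ?X. scl (wt (sg c) ?l ?X \<theta>) (basis_vec
       (coll (?f \<circ> \<theta>) (cut_label \<theta> ?l) {x \<in> ?X. c x = 1}, coll (?f \<circ> \<theta>) (cut_label \<theta> ?l) {x \<in> ?X. c x = 2})))"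
      by (simp add: \<phi>_def J_def)
  qed
  finally show ?thesis unfolding xs_def .
qed

section \<open>The product of two presentations as a state sum\<close>

lemma cut_label_id: "cut_label (\<lambda>x. x) lab = lab"
  by (simp add: cut_label_def fun_eq_iff)

text \<open>The values 1 and 2 make \<open>sg\<close> give the sign of the product: a pair whose
  forward point lies in the first factor counts +1.\<close>

definition side :: "nat \<Rightarrow> nat \<times> nat \<Rightarrow> nat" where
  "side n x = (if fst x < n then 1 else 2)"

context
  fixes Q :: "('v, 'e) pre_digraph" and xs ys :: "('v, 'e darc) cpath list"
  assumes wf: "wf_digraph Q" and cyc: "\<And>c. c \<in> set (xs @ ys) \<Longrightarrow> cyclic_path Q c"
begin

text \<open>The matchings that come from triples \<open>(A, B, \<phi>)\<close>: every pair has one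
  member in each factor.\<close>

definition crossing :: "(nat \<times> nat \<Rightarrow> nat \<times> nat) set" where
  "crossing = {\<theta> \<in> matchings (point_label Q (xs @ ys)) (points (xs @ ys)). \<forall>x. \<theta> x \<noteq> x \<longrightarrow> side (length xs) (\<theta> x) \<noteq> side (length xs) x}"

definition left_moved :: "(nat \<times> nat \<Rightarrow> nat \<times> nat) \<Rightarrow> (nat \<times> nat) set" where
  "left_moved \<theta> = {x. \<theta> x \<noteq> x \<and> side (length xs) x = 1}"

definition right_moved :: "(nat \<times> nat \<Rightarrow> nat \<times> nat) \<Rightarrow> (nat \<times> nat) set" where
  "right_moved \<theta> = {x. \<theta> x \<noteq> x \<and> side (length xs) x = 2}"

lemma side_cases: "side n x = 1 \<or> side n x = 2"
  by (simp add: side_def)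

lemma moved_split: "left_moved \<theta> \<union> right_moved \<theta> = {x. \<theta> x \<noteq> x}" "left_moved \<theta> \<inter> right_moved \<theta> = {}"
  using side_cases by (auto simp: left_moved_def right_moved_def)

lemma crossing_swap:
  assumes \<theta>: "\<theta> \<in> crossing"
  shows "x \<in> left_moved \<theta> \<Longrightarrow> \<theta> x \<in> right_moved \<theta>" "x \<in> right_moved \<theta> \<Longrightarrow> \<theta> x \<in> left_moved \<theta>" "\<theta> (\<theta> x) = x"
proof -
  have m: "\<theta> \<in> matchings (point_label Q (xs @ ys)) (points (xs @ ys))" using \<theta> by (simp add: crossing_def)
  show inv: "\<theta> (\<theta> x) = x" by (rule matchingsD(2)[OF m])
  have s: "\<theta> x \<noteq> x \<Longrightarrow> side (length xs) (\<theta> x) \<noteq> side (length xs) x" using \<theta> unfolding crossing_def by blast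
  show "x \<in> left_moved \<theta> \<Longrightarrow> \<theta> x \<in> right_moved \<theta>" "x \<in> right_moved \<theta> \<Longrightarrow> \<theta> x \<in> left_moved \<theta>"
    using s inv side_cases[of "length xs" "\<theta> x"] by (auto simp: left_moved_def right_moved_def)
qed

lemma bij_betw_crossing:
  assumes \<theta>: "\<theta> \<in> crossing"
  shows "bij_betw \<theta> (left_moved \<theta>) (right_moved \<theta>)"
  by (rule bij_betw_byWitness[where f' = \<theta>]) (use crossing_swap[OF \<theta>] in blast)+

text \<open>\<open>to_involution\<close> continues \<open>\<phi>\<close> by its inverse, and an
  involution is its own inverse.\<close>

lemma to_involution_crossing:
  assumes \<theta>: "\<theta> \<in> crossing" and x: "x \<in> left_moved \<theta> \<union> right_moved \<theta>"
  shows "to_involution (left_moved \<theta>) (restrict \<theta> (left_moved \<theta>)) x = \<theta> x"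
proof (cases "x \<in> left_moved \<theta>")
  case False
  then have "\<theta> x \<in> left_moved \<theta>" using x crossing_swap(2)[OF \<theta>] by blast
  moreover have "inj_on (restrict \<theta> (left_moved \<theta>)) (left_moved \<theta>)"
    using bij_betw_crossing[OF \<theta>] by (auto simp: bij_betw_def inj_on_def)
  ultimately have "inv_into (left_moved \<theta>) (restrict \<theta> (left_moved \<theta>)) (restrict \<theta> (left_moved \<theta>) (\<theta> x)) = \<theta> x"
    by (intro inv_into_f_f)
  then show ?thesis using False \<open>\<theta> x \<in> left_moved \<theta>\<close> crossing_swap(3)[OF \<theta>] by (simp add: to_involution_def)
qed (simp add: to_involution_def)

text \<open>Leads from a triple back to a crossing matching. Off \<open>A \<union> B\<close> the
  value of \<open>to_involution\<close> has no meaning and is replaced by the identity.\<close>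

definition contraction_matching where
  "contraction_matching = (\<lambda>(A, B, \<phi>) x. if x \<in> A \<union> B then to_involution A \<phi> x else x)"

lemma contractionsD:
  assumes "(A, B, \<phi>) \<in> contractions xs ys"
  shows "x \<in> A \<Longrightarrow> x \<in> abstract_edges (xs @ ys) \<and> side (length xs) x = 1"
    "x \<in> B \<Longrightarrow> x \<in> abstract_edges (xs @ ys) \<and> side (length xs) x = 2"
    "\<phi> \<in> A \<rightarrow>\<^sub>E B" "bij_betw \<phi> A B" "x \<in> A \<Longrightarrow> pr (xs @ ys) (\<phi> x) = star (pr (xs @ ys) x)"
  using assms by (auto simp: contractions_def side_def)

lemma contraction_matching_props:
  assumes c: "(A, B, \<phi>) \<in> contractions xs ys"
  defines "\<theta> \<equiv> contraction_matching (A, B, \<phi>)"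
  shows "x \<in> A \<Longrightarrow> \<theta> x = \<phi> x \<and> \<theta> x \<in> B" "x \<in> B \<Longrightarrow> \<theta> x \<in> A \<and> \<phi> (\<theta> x) = x" "x \<notin> A \<Longrightarrow> x \<notin> B \<Longrightarrow> \<theta> x = x"
    "\<theta> (\<theta> x) = x"
proof -
  note cD = contractionsD[OF c]
  have disj: "A \<inter> B = {}" using cD(1,2) by fastforce
  have inj: "inj_on \<phi> A" and im: "\<phi> ` A = B" using cD(4) by (auto simp: bij_betw_def)
  have A: "\<theta> x = \<phi> x \<and> \<theta> x \<in> B" if "x \<in> A" for x
    using that im by (auto simp: \<theta>_def contraction_matching_def to_involution_def)
  have B: "\<theta> x \<in> A \<and> \<phi> (\<theta> x) = x" if "x \<in> B" for x
  proof -
    have "x \<notin> A" using that disj by blast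
    then have "\<theta> x = inv_into A \<phi> x" using that by (simp add: \<theta>_def contraction_matching_def to_involution_def)
    then show ?thesis using that im by (simp add: inv_into_into f_inv_into_f)
  qed
  have N: "\<theta> x = x" if "x \<notin> A" "x \<notin> B" for x using that by (simp add: \<theta>_def contraction_matching_def)
  show "x \<in> A \<Longrightarrow> \<theta> x = \<phi> x \<and> \<theta> x \<in> B" "x \<in> B \<Longrightarrow> \<theta> x \<in> A \<and> \<phi> (\<theta> x) = x" "x \<notin> A \<Longrightarrow> x \<notin> B \<Longrightarrow> \<theta> x = x"
    by (fact A B N)+
  show "\<theta> (\<theta> x) = x"
  proof (cases "x \<in> A")
    case True
    then have "\<theta> (\<theta> x) \<in> A" "\<phi> (\<theta> (\<theta> x)) = \<phi> x" using A[OF True] B[of "\<theta> x"] by auto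
    then show ?thesis using inj True by (auto dest: inj_onD)
  next
    case False
    then show ?thesis using A[of "\<theta> x"] B[of x] N[of x] by (cases "x \<in> B") auto
  qed
qed

lemma contraction_matching_moved:
  assumes c: "(A, B, \<phi>) \<in> contractions xs ys"
  defines "\<theta> \<equiv> contraction_matching (A, B, \<phi>)"
  shows "left_moved \<theta> = A" "right_moved \<theta> = B"
proof -
  note cD = contractionsD[OF c]
  have m: "\<theta> x \<noteq> x \<longleftrightarrow> x \<in> A \<or> x \<in> B" for x
    using contraction_matching_props(1-3)[OF c, of x, folded \<theta>_def] cD(1)[of x] cD(2)[of x] cD(1)[of "\<theta> x"] cD(2)[of "\<theta> x"] by fastforce
  show "left_moved \<theta> = A" "right_moved \<theta> = B"
    unfolding left_moved_def right_moved_def using m cD(1,2) by fastforce+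
qed

lemma contraction_matching_crossing:
  assumes c: "(A, B, \<phi>) \<in> contractions xs ys"
  shows "contraction_matching (A, B, \<phi>) \<in> crossing"
proof -
  let ?\<theta> = "contraction_matching (A, B, \<phi>)"
  note cD = contractionsD[OF c] and th = contraction_matching_props[OF c]
  have pr: "pr (xs @ ys) (?\<theta> x) = star (pr (xs @ ys) x)" if "x \<in> A \<or> x \<in> B" for x
  proof (cases "x \<in> A")
    case True
    then show ?thesis using th(1)[OF True] cD(5) by simp
  next
    case False
    then have "?\<theta> x \<in> A" "\<phi> (?\<theta> x) = x" using that th(2) by auto
    then have "pr (xs @ ys) x = star (pr (xs @ ys) (?\<theta> x))" using cD(5)[of "?\<theta> x"] by simp
    then show ?thesis by simp
  qed
  show ?thesis
    unfolding crossing_def matchings_def mem_Collect_eq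
  proof (intro conjI allI impI ballI)
    fix x
    show "?\<theta> (?\<theta> x) = x" by (rule th(4))
    show "?\<theta> x = x" if "x \<notin> points (xs @ ys)"
      using that th(3)[of x] cD(1)[of x] cD(2)[of x] abstract_edges_points(1)[OF wf cyc, of "xs @ ys" x] by blast
    assume "?\<theta> x \<noteq> x"
    then have AB: "x \<in> A \<or> x \<in> B" using th(3) by blast
    then have A: "x \<in> abstract_edges (xs @ ys)" "?\<theta> x \<in> abstract_edges (xs @ ys)" "side (length xs) (?\<theta> x) \<noteq> side (length xs) x"
    proof (atomize (full), cases "x \<in> A")
      case True
      then have "?\<theta> x \<in> B" using th(1) by blast
      then show "x \<in> abstract_edges (xs @ ys) \<and> ?\<theta> x \<in> abstract_edges (xs @ ys) \<and> side (length xs) (?\<theta> x) \<noteq> side (length xs) x"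
        using cD(1)[OF True] cD(2)[of "?\<theta> x"] by simp
    next
      case False
      then have "x \<in> B" using AB by blast
      moreover from this have "?\<theta> x \<in> A" using th(2) by blast
      ultimately show "x \<in> abstract_edges (xs @ ys) \<and> ?\<theta> x \<in> abstract_edges (xs @ ys) \<and> side (length xs) (?\<theta> x) \<noteq> side (length xs) x"
        using cD(2)[of x] cD(1)[of "?\<theta> x"] by simp
    qed
    show "side (length xs) (?\<theta> x) \<noteq> side (length xs) x" by (rule A(3))
    show "\<exists>a. snd (point_label Q (xs @ ys) x) = Some a \<and> snd (point_label Q (xs @ ys) (?\<theta> x)) = Some (star a)"
      using abstract_edges_points(2)[OF wf cyc A(1)] abstract_edges_points(2)[OF wf cyc A(2)] pr[OF AB] by simp
  qed
qed

lemma bij_betw_contractions: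
  "bij_betw (\<lambda>\<theta>. (left_moved \<theta>, right_moved \<theta>, restrict \<theta> (left_moved \<theta>))) crossing (contractions xs ys)"
proof (rule bij_betw_byWitness[where f' = contraction_matching])
  show "\<forall>\<theta>\<in>crossing. contraction_matching (left_moved \<theta>, right_moved \<theta>, restrict \<theta> (left_moved \<theta>)) = \<theta>"
  proof
    fix \<theta> assume \<theta>: "\<theta> \<in> crossing"
    show "contraction_matching (left_moved \<theta>, right_moved \<theta>, restrict \<theta> (left_moved \<theta>)) = \<theta>"
    proof
      fix x
      show "contraction_matching (left_moved \<theta>, right_moved \<theta>, restrict \<theta> (left_moved \<theta>)) x = \<theta> x"
        using to_involution_crossing[OF \<theta>, of x] moved_split(1)[of \<theta>] by (auto simp: contraction_matching_def simp del: Un_iff)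
    qed
  qed
  show "\<forall>t\<in>contractions xs ys. (left_moved (contraction_matching t), right_moved (contraction_matching t),
      restrict (contraction_matching t) (left_moved (contraction_matching t))) = t"
  proof
    fix t assume "t \<in> contractions xs ys"
    moreover obtain A B \<phi> where t: "t = (A, B, \<phi>)" by (cases t)
    ultimately have c: "(A, B, \<phi>) \<in> contractions xs ys" by simp
    have "restrict (contraction_matching (A, B, \<phi>)) A = \<phi>"
    proof
      fix x show "restrict (contraction_matching (A, B, \<phi>)) A x = \<phi> x"
        using contraction_matching_props(1)[OF c, of x] PiE_arb[OF contractionsD(3)[OF c], of x] by (cases "x \<in> A") auto
    qed
    then show "(left_moved (contraction_matching t), right_moved (contraction_matching t),
      restrict (contraction_matching t) (left_moved (contraction_matching t))) = t"
      unfolding t contraction_matching_moved[OF c] by simp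
  qed
  show "contraction_matching ` contractions xs ys \<subseteq> crossing"
  proof (rule image_subsetI)
    fix t assume "t \<in> contractions xs ys"
    then show "contraction_matching t \<in> crossing" by (cases t) (auto intro: contraction_matching_crossing)
  qed
  show "(\<lambda>\<theta>. (left_moved \<theta>, right_moved \<theta>, restrict \<theta> (left_moved \<theta>))) ` crossing \<subseteq> contractions xs ys"
  proof (rule image_subsetI)
    fix \<theta> assume \<theta>: "\<theta> \<in> crossing"
    then have m: "\<theta> \<in> matchings (point_label Q (xs @ ys)) (points (xs @ ys))" by (simp add: crossing_def)
    have A: "x \<in> abstract_edges (xs @ ys)" if "\<theta> x \<noteq> x" for x
      by (rule moved_abstract[OF wf cyc m refl _ that]) simp_all
    have l: "left_moved \<theta> \<subseteq> {(i, j) \<in> abstract_edges (xs @ ys). i < length xs}"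
      using A by (auto simp: left_moved_def side_def split: if_splits)
    have r: "right_moved \<theta> \<subseteq> {(i, j) \<in> abstract_edges (xs @ ys). length xs \<le> i}"
      using A by (auto simp: right_moved_def side_def split: if_splits)
    have b: "bij_betw (restrict \<theta> (left_moved \<theta>)) (left_moved \<theta>) (right_moved \<theta>)"
      using bij_betw_crossing[OF \<theta>] by (simp cong: bij_betw_cong)
    have st: "pr (xs @ ys) (\<theta> x) = star (pr (xs @ ys) x)" if x: "x \<in> left_moved \<theta>" for x
    proof -
      have mx: "\<theta> x \<noteq> x" "\<theta> (\<theta> x) \<noteq> \<theta> x"
        using x crossing_swap(1)[OF \<theta> x] by (auto simp: left_moved_def right_moved_def)
      obtain a where "snd (point_label Q (xs @ ys) x) = Some a" "snd (point_label Q (xs @ ys) (\<theta> x)) = Some (star a)"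
        by (rule matching_moved[OF m mx(1)])
      then show ?thesis
        using abstract_edges_points(2)[OF wf cyc A[OF mx(1)]] abstract_edges_points(2)[OF wf cyc A[OF mx(2)]] by simp
    qed
    show "(left_moved \<theta>, right_moved \<theta>, restrict \<theta> (left_moved \<theta>)) \<in> contractions xs ys"
      unfolding contractions_def using l r b st crossing_swap(1)[OF \<theta>] by auto
  qed
qed

text \<open>A crossing pair has one left and one forward member, not always the same point; both
  numbers are half the number of moved points.\<close>

lemma card_left_moved:
  assumes \<theta>: "\<theta> \<in> crossing"
  shows "card (left_moved \<theta>) = card (fwd_points (point_label Q (xs @ ys)) (points (xs @ ys)) \<theta>)"
proof -
  have m: "\<theta> \<in> matchings (point_label Q (xs @ ys)) (points (xs @ ys))" using \<theta> by (simp add: crossing_def)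
  have fin: "finite (points (xs @ ys))" by (simp add: points_def)
  have "{x. \<theta> x \<noteq> x} \<subseteq> points (xs @ ys)" using matchingsD(1)[OF m] by blast
  then have f: "finite (left_moved \<theta> \<union> right_moved \<theta>)" unfolding moved_split using fin by (rule finite_subset)
  have "card (left_moved \<theta> \<union> right_moved \<theta>) = card (left_moved \<theta>) + card (right_moved \<theta>)"
    using f moved_split(2) by (intro card_Un_disjoint) auto
  also have "card (right_moved \<theta>) = card (left_moved \<theta>)" using bij_betw_same_card[OF bij_betw_crossing[OF \<theta>]] ..
  finally show ?thesis unfolding moved_split card_moved[OF fin m] by simp
qed

lemma sum_contractions_eq_prod_sum:
  "(\<Sum>(A, B, \<phi>) \<in> contractions xs ys.
        scl (half_h (card A) * (- 1) ^ card {y \<in> B. pr (xs @ ys) y \<in> Fwd ` arcs Q})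
          (basis_vec (glued_collection Q (xs @ ys) (A \<union> B) (to_involution A \<phi>)
                        (members (xs @ ys) (A \<union> B) (to_involution A \<phi>)))))
   = (prod_sum (succ_point (xs @ ys)) (point_label Q (xs @ ys)) (side (length xs)) (points (xs @ ys)) :: _ \<Rightarrow>\<^sub>0 'k::field_char_0 poly)"
proof -
  let ?zs = "xs @ ys" let ?l = "point_label Q ?zs" let ?X = "points ?zs" let ?M = "matchings ?l ?X" let ?f = "succ_point ?zs"
  define T where "T A B \<phi> = scl (half_h (card A) * (- 1) ^ card {y \<in> B. pr ?zs y \<in> Fwd ` arcs Q} :: 'k poly)
          (basis_vec (glued_collection Q ?zs (A \<union> B) (to_involution A \<phi>)
                        (members ?zs (A \<union> B) (to_involution A \<phi>))))" for A B \<phi>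
  have fin: "finite ?X" by (simp add: points_def)
  have "(\<Sum>(A, B, \<phi>) \<in> contractions xs ys. T A B \<phi>)
      = (\<Sum>\<theta>\<in>crossing. T (left_moved \<theta>) (right_moved \<theta>) (restrict \<theta> (left_moved \<theta>)))"
    by (subst sum.reindex_bij_betw[OF bij_betw_contractions, symmetric]) simp_all
  also have "\<dots> = (\<Sum>\<theta>\<in>crossing. scl (wt (sg (side (length xs))) ?l ?X \<theta>) (basis_vec (coll (?f \<circ> \<theta>) (cut_label \<theta> ?l) ?X)))"
  proof (rule sum.cong[OF refl])
    fix \<theta> assume \<theta>: "\<theta> \<in> crossing"
    then have m: "\<theta> \<in> ?M" by (simp add: crossing_def)
    define J where "J = {x. \<theta> x \<noteq> x}"
    define \<phi> where "\<phi> = to_involution (left_moved \<theta>) (restrict \<theta> (left_moved \<theta>))"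
    have J: "left_moved \<theta> \<union> right_moved \<theta> = J" unfolding moved_split J_def ..
    have \<phi>: "\<And>x. x \<in> J \<Longrightarrow> \<phi> x = \<theta> x" unfolding \<phi>_def J[symmetric] by (rule to_involution_crossing[OF \<theta>])
    have mem: "members ?zs J \<phi> = member_at ?zs \<theta> ` ?X" by (rule members_eq[OF wf cyc m J_def \<phi>])
    have gl: "glued_collection Q ?zs J \<phi> (members ?zs J \<phi>) = coll (?f \<circ> \<theta>) (cut_label \<theta> ?l) ?X"
      unfolding mem by (rule glued_collection_eq[OF wf cyc m J_def \<phi>]) auto
    let ?F = "fwd_points ?l ?X \<theta>"
    have R: "{y \<in> right_moved \<theta>. pr ?zs y \<in> Fwd ` arcs Q} = ?F \<inter> right_moved \<theta>"
    proof (rule set_eqI)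
      fix y
      show "y \<in> {y \<in> right_moved \<theta>. pr ?zs y \<in> Fwd ` arcs Q} \<longleftrightarrow> y \<in> ?F \<inter> right_moved \<theta>"
      proof (cases "y \<in> right_moved \<theta>")
        case True
        then have "\<theta> y \<noteq> y" by (simp add: right_moved_def)
        then have "y \<in> ?X" "y \<in> J" using matchingsD(3)[OF m] by (auto simp: J_def)
        then show ?thesis using True fwd_points_points[OF wf cyc m J_def \<phi>, of y] by simp
      qed simp
    qed
    have finF: "finite ?F" using fin by (simp add: fwd_points_def)
    \<comment> \<open>A pair contributes -1 exactly if its forward member lies in the second factor,
      which is the sign in the definition of the product.\<close>
    have "(\<Prod>x\<in>?F. sg (side (length xs)) x (\<theta> x)) = (\<Prod>x\<in>?F. if x \<in> right_moved \<theta> then - 1 else 1 :: 'k poly)"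
    proof (rule prod.cong[OF refl])
      fix x assume "x \<in> ?F"
      then have "\<theta> x \<noteq> x" by (simp add: fwd_points_def)
      then have "side (length xs) (\<theta> x) \<noteq> side (length xs) x" using \<theta> unfolding crossing_def by blast
      then show "sg (side (length xs)) x (\<theta> x) = (if x \<in> right_moved \<theta> then - 1 else 1 :: 'k poly)"
        using \<open>\<theta> x \<noteq> x\<close> by (auto simp: sg_def side_def right_moved_def split: if_splits)
    qed
    also have "\<dots> = (- 1) ^ card (?F \<inter> right_moved \<theta>)"
      using finF by (simp add: prod.If_cases)
    finally have w: "wt (sg (side (length xs))) ?l ?X \<theta> = half_h (card (left_moved \<theta>)) * (- 1 :: 'k poly) ^ card (?F \<inter> right_moved \<theta>)"
      unfolding wt_sg card_left_moved[OF \<theta>] by simp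
    show "T (left_moved \<theta>) (right_moved \<theta>) (restrict \<theta> (left_moved \<theta>))
        = scl (wt (sg (side (length xs))) ?l ?X \<theta>) (basis_vec (coll (?f \<circ> \<theta>) (cut_label \<theta> ?l) ?X))"
      unfolding T_def J \<phi>_def[symmetric] gl R w ..
  qed
  also have "\<dots> = prod_sum ?f ?l (side (length xs)) ?X"
    unfolding prod_sum_def
  \<comment> \<open>A matching that is not crossing has a pair within one factor and therefore
    weight 0.\<close>
  proof (rule sum.mono_neutral_left)
    show "\<forall>\<theta>\<in>?M - crossing. scl (wt (sg (side (length xs))) ?l ?X \<theta> :: 'k poly) (basis_vec (coll (?f \<circ> \<theta>) (cut_label \<theta> ?l) ?X)) = 0"
    proof
      fix \<theta> assume \<theta>: "\<theta> \<in> ?M - crossing"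
      then obtain x where "\<theta> x \<noteq> x" "side (length xs) (\<theta> x) = side (length xs) x" by (auto simp: crossing_def)
      then have "(wt (sg (side (length xs))) ?l ?X \<theta> :: 'k poly) = 0"
        using \<theta> by (intro wt_eq_0[OF fin]) (auto simp: sg_def)
      then show "scl (wt (sg (side (length xs))) ?l ?X \<theta> :: 'k poly) (basis_vec (coll (?f \<circ> \<theta>) (cut_label \<theta> ?l) ?X)) = 0" by simp
    qed
  qed (auto simp: crossing_def finite_matchings[OF fin])
  finally show ?thesis unfolding T_def .
qed

end

lemma star_h_basis_points:
  assumes wf: "wf_digraph Q" and P: "P \<in> collections Q" and R: "R \<in> collections Q"
  defines "zs \<equiv> presentation P @ presentation R"
  shows "(star_h_basis Q P R :: _ \<Rightarrow>\<^sub>0 'k::field_char_0 poly)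
    = prod_sum (succ_point zs) (point_label Q zs) (side (length (presentation P))) (points zs)"
proof -
  have "c \<in> set (presentation P @ presentation R) \<Longrightarrow> cyclic_path Q c" for c
    using presentation_props(2)[OF P wf] presentation_props(2)[OF R wf] by auto
  from sum_contractions_eq_prod_sum[OF wf this] show ?thesis
    by (simp add: star_h_basis_def Let_def zs_def)
qed

section \<open>Independence of the chosen configuration\<close>

lemma iso_of_coloured_coll_eq:
  assumes w: "wfc Q f lab X" "wfc Q g lab' Y" and r: "reduced f lab X" "reduced g lab' Y"
    and e: "\<And>x. x \<in> X \<Longrightarrow> e x \<in> {1, 2::nat} \<and> e (f x) = e x" and e': "\<And>y. y \<in> Y \<Longrightarrow> e' y \<in> {1, 2} \<and> e' (g y) = e' y"
    and eq: "\<And>k. k \<in> {1, 2} \<Longrightarrow> coll f lab {x \<in> X. e x = k} = coll g lab' {y \<in> Y. e' y = k}"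
  shows "\<exists>b. bij_betw b X Y \<and> (\<forall>x\<in>X. b (f x) = g (b x) \<and> lab' (b x) = lab x \<and> e' (b x) = e x)"
proof -
  let ?X = "\<lambda>k. {x \<in> X. e x = k}" and ?Y = "\<lambda>k. {y \<in> Y. e' y = k}"
  have fX: "f x \<in> X" if "x \<in> X" for x using perm_on_in[OF wfc_perm_on[OF w(1)] that] .
  have gY: "g y \<in> Y" if "y \<in> Y" for y using perm_on_in[OF wfc_perm_on[OF w(2)] that] .
  have wX: "wfc Q f lab (?X k)" for k by (rule wfc_subset[OF w(1)]) (use e fX in auto)
  have wY: "wfc Q g lab' (?Y k)" for k by (rule wfc_subset[OF w(2)]) (use e' gY in auto)
  have "\<exists>b. bij_betw b (?X k) (?Y k) \<and> (\<forall>x\<in>?X k. b (f x) = g (b x) \<and> lab' (b x) = lab x)" if "k \<in> {1, 2}" for k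
    by (rule iso_of_coll_eq[OF wfc_perm_on[OF wX] wfc_perm_on[OF wY] _ _ wfc_tail_labelled[OF wX] wfc_tail_labelled[OF wY] eq[OF that]])
      (use r in \<open>auto simp: reduced_def\<close>)
  note ex = this
  obtain b1 where b1: "bij_betw b1 (?X 1) (?Y 1)" "\<forall>x\<in>?X 1. b1 (f x) = g (b1 x) \<and> lab' (b1 x) = lab x"
    using ex[of 1] by blast
  obtain b2 where b2: "bij_betw b2 (?X 2) (?Y 2)" "\<forall>x\<in>?X 2. b2 (f x) = g (b2 x) \<and> lab' (b2 x) = lab x"
    using ex[of 2] by blast
  note b = b1(1) bspec[OF b1(2)] b2(1) bspec[OF b2(2)]
  define b where "b x = (if e x = 1 then b1 x else b2 x)" for x
  have "bij_betw b (?X 1) (?Y 1)" using b(1) by (subst bij_betw_cong[of _ _ b1]) (auto simp: b_def)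
  moreover have "bij_betw b (?X 2) (?Y 2)" using b(3) by (subst bij_betw_cong[of _ _ b2]) (auto simp: b_def)
  moreover have "?Y 1 \<inter> ?Y 2 = {}" by auto
  ultimately have "bij_betw b (?X 1 \<union> ?X 2) (?Y 1 \<union> ?Y 2)" by (rule bij_betw_combine)
  moreover have "?X 1 \<union> ?X 2 = X" "?Y 1 \<union> ?Y 2 = Y" using e e' by blast+
  ultimately have bb: "bij_betw b X Y" by simp
  have "b (f x) = g (b x) \<and> lab' (b x) = lab x \<and> e' (b x) = e x" if x: "x \<in> X" for x
  proof (cases "e x = 1")
    case True
    then have "b1 x \<in> ?Y 1" using bij_betwE[OF b(1)] x by blast
    then show ?thesis using True b(2)[of x] x e[OF x] by (simp add: b_def)
  next
    case False
    then have e2: "e x = 2" using e[OF x] by simp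
    then have "b2 x \<in> ?Y 2" using bij_betwE[OF b(3)] x by blast
    then show ?thesis using e2 b(4)[of x] x e[OF x] by (simp add: b_def)
  qed
  then show ?thesis using bb by blast
qed

text \<open>The product can be computed on any configuration of its two factors, not only on the
  chosen presentations. This is what allows a product to be multiplied again: its terms are
  collections of glued configurations.\<close>

theorem star_h_basis_coll:
  assumes wf: "wf_digraph Q" and w: "wfc Q f lab X"
    and e: "\<And>x. x \<in> X \<Longrightarrow> e x \<in> {1, 2::nat} \<and> e (f x) = e x"
  shows "(star_h_basis Q (coll f lab {x \<in> X. e x = 1}) (coll f lab {x \<in> X. e x = 2}) :: _ \<Rightarrow>\<^sub>0 'k::field_char_0 poly)
    = prod_sum f lab e X"
  using w e
proof (induction f X rule: wfc_induct)
  case (bypass f X x)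
  have e': "e y \<in> {1, 2} \<and> e (bypass x f y) = e y" if "y \<in> X - {x}" for y
    using that bypass.prems[of y] bypass.prems[of x] \<open>x \<in> X\<close> by (auto simp: bypass_def)
  have "coll (bypass x f) lab {y \<in> X - {x}. e y = k} = coll f lab {y \<in> X. e y = k}" for k
  proof -
    have fX: "f y \<in> X" if "y \<in> X" for y using perm_on_in[OF wfc_perm_on[OF bypass.hyps(1)] that] .
    have "coll (bypass x f \<circ> (\<lambda>x. x)) (cut_label (\<lambda>x. x) lab) ({y \<in> X. e y = k} - {x}) = coll (f \<circ> (\<lambda>x. x)) (cut_label (\<lambda>x. x) lab) {y \<in> X. e y = k}"
      by (rule coll_glue_bypass[OF bypass.hyps(1-4) id_matching]) (use bypass.prems fX in auto)
    moreover have "{y \<in> X - {x}. e y = k} = {y \<in> X. e y = k} - {x}" by auto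
    ultimately show ?thesis by (simp add: cut_label_id o_def)
  qed
  then show ?case
    using bypass.IH[OF e'] prod_sum_bypass[OF bypass.hyps(1-4)] by simp
next
  \<comment> \<open>A reduced configuration is isomorphic, factors included, to that of the
    concatenated presentations.\<close>
  case (reduced f X)
  let ?P = "\<lambda>k. coll f lab {x \<in> X. e x = k}"
  have fX: "f y \<in> X" if "y \<in> X" for y using perm_on_in[OF wfc_perm_on[OF reduced.hyps(1)] that] .
  have P: "?P k \<in> collections Q" for k
    by (rule coll_in_collections, rule wfc_subset[OF reduced.hyps(1)]) (use reduced.prems fX in auto)
  define xs where "xs = presentation (?P 1)"
  define ys where "ys = presentation (?P 2)"
  let ?n = "length xs" and ?Z = "points (xs @ ys)" and ?l = "point_label Q (xs @ ys)" and ?g = "succ_point (xs @ ys)"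
  have px: "mset (map abs_necklace xs) = ?P 1" "\<And>c. c \<in> set xs \<Longrightarrow> cyclic_path Q c"
    unfolding xs_def by (rule presentation_props[OF P wf])+
  have py: "mset (map abs_necklace ys) = ?P 2" "\<And>c. c \<in> set ys \<Longrightarrow> cyclic_path Q c"
    unfolding ys_def by (rule presentation_props[OF P wf])+
  have cyc: "\<And>c. c \<in> set (xs @ ys) \<Longrightarrow> cyclic_path Q c" using px(2) py(2) by auto
  have side: "side ?n x \<in> {1, 2} \<and> side ?n (?g x) = side ?n x" for x
    by (cases x) (simp add: side_def succ_point_def)
  have "coll ?g ?l {x \<in> ?Z. side ?n x = 1} = ?P 1"
  proof -
    have "{x \<in> ?Z. side ?n x = 1} = {x \<in> ?Z. fst x \<in> {..<?n}}" by (auto simp: side_def)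
    then have "coll ?g ?l {x \<in> ?Z. side ?n x = 1} = image_mset (\<lambda>i. abs_necklace ((xs @ ys) ! i)) (mset_set {..<?n})"
      using coll_points[OF cyc wf, of "xs @ ys" "{..<?n}"] by simp
    also have "\<dots> = image_mset (\<lambda>i. abs_necklace (xs ! i)) (mset_set {..<?n})"
      by (rule image_mset_cong) (simp add: nth_append)
    also have "\<dots> = mset (map (\<lambda>i. abs_necklace (xs ! i)) [0..<?n])"
      by (simp add: atLeast0LessThan mset_map)
    also have "map (\<lambda>i. abs_necklace (xs ! i)) [0..<?n] = map abs_necklace xs"
      by (rule nth_equalityI) auto
    finally show ?thesis using px(1) by simp
  qed
  moreover have "coll ?g ?l {x \<in> ?Z. side ?n x = 2} = ?P 2"
  proof -
    let ?I = "{?n..<?n + length ys}"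
    have "{x \<in> ?Z. side ?n x = 2} = {x \<in> ?Z. fst x \<in> ?I}" by (auto simp: side_def points_def)
    moreover have "?I \<subseteq> {..<length (xs @ ys)}" by auto
    ultimately have "coll ?g ?l {x \<in> ?Z. side ?n x = 2} = image_mset (\<lambda>i. abs_necklace ((xs @ ys) ! i)) (mset_set ?I)"
      using coll_points[OF cyc wf, of "xs @ ys" ?I] by simp
    also have "\<dots> = mset (map (\<lambda>i. abs_necklace ((xs @ ys) ! i)) [?n..<?n + length ys])"
      by (simp add: mset_map)
    also have "map (\<lambda>i. abs_necklace ((xs @ ys) ! i)) [?n..<?n + length ys] = map abs_necklace ys"
      by (rule nth_equalityI) auto
    finally show ?thesis using py(1) by simp
  qed
  ultimately have eq: "coll f lab {x \<in> X. e x = k} = coll ?g ?l {x \<in> ?Z. side ?n x = k}" if "k \<in> {1, 2}" for k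
    using that by auto
  have wZ: "wfc Q ?g ?l ?Z" by (rule wfc_points[OF _ wf]) (rule cyc)
  have "\<exists>b. bij_betw b X ?Z \<and> (\<forall>x\<in>X. b (f x) = ?g (b x) \<and> ?l (b x) = lab x \<and> side ?n (b x) = e x)"
    by (rule iso_of_coloured_coll_eq[OF reduced.hyps(1) wZ reduced.hyps(2) reduced_points]) (erule reduced.prems, rule side, erule eq)
  then obtain b where b: "bij_betw b X ?Z" "\<And>x. x \<in> X \<Longrightarrow> b (f x) = ?g (b x) \<and> ?l (b x) = lab x \<and> side ?n (b x) = e x"
    by blast
  have "(prod_sum ?g ?l (side ?n) ?Z :: _ \<Rightarrow>\<^sub>0 'k poly) = prod_sum f lab e X"
    by (rule prod_sum_iso[OF reduced.hyps(1) b(1)]) (use b(2) in auto)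
  moreover have "(star_h_basis Q (?P 1) (?P 2) :: _ \<Rightarrow>\<^sub>0 'k poly) = prod_sum ?g ?l (side ?n) ?Z"
    unfolding xs_def ys_def by (rule star_h_basis_points[OF wf P P])
  ultimately show ?case by (rule trans[rotated])
qed

text \<open>It applies in particular to a colour class of a glued configuration, hence to iterated
  coproducts.\<close>

theorem Delta_h_basis_coll:
  assumes wf: "wf_digraph Q" and w: "wfc Q f lab X"
  shows "(Delta_h_basis Q (coll f lab X) :: _ \<Rightarrow>\<^sub>0 'k::field_char_0 poly) = cop_sum f lab X"
  using w
proof (induction f X rule: wfc_induct)
  case (bypass f X x)
  then show ?case
    using coll_bypass(2)[OF wfc_perm_on wfc_coherent, OF bypass.hyps(1,1-4)] cop_sum_bypass[OF bypass.hyps(1-4)] by simp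
next
  case (reduced f X)
  let ?P = "coll f lab X"
  have P: "?P \<in> collections Q" by (rule coll_in_collections[OF reduced.hyps(1)])
  define xs where "xs = presentation ?P"
  have px: "mset (map abs_necklace xs) = ?P" "\<And>c. c \<in> set xs \<Longrightarrow> cyclic_path Q c"
    unfolding xs_def by (rule presentation_props[OF P wf])+
  let ?Z = "points xs" and ?l = "point_label Q xs" and ?g = "succ_point xs"
  have wZ: "wfc Q ?g ?l ?Z" by (rule wfc_points[OF _ wf]) (rule px(2))
  have "coll ?g ?l ?Z = ?P"
  proof -
    have "{x \<in> ?Z. fst x \<in> {..<length xs}} = ?Z" by (auto simp: points_def)
    then have "coll ?g ?l ?Z = image_mset (\<lambda>i. abs_necklace (xs ! i)) (mset_set {..<length xs})"
      using coll_points[OF px(2) wf, of xs "{..<length xs}"] by simp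
    also have "\<dots> = mset (map (\<lambda>i. abs_necklace (xs ! i)) [0..<length xs])"
      by (simp add: atLeast0LessThan mset_map)
    also have "map (\<lambda>i. abs_necklace (xs ! i)) [0..<length xs] = map abs_necklace xs"
      by (rule nth_equalityI) auto
    finally show ?thesis using px(1) by simp
  qed
  then obtain b where b: "bij_betw b X ?Z" "\<And>x. x \<in> X \<Longrightarrow> b (f x) = ?g (b x) \<and> ?l (b x) = lab x"
    using iso_of_coll_eq[OF wfc_perm_on[OF reduced.hyps(1)] wfc_perm_on[OF wZ] reduced.hyps(2) reduced_points
        wfc_tail_labelled[OF reduced.hyps(1)] wfc_tail_labelled[OF wZ]] by auto
  have "(cop_sum ?g ?l ?Z :: _ \<Rightarrow>\<^sub>0 'k poly) = cop_sum f lab X"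
    by (rule cop_sum_iso[OF reduced.hyps(1) b(1)]) (use b(2) in auto)
  moreover have "(Delta_h_basis Q ?P :: _ \<Rightarrow>\<^sub>0 'k poly) = cop_sum ?g ?l ?Z"
    unfolding xs_def by (rule Delta_h_basis_points[OF wf P])
  ultimately show ?case by (rule trans[rotated])
qed

section \<open>The algebra structure\<close>

lemma image_mset_nth_append:
  "image_mset (\<lambda>i. g ((us @ vs @ ws) ! i)) (mset_set {length us..<length us + length vs}) = mset (map g vs)"
proof -
  have "image_mset (\<lambda>i. g ((us @ vs @ ws) ! i)) (mset_set {length us..<length us + length vs})
      = mset (map (\<lambda>i. g ((us @ vs @ ws) ! i)) [length us..<length us + length vs])"
    by (simp add: mset_map)
  also have "map (\<lambda>i. g ((us @ vs @ ws) ! i)) [length us..<length us + length vs] = map g vs"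
    by (rule nth_equalityI) (auto simp: nth_append)
  finally show ?thesis .
qed

text \<open>The rows of one concatenated presentation, coloured by the factor they come from.
  Configurations with fewer factors are obtained from it by empty collections.\<close>

lemma configuration_of_three:
  fixes Q :: "('v, 'e) pre_digraph"
  assumes wf: "wf_digraph Q" and P: "P1 \<in> collections Q" "P2 \<in> collections Q" "P3 \<in> collections Q"
  obtains f :: "nat \<times> nat \<Rightarrow> nat \<times> nat" and lab X e where "wfc Q f lab X"
    "\<forall>x\<in>X. e x \<in> {1, 2, 3::nat} \<and> e (f x) = e x"
    "coll f lab {x \<in> X. e x = 1} = P1" "coll f lab {x \<in> X. e x = 2} = P2" "coll f lab {x \<in> X. e x = 3} = P3"
proof -
  define xs ys zs where "xs = presentation P1" and "ys = presentation P2" and "zs = presentation P3"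
  note pres = presentation_props[OF P(1) wf, folded xs_def] presentation_props[OF P(2) wf, folded ys_def]
    presentation_props[OF P(3) wf, folded zs_def]
  let ?ws = "xs @ ys @ zs" let ?a = "length xs" let ?b = "?a + length ys" let ?c = "?b + length zs"
  let ?f = "succ_point ?ws" and ?l = "point_label Q ?ws" and ?X = "points ?ws"
  let ?e = "\<lambda>x :: nat \<times> nat. if fst x < ?a then 1 else if fst x < ?b then 2 else 3 :: nat"
  have cyc: "c \<in> set ?ws \<Longrightarrow> cyclic_path Q c" for c using pres(2,4,6) by auto
  have w: "wfc Q ?f ?l ?X" by (rule wfc_points[OF cyc wf])
  have e: "?e x \<in> {1, 2, 3::nat} \<and> ?e (?f x) = ?e x" for x by (cases x) (simp add: succ_point_def)
  have rows: "coll ?f ?l {x \<in> ?X. fst x \<in> I} = image_mset (\<lambda>i. abs_necklace (?ws ! i)) (mset_set I)"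
    if "I \<subseteq> {..<?c}" for I
    by (rule coll_points[OF cyc wf]) (use that in \<open>auto simp: add.assoc\<close>)
  have "{x \<in> ?X. ?e x = 1} = {x \<in> ?X. fst x \<in> {length []..<length [] + ?a}}" by auto
  then have 1: "coll ?f ?l {x \<in> ?X. ?e x = 1} = P1"
    using rows[of "{length []..<length [] + ?a}"] image_mset_nth_append[of abs_necklace "[]" xs "ys @ zs"] pres(1)
    by (simp add: subset_iff)
  have "{x \<in> ?X. ?e x = 2} = {x \<in> ?X. fst x \<in> {?a..<?b}}" by auto
  then have 2: "coll ?f ?l {x \<in> ?X. ?e x = 2} = P2"
    using rows[of "{?a..<?b}"] image_mset_nth_append[of abs_necklace xs ys zs] pres(3)
    by (simp add: subset_iff)
  have "{x \<in> ?X. ?e x = 3} = {x \<in> ?X. fst x \<in> {?b..<?c}}" by (auto simp: points_def)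
  then have 3: "coll ?f ?l {x \<in> ?X. ?e x = 3} = P3"
    using rows[of "{?b..<?c}"] image_mset_nth_append[of abs_necklace "xs @ ys" zs "[]"] pres(5)
    by (simp add: subset_iff)
  show ?thesis by (rule that[OF w _ 1 2 3]) (use e in blast)
qed

lemma empty_in_collections: "{#} \<in> collections Q"
  by (simp add: collections_def)

lemma configuration_of_two:
  fixes Q :: "('v, 'e) pre_digraph"
  assumes wf: "wf_digraph Q" and P: "P1 \<in> collections Q" "P2 \<in> collections Q"
  obtains f :: "nat \<times> nat \<Rightarrow> nat \<times> nat" and lab X e where "wfc Q f lab X"
    "\<forall>x\<in>X. e x \<in> {1, 2::nat} \<and> e (f x) = e x"
    "coll f lab {x \<in> X. e x = 1} = P1" "coll f lab {x \<in> X. e x = 2} = P2"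
proof -
  obtain f :: "nat \<times> nat \<Rightarrow> nat \<times> nat" and lab X e where w: "wfc Q f lab X"
    and e0: "\<forall>x\<in>X. e x \<in> {1, 2, 3::nat} \<and> e (f x) = e x"
    and c: "coll f lab {x \<in> X. e x = 1} = P1" "coll f lab {x \<in> X. e x = 2} = P2" "coll f lab {x \<in> X. e x = 3} = {#}"
    by (rule configuration_of_three[OF wf P empty_in_collections]) (rule that; assumption)
  note e = bspec[OF e0]
  have "finite {x \<in> X. e x = 3}" using wfc_finite[OF w] by simp
  then have "{x \<in> X. e x = 3} = {}" using c(3) coll_eq_empty_iff by blast
  then have "e x \<noteq> 3" if "x \<in> X" for x using that by blast
  then have "\<forall>x\<in>X. e x \<in> {1, 2} \<and> e (f x) = e x" using e by blast
  then show ?thesis by (rule that[OF w _ c(1,2)])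
qed

lemma configuration_of_one:
  fixes Q :: "('v, 'e) pre_digraph"
  assumes wf: "wf_digraph Q" and P: "P \<in> collections Q"
  obtains f :: "nat \<times> nat \<Rightarrow> nat \<times> nat" and lab X where "wfc Q f lab X" "coll f lab X = P"
proof -
  obtain f :: "nat \<times> nat \<Rightarrow> nat \<times> nat" and lab X e where w: "wfc Q f lab X"
    and e0: "\<forall>x\<in>X. e x \<in> {1, 2::nat} \<and> e (f x) = e x"
    and c: "coll f lab {x \<in> X. e x = 1} = P" "coll f lab {x \<in> X. e x = 2} = {#}"
    by (rule configuration_of_two[OF wf P empty_in_collections]) (rule that; assumption)
  note e = bspec[OF e0]
  have "finite {x \<in> X. e x = 2}" using wfc_finite[OF w] by simp
  then have "{x \<in> X. e x = 2} = {}" using c(2) coll_eq_empty_iff by blast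
  then have "{x \<in> X. e x = 1} = X" using e by blast
  then show ?thesis using that[OF w] c(1) by simp
qed

lemma prod_sum_in_free_mod:
  assumes "wfc Q f lab X"
  shows "prod_sum f lab e X \<in> free_mod (collections Q)"
  unfolding prod_sum_def
  by (intro sum_in_free_mod scl_in_free_mod basis_in_free_mod coll_in_collections wfc_glue[OF assms])

lemma wt_id: "wt s lab X (\<lambda>x. x) = 1"
  by (simp add: wt_def fwd_points_def)

lemma wt_constant:
  assumes fin: "finite X" and \<theta>: "\<theta> \<in> matchings lab X" and e: "\<And>x y. x \<in> X \<Longrightarrow> y \<in> X \<Longrightarrow> e x = e y"
  shows "wt (sg e) lab X \<theta> = (if \<theta> = (\<lambda>x. x) then 1 else 0)"
proof (cases "\<theta> = (\<lambda>x. x)")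
  case False
  then obtain x where x: "\<theta> x \<noteq> x" by (auto simp: fun_eq_iff)
  then have "e (\<theta> x) = e x" using matchingsD(3)[OF \<theta> x] e by blast
  then have "wt (sg e) lab X \<theta> = 0" by (intro wt_eq_0[OF fin \<theta> x]) (simp_all add: sg_def)
  then show ?thesis using False by simp
qed (simp add: wt_id)

text \<open>With a single factor every pair has sign 0 and only the empty contraction is left. This
  gives the unit laws and, later, the counit laws.\<close>

lemma prod_sum_constant:
  assumes fin: "finite X" and e: "\<And>x y. x \<in> X \<Longrightarrow> y \<in> X \<Longrightarrow> e x = e y"
  shows "prod_sum f lab e X = basis_vec (coll f lab X)"
proof -
  have "prod_sum f lab e X = (\<Sum>\<theta>\<in>matchings lab X. if \<theta> = (\<lambda>x. x) then basis_vec (coll f lab X) else 0)"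
    unfolding prod_sum_def
    by (intro sum.cong) (auto simp: wt_constant[OF fin _ e] cut_label_id o_def)
  then show ?thesis by (simp add: finite_matchings[OF fin] id_matching)
qed

text \<open>Extending the first sign rule by 0 outside \<open>Y\<close> makes both contractions take
  place on \<open>X\<close>, so that the weights of the two steps can be added.\<close>

lemma sum_scl_matchings_refine:
  assumes fin: "finite X" and Y: "Y \<subseteq> X"
    and s: "\<And>x y. x \<in> X \<Longrightarrow> y \<in> X \<Longrightarrow> (if x \<in> Y \<and> y \<in> Y then a x y else 0) + b x y = c x y"
  shows "(\<Sum>\<theta>\<in>matchings lab Y. \<Sum>\<theta>'\<in>matchings (cut_label \<theta> lab) X.
      scl (wt a lab Y \<theta> * wt b (cut_label \<theta> lab) X \<theta>') (H (\<theta> \<circ> \<theta>')))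
    = (\<Sum>\<tau>\<in>matchings lab X. scl (wt c lab X \<tau>) (H \<tau>))"
proof -
  let ?a = "\<lambda>x y. if x \<in> Y \<and> y \<in> Y then a x y else 0"
  have wY: "wt ?a lab Y \<theta> = wt a lab Y \<theta>" if "\<theta> \<in> matchings lab Y" for \<theta>
    by (rule wt_cong) (use matchingsD(4)[OF that] in auto)
  have "(\<Sum>\<theta>\<in>matchings lab Y. \<Sum>\<theta>'\<in>matchings (cut_label \<theta> lab) X.
      scl (wt a lab Y \<theta> * wt b (cut_label \<theta> lab) X \<theta>') (H (\<theta> \<circ> \<theta>')))
    = (\<Sum>\<theta>\<in>matchings lab Y. scl (wt ?a lab Y \<theta>) (\<Sum>\<theta>'\<in>matchings (cut_label \<theta> lab) X.
      scl (wt b (cut_label \<theta> lab) X \<theta>') (H (\<theta> \<circ> \<theta>'))))"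
    by (intro sum.cong) (simp_all add: wY scl_sum)
  also have "\<dots> = (\<Sum>\<theta>\<in>matchings lab X. scl (wt ?a lab X \<theta>) (\<Sum>\<theta>'\<in>matchings (cut_label \<theta> lab) X.
      scl (wt b (cut_label \<theta> lab) X \<theta>') (H (\<theta> \<circ> \<theta>'))))"
    by (rule sum_matchings_restrict[symmetric, OF fin Y]) auto
  also have "\<dots> = (\<Sum>\<theta>\<in>matchings lab X. \<Sum>\<theta>'\<in>matchings (cut_label \<theta> lab) X.
      scl (wt ?a lab X \<theta> * wt b (cut_label \<theta> lab) X \<theta>') (H (\<theta> \<circ> \<theta>')))"
    by (simp add: scl_sum)
  also have "\<dots> = (\<Sum>\<tau>\<in>matchings lab X. scl (wt (\<lambda>x y. ?a x y + b x y) lab X \<tau>) (H \<tau>))"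
    by (rule sum_nested_matchings_wt[OF fin])
  also have "\<dots> = (\<Sum>\<tau>\<in>matchings lab X. scl (wt c lab X \<tau>) (H \<tau>))"
  proof (rule sum.cong[OF refl])
    fix \<tau> assume \<tau>: "\<tau> \<in> matchings lab X"
    have "wt (\<lambda>x y. ?a x y + b x y) lab X \<tau> = wt c lab X \<tau>"
      by (rule wt_cong) (use s matchingsD(4)[OF \<tau>] in blast)
    then show "scl (wt (\<lambda>x y. ?a x y + b x y) lab X \<tau>) (H \<tau>) = scl (wt c lab X \<tau>) (H \<tau>)" by simp
  qed
  finally show ?thesis .
qed

text \<open>The inner product lives on the two factors in \<open>Y\<close>; the outer one uses a
  coarser colouring \<open>d\<close> with these two merged. The sign hypothesis is all that
  associativity requires.\<close>

lemma prod_sum_refine: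
  assumes fin: "finite X" and Y: "Y \<subseteq> X"
    and s: "\<And>x y. x \<in> X \<Longrightarrow> y \<in> X \<Longrightarrow> (if x \<in> Y \<and> y \<in> Y then sg e x y else 0) + sg d x y = (sg e x y :: 'k::field_char_0 poly)"
  shows "(\<Sum>\<theta>\<in>matchings lab Y. scl (wt (sg e) lab Y \<theta>) (prod_sum (f \<circ> \<theta>) (cut_label \<theta> lab) d X))
    = (prod_sum f lab e X :: _ \<Rightarrow>\<^sub>0 'k poly)"
proof -
  have "(\<Sum>\<theta>\<in>matchings lab Y. scl (wt (sg e) lab Y \<theta> :: 'k poly) (prod_sum (f \<circ> \<theta>) (cut_label \<theta> lab) d X))
     = (\<Sum>\<theta>\<in>matchings lab Y. \<Sum>\<theta>'\<in>matchings (cut_label \<theta> lab) X.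
      scl (wt (sg e) lab Y \<theta> * wt (sg d) (cut_label \<theta> lab) X \<theta>') (basis_vec (coll (f \<circ> (\<theta> \<circ> \<theta>')) (cut_label (\<theta> \<circ> \<theta>') lab) X)))"
    unfolding prod_sum_def scl_sum
  proof (intro sum.cong refl)
    fix \<theta> \<theta>' assume \<theta>: "\<theta> \<in> matchings lab Y" "\<theta>' \<in> matchings (cut_label \<theta> lab) X"
    then have "\<theta> \<in> matchings lab X" using matchings_subset[OF Y] by blast
    then have "cut_label \<theta>' (cut_label \<theta> lab) = cut_label (\<theta> \<circ> \<theta>') lab" using \<theta> by (intro matchings_cut(5))
    then show "scl (wt (sg e) lab Y \<theta> :: 'k poly) (scl (wt (sg d) (cut_label \<theta> lab) X \<theta>')
          (basis_vec (coll (f \<circ> \<theta> \<circ> \<theta>') (cut_label \<theta>' (cut_label \<theta> lab)) X)))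
       = scl (wt (sg e) lab Y \<theta> * wt (sg d) (cut_label \<theta> lab) X \<theta>') (basis_vec (coll (f \<circ> (\<theta> \<circ> \<theta>')) (cut_label (\<theta> \<circ> \<theta>') lab) X))"
      by (simp add: comp_assoc)
  qed
  also have "\<dots> = prod_sum f lab e X"
    unfolding prod_sum_def by (rule sum_scl_matchings_refine[OF fin Y s])
  finally show ?thesis .
qed

lemma coll_glue_untouched:
  assumes w: "wfc Q f lab Z" and \<theta>: "\<And>x. x \<in> Z \<Longrightarrow> \<theta> x = x"
  shows "coll (f \<circ> \<theta>) (cut_label \<theta> lab) Z = coll f lab Z"
proof (rule coll_cong[symmetric, OF wfc_perm_on[OF w] wfc_coherent[OF w]])
  show "x \<in> Z \<Longrightarrow> f x = (f \<circ> \<theta>) x" "x \<in> Z \<Longrightarrow> lab x = cut_label \<theta> lab x" for x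
    using \<theta> by (simp_all add: cut_label_def)
qed

context
  fixes Q :: "('v, 'e) pre_digraph"
  assumes wf: "wf_digraph Q"
begin

lemma star_h_basis_closed:
  assumes "P \<in> collections Q" "R \<in> collections Q"
  shows "(star_h_basis Q P R :: _ \<Rightarrow>\<^sub>0 'k::field_char_0 poly) \<in> free_mod (collections Q)"
proof -
  obtain f :: "nat \<times> nat \<Rightarrow> nat \<times> nat" and lab X e where w: "wfc Q f lab X"
    and e0: "\<forall>x\<in>X. e x \<in> {1, 2::nat} \<and> e (f x) = e x"
    and c: "coll f lab {x \<in> X. e x = 1} = P" "coll f lab {x \<in> X. e x = 2} = R"
    by (rule configuration_of_two[OF wf assms]) (rule that; assumption)
  note e = bspec[OF e0]
  have "(star_h_basis Q P R :: _ \<Rightarrow>\<^sub>0 'k poly) = prod_sum f lab e X"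
    unfolding c[symmetric] by (rule star_h_basis_coll[OF wf w]) (rule e)
  then show ?thesis using prod_sum_in_free_mod[OF w] by simp
qed

lemma star_h_basis_unit:
  assumes P: "P \<in> collections Q"
  shows "star_h_basis Q {#} P = (basis_vec P :: _ \<Rightarrow>\<^sub>0 'k::field_char_0 poly)"
    "star_h_basis Q P {#} = (basis_vec P :: _ \<Rightarrow>\<^sub>0 'k poly)"
proof -
  obtain f :: "nat \<times> nat \<Rightarrow> nat \<times> nat" and lab X where w: "wfc Q f lab X" and c: "coll f lab X = P"
    by (rule configuration_of_one[OF wf P]) (rule that; assumption)
  have "star_h_basis Q (coll f lab {x \<in> X. k = 1}) (coll f lab {x \<in> X. k = 2}) = (basis_vec (coll f lab X) :: _ \<Rightarrow>\<^sub>0 'k poly)"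
    if "k \<in> {1, 2::nat}" for k
    by (rule trans[OF star_h_basis_coll[OF wf w, of "\<lambda>_. k"] prod_sum_constant[OF wfc_finite[OF w]]])
      (use that in auto)
  from this[of 1] this[of 2] show "star_h_basis Q {#} P = (basis_vec P :: _ \<Rightarrow>\<^sub>0 'k poly)"
    "star_h_basis Q P {#} = (basis_vec P :: _ \<Rightarrow>\<^sub>0 'k poly)"
    by (simp_all add: c)
qed

text \<open>A single configuration carries all three factors, and both bracketings turn out to be
  its state sum for the colours 1, 2, 3.\<close>

lemma star_h_basis_assoc:
  assumes "P1 \<in> collections Q" "P2 \<in> collections Q" "P3 \<in> collections Q"
  shows "lin_ext (\<lambda>D. star_h_basis Q D P3) (star_h_basis Q P1 P2) =
    (lin_ext (star_h_basis Q P1) (star_h_basis Q P2 P3) :: _ \<Rightarrow>\<^sub>0 'k::field_char_0 poly)"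
proof -
  obtain f :: "nat \<times> nat \<Rightarrow> nat \<times> nat" and lab X e where w: "wfc Q f lab X"
    and e0: "\<forall>x\<in>X. e x \<in> {1, 2, 3::nat} \<and> e (f x) = e x"
    and c: "coll f lab {x \<in> X. e x = 1} = P1" "coll f lab {x \<in> X. e x = 2} = P2" "coll f lab {x \<in> X. e x = 3} = P3"
    by (rule configuration_of_three[OF wf assms]) (rule that; assumption)
  note e = bspec[OF e0]
  note fin = wfc_finite[OF w]
  have fX: "x \<in> X \<Longrightarrow> f x \<in> X" for x using perm_on_in[OF wfc_perm_on[OF w]] .
  define Y where "Y = {x \<in> X. e x \<noteq> 3}"
  define Z where "Z = {x \<in> X. e x \<noteq> 1}"
  \<comment> \<open>The two factors of the outer product: for \<open>d\<close> the factors 1 and 2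
    have been merged by the inner product, for \<open>d'\<close> the factors 2 and 3.\<close>
  define d where "d x = (if e x = 3 then 2 else 1 :: nat)" for x
  define d' where "d' x = (if e x = 1 then 1 else 2 :: nat)" for x
  have wY: "wfc Q f lab Y" by (rule wfc_subset[OF w]) (use e fX in \<open>auto simp: Y_def\<close>)
  have wZ: "wfc Q f lab Z" by (rule wfc_subset[OF w]) (use e fX in \<open>auto simp: Z_def\<close>)
  have wk: "wfc Q f lab {x \<in> X. e x = k}" for k by (rule wfc_subset[OF w]) (use e fX in auto)
  have sets: "{x \<in> Y. e x = 1} = {x \<in> X. e x = 1}" "{x \<in> Y. e x = 2} = {x \<in> X. e x = 2}"
    "{x \<in> Z. e x - 1 = 1} = {x \<in> X. e x = 2}" "{x \<in> Z. e x - 1 = 2} = {x \<in> X. e x = 3}"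
    using e by (auto simp: Y_def Z_def)
  have "lin_ext (\<lambda>D. star_h_basis Q D P3) (star_h_basis Q P1 P2 :: _ \<Rightarrow>\<^sub>0 'k poly) = prod_sum f lab e X"
  proof -
    have "(star_h_basis Q P1 P2 :: _ \<Rightarrow>\<^sub>0 'k poly) = prod_sum f lab e Y"
      using star_h_basis_coll[OF wf wY, of e] e unfolding sets c by (auto simp: Y_def)
    moreover have "lin_ext (\<lambda>D. star_h_basis Q D P3) (prod_sum f lab e Y :: _ \<Rightarrow>\<^sub>0 'k poly)
        = (\<Sum>\<theta>\<in>matchings lab Y. scl (wt (sg e) lab Y \<theta>) (prod_sum (f \<circ> \<theta>) (cut_label \<theta> lab) d X))"
      unfolding prod_sum_def[of f lab e Y] lin_ext_sum lin_ext_scl lin_ext_basis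
    proof (rule sum.cong[OF refl])
      fix \<theta> assume \<theta>: "\<theta> \<in> matchings lab Y"
      then have \<theta>X: "\<theta> \<in> matchings lab X" using matchings_subset[of Y X] by (auto simp: Y_def)
      have dth: "d (\<theta> x) = d x" if "x \<in> X" for x
        using matchingsD(3)[OF \<theta>, of x] by (cases "\<theta> x = x") (auto simp: d_def Y_def)
      have "star_h_basis Q (coll (f \<circ> \<theta>) (cut_label \<theta> lab) {x \<in> X. d x = 1}) (coll (f \<circ> \<theta>) (cut_label \<theta> lab) {x \<in> X. d x = 2})
          = (prod_sum (f \<circ> \<theta>) (cut_label \<theta> lab) d X :: _ \<Rightarrow>\<^sub>0 'k poly)"
        by (rule star_h_basis_coll[OF wf wfc_glue[OF w \<theta>X]])
          (use e dth matchingsD(4)[OF \<theta>X] in \<open>auto simp: d_def\<close>)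
      moreover have "{x \<in> X. d x = 1} = Y" "{x \<in> X. d x = 2} = {x \<in> X. e x = 3}" by (auto simp: d_def Y_def)
      moreover have "coll (f \<circ> \<theta>) (cut_label \<theta> lab) {x \<in> X. e x = 3} = P3"
        unfolding c(3)[symmetric] by (rule coll_glue_untouched[OF wk]) (use matchingsD(1)[OF \<theta>] in \<open>auto simp: Y_def\<close>)
      ultimately show "scl (wt (sg e) lab Y \<theta>) (star_h_basis Q (coll (f \<circ> \<theta>) (cut_label \<theta> lab) Y) P3)
          = scl (wt (sg e) lab Y \<theta>) (prod_sum (f \<circ> \<theta>) (cut_label \<theta> lab) d X :: _ \<Rightarrow>\<^sub>0 'k poly)" by simp
    qed
    moreover have "\<dots> = prod_sum f lab e X"
    \<comment> \<open>A pair inside \<open>Y\<close> receives its sign in the first step and has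
      equal colours under \<open>d\<close>; for any other pair \<open>d\<close> compares as
      \<open>e\<close> does.\<close>
    proof (rule prod_sum_refine[OF fin])
      show "(if x \<in> Y \<and> y \<in> Y then sg e x y else 0) + sg d x y = (sg e x y :: 'k poly)" if "x \<in> X" "y \<in> X" for x y
        using e[OF that(1)] e[OF that(2)] that by (auto simp: Y_def sg_def d_def)
    qed (auto simp: Y_def)
    ultimately show ?thesis by simp
  qed
  moreover have "lin_ext (star_h_basis Q P1) (star_h_basis Q P2 P3 :: _ \<Rightarrow>\<^sub>0 'k poly) = prod_sum f lab e X"
  proof -
    \<comment> \<open>\<open>star_h_basis_coll\<close> expects the colours 1 and 2; shifting 2 and 3
      down by one changes no sign.\<close>
    have eZ: "e x - 1 \<in> {1, 2} \<and> e (f x) - 1 = e x - 1" if "x \<in> Z" for x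
      using that e[of x] by (auto simp: Z_def)
    have "(star_h_basis Q (coll f lab {x \<in> Z. e x - 1 = 1}) (coll f lab {x \<in> Z. e x - 1 = 2}) :: _ \<Rightarrow>\<^sub>0 'k poly) = prod_sum f lab (\<lambda>x. e x - 1) Z"
      by (rule star_h_basis_coll[OF wf wZ]) (rule eZ)
    then have "(star_h_basis Q P2 P3 :: _ \<Rightarrow>\<^sub>0 'k poly) = prod_sum f lab (\<lambda>x. e x - 1) Z"
      unfolding sets c .
    also have "\<dots> = prod_sum f lab e Z"
      unfolding prod_sum_def
    proof (rule sum.cong[OF refl])
      fix \<theta> assume \<theta>: "\<theta> \<in> matchings lab Z"
      have "wt (sg (\<lambda>x. e x - 1)) lab Z \<theta> = (wt (sg e) lab Z \<theta> :: 'k poly)"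
      proof (rule wt_cong)
        fix x assume "x \<in> Z"
        then have "e x \<in> {2, 3}" "e (\<theta> x) \<in> {2, 3}"
          using e matchingsD(4)[OF \<theta>, of x] unfolding Z_def by blast+
        then show "sg (\<lambda>x. e x - 1) x (\<theta> x) = (sg e x (\<theta> x) :: 'k poly)" by (auto simp: sg_def)
      qed
      then show "scl (wt (sg (\<lambda>x. e x - 1)) lab Z \<theta> :: 'k poly) (basis_vec (coll (f \<circ> \<theta>) (cut_label \<theta> lab) Z))
        = scl (wt (sg e) lab Z \<theta>) (basis_vec (coll (f \<circ> \<theta>) (cut_label \<theta> lab) Z))" by simp
    qed
    finally have "(star_h_basis Q P2 P3 :: _ \<Rightarrow>\<^sub>0 'k poly) = prod_sum f lab e Z" .
    moreover have "lin_ext (star_h_basis Q P1) (prod_sum f lab e Z :: _ \<Rightarrow>\<^sub>0 'k poly)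
        = (\<Sum>\<theta>\<in>matchings lab Z. scl (wt (sg e) lab Z \<theta>) (prod_sum (f \<circ> \<theta>) (cut_label \<theta> lab) d' X))"
      unfolding prod_sum_def[of f lab e Z] lin_ext_sum lin_ext_scl lin_ext_basis
    proof (rule sum.cong[OF refl])
      fix \<theta> assume \<theta>: "\<theta> \<in> matchings lab Z"
      then have \<theta>X: "\<theta> \<in> matchings lab X" using matchings_subset[of Z X] by (auto simp: Z_def)
      have dth: "d' (\<theta> x) = d' x" if "x \<in> X" for x
        using matchingsD(3)[OF \<theta>, of x] by (cases "\<theta> x = x") (auto simp: d'_def Z_def)
      have "star_h_basis Q (coll (f \<circ> \<theta>) (cut_label \<theta> lab) {x \<in> X. d' x = 1}) (coll (f \<circ> \<theta>) (cut_label \<theta> lab) {x \<in> X. d' x = 2})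
          = (prod_sum (f \<circ> \<theta>) (cut_label \<theta> lab) d' X :: _ \<Rightarrow>\<^sub>0 'k poly)"
        by (rule star_h_basis_coll[OF wf wfc_glue[OF w \<theta>X]])
          (use e dth matchingsD(4)[OF \<theta>X] in \<open>auto simp: d'_def\<close>)
      moreover have "{x \<in> X. d' x = 2} = Z" "{x \<in> X. d' x = 1} = {x \<in> X. e x = 1}" by (auto simp: d'_def Z_def)
      moreover have "coll (f \<circ> \<theta>) (cut_label \<theta> lab) {x \<in> X. e x = 1} = P1"
        unfolding c(1)[symmetric] by (rule coll_glue_untouched[OF wk]) (use matchingsD(1)[OF \<theta>] in \<open>auto simp: Z_def\<close>)
      ultimately show "scl (wt (sg e) lab Z \<theta>) (star_h_basis Q P1 (coll (f \<circ> \<theta>) (cut_label \<theta> lab) Z))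
          = scl (wt (sg e) lab Z \<theta>) (prod_sum (f \<circ> \<theta>) (cut_label \<theta> lab) d' X :: _ \<Rightarrow>\<^sub>0 'k poly)" by simp
    qed
    moreover have "\<dots> = prod_sum f lab e X"
    proof (rule prod_sum_refine[OF fin])
      show "(if x \<in> Z \<and> y \<in> Z then sg e x y else 0) + sg d' x y = (sg e x y :: 'k poly)" if "x \<in> X" "y \<in> X" for x y
        using e[OF that(1)] e[OF that(2)] that by (auto simp: Z_def sg_def d'_def)
    qed (auto simp: Z_def)
    ultimately show ?thesis by simp
  qed
  ultimately show ?thesis by simp
qed

end

section \<open>The coalgebra structure\<close>

text \<open>Which colourings are admissible depends on the matching. Summing over all functions,
  with 0 for inadmissible ones, allows the sums to be exchanged.\<close>

lemma sum_colourings: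
  assumes "finite X" "finite K"
  shows "sum F (colourings K h X) = (\<Sum>c\<in>X \<rightarrow>\<^sub>E K. if \<forall>x\<in>X. c (h x) = c x then F c else 0)"
  unfolding colourings_def using assms by (intro sum.inter_filter) (simp add: finite_PiE)

lemma sg_comp: "sg c x y = sg (\<lambda>i. i) (c x) (c y)"
  by (simp add: sg_def)

text \<open>Counterpart of \<open>sum_scl_matchings_refine\<close> with the smaller set in the
  second step: after a coproduct only one tensor factor is contracted again.\<close>

lemma sum_scl_matchings_refine_inner:
  assumes fin: "finite X" and Y: "Y \<subseteq> X"
    and s: "\<And>x y. x \<in> X \<Longrightarrow> y \<in> X \<Longrightarrow> a x y + (if x \<in> Y \<and> y \<in> Y then b x y else 0) = c x y"
  shows "(\<Sum>\<theta>\<in>matchings lab X. \<Sum>\<theta>'\<in>matchings (cut_label \<theta> lab) Y.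
      scl (wt a lab X \<theta> * wt b (cut_label \<theta> lab) Y \<theta>') (H (\<theta> \<circ> \<theta>')))
    = (\<Sum>\<tau>\<in>matchings lab X. scl (wt c lab X \<tau>) (H \<tau>))"
proof -
  let ?b = "\<lambda>x y. if x \<in> Y \<and> y \<in> Y then b x y else 0"
  have "(\<Sum>\<theta>\<in>matchings lab X. \<Sum>\<theta>'\<in>matchings (cut_label \<theta> lab) Y.
      scl (wt a lab X \<theta> * wt b (cut_label \<theta> lab) Y \<theta>') (H (\<theta> \<circ> \<theta>')))
    = (\<Sum>\<theta>\<in>matchings lab X. \<Sum>\<theta>'\<in>matchings (cut_label \<theta> lab) X.
      scl (wt a lab X \<theta> * wt ?b (cut_label \<theta> lab) X \<theta>') (H (\<theta> \<circ> \<theta>')))"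
  proof (rule sum.cong[OF refl])
    fix \<theta> assume "\<theta> \<in> matchings lab X"
    let ?l = "cut_label \<theta> lab"
    have "(\<Sum>\<theta>'\<in>matchings ?l Y. scl (wt a lab X \<theta> * wt b ?l Y \<theta>') (H (\<theta> \<circ> \<theta>')))
        = scl (wt a lab X \<theta>) (\<Sum>\<theta>'\<in>matchings ?l Y. scl (wt ?b ?l Y \<theta>') (H (\<theta> \<circ> \<theta>')))"
      unfolding scl_sum scl_scl
    proof (rule sum.cong[OF refl])
      fix \<theta>' assume "\<theta>' \<in> matchings ?l Y"
      then have "wt ?b ?l Y \<theta>' = wt b ?l Y \<theta>'" by (intro wt_cong) (auto simp: matchingsD(4))
      then show "scl (wt a lab X \<theta> * wt b ?l Y \<theta>') (H (\<theta> \<circ> \<theta>')) = scl (wt a lab X \<theta> * wt ?b ?l Y \<theta>') (H (\<theta> \<circ> \<theta>'))" by simp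
    qed
    also have "(\<Sum>\<theta>'\<in>matchings ?l Y. scl (wt ?b ?l Y \<theta>') (H (\<theta> \<circ> \<theta>'))) = (\<Sum>\<theta>'\<in>matchings ?l X. scl (wt ?b ?l X \<theta>') (H (\<theta> \<circ> \<theta>')))"
      by (rule sum_matchings_restrict[symmetric, OF fin Y]) auto
    finally show "(\<Sum>\<theta>'\<in>matchings ?l Y. scl (wt a lab X \<theta> * wt b ?l Y \<theta>') (H (\<theta> \<circ> \<theta>')))
        = (\<Sum>\<theta>'\<in>matchings ?l X. scl (wt a lab X \<theta> * wt ?b ?l X \<theta>') (H (\<theta> \<circ> \<theta>')))"
      by (simp only: scl_sum scl_scl)
  qed
  also have "\<dots> = (\<Sum>\<tau>\<in>matchings lab X. scl (wt (\<lambda>x y. a x y + ?b x y) lab X \<tau>) (H \<tau>))"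
    by (rule sum_nested_matchings_wt[OF fin])
  also have "\<dots> = (\<Sum>\<tau>\<in>matchings lab X. scl (wt c lab X \<tau>) (H \<tau>))"
  proof (rule sum.cong[OF refl])
    fix \<tau> assume \<tau>: "\<tau> \<in> matchings lab X"
    have "wt (\<lambda>x y. a x y + ?b x y) lab X \<tau> = wt c lab X \<tau>"
      by (rule wt_cong) (use s matchingsD(4)[OF \<tau>] in blast)
    then show "scl (wt (\<lambda>x y. a x y + ?b x y) lab X \<tau>) (H \<tau>) = scl (wt c lab X \<tau>) (H \<tau>)" by simp
  qed
  finally show ?thesis .
qed

text \<open>Independent matchings of \<open>Y\<close> and \<open>Z\<close> are a matching of
  \<open>X\<close> without pairs between the two; \<open>s'\<close> gives such pairs the sign
  0.\<close>

lemma sum_matchings_split: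
  assumes fin: "finite X" and YZ: "Y \<union> Z = X" "Y \<inter> Z = {}"
    and s': "\<And>x y. x \<in> X \<Longrightarrow> y \<in> X \<Longrightarrow> s' x y = (if x \<in> Y \<longleftrightarrow> y \<in> Y then s x y else 0)"
  shows "(\<Sum>\<theta>\<in>matchings lab Y. \<Sum>\<theta>'\<in>matchings lab Z. scl (wt s lab Y \<theta> * wt s lab Z \<theta>') (F (\<theta> \<circ> \<theta>')))
    = (\<Sum>\<theta>\<in>matchings lab X. scl (wt s' lab X \<theta>) (F \<theta>))"
proof -
  let ?b = "\<lambda>x y. if x \<in> Z \<and> y \<in> Z then s x y else 0"
  have Y: "Y \<subseteq> X" and Z: "Z \<subseteq> X" using YZ by auto
  have "(\<Sum>\<theta>\<in>matchings lab Y. \<Sum>\<theta>'\<in>matchings lab Z. scl (wt s lab Y \<theta> * wt s lab Z \<theta>') (F (\<theta> \<circ> \<theta>')))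
     = (\<Sum>\<theta>\<in>matchings lab Y. \<Sum>\<theta>'\<in>matchings (cut_label \<theta> lab) X.
      scl (wt s lab Y \<theta> * wt ?b (cut_label \<theta> lab) X \<theta>') (F (\<theta> \<circ> \<theta>')))"
  proof (rule sum.cong[OF refl])
    fix \<theta> assume \<theta>: "\<theta> \<in> matchings lab Y"
    let ?l = "cut_label \<theta> lab"
    \<comment> \<open>\<open>\<theta>\<close> does not touch \<open>Z\<close>, so cutting along it
      hides no arc there.\<close>
    have lZ: "snd (?l x) = snd (lab x)" if "x \<in> Z" for x
      using matchingsD(1)[OF \<theta>, of x] YZ(2) that by (auto simp: cut_label_def)
    have m: "matchings ?l Z = matchings lab Z"
    proof (intro equalityI subsetI)
      fix k assume k: "k \<in> matchings ?l Z"
      then show "k \<in> matchings lab Z" using lZ matchingsD(4)[OF k] unfolding matchings_def by auto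
    next
      fix k assume k: "k \<in> matchings lab Z"
      then show "k \<in> matchings ?l Z" using lZ matchingsD(4)[OF k] unfolding matchings_def by auto
    qed
    have "wt s lab Z \<theta>' = wt ?b ?l Z \<theta>'" if \<theta>': "\<theta>' \<in> matchings lab Z" for \<theta>'
    proof -
      have "fwd_points ?l Z \<theta>' = fwd_points lab Z \<theta>'"
        using lZ by (auto simp: fwd_points_def is_fwd_def)
      then show ?thesis
        unfolding wt_def using matchingsD(4)[OF \<theta>'] by (auto simp: fwd_points_def intro!: prod.cong)
    qed
    then have "(\<Sum>\<theta>'\<in>matchings lab Z. scl (wt s lab Y \<theta> * wt s lab Z \<theta>') (F (\<theta> \<circ> \<theta>')))
       = scl (wt s lab Y \<theta>) (\<Sum>\<theta>'\<in>matchings ?l Z. scl (wt ?b ?l Z \<theta>') (F (\<theta> \<circ> \<theta>')))"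
      unfolding m scl_sum scl_scl by (intro sum.cong) auto
    also have "(\<Sum>\<theta>'\<in>matchings ?l Z. scl (wt ?b ?l Z \<theta>') (F (\<theta> \<circ> \<theta>'))) = (\<Sum>\<theta>'\<in>matchings ?l X. scl (wt ?b ?l X \<theta>') (F (\<theta> \<circ> \<theta>')))"
      by (rule sum_matchings_restrict[symmetric, OF fin Z]) auto
    finally show "(\<Sum>\<theta>'\<in>matchings lab Z. scl (wt s lab Y \<theta> * wt s lab Z \<theta>') (F (\<theta> \<circ> \<theta>')))
       = (\<Sum>\<theta>'\<in>matchings ?l X. scl (wt s lab Y \<theta> * wt ?b ?l X \<theta>') (F (\<theta> \<circ> \<theta>')))"
      by (simp only: scl_sum scl_scl)
  qed
  also have "\<dots> = (\<Sum>\<theta>\<in>matchings lab X. scl (wt s' lab X \<theta>) (F \<theta>))"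
    by (rule sum_scl_matchings_refine[OF fin Y]) (use s' YZ in auto)
  finally show ?thesis .
qed

text \<open>Recolouring the colour \<open>j\<close> class of a 2-colouring with two colours: \<open>m\<close> merges the three resulting
  colours, and \<open>u\<close>, \<open>v\<close> identify those merging to \<open>j\<close> with \<open>{1, 2}\<close>.\<close>

lemma sum_PiE_recolour:
  fixes m u v :: "nat \<Rightarrow> nat"
  assumes fin: "finite X"
    and m: "\<And>k. k \<in> {1, 2, 3} \<Longrightarrow> m k \<in> {1, 2}" and k0: "k0 \<in> {1, 2, 3}" "m k0 \<in> {1, 2} - {j}"
    and u: "\<And>k. k \<in> {1, 2, 3} \<Longrightarrow> m k = j \<Longrightarrow> u k \<in> {1, 2} \<and> v (u k) = k"
    and v: "\<And>i. i \<in> {1, 2} \<Longrightarrow> v i \<in> {1, 2, 3} \<and> m (v i) = j \<and> u (v i) = i"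
    and k0': "\<And>k. k \<in> {1, 2, 3} \<Longrightarrow> m k \<noteq> j \<Longrightarrow> k = k0" and two: "\<And>i. i \<in> {1, 2} \<Longrightarrow> i \<noteq> j \<Longrightarrow> i = m k0"
  shows "(\<Sum>c\<in>X \<rightarrow>\<^sub>E {1, 2}. \<Sum>d\<in>{x \<in> X. c x = j} \<rightarrow>\<^sub>E {1, 2}. F c d (\<lambda>x\<in>X. if c x = j then v (d x) else k0))
    = (\<Sum>g\<in>X \<rightarrow>\<^sub>E {1, 2, 3}. F (\<lambda>x\<in>X. m (g x)) (\<lambda>x\<in>{x \<in> X. m (g x) = j}. u (g x)) g)"
proof -
  have "(\<Sum>c\<in>X \<rightarrow>\<^sub>E {1, 2}. \<Sum>d\<in>{x \<in> X. c x = j} \<rightarrow>\<^sub>E {1, 2}. F c d (\<lambda>x\<in>X. if c x = j then v (d x) else k0))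
    = (\<Sum>(c, d)\<in>(SIGMA c:X \<rightarrow>\<^sub>E {1, 2}. {x \<in> X. c x = j} \<rightarrow>\<^sub>E {1, 2}). F c d (\<lambda>x\<in>X. if c x = j then v (d x) else k0))"
    by (rule sum.Sigma) (use fin in \<open>auto simp: finite_PiE\<close>)
  also have "\<dots> = (\<Sum>g\<in>X \<rightarrow>\<^sub>E {1, 2, 3}. F (\<lambda>x\<in>X. m (g x)) (\<lambda>x\<in>{x \<in> X. m (g x) = j}. u (g x)) g)"
  proof (rule sum.reindex_bij_witness[where i = "\<lambda>g. (\<lambda>x\<in>X. m (g x), \<lambda>x\<in>{x \<in> X. m (g x) = j}. u (g x))"
        and j = "\<lambda>(c, d). \<lambda>x\<in>X. if c x = j then v (d x) else k0"])
    fix g assume g: "g \<in> X \<rightarrow>\<^sub>E {1, 2, 3::nat}"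
    then have gx: "x \<in> X \<Longrightarrow> g x \<in> {1, 2, 3}" for x by blast
    have sets: "{x \<in> X. (\<lambda>x\<in>X. m (g x)) x = j} = {x \<in> X. m (g x) = j}" by auto
    show "(\<lambda>x\<in>X. m (g x), \<lambda>x\<in>{x \<in> X. m (g x) = j}. u (g x)) \<in> (SIGMA c:X \<rightarrow>\<^sub>E {1, 2}. {x \<in> X. c x = j} \<rightarrow>\<^sub>E {1, 2})"
      unfolding mem_Sigma_iff sets using gx m u by auto
    show "(case (\<lambda>x\<in>X. m (g x), \<lambda>x\<in>{x \<in> X. m (g x) = j}. u (g x)) of (c, d) \<Rightarrow> \<lambda>x\<in>X. if c x = j then v (d x) else k0) = g"
    proof (unfold split_conv, rule ext)
      fix x
      show "(\<lambda>x\<in>X. if (\<lambda>x\<in>X. m (g x)) x = j then v ((\<lambda>x\<in>{x \<in> X. m (g x) = j}. u (g x)) x) else k0) x = g x"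
      proof (cases "x \<in> X")
        case True
        then show ?thesis using u[OF gx[OF True]] k0'[OF gx[OF True]] by simp
      next
        case False
        then show ?thesis using PiE_arb[OF g False] by simp
      qed
    qed
  next
    fix p assume "p \<in> (SIGMA c:X \<rightarrow>\<^sub>E {1, 2}. {x \<in> X. c x = j} \<rightarrow>\<^sub>E {1, 2::nat})"
    then obtain c d where p: "p = (c, d)" and c: "c \<in> X \<rightarrow>\<^sub>E {1, 2}" and d: "d \<in> {x \<in> X. c x = j} \<rightarrow>\<^sub>E {1, 2::nat}"
      by (cases p) auto
    let ?g = "\<lambda>x\<in>X. if c x = j then v (d x) else k0"
    have cx: "x \<in> X \<Longrightarrow> c x \<in> {1, 2}" for x using c by blast
    have dx: "x \<in> X \<Longrightarrow> c x = j \<Longrightarrow> d x \<in> {1, 2}" for x using d by blast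
    have mg: "x \<in> X \<Longrightarrow> m (?g x) = c x" for x
      using v[OF dx] two[OF cx] by (cases "c x = j") auto
    show "(case p of (c, d) \<Rightarrow> \<lambda>x\<in>X. if c x = j then v (d x) else k0) \<in> X \<rightarrow>\<^sub>E {1, 2, 3}"
      unfolding p split_conv
    proof (rule PiE_I)
      fix x assume "x \<in> X"
      then show "?g x \<in> {1, 2, 3}" using v[OF dx[of x]] k0(1) by (cases "c x = j") auto
    qed (simp add: restrict_def)
    have c_eq: "(\<lambda>x\<in>X. m (?g x)) = c"
    proof
      fix x show "(\<lambda>x\<in>X. m (?g x)) x = c x"
        using mg[of x] PiE_arb[OF c, of x] by (cases "x \<in> X") auto
    qed
    have sets: "{x \<in> X. m (?g x) = j} = {x \<in> X. c x = j}" using mg by auto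
    have d_eq: "(\<lambda>x\<in>{x \<in> X. m (?g x) = j}. u (?g x)) = d"
    proof
      fix x
      show "(\<lambda>x\<in>{x \<in> X. m (?g x) = j}. u (?g x)) x = d x"
        unfolding sets using PiE_arb[OF d, of x] v[OF dx[of x]] by (cases "x \<in> X \<and> c x = j") auto
    qed
    show "(\<lambda>x\<in>X. m ((case p of (c, d) \<Rightarrow> \<lambda>x\<in>X. if c x = j then v (d x) else k0) x),
        \<lambda>x\<in>{x \<in> X. m ((case p of (c, d) \<Rightarrow> \<lambda>x\<in>X. if c x = j then v (d x) else k0) x) = j}. u ((case p of (c, d) \<Rightarrow> \<lambda>x\<in>X. if c x = j then v (d x) else k0) x)) = p"
      unfolding p split_conv c_eq d_eq ..
    show "F (\<lambda>x\<in>X. m ((case p of (c, d) \<Rightarrow> \<lambda>x\<in>X. if c x = j then v (d x) else k0) x))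
        (\<lambda>x\<in>{x \<in> X. m ((case p of (c, d) \<Rightarrow> \<lambda>x\<in>X. if c x = j then v (d x) else k0) x) = j}. u ((case p of (c, d) \<Rightarrow> \<lambda>x\<in>X. if c x = j then v (d x) else k0) x))
        (case p of (c, d) \<Rightarrow> \<lambda>x\<in>X. if c x = j then v (d x) else k0)
       = (case p of (c, d) \<Rightarrow> F c d (\<lambda>x\<in>X. if c x = j then v (d x) else k0))"
      unfolding p split_conv c_eq d_eq ..
  qed
  finally show ?thesis .
qed

text \<open>Contracting again within the tensor factor of colour \<open>j\<close> gives a sum over
  3-colourings, where \<open>k0\<close> is the colour of the factor left alone. The hypothesis on
  signs says that the outer sign, plus the inner one if both points have outer colour
  \<open>j\<close>, is the sign of the 3-colouring.\<close>

lemma cop_sum_refine: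
  fixes m u v :: "nat \<Rightarrow> nat" and H :: "('x \<Rightarrow> 'x) \<Rightarrow> ('x \<Rightarrow> nat) \<Rightarrow> ('c \<Rightarrow>\<^sub>0 'k::field_char_0 poly)"
  assumes p: "perm_on f X"
    and m: "\<And>k. k \<in> {1, 2, 3} \<Longrightarrow> m k \<in> {1, 2}" and k0: "k0 \<in> {1, 2, 3}" "m k0 \<in> {1, 2} - {j}"
    and u: "\<And>k. k \<in> {1, 2, 3} \<Longrightarrow> m k = j \<Longrightarrow> u k \<in> {1, 2} \<and> v (u k) = k"
    and v: "\<And>i. i \<in> {1, 2} \<Longrightarrow> v i \<in> {1, 2, 3} \<and> m (v i) = j \<and> u (v i) = i"
    and k0': "\<And>k. k \<in> {1, 2, 3} \<Longrightarrow> m k \<noteq> j \<Longrightarrow> k = k0" and two: "\<And>i. i \<in> {1, 2} \<Longrightarrow> i \<noteq> j \<Longrightarrow> i = m k0"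
    and s: "\<And>k l. k \<in> {1, 2, 3} \<Longrightarrow> l \<in> {1, 2, 3} \<Longrightarrow>
       sg (\<lambda>i. i) (m k) (m l) + (if m k = j \<and> m l = j then sg (\<lambda>i. i) (u k) (u l) else 0) = (sg (\<lambda>i. i) k l :: 'k poly)"
  shows "(\<Sum>\<theta>\<in>matchings lab X. \<Sum>c\<in>colourings {1, 2} (f \<circ> \<theta>) X. scl (wt (sg c) lab X \<theta>)
      (\<Sum>\<theta>'\<in>matchings (cut_label \<theta> lab) {x \<in> X. c x = j}. \<Sum>d\<in>colourings {1, 2} (f \<circ> \<theta> \<circ> \<theta>') {x \<in> X. c x = j}.
        scl (wt (sg d) (cut_label \<theta> lab) {x \<in> X. c x = j} \<theta>') (H (\<theta> \<circ> \<theta>') (\<lambda>x\<in>X. if c x = j then v (d x) else k0))))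
    = (\<Sum>\<tau>\<in>matchings lab X. \<Sum>g\<in>colourings {1, 2, 3} (f \<circ> \<tau>) X. scl (wt (sg g) lab X \<tau>) (H \<tau> g))"
proof -
  have fin: "finite X" using p by (simp add: perm_on_def)
  let ?Y = "\<lambda>c. {x \<in> X. c x = j}"
  \<comment> \<open>Both admissibility conditions go into the summand, so that the sums over
    colourings can be moved outside those over matchings.\<close>
  define T where "T c d g \<theta> \<theta>' = (if (\<forall>x\<in>X. c (f (\<theta> x)) = c x) \<and> (\<forall>x\<in>?Y c. d (f (\<theta> (\<theta>' x))) = d x)
    then scl (wt (sg c) lab X \<theta> * wt (sg d) (cut_label \<theta> lab) (?Y c) \<theta>') (H (\<theta> \<circ> \<theta>') g) else 0)" for c d g \<theta> \<theta>'
  have "(\<Sum>\<theta>\<in>matchings lab X. \<Sum>c\<in>colourings {1, 2} (f \<circ> \<theta>) X. scl (wt (sg c) lab X \<theta>)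
      (\<Sum>\<theta>'\<in>matchings (cut_label \<theta> lab) (?Y c). \<Sum>d\<in>colourings {1, 2} (f \<circ> \<theta> \<circ> \<theta>') (?Y c).
        scl (wt (sg d) (cut_label \<theta> lab) (?Y c) \<theta>') (H (\<theta> \<circ> \<theta>') (\<lambda>x\<in>X. if c x = j then v (d x) else k0))))
    = (\<Sum>\<theta>\<in>matchings lab X. \<Sum>c\<in>X \<rightarrow>\<^sub>E {1, 2}. \<Sum>\<theta>'\<in>matchings (cut_label \<theta> lab) (?Y c). \<Sum>d\<in>?Y c \<rightarrow>\<^sub>E {1, 2}.
        T c d (\<lambda>x\<in>X. if c x = j then v (d x) else k0) \<theta> \<theta>')"
  proof (rule sum.cong[OF refl], subst sum_colourings[where X = X and h = "f \<circ> \<theta>" for \<theta>], goal_cases)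
    case (3 \<theta>)
    show ?case
    proof (rule sum.cong[OF refl])
      fix c :: "'x \<Rightarrow> nat"
      have fY: "finite (?Y c)" using fin by simp
      show "(if \<forall>x\<in>X. c ((f \<circ> \<theta>) x) = c x then scl (wt (sg c) lab X \<theta>)
      (\<Sum>\<theta>'\<in>matchings (cut_label \<theta> lab) (?Y c). \<Sum>d\<in>colourings {1, 2} (f \<circ> \<theta> \<circ> \<theta>') (?Y c).
        scl (wt (sg d) (cut_label \<theta> lab) (?Y c) \<theta>') (H (\<theta> \<circ> \<theta>') (\<lambda>x\<in>X. if c x = j then v (d x) else k0))) else 0)
       = (\<Sum>\<theta>'\<in>matchings (cut_label \<theta> lab) (?Y c). \<Sum>d\<in>?Y c \<rightarrow>\<^sub>E {1, 2}. T c d (\<lambda>x\<in>X. if c x = j then v (d x) else k0) \<theta> \<theta>')"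
      proof (cases "\<forall>x\<in>X. c (f (\<theta> x)) = c x")
        case True
        then show ?thesis
          by (simp add: sum_colourings[OF fY] scl_sum T_def if_distrib[where f = "scl _"] cong: if_cong)
      next
        case False
        then have "T c d g \<theta> \<theta>' = 0" for d g \<theta>' unfolding T_def by (intro if_not_P) blast
        with False show ?thesis by (subst if_not_P) (simp_all only: o_apply, simp_all)
      qed
    qed
  qed (use fin in auto)
  also have "\<dots> = (\<Sum>c\<in>X \<rightarrow>\<^sub>E {1, 2}. \<Sum>\<theta>\<in>matchings lab X. \<Sum>d\<in>?Y c \<rightarrow>\<^sub>E {1, 2}. \<Sum>\<theta>'\<in>matchings (cut_label \<theta> lab) (?Y c).
        T c d (\<lambda>x\<in>X. if c x = j then v (d x) else k0) \<theta> \<theta>')"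
    by (subst sum.swap) (intro sum.cong refl sum.swap)
  also have "\<dots> = (\<Sum>c\<in>X \<rightarrow>\<^sub>E {1, 2}. \<Sum>d\<in>?Y c \<rightarrow>\<^sub>E {1, 2}. \<Sum>\<theta>\<in>matchings lab X. \<Sum>\<theta>'\<in>matchings (cut_label \<theta> lab) (?Y c).
        T c d (\<lambda>x\<in>X. if c x = j then v (d x) else k0) \<theta> \<theta>')"
    by (intro sum.cong refl sum.swap)
  also have "\<dots> = (\<Sum>g\<in>X \<rightarrow>\<^sub>E {1, 2, 3}. \<Sum>\<theta>\<in>matchings lab X. \<Sum>\<theta>'\<in>matchings (cut_label \<theta> lab) (?Y (\<lambda>x\<in>X. m (g x))).
        T (\<lambda>x\<in>X. m (g x)) (\<lambda>x\<in>{x \<in> X. m (g x) = j}. u (g x)) g \<theta> \<theta>')"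
    by (rule sum_PiE_recolour[OF fin m k0 u v k0' two,
          of "\<lambda>c d g. \<Sum>\<theta>\<in>matchings lab X. \<Sum>\<theta>'\<in>matchings (cut_label \<theta> lab) (?Y c). T c d g \<theta> \<theta>'"])
  also have "\<dots> = (\<Sum>g\<in>X \<rightarrow>\<^sub>E {1, 2, 3}. \<Sum>\<tau>\<in>matchings lab X. if \<forall>x\<in>X. g ((f \<circ> \<tau>) x) = g x then scl (wt (sg g) lab X \<tau>) (H \<tau> g) else 0)"
  proof (rule sum.cong[OF refl])
    fix g assume "g \<in> X \<rightarrow>\<^sub>E {1, 2, 3::nat}"
    then have gx: "x \<in> X \<Longrightarrow> g x \<in> {1, 2, 3}" for x by blast
    define c where "c = (\<lambda>x\<in>X. m (g x))"
    define Y where "Y = {x \<in> X. m (g x) = j}"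
    define d where "d = (\<lambda>x\<in>Y. u (g x))"
    have Yc: "?Y c = Y" by (auto simp: c_def Y_def)
    have YX: "Y \<subseteq> X" by (auto simp: Y_def)
    let ?H = "\<lambda>\<tau>. if \<forall>x\<in>X. g (f (\<tau> x)) = g x then H \<tau> g else 0"
    have "(\<Sum>\<theta>\<in>matchings lab X. \<Sum>\<theta>'\<in>matchings (cut_label \<theta> lab) Y. T c d g \<theta> \<theta>')
       = (\<Sum>\<theta>\<in>matchings lab X. \<Sum>\<theta>'\<in>matchings (cut_label \<theta> lab) Y.
            scl (wt (sg c) lab X \<theta> * wt (sg d) (cut_label \<theta> lab) Y \<theta>') (?H (\<theta> \<circ> \<theta>')))"
    proof (intro sum.cong refl)
      fix \<theta> \<theta>' assume \<theta>: "\<theta> \<in> matchings lab X" and \<theta>': "\<theta>' \<in> matchings (cut_label \<theta> lab) Y"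
      have in_X: "f (\<theta> x) \<in> X" if "x \<in> X" for x
        using perm_on_in[OF p matchingsD(4)[OF \<theta> that]] .
      have th'X: "\<theta>' x \<in> X" "c (\<theta>' x) = c x" if "x \<in> X" for x
      proof -
        have "\<theta>' x = x \<or> x \<in> Y \<and> \<theta>' x \<in> Y" using matchingsD(3)[OF \<theta>', of x] by blast
        then show "\<theta>' x \<in> X" "c (\<theta>' x) = c x" using that by (auto simp: Y_def c_def)
      qed
      have th'inv: "\<theta>' (\<theta>' x) = x" for x by (rule matchingsD(2)[OF \<theta>'])
      \<comment> \<open>The inner matching moves points only within \<open>Y\<close>, so it respects
        the outer colour: admissibility in both steps amounts to admissibility of the combined
        3-colouring.\<close>
      have inv: "(\<forall>x\<in>X. c (f (\<theta> x)) = c x) \<and> (\<forall>x\<in>Y. d (f (\<theta> (\<theta>' x))) = d x) \<longleftrightarrow> (\<forall>x\<in>X. g (f (\<theta> (\<theta>' x))) = g x)"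
      proof
        assume A: "(\<forall>x\<in>X. c (f (\<theta> x)) = c x) \<and> (\<forall>x\<in>Y. d (f (\<theta> (\<theta>' x))) = d x)"
        show "\<forall>x\<in>X. g (f (\<theta> (\<theta>' x))) = g x"
        proof
          fix x assume x: "x \<in> X"
          let ?y = "f (\<theta> (\<theta>' x))"
          have y: "?y \<in> X" by (rule in_X[OF th'X(1)[OF x]])
          have "c ?y = c x" using A th'X[OF x] by simp
          then have mm: "m (g ?y) = m (g x)" using x y by (simp add: c_def)
          show "g ?y = g x"
          proof (cases "m (g x) = j")
            case True
            then have "x \<in> Y" "?y \<in> Y" using x y mm by (auto simp: Y_def)
            then have "u (g ?y) = u (g x)" using A by (auto simp: d_def)
            then show ?thesis using u[OF gx[OF x] True] u[OF gx[OF y]] mm True by metis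
          next
            case False
            then have "m (g ?y) \<noteq> j" by (simp only: mm not_False_eq_True)
            then have "g ?y = k0" by (rule k0'[OF gx[OF y]])
            moreover have "g x = k0" by (rule k0'[OF gx[OF x] False])
            ultimately show ?thesis by (simp only:)
          qed
        qed
      next
        assume A: "\<forall>x\<in>X. g (f (\<theta> (\<theta>' x))) = g x"
        have "c (f (\<theta> x)) = c x" if x: "x \<in> X" for x
        proof -
          have "g (f (\<theta> x)) = g (\<theta>' x)" using A th'X(1)[OF x] th'inv[of x] by force
          then have "c (f (\<theta> x)) = c (\<theta>' x)" using in_X[OF x] th'X(1)[OF x] by (simp add: c_def)
          then show ?thesis using th'X(2)[OF x] by simp
        qed
        moreover have "d (f (\<theta> (\<theta>' x))) = d x" if x: "x \<in> Y" for x
        proof -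
          have xX: "x \<in> X" using x YX by blast
          then have "g (f (\<theta> (\<theta>' x))) = g x" "f (\<theta> (\<theta>' x)) \<in> X" using A in_X[OF th'X(1)] by auto
          then show ?thesis using x by (simp add: d_def Y_def)
        qed
        ultimately show "(\<forall>x\<in>X. c (f (\<theta> x)) = c x) \<and> (\<forall>x\<in>Y. d (f (\<theta> (\<theta>' x))) = d x)" by blast
      qed
      show "T c d g \<theta> \<theta>' = scl (wt (sg c) lab X \<theta> * wt (sg d) (cut_label \<theta> lab) Y \<theta>') (?H (\<theta> \<circ> \<theta>'))"
        unfolding T_def Yc inv by simp
    qed
    also have "\<dots> = (\<Sum>\<tau>\<in>matchings lab X. scl (wt (sg g) lab X \<tau>) (?H \<tau>))"
    proof (rule sum_scl_matchings_refine_inner[OF fin YX])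
      fix x y assume xy: "x \<in> X" "y \<in> X"
      show "sg c x y + (if x \<in> Y \<and> y \<in> Y then sg d x y else 0) = (sg g x y :: 'k poly)"
      proof -
        have 1: "(sg c x y :: 'k poly) = sg (\<lambda>i. i) (m (g x)) (m (g y))" unfolding sg_def c_def using xy by simp
        have 2: "(if x \<in> Y \<and> y \<in> Y then sg d x y else 0)
            = (if m (g x) = j \<and> m (g y) = j then sg (\<lambda>i. i) (u (g x)) (u (g y)) else 0 :: 'k poly)"
        proof (rule if_cong)
          show "(x \<in> Y \<and> y \<in> Y) = (m (g x) = j \<and> m (g y) = j)" using xy by (simp add: Y_def)
          show "m (g x) = j \<and> m (g y) = j \<Longrightarrow> (sg d x y :: 'k poly) = sg (\<lambda>i. i) (u (g x)) (u (g y))"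
            unfolding sg_def d_def Y_def using xy by simp
        qed simp
        show ?thesis unfolding 1 2 sg_comp[of g] by (rule s[OF gx[OF xy(1)] gx[OF xy(2)]])
      qed
    qed
    finally show "(\<Sum>\<theta>\<in>matchings lab X. \<Sum>\<theta>'\<in>matchings (cut_label \<theta> lab) (?Y (\<lambda>x\<in>X. m (g x))).
        T (\<lambda>x\<in>X. m (g x)) (\<lambda>x\<in>{x \<in> X. m (g x) = j}. u (g x)) g \<theta> \<theta>')
      = (\<Sum>\<tau>\<in>matchings lab X. if \<forall>x\<in>X. g ((f \<circ> \<tau>) x) = g x then scl (wt (sg g) lab X \<tau>) (H \<tau> g) else 0)"
      unfolding c_def[symmetric] Yc d_def[symmetric, unfolded Y_def] by (simp add: if_distrib[where f = "scl _"] Y_def[symmetric] d_def cong: if_cong)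
  qed
  also have "\<dots> = (\<Sum>\<tau>\<in>matchings lab X. \<Sum>g\<in>colourings {1, 2, 3} (f \<circ> \<tau>) X. scl (wt (sg g) lab X \<tau>) (H \<tau> g))"
    by (subst sum.swap) (simp add: sum_colourings[OF fin])
  finally show ?thesis .
qed

lemma wfc_colour:
  assumes w: "wfc Q g lab X" and c: "c \<in> colourings K g X"
  shows "wfc Q g lab {x \<in> X. c x = k}"
  by (rule wfc_subset[OF w]) (use c perm_on_in[OF wfc_perm_on[OF w]] in \<open>auto simp: colourings_def\<close>)

text \<open>The second contraction stays within \<open>Y\<close>, so the tensor factor disjoint from
  \<open>Y\<close> keeps its collection.\<close>

lemma coll_recut:
  assumes w: "wfc Q f lab X" and \<theta>: "\<theta> \<in> matchings lab X" and \<theta>': "\<theta>' \<in> matchings (cut_label \<theta> lab) Y" and Y: "Y \<subseteq> X"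
  shows "cut_label \<theta>' (cut_label \<theta> lab) = cut_label (\<theta> \<circ> \<theta>') lab"
    and "wfc Q (f \<circ> \<theta>) (cut_label \<theta> lab) Z \<Longrightarrow> Z \<inter> Y = {} \<Longrightarrow>
      coll (f \<circ> (\<theta> \<circ> \<theta>')) (cut_label (\<theta> \<circ> \<theta>') lab) Z = coll (f \<circ> \<theta>) (cut_label \<theta> lab) Z"
proof -
  have m: "\<theta>' \<in> matchings (cut_label \<theta> lab) X" using matchings_subset[OF Y] \<theta>' by blast
  show eq: "cut_label \<theta>' (cut_label \<theta> lab) = cut_label (\<theta> \<circ> \<theta>') lab" by (rule matchings_cut(5)[OF \<theta> m])
  assume wZ: "wfc Q (f \<circ> \<theta>) (cut_label \<theta> lab) Z" and ZY: "Z \<inter> Y = {}"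
  have "coll (f \<circ> \<theta> \<circ> \<theta>') (cut_label \<theta>' (cut_label \<theta> lab)) Z = coll (f \<circ> \<theta>) (cut_label \<theta> lab) Z"
    by (rule coll_glue_untouched[OF wZ], rule matchingsD(1)[OF \<theta>']) (use ZY in blast)
  then show "coll (f \<circ> (\<theta> \<circ> \<theta>')) (cut_label (\<theta> \<circ> \<theta>') lab) Z = coll (f \<circ> \<theta>) (cut_label \<theta> lab) Z"
    unfolding eq comp_assoc .
qed

context
  fixes Q :: "('v, 'e) pre_digraph"
  assumes wf: "wf_digraph Q"
begin

lemma Delta_h_basis_closed:
  assumes "P \<in> collections Q"
  shows "(Delta_h_basis Q P :: _ \<Rightarrow>\<^sub>0 'k::field_char_0 poly) \<in> free_mod (collections Q \<times> collections Q)"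
proof -
  obtain f :: "nat \<times> nat \<Rightarrow> nat \<times> nat" and lab X where w: "wfc Q f lab X" and c: "coll f lab X = P"
    by (rule configuration_of_one[OF wf assms]) (rule that; assumption)
  have "(cop_sum f lab X :: _ \<Rightarrow>\<^sub>0 'k poly) \<in> free_mod (collections Q \<times> collections Q)"
    unfolding cop_sum_def
    by (intro sum_in_free_mod scl_in_free_mod basis_in_free_mod SigmaI coll_in_collections wfc_colour wfc_glue[OF w])
  then show ?thesis unfolding c[symmetric] Delta_h_basis_coll[OF wf w] .
qed

text \<open>A tensor factor is the empty collection only if no point has its colour, which leaves
  one constant colouring. Its signs vanish on every pair, so only the empty contraction
  survives.\<close>

lemma Delta_h_basis_counit:
  assumes "P \<in> collections Q"
  shows "lin_ext (\<lambda>(x, y). scl (if x = {#} then 1 else 0) (basis_vec y)) (Delta_h_basis Q P)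
      = (basis_vec P :: _ \<Rightarrow>\<^sub>0 'k::field_char_0 poly)"
    and "lin_ext (\<lambda>(x, y). scl (if y = {#} then 1 else 0) (basis_vec x)) (Delta_h_basis Q P)
      = (basis_vec P :: _ \<Rightarrow>\<^sub>0 'k poly)"
proof -
  obtain f :: "nat \<times> nat \<Rightarrow> nat \<times> nat" and lab X where w: "wfc Q f lab X" and P: "coll f lab X = P"
    by (rule configuration_of_one[OF wf assms]) (rule that; assumption)
  note fin = wfc_finite[OF w]
  have eq: "(\<Sum>\<theta>\<in>matchings lab X. \<Sum>c\<in>colourings {1, 2} (f \<circ> \<theta>) X. scl (wt (sg c) lab X \<theta> :: 'k poly)
       (scl (if coll (f \<circ> \<theta>) (cut_label \<theta> lab) {x \<in> X. c x = k} = {#} then 1 else 0)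
         (basis_vec (coll (f \<circ> \<theta>) (cut_label \<theta> lab) {x \<in> X. c x = l})))) = basis_vec P"
    if kl: "k \<in> {1, 2}" "l \<in> {1, 2}" "k \<noteq> l" for k l
  proof -
    let ?c = "\<lambda>x\<in>X. l"
    have "(\<Sum>c\<in>colourings {1, 2} (f \<circ> \<theta>) X. scl (wt (sg c) lab X \<theta> :: 'k poly)
       (scl (if coll (f \<circ> \<theta>) (cut_label \<theta> lab) {x \<in> X. c x = k} = {#} then 1 else 0)
         (basis_vec (coll (f \<circ> \<theta>) (cut_label \<theta> lab) {x \<in> X. c x = l}))))
      = scl (wt (sg ?c) lab X \<theta>) (basis_vec (coll (f \<circ> \<theta>) (cut_label \<theta> lab) X))" if \<theta>: "\<theta> \<in> matchings lab X" for \<theta>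
    proof -
      have mem: "?c \<in> colourings {1, 2} (f \<circ> \<theta>) X"
        using kl perm_on_in[OF wfc_perm_on[OF wfc_glue[OF w \<theta>]]] by (auto simp: colourings_def)
      have "scl (wt (sg c) lab X \<theta> :: 'k poly)
         (scl (if coll (f \<circ> \<theta>) (cut_label \<theta> lab) {x \<in> X. c x = k} = {#} then 1 else 0)
           (basis_vec (coll (f \<circ> \<theta>) (cut_label \<theta> lab) {x \<in> X. c x = l})))
         = (if c = ?c then scl (wt (sg ?c) lab X \<theta>) (basis_vec (coll (f \<circ> \<theta>) (cut_label \<theta> lab) X)) else 0)"
        if c: "c \<in> colourings {1, 2} (f \<circ> \<theta>) X" for c
      proof -
        have cE: "c \<in> X \<rightarrow>\<^sub>E {1, 2}" using c by (simp add: colourings_def)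
        have "finite {x \<in> X. c x = k}" using fin by simp
        then have "coll (f \<circ> \<theta>) (cut_label \<theta> lab) {x \<in> X. c x = k} = {#} \<longleftrightarrow> {x \<in> X. c x = k} = {}"
          by (rule coll_eq_empty_iff)
        also have "\<dots> \<longleftrightarrow> (\<forall>x\<in>X. c x = l)" using PiE_mem[OF cE] kl by blast
        also have "\<dots> \<longleftrightarrow> c = ?c"
        proof
          assume "\<forall>x\<in>X. c x = l"
          then show "c = ?c" using PiE_arb[OF cE] by (intro ext) (simp add: restrict_def)
        next
          assume "c = ?c"
          then show "\<forall>x\<in>X. c x = l" by (metis restrict_apply')
        qed
        finally have iff: "coll (f \<circ> \<theta>) (cut_label \<theta> lab) {x \<in> X. c x = k} = {#} \<longleftrightarrow> c = ?c" .
        have "{x \<in> X. ?c x = l} = X" by auto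
        then show ?thesis unfolding iff by (cases "c = ?c") simp_all
      qed
      then have "(\<Sum>c\<in>colourings {1, 2} (f \<circ> \<theta>) X. scl (wt (sg c) lab X \<theta> :: 'k poly)
       (scl (if coll (f \<circ> \<theta>) (cut_label \<theta> lab) {x \<in> X. c x = k} = {#} then 1 else 0)
         (basis_vec (coll (f \<circ> \<theta>) (cut_label \<theta> lab) {x \<in> X. c x = l}))))
        = (\<Sum>c\<in>colourings {1, 2} (f \<circ> \<theta>) X. if c = ?c then scl (wt (sg ?c) lab X \<theta>) (basis_vec (coll (f \<circ> \<theta>) (cut_label \<theta> lab) X)) else 0)"
        by (intro sum.cong refl)
      moreover have "finite (colourings {1, 2} (f \<circ> \<theta>) X)"
        using fin by (simp add: colourings_def finite_PiE)
      ultimately show ?thesis using mem by simp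
    qed
    \<comment> \<open>With the constant colouring left, the sum over contractions is a product state
      sum with a single factor.\<close>
    then have "(\<Sum>\<theta>\<in>matchings lab X. \<Sum>c\<in>colourings {1, 2} (f \<circ> \<theta>) X. scl (wt (sg c) lab X \<theta> :: 'k poly)
       (scl (if coll (f \<circ> \<theta>) (cut_label \<theta> lab) {x \<in> X. c x = k} = {#} then 1 else 0)
         (basis_vec (coll (f \<circ> \<theta>) (cut_label \<theta> lab) {x \<in> X. c x = l})))) = prod_sum f lab ?c X"
      unfolding prod_sum_def by (intro sum.cong refl)
    also have "\<dots> = basis_vec P" unfolding P[symmetric] by (rule prod_sum_constant[OF fin]) simp
    finally show ?thesis .
  qed
  have \<Delta>: "(Delta_h_basis Q P :: _ \<Rightarrow>\<^sub>0 'k poly) = cop_sum f lab X"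
    unfolding P[symmetric] by (rule Delta_h_basis_coll[OF wf w])
  show "lin_ext (\<lambda>(x, y). scl (if x = {#} then 1 else 0) (basis_vec y)) (Delta_h_basis Q P) = (basis_vec P :: _ \<Rightarrow>\<^sub>0 'k poly)"
    unfolding \<Delta> cop_sum_def lin_ext_sum lin_ext_scl lin_ext_basis split_conv by (rule eq) simp_all
  show "lin_ext (\<lambda>(x, y). scl (if y = {#} then 1 else 0) (basis_vec x)) (Delta_h_basis Q P) = (basis_vec P :: _ \<Rightarrow>\<^sub>0 'k poly)"
    unfolding \<Delta> cop_sum_def lin_ext_sum lin_ext_scl lin_ext_basis split_conv by (rule eq) simp_all
qed

lemma Delta_h_basis_unit: "Delta_h_basis Q {#} = (basis_vec ({#}, {#}) :: _ \<Rightarrow>\<^sub>0 'k::field_char_0 poly)"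
proof -
  let ?lab = "undefined :: nat \<Rightarrow> 'v \<times> 'e darc option"
  have w: "wfc Q (\<lambda>x. x) ?lab {}" by (simp add: wfc_def perm_on_def bij_betw_def)
  have "matchings ?lab {} = {\<lambda>x. x}" by (auto simp: matchings_def)
  moreover have "colourings {1, 2} g {} = {\<lambda>x. undefined}" for g :: "nat \<Rightarrow> nat" by (auto simp: colourings_def)
  ultimately have "(cop_sum (\<lambda>x. x) ?lab {} :: _ \<Rightarrow>\<^sub>0 'k poly) = basis_vec ({#}, {#})"
    by (simp add: cop_sum_def wt_id)
  moreover have "(Delta_h_basis Q (coll (\<lambda>x. x) ?lab {}) :: _ \<Rightarrow>\<^sub>0 'k poly) = cop_sum (\<lambda>x. x) ?lab {}"
    by (rule Delta_h_basis_coll[OF wf w])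
  ultimately show ?thesis by simp
qed

text \<open>Gluing keeps all points, so a term of the product can be the empty collection only if
  both factors are.\<close>

lemma star_h_basis_counit:
  assumes "P \<in> collections Q" "R \<in> collections Q"
  defines "s \<equiv> star_h_basis Q P R :: _ \<Rightarrow>\<^sub>0 'k::field_char_0 poly"
  shows "(\<Sum>b\<in>Poly_Mapping.keys s. Poly_Mapping.lookup s b * (if b = {#} then 1 else 0))
    = (if P = {#} then 1 else 0) * (if R = {#} then 1 else 0)"
proof -
  obtain f :: "nat \<times> nat \<Rightarrow> nat \<times> nat" and lab X e where w: "wfc Q f lab X"
    and e0: "\<forall>x\<in>X. e x \<in> {1, 2::nat} \<and> e (f x) = e x"
    and c: "coll f lab {x \<in> X. e x = 1} = P" "coll f lab {x \<in> X. e x = 2} = R"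
    by (rule configuration_of_two[OF wf assms(1,2)]) (rule that; assumption)
  note e = bspec[OF e0] and fin = wfc_finite[OF w]
  have s: "s = prod_sum f lab e X" unfolding s_def c[symmetric] by (rule star_h_basis_coll[OF wf w]) (rule e)
  have "P = {#} \<longleftrightarrow> {x \<in> X. e x = 1} = {}" "R = {#} \<longleftrightarrow> {x \<in> X. e x = 2} = {}"
    unfolding c[symmetric] using fin by (intro coll_eq_empty_iff; simp)+
  then have X: "P = {#} \<and> R = {#} \<longleftrightarrow> X = {}" using e by blast
  have "scl (\<Sum>b\<in>Poly_Mapping.keys s. Poly_Mapping.lookup s b * (if b = {#} then 1 else 0)) (basis_vec ())
      = lin_ext (\<lambda>b. scl (if b = {#} then 1 else 0) (basis_vec ())) s"
    by (simp add: lin_ext_def scl_sum_left)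
  also have "\<dots> = (\<Sum>\<theta>\<in>matchings lab X. scl (wt (sg e) lab X \<theta>) (scl (if X = {} then 1 else 0) (basis_vec ())))"
    unfolding s prod_sum_def lin_ext_sum lin_ext_scl lin_ext_basis coll_eq_empty_iff[OF fin] ..
  also have "\<dots> = scl (if X = {} then 1 else 0) (basis_vec ())"
  proof (cases "X = {}")
    case True
    then have "matchings lab X = {\<lambda>x. x}" by (auto simp: matchings_def)
    then show ?thesis by (simp add: wt_id)
  qed simp
  finally have "Poly_Mapping.lookup (scl (\<Sum>b\<in>Poly_Mapping.keys s. Poly_Mapping.lookup s b * (if b = {#} then 1 else 0)) (basis_vec ())) ()
     = Poly_Mapping.lookup (scl (if X = {} then 1 else 0 :: 'k poly) (basis_vec ())) ()" by simp
  then show ?thesis using X by (auto split: if_splits)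
qed

text \<open>Both sides become the same sum over 3-colourings; \<open>H\<close> lists the collections
  of the three tensor factors.\<close>

lemma Delta_h_basis_coassoc:
  assumes "P \<in> collections Q"
  shows "tensor_assoc (tensor_map (Delta_h Q) id (Delta_h_basis Q P))
    = (tensor_map id (Delta_h Q) (Delta_h_basis Q P) :: _ \<Rightarrow>\<^sub>0 'k::field_char_0 poly)"
proof -
  obtain f :: "nat \<times> nat \<Rightarrow> nat \<times> nat" and lab X where w: "wfc Q f lab X" and P: "coll f lab X = P"
    by (rule configuration_of_one[OF wf assms]) (rule that; assumption)
  note p = wfc_perm_on[OF w]
  define H :: "(nat \<times> nat \<Rightarrow> nat \<times> nat) \<Rightarrow> (nat \<times> nat \<Rightarrow> nat) \<Rightarrow> (('v, 'e) collection \<times> ('v, 'e) collection \<times> ('v, 'e) collection \<Rightarrow>\<^sub>0 'k poly)" where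
    "H \<tau> g = (let C = \<lambda>k. coll (f \<circ> \<tau>) (cut_label \<tau> lab) {x \<in> X. g x = k} in basis_vec (C 1, C 2, C 3))" for \<tau> g
  have \<Delta>: "(Delta_h_basis Q P :: _ \<Rightarrow>\<^sub>0 'k poly) = cop_sum f lab X"
    unfolding P[symmetric] by (rule Delta_h_basis_coll[OF wf w])
  have \<Delta>': "Delta_h Q (basis_vec (coll (f \<circ> \<theta>) (cut_label \<theta> lab) {x \<in> X. c x = k}))
      = (cop_sum (f \<circ> \<theta>) (cut_label \<theta> lab) {x \<in> X. c x = k} :: _ \<Rightarrow>\<^sub>0 'k poly)"
    if "\<theta> \<in> matchings lab X" "c \<in> colourings {1, 2} (f \<circ> \<theta>) X" for \<theta> c k
    unfolding Delta_h_def lin_ext_basis by (rule Delta_h_basis_coll[OF wf wfc_colour[OF wfc_glue[OF w that(1)] that(2)]])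
  have "tensor_assoc (tensor_map (Delta_h Q) id (Delta_h_basis Q P)) = (\<Sum>\<tau>\<in>matchings lab X. \<Sum>g\<in>colourings {1, 2, 3} (f \<circ> \<tau>) X. scl (wt (sg g) lab X \<tau>) (H \<tau> g))"
  proof -
    \<comment> \<open>The first factor is split again into the colours 1 and 2, and the second
      becomes colour 3.\<close>
    let ?u = "\<lambda>k::nat. k" and ?m = "\<lambda>k::nat. if k = 3 then 2 else 1::nat"
    have "tensor_assoc (tensor_map (Delta_h Q) id (Delta_h_basis Q P))
      = (\<Sum>\<theta>\<in>matchings lab X. \<Sum>c\<in>colourings {1, 2} (f \<circ> \<theta>) X. scl (wt (sg c) lab X \<theta> :: 'k poly)
        (tensor_assoc (tensor (Delta_h Q (basis_vec (coll (f \<circ> \<theta>) (cut_label \<theta> lab) {x \<in> X. c x = 1})))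
           (basis_vec (coll (f \<circ> \<theta>) (cut_label \<theta> lab) {x \<in> X. c x = 2})))))"
      unfolding \<Delta> cop_sum_def
      by (simp add: tensor_map_def lin_ext_sum lin_ext_scl tensor_assoc_def)
    also have "\<dots> = (\<Sum>\<theta>\<in>matchings lab X. \<Sum>c\<in>colourings {1, 2} (f \<circ> \<theta>) X. scl (wt (sg c) lab X \<theta> :: 'k poly)
      (\<Sum>\<theta>'\<in>matchings (cut_label \<theta> lab) {x \<in> X. c x = 1}. \<Sum>d\<in>colourings {1, 2} (f \<circ> \<theta> \<circ> \<theta>') {x \<in> X. c x = 1}.
        scl (wt (sg d) (cut_label \<theta> lab) {x \<in> X. c x = 1} \<theta>') (H (\<theta> \<circ> \<theta>') (\<lambda>x\<in>X. if c x = 1 then ?u (d x) else 3))))"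
    proof (intro sum.cong refl arg_cong[where f = "scl _"])
      fix \<theta> c assume \<theta>: "\<theta> \<in> matchings lab X" and c: "c \<in> colourings {1, 2} (f \<circ> \<theta>) X"
      let ?Y = "{x \<in> X. c x = 1}" and ?l = "cut_label \<theta> lab" and ?C2 = "coll (f \<circ> \<theta>) (cut_label \<theta> lab) {x \<in> X. c x = 2}"
      have "tensor_assoc (tensor (Delta_h Q (basis_vec (coll (f \<circ> \<theta>) ?l ?Y))) (basis_vec ?C2))
        = (\<Sum>\<theta>'\<in>matchings ?l ?Y. \<Sum>d\<in>colourings {1, 2} (f \<circ> \<theta> \<circ> \<theta>') ?Y. scl (wt (sg d) ?l ?Y \<theta>' :: 'k poly)
           (basis_vec (coll (f \<circ> \<theta> \<circ> \<theta>') (cut_label \<theta>' ?l) {x \<in> ?Y. d x = 1}, coll (f \<circ> \<theta> \<circ> \<theta>') (cut_label \<theta>' ?l) {x \<in> ?Y. d x = 2}, ?C2)))"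
        unfolding \<Delta>'[OF \<theta> c] cop_sum_def
        by (simp add: klinear_sum[OF klinear_tensor(1)] klinearD[OF klinear_tensor(1)] tensor_assoc_def lin_ext_sum lin_ext_scl)
      also have "\<dots> = (\<Sum>\<theta>'\<in>matchings ?l ?Y. \<Sum>d\<in>colourings {1, 2} (f \<circ> \<theta> \<circ> \<theta>') ?Y.
        scl (wt (sg d) ?l ?Y \<theta>') (H (\<theta> \<circ> \<theta>') (\<lambda>x\<in>X. if c x = 1 then ?u (d x) else 3)))"
      proof (intro sum.cong refl arg_cong[where f = "scl _"])
        fix \<theta>' d assume \<theta>': "\<theta>' \<in> matchings ?l ?Y" and d: "d \<in> colourings {1, 2} (f \<circ> \<theta> \<circ> \<theta>') ?Y"
        let ?g = "\<lambda>x\<in>X. if c x = 1 then ?u (d x) else 3"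
        have cx: "c x \<in> {1, 2}" if "x \<in> X" for x using c that by (auto simp: colourings_def)
        have dx: "d x \<in> {1, 2}" if "x \<in> X" "c x = 1" for x using d that by (auto simp: colourings_def)
        have "?g x = 1 \<longleftrightarrow> c x = 1 \<and> d x = 1" "?g x = 2 \<longleftrightarrow> c x = 1 \<and> d x = 2" "?g x = 3 \<longleftrightarrow> c x = 2" if "x \<in> X" for x
          using cx[OF that] dx[OF that] that by (cases "c x = 1"; force)+
        then have sets: "{x \<in> ?Y. d x = 1} = {x \<in> X. ?g x = 1}" "{x \<in> ?Y. d x = 2} = {x \<in> X. ?g x = 2}" "{x \<in> X. c x = 2} = {x \<in> X. ?g x = 3}"
          by blast+
        have C2: "?C2 = coll (f \<circ> (\<theta> \<circ> \<theta>')) (cut_label (\<theta> \<circ> \<theta>') lab) {x \<in> X. c x = 2}"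
          by (rule coll_recut(2)[symmetric, OF w \<theta> \<theta>' _ wfc_colour[OF wfc_glue[OF w \<theta>] c]]) auto
        show "basis_vec (coll (f \<circ> \<theta> \<circ> \<theta>') (cut_label \<theta>' ?l) {x \<in> ?Y. d x = 1}, coll (f \<circ> \<theta> \<circ> \<theta>') (cut_label \<theta>' ?l) {x \<in> ?Y. d x = 2}, ?C2)
          = H (\<theta> \<circ> \<theta>') ?g"
          unfolding C2 unfolding H_def Let_def sets coll_recut(1)[OF w \<theta> \<theta>', simplified] comp_assoc ..
      qed
      finally show "tensor_assoc (tensor (Delta_h Q (basis_vec (coll (f \<circ> \<theta>) ?l ?Y))) (basis_vec ?C2))
        = (\<Sum>\<theta>'\<in>matchings ?l ?Y. \<Sum>d\<in>colourings {1, 2} (f \<circ> \<theta> \<circ> \<theta>') ?Y.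
        scl (wt (sg d) ?l ?Y \<theta>') (H (\<theta> \<circ> \<theta>') (\<lambda>x\<in>X. if c x = 1 then ?u (d x) else 3)))" .
    qed
    also have "\<dots> = (\<Sum>\<tau>\<in>matchings lab X. \<Sum>g\<in>colourings {1, 2, 3} (f \<circ> \<tau>) X. scl (wt (sg g) lab X \<tau>) (H \<tau> g))"
    proof (rule cop_sum_refine[OF p, where H = H and m = ?m and u = ?u and v = ?u and j = 1 and ?k0.0 = 3])
      show "?m k \<in> {1, 2}" for k by simp
      show "(3::nat) \<in> {1, 2, 3}" "?m 3 \<in> {1, 2} - {1}" by simp_all
      show "?u k \<in> {1, 2} \<and> ?u (?u k) = k" if "k \<in> {1, 2, 3}" "?m k = 1" for k
        using that by (elim insertE emptyE; simp)
      show "?u i \<in> {1, 2, 3} \<and> ?m (?u i) = 1 \<and> ?u (?u i) = i" if "i \<in> {1, 2}" for i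
        using that by (elim insertE emptyE; simp)
      show "k = 3" if "k \<in> {1, 2, 3}" "?m k \<noteq> 1" for k using that by (elim insertE emptyE; simp)
      show "i = ?m 3" if "i \<in> {1, 2}" "i \<noteq> 1" for i using that by (elim insertE emptyE; simp)
      show "sg (\<lambda>i. i) (?m k) (?m l) + (if ?m k = 1 \<and> ?m l = 1 then sg (\<lambda>i. i) (?u k) (?u l) else 0) = (sg (\<lambda>i. i) k l :: 'k poly)"
        if "k \<in> {1, 2, 3}" "l \<in> {1, 2, 3}" for k l
        using that by (elim insertE emptyE; simp add: sg_def)
    qed
    finally show ?thesis .
  qed
  moreover have "tensor_map id (Delta_h Q) (Delta_h_basis Q P) = (\<Sum>\<tau>\<in>matchings lab X. \<Sum>g\<in>colourings {1, 2, 3} (f \<circ> \<tau>) X. scl (wt (sg g) lab X \<tau>) (H \<tau> g))"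
  proof -
    \<comment> \<open>Here the second factor is split: its inner colours 1 and 2 become 2 and 3,
      whence the shift.\<close>
    let ?u = "\<lambda>k::nat. k - 1" and ?v = "\<lambda>k::nat. Suc k" and ?m = "\<lambda>k::nat. if k = 1 then 1 else 2::nat"
    have "tensor_map id (Delta_h Q) (Delta_h_basis Q P)
      = (\<Sum>\<theta>\<in>matchings lab X. \<Sum>c\<in>colourings {1, 2} (f \<circ> \<theta>) X. scl (wt (sg c) lab X \<theta> :: 'k poly)
        (tensor (basis_vec (coll (f \<circ> \<theta>) (cut_label \<theta> lab) {x \<in> X. c x = 1}))
          (Delta_h Q (basis_vec (coll (f \<circ> \<theta>) (cut_label \<theta> lab) {x \<in> X. c x = 2})))))"
      unfolding \<Delta> cop_sum_def
      by (simp add: tensor_map_def lin_ext_sum lin_ext_scl)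
    also have "\<dots> = (\<Sum>\<theta>\<in>matchings lab X. \<Sum>c\<in>colourings {1, 2} (f \<circ> \<theta>) X. scl (wt (sg c) lab X \<theta> :: 'k poly)
      (\<Sum>\<theta>'\<in>matchings (cut_label \<theta> lab) {x \<in> X. c x = 2}. \<Sum>d\<in>colourings {1, 2} (f \<circ> \<theta> \<circ> \<theta>') {x \<in> X. c x = 2}.
        scl (wt (sg d) (cut_label \<theta> lab) {x \<in> X. c x = 2} \<theta>') (H (\<theta> \<circ> \<theta>') (\<lambda>x\<in>X. if c x = 2 then ?v (d x) else 1))))"
    proof (intro sum.cong refl arg_cong[where f = "scl _"])
      fix \<theta> c assume \<theta>: "\<theta> \<in> matchings lab X" and c: "c \<in> colourings {1, 2} (f \<circ> \<theta>) X"
      let ?Y = "{x \<in> X. c x = 2}" and ?l = "cut_label \<theta> lab" and ?C1 = "coll (f \<circ> \<theta>) (cut_label \<theta> lab) {x \<in> X. c x = 1}"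
      have "tensor (basis_vec ?C1) (Delta_h Q (basis_vec (coll (f \<circ> \<theta>) ?l ?Y)))
        = (\<Sum>\<theta>'\<in>matchings ?l ?Y. \<Sum>d\<in>colourings {1, 2} (f \<circ> \<theta> \<circ> \<theta>') ?Y. scl (wt (sg d) ?l ?Y \<theta>' :: 'k poly)
           (basis_vec (?C1, coll (f \<circ> \<theta> \<circ> \<theta>') (cut_label \<theta>' ?l) {x \<in> ?Y. d x = 1}, coll (f \<circ> \<theta> \<circ> \<theta>') (cut_label \<theta>' ?l) {x \<in> ?Y. d x = 2})))"
        unfolding \<Delta>'[OF \<theta> c] cop_sum_def
        by (simp add: klinear_sum[OF klinear_tensor(2)] klinearD[OF klinear_tensor(2)])
      also have "\<dots> = (\<Sum>\<theta>'\<in>matchings ?l ?Y. \<Sum>d\<in>colourings {1, 2} (f \<circ> \<theta> \<circ> \<theta>') ?Y.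
        scl (wt (sg d) ?l ?Y \<theta>') (H (\<theta> \<circ> \<theta>') (\<lambda>x\<in>X. if c x = 2 then ?v (d x) else 1)))"
      proof (intro sum.cong refl arg_cong[where f = "scl _"])
        fix \<theta>' d assume \<theta>': "\<theta>' \<in> matchings ?l ?Y" and d: "d \<in> colourings {1, 2} (f \<circ> \<theta> \<circ> \<theta>') ?Y"
        let ?g = "\<lambda>x\<in>X. if c x = 2 then ?v (d x) else 1"
        have cx: "c x \<in> {1, 2}" if "x \<in> X" for x using c that by (auto simp: colourings_def)
        have dx: "d x \<in> {1, 2}" if "x \<in> X" "c x = 2" for x using d that by (auto simp: colourings_def)
        have "?g x = 2 \<longleftrightarrow> c x = 2 \<and> d x = 1" "?g x = 3 \<longleftrightarrow> c x = 2 \<and> d x = 2" "?g x = 1 \<longleftrightarrow> c x = 1" if "x \<in> X" for x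
          using cx[OF that] dx[OF that] that by (cases "c x = 2"; force)+
        then have sets: "{x \<in> ?Y. d x = 1} = {x \<in> X. ?g x = 2}" "{x \<in> ?Y. d x = 2} = {x \<in> X. ?g x = 3}" "{x \<in> X. c x = 1} = {x \<in> X. ?g x = 1}"
          by blast+
        have C1: "?C1 = coll (f \<circ> (\<theta> \<circ> \<theta>')) (cut_label (\<theta> \<circ> \<theta>') lab) {x \<in> X. c x = 1}"
          by (rule coll_recut(2)[symmetric, OF w \<theta> \<theta>' _ wfc_colour[OF wfc_glue[OF w \<theta>] c]]) auto
        show "basis_vec (?C1, coll (f \<circ> \<theta> \<circ> \<theta>') (cut_label \<theta>' ?l) {x \<in> ?Y. d x = 1}, coll (f \<circ> \<theta> \<circ> \<theta>') (cut_label \<theta>' ?l) {x \<in> ?Y. d x = 2})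
          = H (\<theta> \<circ> \<theta>') ?g"
          unfolding C1 unfolding H_def Let_def sets coll_recut(1)[OF w \<theta> \<theta>', simplified] comp_assoc ..
      qed
      finally show "tensor (basis_vec ?C1) (Delta_h Q (basis_vec (coll (f \<circ> \<theta>) ?l ?Y)))
        = (\<Sum>\<theta>'\<in>matchings ?l ?Y. \<Sum>d\<in>colourings {1, 2} (f \<circ> \<theta> \<circ> \<theta>') ?Y.
        scl (wt (sg d) ?l ?Y \<theta>') (H (\<theta> \<circ> \<theta>') (\<lambda>x\<in>X. if c x = 2 then ?v (d x) else 1)))" .
    qed
    also have "\<dots> = (\<Sum>\<tau>\<in>matchings lab X. \<Sum>g\<in>colourings {1, 2, 3} (f \<circ> \<tau>) X. scl (wt (sg g) lab X \<tau>) (H \<tau> g))"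
    proof (rule cop_sum_refine[OF p, where H = H and m = ?m and u = ?u and v = ?v and j = 2 and ?k0.0 = 1])
      show "?m k \<in> {1, 2}" for k by simp
      show "(1::nat) \<in> {1, 2, 3}" "?m 1 \<in> {1, 2} - {2}" by simp_all
      show "?u k \<in> {1, 2} \<and> ?v (?u k) = k" if "k \<in> {1, 2, 3}" "?m k = 2" for k
        using that by (elim insertE emptyE; simp)
      show "?v i \<in> {1, 2, 3} \<and> ?m (?v i) = 2 \<and> ?u (?v i) = i" if "i \<in> {1, 2}" for i
        using that by (elim insertE emptyE; simp)
      show "k = 1" if "k \<in> {1, 2, 3}" "?m k \<noteq> 2" for k using that by (elim insertE emptyE; simp)
      show "i = ?m 1" if "i \<in> {1, 2}" "i \<noteq> 2" for i using that by (elim insertE emptyE; simp)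
      show "sg (\<lambda>i. i) (?m k) (?m l) + (if ?m k = 2 \<and> ?m l = 2 then sg (\<lambda>i. i) (?u k) (?u l) else 0) = (sg (\<lambda>i. i) k l :: 'k poly)"
        if "k \<in> {1, 2, 3}" "l \<in> {1, 2, 3}" for k l
        using that by (elim insertE emptyE; simp add: sg_def)
    qed
    finally show ?thesis .
  qed
  ultimately show ?thesis by simp
qed

end

section \<open>Compatibility of product and coproduct\<close>

text \<open>Since \<open>f\<close> is a bijection, the points of colour 1 are as many as the points
  with image of colour 1. Removing the points common to both sets leaves the two kinds of
  changes.\<close>

lemma card_colour_changes:
  fixes c :: "'x \<Rightarrow> nat"
  assumes p: "perm_on f A" and c: "\<And>x. x \<in> A \<Longrightarrow> c x \<in> {1, 2}"
  shows "card {x \<in> A. c x = 1 \<and> c (f x) = 2} = card {x \<in> A. c x = 2 \<and> c (f x) = 1}"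
proof -
  have fin: "finite A" using p by (simp add: perm_on_def)
  have fA: "x \<in> A \<Longrightarrow> f x \<in> A" for x by (rule perm_on_in[OF p])
  have bij: "bij_betw f {x \<in> A. c (f x) = 1} {x \<in> A. c x = 1}"
    unfolding bij_betw_def
  proof
    show "inj_on f {x \<in> A. c (f x) = 1}" using perm_on_inj[OF p] by (auto simp: inj_on_def)
    show "f ` {x \<in> A. c (f x) = 1} = {x \<in> A. c x = 1}"
    proof (intro equalityI subsetI)
      fix y assume y: "y \<in> {x \<in> A. c x = 1}"
      then obtain x where "x \<in> A" "f x = y" using perm_on_surj[OF p] by blast
      then show "y \<in> f ` {x \<in> A. c (f x) = 1}" using y by blast
    qed (use fA in auto)
  qed
  have "{x \<in> A. c x = 1} = {x \<in> A. c x = 1 \<and> c (f x) = 2} \<union> {x \<in> A. c x = 1 \<and> c (f x) = 1}"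
    using c[OF fA] by auto
  then have "card {x \<in> A. c x = 1} = card {x \<in> A. c x = 1 \<and> c (f x) = 2} + card {x \<in> A. c x = 1 \<and> c (f x) = 1}"
    using fin by (simp only:) (rule card_Un_disjoint, auto)
  moreover have "{x \<in> A. c (f x) = 1} = {x \<in> A. c x = 2 \<and> c (f x) = 1} \<union> {x \<in> A. c x = 1 \<and> c (f x) = 1}"
    using c by auto
  then have "card {x \<in> A. c (f x) = 1} = card {x \<in> A. c x = 2 \<and> c (f x) = 1} + card {x \<in> A. c x = 1 \<and> c (f x) = 1}"
    using fin by (simp only:) (rule card_Un_disjoint, auto)
  ultimately show ?thesis using bij_betw_same_card[OF bij] by linarith
qed

text \<open>Along the cycles of the left factor there are as many changes of colour from 1 to 2 as from 2
  to 1, and those matched within the left factor pair up. So if some contracted pair joins the two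
  factors and changes colour, then there is one with its left member of colour 2; the two steps give it
  opposite signs, and its weight vanishes.\<close>

lemma wt_crossing_colour_change:
  fixes c e :: "'x \<Rightarrow> nat"
  assumes p: "perm_on f X" and \<tau>: "\<tau> \<in> matchings lab X"
    and e: "\<And>x. x \<in> X \<Longrightarrow> e x \<in> {1, 2} \<and> e (f x) = e x" and c: "\<And>x. x \<in> X \<Longrightarrow> c x \<in> {1, 2}"
    and inv: "\<And>x. x \<in> X \<Longrightarrow> c (f (\<tau> x)) = c x"
  shows "wt (\<lambda>x y. sg e x y + sg c x y) lab X \<tau>
    = (wt (\<lambda>x y. (if e x = e y then sg c x y else 0) + (if c x = c y then sg e x y else 0)) lab X \<tau> :: 'k::field_char_0 poly)"
proof (cases "\<exists>x\<in>X. e (\<tau> x) \<noteq> e x \<and> c (\<tau> x) \<noteq> c x")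
  case False
  \<comment> \<open>A pair that changes at most one of the two colours has the same weight on both
    sides.\<close>
  show ?thesis
  proof (rule wt_cong)
    fix x assume "x \<in> X" "\<tau> x \<noteq> x"
    then have "e (\<tau> x) = e x \<or> c (\<tau> x) = c x" using False by blast
    then show "sg e x (\<tau> x) + sg c x (\<tau> x)
      = (if e x = e (\<tau> x) then sg c x (\<tau> x) else 0) + (if c x = c (\<tau> x) then sg e x (\<tau> x) else 0)"
      by (auto simp: sg_def)
  qed
next
  case True
  have fin: "finite X" using p by (simp add: perm_on_def)
  note \<tau>X = matchingsD(4)[OF \<tau>] and \<tau>\<tau> = matchingsD(2)[OF \<tau>]
  define A where "A = {x \<in> X. e x = 1}"
  have pA: "perm_on f A" by (rule perm_on_subset[OF p]) (use e perm_on_in[OF p] in \<open>auto simp: A_def\<close>)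
  \<comment> \<open>Invariance at \<open>\<tau> x\<close>: a change of \<open>c\<close> along
    \<open>f\<close> is a change across the pair of \<open>x\<close>.\<close>
  have cf: "c (f x) = c (\<tau> x)" if "x \<in> X" for x using inv[OF \<tau>X[OF that]] \<tau>\<tau>[of x] by simp
  define Cross where "Cross i j = {x \<in> A. c x = i \<and> c (\<tau> x) = j \<and> e (\<tau> x) = 2}" for i j
  define Inner where "Inner i j = {x \<in> A. c x = i \<and> c (\<tau> x) = j \<and> e (\<tau> x) = 1}" for i j
  have split: "card {x \<in> A. c x = i \<and> c (f x) = j} = card (Cross i j) + card (Inner i j)" for i j
  proof -
    have "{x \<in> A. c x = i \<and> c (f x) = j} = Cross i j \<union> Inner i j"
    proof (rule set_eqI)
      fix x
      show "x \<in> {x \<in> A. c x = i \<and> c (f x) = j} \<longleftrightarrow> x \<in> Cross i j \<union> Inner i j"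
      proof (cases "x \<in> A")
        case True
        then have x: "x \<in> X" by (simp add: A_def)
        then show ?thesis using True cf[OF x] e[OF \<tau>X[OF x]] by (auto simp: Cross_def Inner_def)
      qed (simp add: Cross_def Inner_def)
    qed
    moreover have "finite A" using fin by (simp add: A_def)
    ultimately show ?thesis by (simp only:) (rule card_Un_disjoint, auto simp: Cross_def Inner_def)
  qed
  have "bij_betw \<tau> (Inner 1 2) (Inner 2 1)"
    by (rule bij_betw_byWitness[where f' = \<tau>]) (use \<tau>X \<tau>\<tau> in \<open>auto simp: Inner_def A_def\<close>)
  then have "card (Inner 1 2) = card (Inner 2 1)" by (rule bij_betw_same_card)
  moreover have "card {x \<in> A. c x = 1 \<and> c (f x) = 2} = card {x \<in> A. c x = 2 \<and> c (f x) = 1}"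
    by (rule card_colour_changes[OF pA]) (use c in \<open>auto simp: A_def\<close>)
  ultimately have cards: "card (Cross 1 2) = card (Cross 2 1)" using split by simp
  obtain x where x: "x \<in> X" "e (\<tau> x) \<noteq> e x" "c (\<tau> x) \<noteq> c x" using True by blast
  obtain y where y: "y \<in> X" "e y = 1" "e (\<tau> y) = 2" "c (\<tau> y) \<noteq> c y"
  proof (cases "e x = 1")
    case True
    then show ?thesis using that[of x] x e[OF \<tau>X[OF x(1)]] by auto
  next
    case False
    then show ?thesis using that[of "\<tau> x"] x e[OF x(1)] e[OF \<tau>X[OF x(1)]] \<tau>X[OF x(1)] \<tau>\<tau>[of x] by auto
  qed
  have "Cross 2 1 \<noteq> {}"
  proof
    assume "Cross 2 1 = {}"
    moreover have "finite (Cross 1 2)" using fin by (simp add: Cross_def A_def)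
    ultimately have "Cross 1 2 = {}" "Cross 2 1 = {}" using cards by auto
    then have "y \<notin> Cross 1 2" "y \<notin> Cross 2 1" by simp_all
    then show False using y c[OF y(1)] c[OF \<tau>X[OF y(1)]] by (auto simp: Cross_def A_def)
  qed
  then obtain z where z: "e z = 1" "c z = 2" "c (\<tau> z) = 1" "e (\<tau> z) = 2" by (auto simp: Cross_def A_def)
  have m: "\<tau> z \<noteq> z" using z by auto
  have "wt (\<lambda>x y. sg e x y + sg c x y) lab X \<tau> = (0 :: 'k poly)"
    by (rule wt_eq_0[OF fin \<tau> m]) (use z in \<open>simp_all add: sg_def\<close>)
  \<comment> \<open>On this side the pair changes both colours, so both of its terms are 0.\<close>
  moreover have "wt (\<lambda>x y. (if e x = e y then sg c x y else 0) + (if c x = c y then sg e x y else 0)) lab X \<tau> = (0 :: 'k poly)"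
    by (rule wt_eq_0[OF fin \<tau> m]) (use z in simp_all)
  ultimately show ?thesis by simp
qed

section \<open>Coproduct of a product and product of coproducts as sums over matchings\<close>

lemma matchings_comp_disjoint:
  assumes \<theta>1: "\<theta>1 \<in> matchings lab A" and \<theta>2: "\<theta>2 \<in> matchings lab B" and AB: "A \<inter> B = {}" "A \<union> B = X"
  shows "\<theta>1 \<circ> \<theta>2 \<in> matchings lab X" "\<And>x. x \<in> A \<Longrightarrow> (\<theta>1 \<circ> \<theta>2) x = \<theta>1 x" "\<And>x. x \<in> B \<Longrightarrow> (\<theta>1 \<circ> \<theta>2) x = \<theta>2 x"
proof -
  show onA: "(\<theta>1 \<circ> \<theta>2) x = \<theta>1 x" if "x \<in> A" for x
  proof -
    have "x \<notin> B" using that AB(1) by blast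
    then show ?thesis using matchingsD(1)[OF \<theta>2] by simp
  qed
  show onB: "(\<theta>1 \<circ> \<theta>2) x = \<theta>2 x" if "x \<in> B" for x
  proof -
    have "\<theta>2 x \<notin> A" using matchingsD(4)[OF \<theta>2 that] AB(1) by blast
    then show ?thesis using matchingsD(1)[OF \<theta>1] by simp
  qed
  show "\<theta>1 \<circ> \<theta>2 \<in> matchings lab X"
    unfolding matchings_def mem_Collect_eq
  proof (intro conjI allI impI ballI)
    fix x
    show out: "x \<notin> X \<Longrightarrow> (\<theta>1 \<circ> \<theta>2) x = x" using matchingsD(1)[OF \<theta>1, of x] matchingsD(1)[OF \<theta>2, of x] AB(2) by auto
    show "(\<theta>1 \<circ> \<theta>2) ((\<theta>1 \<circ> \<theta>2) x) = x"
    proof (cases "x \<in> A")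
      case True
      then show ?thesis using onA[OF True] onA[OF matchingsD(4)[OF \<theta>1 True]] matchingsD(2)[OF \<theta>1] by simp
    next
      case False
      then show ?thesis
      proof (cases "x \<in> B")
        case True
        then show ?thesis using onB[OF True] onB[OF matchingsD(4)[OF \<theta>2 True]] matchingsD(2)[OF \<theta>2] by simp
      next
        case nB: False
        then show ?thesis using False out AB(2) by (metis Un_iff)
      qed
    qed
    assume "x \<in> X" and m: "(\<theta>1 \<circ> \<theta>2) x \<noteq> x"
    then consider "x \<in> A" | "x \<in> B" using AB(2) by blast
    then show "\<exists>a. snd (lab x) = Some a \<and> snd (lab ((\<theta>1 \<circ> \<theta>2) x)) = Some (star a)"
    proof cases
      case 1
      then show ?thesis using m matchingsD(3)[OF \<theta>1, of x] onA[OF 1] by simp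
    next
      case 2
      then show ?thesis using m matchingsD(3)[OF \<theta>2, of x] onB[OF 2] by simp
    qed
  qed
qed

lemma sum_PiE_split:
  fixes F :: "('x \<Rightarrow> nat) \<Rightarrow> ('x \<Rightarrow> nat) \<Rightarrow> 'z::comm_monoid_add"
  assumes fin: "finite X" and AB: "A \<inter> B = {}" "A \<union> B = X"
  shows "(\<Sum>c1\<in>A \<rightarrow>\<^sub>E K. \<Sum>c2\<in>B \<rightarrow>\<^sub>E K. F c1 c2) = (\<Sum>c\<in>X \<rightarrow>\<^sub>E K. F (restrict c A) (restrict c B))"
proof -
  have "(\<Sum>c1\<in>A \<rightarrow>\<^sub>E K. \<Sum>c2\<in>B \<rightarrow>\<^sub>E K. F c1 c2) = (\<Sum>(c1, c2)\<in>(A \<rightarrow>\<^sub>E K) \<times> (B \<rightarrow>\<^sub>E K). F c1 c2)"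
    by (rule sum.cartesian_product)
  also have "\<dots> = (\<Sum>c\<in>X \<rightarrow>\<^sub>E K. F (restrict c A) (restrict c B))"
  proof (rule sum.reindex_bij_witness[where i = "\<lambda>c. (restrict c A, restrict c B)" and j = "\<lambda>(c1, c2). \<lambda>x\<in>X. if x \<in> A then c1 x else c2 x"])
    fix q assume "q \<in> (A \<rightarrow>\<^sub>E K) \<times> (B \<rightarrow>\<^sub>E K)"
    then obtain c1 c2 where q: "q = (c1, c2)" and c1: "c1 \<in> A \<rightarrow>\<^sub>E K" and c2: "c2 \<in> B \<rightarrow>\<^sub>E K" by (cases q) auto
    let ?c = "\<lambda>x\<in>X. if x \<in> A then c1 x else c2 x"
    have 1: "restrict ?c A = c1"
    proof
      fix x show "restrict ?c A x = c1 x" using AB PiE_arb[OF c1, of x] by (cases "x \<in> A") auto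
    qed
    have 2: "restrict ?c B = c2"
    proof
      fix x show "restrict ?c B x = c2 x" using AB PiE_arb[OF c2, of x] by (cases "x \<in> B") auto
    qed
    show "(restrict (case q of (c1, c2) \<Rightarrow> \<lambda>x\<in>X. if x \<in> A then c1 x else c2 x) A,
        restrict (case q of (c1, c2) \<Rightarrow> \<lambda>x\<in>X. if x \<in> A then c1 x else c2 x) B) = q"
      unfolding q split_conv 1 2 ..
    show "(case q of (c1, c2) \<Rightarrow> \<lambda>x\<in>X. if x \<in> A then c1 x else c2 x) \<in> X \<rightarrow>\<^sub>E K"
      unfolding q split_conv using PiE_mem[OF c1] PiE_mem[OF c2] AB by auto
    show "F (restrict (case q of (c1, c2) \<Rightarrow> \<lambda>x\<in>X. if x \<in> A then c1 x else c2 x) A)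
        (restrict (case q of (c1, c2) \<Rightarrow> \<lambda>x\<in>X. if x \<in> A then c1 x else c2 x) B) = (case q of (c1, c2) \<Rightarrow> F c1 c2)"
      unfolding q split_conv 1 2 ..
  next
    fix c assume c: "c \<in> X \<rightarrow>\<^sub>E K"
    show "(restrict c A, restrict c B) \<in> (A \<rightarrow>\<^sub>E K) \<times> (B \<rightarrow>\<^sub>E K)" using PiE_mem[OF c] AB by auto
    show "(case (restrict c A, restrict c B) of (c1, c2) \<Rightarrow> \<lambda>x\<in>X. if x \<in> A then c1 x else c2 x) = c"
    proof (unfold split_conv, rule ext)
      fix x show "(\<lambda>x\<in>X. if x \<in> A then restrict c A x else restrict c B x) x = c x"
        using PiE_arb[OF c, of x] AB by (cases "x \<in> X") auto
    qed
  qed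
  finally show ?thesis .
qed

context
  fixes Q :: "('v, 'e) pre_digraph" and f :: "'x \<Rightarrow> 'x" and lab X and e :: "'x \<Rightarrow> nat"
  assumes wf: "wf_digraph Q" and w: "wfc Q f lab X" and e: "\<And>x. x \<in> X \<Longrightarrow> e x \<in> {1, 2} \<and> e (f x) = e x"
begin

text \<open>Inadmissible colourings give 0, so that the sum over colourings can be taken
  outermost.\<close>

definition cop_term :: "('x \<Rightarrow> nat) \<Rightarrow> ('x \<Rightarrow> 'x) \<Rightarrow> (('v, 'e) collection \<times> ('v, 'e) collection \<Rightarrow>\<^sub>0 'k::field_char_0 poly)" where
  "cop_term c \<tau> = (if \<forall>x\<in>X. c (f (\<tau> x)) = c x then basis_vec
     (coll (f \<circ> \<tau>) (cut_label \<tau> lab) {x \<in> X. c x = 1}, coll (f \<circ> \<tau>) (cut_label \<tau> lab) {x \<in> X. c x = 2}) else 0)"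

text \<open>Product first, coproduct second: a pair is contracted either between the factors or
  between the tensor factors, hence the sum of the two signs.\<close>

lemma Delta_prod_sum:
  "lin_ext (Delta_h_basis Q) (prod_sum f lab e X) = (\<Sum>c\<in>X \<rightarrow>\<^sub>E {1, 2}. \<Sum>\<tau>\<in>matchings lab X.
     scl (wt (\<lambda>x y. sg e x y + sg c x y) lab X \<tau> :: 'k::field_char_0 poly) (cop_term c \<tau>))"
proof -
  note fin = wfc_finite[OF w]
  have fin12: "finite {1, 2::nat}" by simp
  have "lin_ext (Delta_h_basis Q) (prod_sum f lab e X) = (\<Sum>\<theta>\<in>matchings lab X. scl (wt (sg e) lab X \<theta> :: 'k poly) (cop_sum (f \<circ> \<theta>) (cut_label \<theta> lab) X))"
    unfolding prod_sum_def lin_ext_sum lin_ext_scl lin_ext_basis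
    by (intro sum.cong refl arg_cong[where f = "scl _"] Delta_h_basis_coll[OF wf wfc_glue[OF w]])
  also have "\<dots> = (\<Sum>\<theta>\<in>matchings lab X. \<Sum>\<theta>'\<in>matchings (cut_label \<theta> lab) X. \<Sum>c\<in>X \<rightarrow>\<^sub>E {1, 2}.
      scl (wt (sg e) lab X \<theta> * wt (sg c) (cut_label \<theta> lab) X \<theta>') (cop_term c (\<theta> \<circ> \<theta>')))"
    unfolding cop_sum_def scl_sum
  proof (rule sum.cong[OF refl], rule sum.cong[OF refl])
    fix \<theta> \<theta>' assume \<theta>: "\<theta> \<in> matchings lab X" "\<theta>' \<in> matchings (cut_label \<theta> lab) X"
    show "(\<Sum>c\<in>colourings {1, 2} (f \<circ> \<theta> \<circ> \<theta>') X. scl (wt (sg e) lab X \<theta> :: 'k poly) (scl (wt (sg c) (cut_label \<theta> lab) X \<theta>')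
         (basis_vec (coll (f \<circ> \<theta> \<circ> \<theta>') (cut_label \<theta>' (cut_label \<theta> lab)) {x \<in> X. c x = 1},
           coll (f \<circ> \<theta> \<circ> \<theta>') (cut_label \<theta>' (cut_label \<theta> lab)) {x \<in> X. c x = 2}))))
      = (\<Sum>c\<in>X \<rightarrow>\<^sub>E {1, 2}. scl (wt (sg e) lab X \<theta> * wt (sg c) (cut_label \<theta> lab) X \<theta>') (cop_term c (\<theta> \<circ> \<theta>')))"
      unfolding sum_colourings[OF fin fin12] matchings_cut(5)[OF \<theta>] comp_assoc
      by (intro sum.cong refl) (simp add: cop_term_def comp_assoc)
  qed
  also have "\<dots> = (\<Sum>c\<in>X \<rightarrow>\<^sub>E {1, 2}. \<Sum>\<theta>\<in>matchings lab X. \<Sum>\<theta>'\<in>matchings (cut_label \<theta> lab) X.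
      scl (wt (sg e) lab X \<theta> * wt (sg c) (cut_label \<theta> lab) X \<theta>') (cop_term c (\<theta> \<circ> \<theta>')))"
    by (subst (2) sum.swap) (intro sum.cong refl sum.swap)
  also have "\<dots> = (\<Sum>c\<in>X \<rightarrow>\<^sub>E {1, 2}. \<Sum>\<tau>\<in>matchings lab X. scl (wt (\<lambda>x y. sg e x y + sg c x y) lab X \<tau>) (cop_term c \<tau>))"
    by (intro sum.cong refl sum_nested_matchings_wt[OF fin])
  finally show ?thesis .
qed

lemma tensor_mult_basis:
  "tensor_mult (star_h Q) (basis_vec (a, b)) (basis_vec (c, d)) = tensor (star_h_basis Q a c) (star_h_basis Q b d)"
  by (simp add: tensor_mult_def star_h_def)

text \<open>The parts of colour \<open>k\<close> of the two factors meet in the \<open>k\<close>-th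
  tensor factor. As the factors share no point, their contractions act there as the single one
  \<open>\<theta>1 \<circ> \<theta>2\<close>.\<close>

lemma star_colour_class:
  fixes c :: "'x \<Rightarrow> nat"
  defines "A \<equiv> {x \<in> X. e x = 1}" and "B \<equiv> {x \<in> X. e x = 2}"
  assumes \<theta>1: "\<theta>1 \<in> matchings lab A" and \<theta>2: "\<theta>2 \<in> matchings lab B"
    and inv: "\<forall>x\<in>X. c (f ((\<theta>1 \<circ> \<theta>2) x)) = c x"
  shows "star_h_basis Q (coll (f \<circ> \<theta>1) (cut_label \<theta>1 lab) {x \<in> A. c x = k}) (coll (f \<circ> \<theta>2) (cut_label \<theta>2 lab) {x \<in> B. c x = k})
    = (prod_sum (f \<circ> (\<theta>1 \<circ> \<theta>2)) (cut_label (\<theta>1 \<circ> \<theta>2) lab) e {x \<in> X. c x = k} :: _ \<Rightarrow>\<^sub>0 'k::field_char_0 poly)"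
proof -
  have AB: "A \<inter> B = {}" "A \<union> B = X" using e by (auto simp: A_def B_def)
  let ?\<theta> = "\<theta>1 \<circ> \<theta>2" let ?Xk = "{x \<in> X. c x = k}"
  note comp = matchings_comp_disjoint[OF \<theta>1 \<theta>2 AB]
  have fX: "f x \<in> X" if "x \<in> X" for x using perm_on_in[OF wfc_perm_on[OF w] that] .
  have \<theta>X: "?\<theta> x \<in> X" if "x \<in> X" for x using matchingsD(4)[OF comp(1) that] .
  have e\<theta>: "e (?\<theta> x) = e x" if "x \<in> X" for x
    using that comp(2)[of x] comp(3)[of x] matchingsD(4)[OF \<theta>1, of x] matchingsD(4)[OF \<theta>2, of x] e[OF that] by (auto simp: A_def B_def)
  have wk: "wfc Q (f \<circ> ?\<theta>) (cut_label ?\<theta> lab) ?Xk"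
    by (rule wfc_subset[OF wfc_glue[OF w comp(1)]]) (use inv fX \<theta>X in auto)
  have ek: "e x \<in> {1, 2} \<and> e ((f \<circ> ?\<theta>) x) = e x" if "x \<in> ?Xk" for x
    using that e[of x] e[OF \<theta>X[of x]] e\<theta>[of x] by (auto simp del: o_apply) (auto simp: o_apply)
  have sub: "wfc Q (f \<circ> ?\<theta>) (cut_label ?\<theta> lab) {x \<in> ?Xk. e x = i}" for i
    by (rule wfc_subset[OF wk]) (use perm_on_in[OF wfc_perm_on[OF wk]] ek in auto)
  have setA: "{x \<in> A. c x = k} = {x \<in> ?Xk. e x = 1}" and setB: "{x \<in> B. c x = k} = {x \<in> ?Xk. e x = 2}"
    by (auto simp: A_def B_def)
  have "coll (f \<circ> ?\<theta>) (cut_label ?\<theta> lab) {x \<in> ?Xk. e x = 1} = coll (f \<circ> \<theta>1) (cut_label \<theta>1 lab) {x \<in> ?Xk. e x = 1}"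
  proof (rule coll_cong[OF wfc_perm_on[OF sub] wfc_coherent[OF sub]])
    fix x assume "x \<in> {x \<in> ?Xk. e x = 1}"
    then have "?\<theta> x = \<theta>1 x" using comp(2)[of x] by (simp add: A_def)
    then show "(f \<circ> ?\<theta>) x = (f \<circ> \<theta>1) x" "cut_label ?\<theta> lab x = cut_label \<theta>1 lab x" by (simp_all add: cut_label_def)
  qed
  moreover have "coll (f \<circ> ?\<theta>) (cut_label ?\<theta> lab) {x \<in> ?Xk. e x = 2} = coll (f \<circ> \<theta>2) (cut_label \<theta>2 lab) {x \<in> ?Xk. e x = 2}"
  proof (rule coll_cong[OF wfc_perm_on[OF sub] wfc_coherent[OF sub]])
    fix x assume "x \<in> {x \<in> ?Xk. e x = 2}"
    then have "?\<theta> x = \<theta>2 x" using comp(3)[of x] by (simp add: B_def)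
    then show "(f \<circ> ?\<theta>) x = (f \<circ> \<theta>2) x" "cut_label ?\<theta> lab x = cut_label \<theta>2 lab x" by (simp_all add: cut_label_def)
  qed
  moreover have "star_h_basis Q (coll (f \<circ> ?\<theta>) (cut_label ?\<theta> lab) {x \<in> ?Xk. e x = 1}) (coll (f \<circ> ?\<theta>) (cut_label ?\<theta> lab) {x \<in> ?Xk. e x = 2})
    = (prod_sum (f \<circ> ?\<theta>) (cut_label ?\<theta> lab) e ?Xk :: _ \<Rightarrow>\<^sub>0 'k poly)"
    by (rule star_h_basis_coll[where e = e and X = ?Xk and f = "f \<circ> ?\<theta>", OF wf wk]) (rule ek)
  ultimately show ?thesis unfolding setA setB by simp
qed

text \<open>The tensor factors share no point, so contracting them independently is contracting
  \<open>X\<close> along pairs of equal colour \<open>c\<close>.\<close>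

lemma tensor_prod_sum:
  fixes c :: "'x \<Rightarrow> nat"
  assumes c: "\<And>x. x \<in> X \<Longrightarrow> c x \<in> {1, 2}" and \<theta>: "\<theta> \<in> matchings lab X" and inv: "\<forall>x\<in>X. c (f (\<theta> x)) = c x"
  shows "tensor (prod_sum (f \<circ> \<theta>) (cut_label \<theta> lab) e {x \<in> X. c x = 1}) (prod_sum (f \<circ> \<theta>) (cut_label \<theta> lab) e {x \<in> X. c x = 2})
    = (\<Sum>\<theta>'\<in>matchings (cut_label \<theta> lab) X. scl (wt (\<lambda>x y. if c x = c y then sg e x y else 0) (cut_label \<theta> lab) X \<theta>' :: 'k::field_char_0 poly)
        (basis_vec (coll (f \<circ> (\<theta> \<circ> \<theta>')) (cut_label (\<theta> \<circ> \<theta>') lab) {x \<in> X. c x = 1}, coll (f \<circ> (\<theta> \<circ> \<theta>')) (cut_label (\<theta> \<circ> \<theta>') lab) {x \<in> X. c x = 2})))"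
proof -
  note fin = wfc_finite[OF w]
  let ?X = "\<lambda>k. {x \<in> X. c x = k}" and ?l = "cut_label \<theta> lab" and ?g = "f \<circ> \<theta>"
  have X12: "?X 1 \<inter> ?X 2 = {}" "?X 1 \<union> ?X 2 = X" using c by auto
  have fX: "f x \<in> X" if "x \<in> X" for x using perm_on_in[OF wfc_perm_on[OF w] that] .
  have wk: "wfc Q ?g ?l (?X k)" for k
    by (rule wfc_subset[OF wfc_glue[OF w \<theta>]]) (use inv fX matchingsD(4)[OF \<theta>] in auto)
  have "tensor (prod_sum ?g ?l e (?X 1)) (prod_sum ?g ?l e (?X 2))
     = (\<Sum>\<theta>1\<in>matchings ?l (?X 1). \<Sum>\<theta>2\<in>matchings ?l (?X 2). scl (wt (sg e) ?l (?X 1) \<theta>1 * wt (sg e) ?l (?X 2) \<theta>2 :: 'k poly)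
        (basis_vec (coll (?g \<circ> \<theta>1) (cut_label \<theta>1 ?l) (?X 1), coll (?g \<circ> \<theta>2) (cut_label \<theta>2 ?l) (?X 2))))"
    unfolding prod_sum_def klinear_sum[OF klinear_tensor(1)] klinearD(2)[OF klinear_tensor(1)] klinear_sum[OF klinear_tensor(2)]
      klinearD(2)[OF klinear_tensor(2)] scl_sum scl_scl
    by (subst sum.swap) (simp add: mult.commute)
  also have "\<dots> = (\<Sum>\<theta>1\<in>matchings ?l (?X 1). \<Sum>\<theta>2\<in>matchings ?l (?X 2). scl (wt (sg e) ?l (?X 1) \<theta>1 * wt (sg e) ?l (?X 2) \<theta>2 :: 'k poly)
        (basis_vec (coll (?g \<circ> (\<theta>1 \<circ> \<theta>2)) (cut_label (\<theta>1 \<circ> \<theta>2) ?l) (?X 1), coll (?g \<circ> (\<theta>1 \<circ> \<theta>2)) (cut_label (\<theta>1 \<circ> \<theta>2) ?l) (?X 2))))"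
  proof (intro sum.cong refl)
    fix \<theta>1 \<theta>2 assume \<theta>1: "\<theta>1 \<in> matchings ?l (?X 1)" and \<theta>2: "\<theta>2 \<in> matchings ?l (?X 2)"
    note comp = matchings_comp_disjoint[OF \<theta>1 \<theta>2 X12]
    note w1 = wfc_glue[OF wk \<theta>1] and w2 = wfc_glue[OF wk \<theta>2]
    have "coll (?g \<circ> \<theta>1) (cut_label \<theta>1 ?l) (?X 1) = coll (?g \<circ> (\<theta>1 \<circ> \<theta>2)) (cut_label (\<theta>1 \<circ> \<theta>2) ?l) (?X 1)"
      by (rule coll_cong[OF wfc_perm_on[OF w1] wfc_coherent[OF w1]]) (use comp(2) in \<open>simp_all add: cut_label_def\<close>)
    moreover have "coll (?g \<circ> \<theta>2) (cut_label \<theta>2 ?l) (?X 2) = coll (?g \<circ> (\<theta>1 \<circ> \<theta>2)) (cut_label (\<theta>1 \<circ> \<theta>2) ?l) (?X 2)"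
      by (rule coll_cong[OF wfc_perm_on[OF w2] wfc_coherent[OF w2]]) (use comp(3) in \<open>simp_all add: cut_label_def\<close>)
    ultimately show "scl (wt (sg e) ?l (?X 1) \<theta>1 * wt (sg e) ?l (?X 2) \<theta>2 :: 'k poly)
        (basis_vec (coll (?g \<circ> \<theta>1) (cut_label \<theta>1 ?l) (?X 1), coll (?g \<circ> \<theta>2) (cut_label \<theta>2 ?l) (?X 2)))
      = scl (wt (sg e) ?l (?X 1) \<theta>1 * wt (sg e) ?l (?X 2) \<theta>2 :: 'k poly)
        (basis_vec (coll (?g \<circ> (\<theta>1 \<circ> \<theta>2)) (cut_label (\<theta>1 \<circ> \<theta>2) ?l) (?X 1), coll (?g \<circ> (\<theta>1 \<circ> \<theta>2)) (cut_label (\<theta>1 \<circ> \<theta>2) ?l) (?X 2)))"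
      by (simp only:)
  qed
  also have "\<dots> = (\<Sum>\<theta>'\<in>matchings ?l X. scl (wt (\<lambda>x y. if c x = c y then sg e x y else 0) ?l X \<theta>')
        (basis_vec (coll (?g \<circ> \<theta>') (cut_label \<theta>' ?l) (?X 1), coll (?g \<circ> \<theta>') (cut_label \<theta>' ?l) (?X 2))))"
  proof (rule sum_matchings_split[OF fin X12(2,1), where F = "\<lambda>\<theta>'. basis_vec (coll (?g \<circ> \<theta>') (cut_label \<theta>' ?l) (?X 1), coll (?g \<circ> \<theta>') (cut_label \<theta>' ?l) (?X 2))"])
    fix x y assume xy: "x \<in> X" "y \<in> X"
    then have "c x = c y \<longleftrightarrow> (x \<in> ?X 1 \<longleftrightarrow> y \<in> ?X 1)" using c[OF xy(1)] c[OF xy(2)] by auto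
    then show "(if c x = c y then sg e x y else 0) = (if x \<in> ?X 1 \<longleftrightarrow> y \<in> ?X 1 then sg e x y else 0 :: 'k poly)" by simp
  qed
  also have "\<dots> = (\<Sum>\<theta>'\<in>matchings ?l X. scl (wt (\<lambda>x y. if c x = c y then sg e x y else 0) ?l X \<theta>')
        (basis_vec (coll (f \<circ> (\<theta> \<circ> \<theta>')) (cut_label (\<theta> \<circ> \<theta>') lab) (?X 1), coll (f \<circ> (\<theta> \<circ> \<theta>')) (cut_label (\<theta> \<circ> \<theta>') lab) (?X 2))))"
    by (intro sum.cong refl) (simp only: matchings_cut(5)[OF \<theta>] comp_assoc)
  finally show ?thesis .
qed

text \<open>Coproducts first: they contract pairs within one factor, with signs from
  \<open>c\<close>. The products then contract pairs within one tensor factor, with signs from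
  \<open>e\<close>.\<close>

lemma tensor_mult_cop_sum:
  "tensor_mult (star_h Q) (cop_sum f lab {x \<in> X. e x = 1}) (cop_sum f lab {x \<in> X. e x = 2})
   = (\<Sum>c\<in>X \<rightarrow>\<^sub>E {1, 2}. \<Sum>\<tau>\<in>matchings lab X.
     scl (wt (\<lambda>x y. (if e x = e y then sg c x y else 0) + (if c x = c y then sg e x y else 0)) lab X \<tau> :: 'k::field_char_0 poly) (cop_term c \<tau>))"
proof -
  note fin = wfc_finite[OF w]
  have fin12: "finite {1, 2::nat}" by simp
  define A where "A = {x \<in> X. e x = 1}"
  define B where "B = {x \<in> X. e x = 2}"
  have AB: "A \<inter> B = {}" "A \<union> B = X" using e by (auto simp: A_def B_def)
  have finAB: "finite A" "finite B" using fin by (auto simp: A_def B_def)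
  let ?C = "\<lambda>Y c k \<theta>. coll (f \<circ> \<theta>) (cut_label \<theta> lab) {x \<in> Y. c x = (k::nat)}"
  define T where "T c1 c2 \<theta>1 \<theta>2 = scl (wt (sg c1) lab A \<theta>1 * wt (sg c2) lab B \<theta>2 :: 'k poly)
       (if (\<forall>x\<in>A. c1 (f (\<theta>1 x)) = c1 x) \<and> (\<forall>x\<in>B. c2 (f (\<theta>2 x)) = c2 x) then
        tensor (star_h_basis Q (?C A c1 1 \<theta>1) (?C B c2 1 \<theta>2)) (star_h_basis Q (?C A c1 2 \<theta>1) (?C B c2 2 \<theta>2)) else 0)" for c1 c2 \<theta>1 \<theta>2
  \<comment> \<open>What is left once both coproducts have contracted along \<open>\<theta>\<close>:
    the products in the two tensor factors.\<close>
  define \<Phi> where "\<Phi> c \<theta> = (if \<forall>x\<in>X. c (f (\<theta> x)) = c x then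
      tensor (prod_sum (f \<circ> \<theta>) (cut_label \<theta> lab) e {x \<in> X. c x = 1}) (prod_sum (f \<circ> \<theta>) (cut_label \<theta> lab) e {x \<in> X. c x = 2} :: _ \<Rightarrow>\<^sub>0 'k poly)
      else 0)" for c :: "'x \<Rightarrow> nat" and \<theta>
  have "tensor_mult (star_h Q) (cop_sum f lab A) (cop_sum f lab B :: _ \<Rightarrow>\<^sub>0 'k poly)
     = (\<Sum>\<theta>1\<in>matchings lab A. \<Sum>c1\<in>A \<rightarrow>\<^sub>E {1, 2}. \<Sum>\<theta>2\<in>matchings lab B. \<Sum>c2\<in>B \<rightarrow>\<^sub>E {1, 2}. T c1 c2 \<theta>1 \<theta>2)"
  proof -
    have cop: "cop_sum f lab Y = (\<Sum>\<theta>\<in>matchings lab Y. \<Sum>c\<in>Y \<rightarrow>\<^sub>E {1, 2}. scl (wt (sg c) lab Y \<theta> :: 'k poly)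
        (if \<forall>x\<in>Y. c (f (\<theta> x)) = c x then basis_vec (?C Y c 1 \<theta>, ?C Y c 2 \<theta>) else 0))" if "finite Y" for Y
      unfolding cop_sum_def sum_colourings[OF that fin12] by (intro sum.cong refl) simp
    have TM: "tensor_mult (star_h Q) (if a then basis_vec (u, v) else 0) (if b then basis_vec (u', v') else 0)
        = (if a \<and> b then tensor (star_h_basis Q u u') (star_h_basis Q v v') else (0 :: _ \<Rightarrow>\<^sub>0 'k poly))" for a b u v u' v'
      by (simp add: tensor_mult_basis klinear_0[OF klinear_tensor_mult(1)] klinear_0[OF klinear_tensor_mult(2)])
    show ?thesis
      unfolding cop[OF finAB(1)] klinear_sum[OF klinear_tensor_mult(1)] klinearD(2)[OF klinear_tensor_mult(1)]
      unfolding cop[OF finAB(2)] klinear_sum[OF klinear_tensor_mult(2)] klinearD(2)[OF klinear_tensor_mult(2)] scl_sum scl_scl TM T_def ..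
  qed
  also have "\<dots> = (\<Sum>c1\<in>A \<rightarrow>\<^sub>E {1, 2}. \<Sum>\<theta>1\<in>matchings lab A. \<Sum>c2\<in>B \<rightarrow>\<^sub>E {1, 2}. \<Sum>\<theta>2\<in>matchings lab B. T c1 c2 \<theta>1 \<theta>2)"
    by (subst sum.swap) (intro sum.cong refl sum.swap)
  also have "\<dots> = (\<Sum>c1\<in>A \<rightarrow>\<^sub>E {1, 2}. \<Sum>c2\<in>B \<rightarrow>\<^sub>E {1, 2}. \<Sum>\<theta>1\<in>matchings lab A. \<Sum>\<theta>2\<in>matchings lab B. T c1 c2 \<theta>1 \<theta>2)"
    by (intro sum.cong refl sum.swap)
  also have "\<dots> = (\<Sum>c\<in>X \<rightarrow>\<^sub>E {1, 2}. \<Sum>\<theta>1\<in>matchings lab A. \<Sum>\<theta>2\<in>matchings lab B. T (restrict c A) (restrict c B) \<theta>1 \<theta>2)"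
    by (rule sum_PiE_split[OF fin AB])
  also have "\<dots> = (\<Sum>c\<in>X \<rightarrow>\<^sub>E {1, 2}. \<Sum>\<tau>\<in>matchings lab X.
     scl (wt (\<lambda>x y. (if e x = e y then sg c x y else 0) + (if c x = c y then sg e x y else 0)) lab X \<tau>) (cop_term c \<tau>))"
  proof (rule sum.cong[OF refl])
    fix c assume cE: "c \<in> X \<rightarrow>\<^sub>E {1, 2::nat}"
    then have c: "c x \<in> {1, 2}" if "x \<in> X" for x using that by blast
    have "(\<Sum>\<theta>1\<in>matchings lab A. \<Sum>\<theta>2\<in>matchings lab B. T (restrict c A) (restrict c B) \<theta>1 \<theta>2)
      = (\<Sum>\<theta>1\<in>matchings lab A. \<Sum>\<theta>2\<in>matchings lab B. scl (wt (sg c) lab A \<theta>1 * wt (sg c) lab B \<theta>2) (\<Phi> c (\<theta>1 \<circ> \<theta>2)))"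
    proof (intro sum.cong refl)
      fix \<theta>1 \<theta>2 assume \<theta>1: "\<theta>1 \<in> matchings lab A" and \<theta>2: "\<theta>2 \<in> matchings lab B"
      note comp = matchings_comp_disjoint[OF \<theta>1 \<theta>2 AB]
      have fA: "f (\<theta>1 x) \<in> A" if "x \<in> A" for x
        using matchingsD(4)[OF \<theta>1 that] e perm_on_in[OF wfc_perm_on[OF w]] by (auto simp: A_def)
      have fB: "f (\<theta>2 x) \<in> B" if "x \<in> B" for x
        using matchingsD(4)[OF \<theta>2 that] e perm_on_in[OF wfc_perm_on[OF w]] by (auto simp: B_def)
      have inv: "(\<forall>x\<in>A. restrict c A (f (\<theta>1 x)) = restrict c A x) \<and> (\<forall>x\<in>B. restrict c B (f (\<theta>2 x)) = restrict c B x)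
          \<longleftrightarrow> (\<forall>x\<in>X. c (f ((\<theta>1 \<circ> \<theta>2) x)) = c x)"
      proof -
        have "restrict c A (f (\<theta>1 x)) = restrict c A x \<longleftrightarrow> c (f ((\<theta>1 \<circ> \<theta>2) x)) = c x" if "x \<in> A" for x
          unfolding comp(2)[OF that] using fA[OF that] that by simp
        moreover have "restrict c B (f (\<theta>2 x)) = restrict c B x \<longleftrightarrow> c (f ((\<theta>1 \<circ> \<theta>2) x)) = c x" if "x \<in> B" for x
          unfolding comp(3)[OF that] using fB[OF that] that by simp
        ultimately show ?thesis
          unfolding AB(2)[symmetric] ball_Un by (intro arg_cong2[where f = "(\<and>)"] ball_cong refl)
      qed
      have wA: "wt (sg (restrict c A)) lab A \<theta>1 = (wt (sg c) lab A \<theta>1 :: 'k poly)"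
        by (rule wt_cong) (simp add: sg_def matchingsD(4)[OF \<theta>1])
      have wB: "wt (sg (restrict c B)) lab B \<theta>2 = (wt (sg c) lab B \<theta>2 :: 'k poly)"
        by (rule wt_cong) (simp add: sg_def matchingsD(4)[OF \<theta>2])
      have sets: "{x \<in> A. restrict c A x = k} = {x \<in> A. c x = k}" "{x \<in> B. restrict c B x = k} = {x \<in> B. c x = k}" for k
        by auto
      show "T (restrict c A) (restrict c B) \<theta>1 \<theta>2 = scl (wt (sg c) lab A \<theta>1 * wt (sg c) lab B \<theta>2) (\<Phi> c (\<theta>1 \<circ> \<theta>2))"
      proof (cases "\<forall>x\<in>X. c (f ((\<theta>1 \<circ> \<theta>2) x)) = c x")
        case True
        have "star_h_basis Q (?C A c k \<theta>1) (?C B c k \<theta>2)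
          = (prod_sum (f \<circ> (\<theta>1 \<circ> \<theta>2)) (cut_label (\<theta>1 \<circ> \<theta>2) lab) e {x \<in> X. c x = k} :: _ \<Rightarrow>\<^sub>0 'k poly)" for k
          unfolding A_def B_def by (rule star_colour_class[OF \<theta>1[unfolded A_def] \<theta>2[unfolded B_def] True])
        then show ?thesis unfolding T_def \<Phi>_def inv wA wB sets if_P[OF True] by (simp only:)
      qed (simp only: T_def \<Phi>_def inv wA wB sets if_False scl_zero_right)
    qed
    also have "\<dots> = (\<Sum>\<theta>\<in>matchings lab X. scl (wt (\<lambda>x y. if e x = e y then sg c x y else 0) lab X \<theta>) (\<Phi> c \<theta>))"
    proof (rule sum_matchings_split[OF fin AB(2,1)])
      fix x y assume xy: "x \<in> X" "y \<in> X"
      then have "e x = e y \<longleftrightarrow> (x \<in> A \<longleftrightarrow> y \<in> A)" using e[OF xy(1)] e[OF xy(2)] by (auto simp: A_def)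
      then show "(if e x = e y then sg c x y else 0) = (if x \<in> A \<longleftrightarrow> y \<in> A then sg c x y else 0 :: 'k poly)" by simp
    qed
    also have "\<dots> = (\<Sum>\<theta>\<in>matchings lab X. \<Sum>\<theta>'\<in>matchings (cut_label \<theta> lab) X.
        scl (wt (\<lambda>x y. if e x = e y then sg c x y else 0) lab X \<theta> * wt (\<lambda>x y. if c x = c y then sg e x y else 0) (cut_label \<theta> lab) X \<theta>')
         (cop_term c (\<theta> \<circ> \<theta>')))"
    proof (rule sum.cong[OF refl])
      fix \<theta> assume \<theta>: "\<theta> \<in> matchings lab X"
      let ?w = "\<lambda>\<theta>'. wt (\<lambda>x y. if c x = c y then sg e x y else 0) (cut_label \<theta> lab) X \<theta>' :: 'k poly"
      \<comment> \<open>A second contraction of nonzero weight joins points of equal colour, so it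
        does not affect whether the colouring is admissible.\<close>
      have w0: "?w \<theta>' = 0 \<or> ((\<forall>x\<in>X. c (f (\<theta> x)) = c x) \<longleftrightarrow> (\<forall>x\<in>X. c (f ((\<theta> \<circ> \<theta>') x)) = c x))"
        if \<theta>': "\<theta>' \<in> matchings (cut_label \<theta> lab) X" for \<theta>'
      proof (cases "\<forall>x\<in>X. c (\<theta>' x) = c x")
        case False
        then obtain x where x: "x \<in> X" "c (\<theta>' x) \<noteq> c x" by blast
        then have "?w \<theta>' = 0" by (intro wt_eq_0[OF fin \<theta>', of x]) auto
        then show ?thesis ..
      next
        case True
        have "c (f (\<theta> x)) = c x \<longleftrightarrow> c (f ((\<theta> \<circ> \<theta>') (\<theta>' x))) = c (\<theta>' x)" if "x \<in> X" for x
          using True that matchingsD(2)[OF \<theta>', of x] by simp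
        then have "(\<forall>x\<in>X. c (f (\<theta> x)) = c x) \<longleftrightarrow> (\<forall>x\<in>X. c (f ((\<theta> \<circ> \<theta>') x)) = c x)"
          using matchingsD(4)[OF \<theta>'] matchingsD(2)[OF \<theta>'] by metis
        then show ?thesis ..
      qed
      have "\<Phi> c \<theta> = (\<Sum>\<theta>'\<in>matchings (cut_label \<theta> lab) X. scl (?w \<theta>') (cop_term c (\<theta> \<circ> \<theta>')))"
      proof (cases "\<forall>x\<in>X. c (f (\<theta> x)) = c x")
        case True
        have "\<Phi> c \<theta> = (\<Sum>\<theta>'\<in>matchings (cut_label \<theta> lab) X. scl (?w \<theta>') (basis_vec (coll (f \<circ> (\<theta> \<circ> \<theta>')) (cut_label (\<theta> \<circ> \<theta>') lab) {x \<in> X. c x = 1},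
             coll (f \<circ> (\<theta> \<circ> \<theta>')) (cut_label (\<theta> \<circ> \<theta>') lab) {x \<in> X. c x = 2})))"
          unfolding \<Phi>_def if_P[OF True] by (rule tensor_prod_sum[OF c \<theta> True])
        also have "\<dots> = (\<Sum>\<theta>'\<in>matchings (cut_label \<theta> lab) X. scl (?w \<theta>') (cop_term c (\<theta> \<circ> \<theta>')))"
        proof (rule sum.cong[OF refl])
          fix \<theta>' assume "\<theta>' \<in> matchings (cut_label \<theta> lab) X"
          from w0[OF this] True have "?w \<theta>' = 0 \<or> (\<forall>x\<in>X. c (f ((\<theta> \<circ> \<theta>') x)) = c x)" by blast
          then show "scl (?w \<theta>') (basis_vec (coll (f \<circ> (\<theta> \<circ> \<theta>')) (cut_label (\<theta> \<circ> \<theta>') lab) {x \<in> X. c x = 1},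
             coll (f \<circ> (\<theta> \<circ> \<theta>')) (cut_label (\<theta> \<circ> \<theta>') lab) {x \<in> X. c x = 2})) = scl (?w \<theta>') (cop_term c (\<theta> \<circ> \<theta>'))"
            unfolding cop_term_def by (elim disjE) (simp only: scl_zero_left, subst if_P, assumption, rule refl)
        qed
        finally show ?thesis .
      next
        case False
        have "scl (?w \<theta>') (cop_term c (\<theta> \<circ> \<theta>')) = 0" if "\<theta>' \<in> matchings (cut_label \<theta> lab) X" for \<theta>'
        proof -
          from w0[OF that] False have "?w \<theta>' = 0 \<or> \<not> (\<forall>x\<in>X. c (f ((\<theta> \<circ> \<theta>') x)) = c x)" by blast
          then show ?thesis unfolding cop_term_def by (elim disjE) (simp only: scl_zero_left, subst if_not_P, assumption, rule scl_zero_right)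
        qed
        then have "(\<Sum>\<theta>'\<in>matchings (cut_label \<theta> lab) X. scl (?w \<theta>') (cop_term c (\<theta> \<circ> \<theta>'))) = 0"
          by (intro sum.neutral ballI)
        then show ?thesis unfolding \<Phi>_def if_not_P[OF False] by (rule sym)
      qed
      then show "scl (wt (\<lambda>x y. if e x = e y then sg c x y else 0) lab X \<theta>) (\<Phi> c \<theta>)
        = (\<Sum>\<theta>'\<in>matchings (cut_label \<theta> lab) X. scl (wt (\<lambda>x y. if e x = e y then sg c x y else 0) lab X \<theta> * ?w \<theta>') (cop_term c (\<theta> \<circ> \<theta>')))"
        by (simp only: scl_sum scl_scl)
    qed
    also have "\<dots> = (\<Sum>\<tau>\<in>matchings lab X.
       scl (wt (\<lambda>x y. (if e x = e y then sg c x y else 0) + (if c x = c y then sg e x y else 0)) lab X \<tau>) (cop_term c \<tau>))"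
      by (rule sum_nested_matchings_wt[OF fin])
    finally show "(\<Sum>\<theta>1\<in>matchings lab A. \<Sum>\<theta>2\<in>matchings lab B. T (restrict c A) (restrict c B) \<theta>1 \<theta>2) = \<dots>" .
  qed
  finally show ?thesis unfolding A_def B_def .
qed

text \<open>The weights of a pair differ in the two sums only if the pair changes both colours; for
  an admissible colouring the total weights agree all the same.\<close>

theorem Delta_star_config:
  "lin_ext (Delta_h_basis Q) (prod_sum f lab e X)
    = (tensor_mult (star_h Q) (cop_sum f lab {x \<in> X. e x = 1}) (cop_sum f lab {x \<in> X. e x = 2}) :: _ \<Rightarrow>\<^sub>0 'k::field_char_0 poly)"
  unfolding Delta_prod_sum tensor_mult_cop_sum
proof (intro sum.cong refl)
  fix c \<tau> assume cE: "c \<in> X \<rightarrow>\<^sub>E {1, 2::nat}" and \<tau>: "\<tau> \<in> matchings lab X"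
  show "scl (wt (\<lambda>x y. sg e x y + sg c x y) lab X \<tau> :: 'k poly) (cop_term c \<tau>)
    = scl (wt (\<lambda>x y. (if e x = e y then sg c x y else 0) + (if c x = c y then sg e x y else 0)) lab X \<tau>) (cop_term c \<tau>)"
  proof (cases "\<forall>x\<in>X. c (f (\<tau> x)) = c x")
    case True
    have "wt (\<lambda>x y. sg e x y + sg c x y) lab X \<tau>
      = (wt (\<lambda>x y. (if e x = e y then sg c x y else 0) + (if c x = c y then sg e x y else 0)) lab X \<tau> :: 'k poly)"
      by (rule wt_crossing_colour_change[where f = f]) (use wfc_perm_on[OF w] \<tau> e cE True in \<open>auto simp: PiE_iff\<close>)
    then show ?thesis by (simp only:)
  qed (simp only: cop_term_def if_False scl_zero_right)
qed

end

lemma Delta_h_basis_star: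
  fixes Q :: "('v, 'e) pre_digraph"
  assumes wf: "wf_digraph Q" and PR: "P \<in> collections Q" "R \<in> collections Q"
  shows "lin_ext (Delta_h_basis Q) (star_h_basis Q P R)
    = (tensor_mult (star_h Q) (Delta_h_basis Q P) (Delta_h_basis Q R) :: _ \<Rightarrow>\<^sub>0 'k::field_char_0 poly)"
proof -
  obtain f :: "nat \<times> nat \<Rightarrow> nat \<times> nat" and lab X e where w: "wfc Q f lab X"
    and e0: "\<forall>x\<in>X. e x \<in> {1, 2::nat} \<and> e (f x) = e x"
    and c: "coll f lab {x \<in> X. e x = 1} = P" "coll f lab {x \<in> X. e x = 2} = R"
    by (rule configuration_of_two[OF wf PR]) (rule that; assumption)
  note e = bspec[OF e0]
  have wk: "wfc Q f lab {x \<in> X. e x = k}" for k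
    by (rule wfc_subset[OF w]) (use e perm_on_in[OF wfc_perm_on[OF w]] in auto)
  have s: "(star_h_basis Q P R :: _ \<Rightarrow>\<^sub>0 'k poly) = prod_sum f lab e X"
    unfolding c[symmetric] by (rule star_h_basis_coll[where e = e, OF wf w]) (rule e)
  have d: "(Delta_h_basis Q P :: _ \<Rightarrow>\<^sub>0 'k poly) = cop_sum f lab {x \<in> X. e x = 1}"
     "(Delta_h_basis Q R :: _ \<Rightarrow>\<^sub>0 'k poly) = cop_sum f lab {x \<in> X. e x = 2}"
    unfolding c[symmetric] by (rule Delta_h_basis_coll[OF wf wk])+
  show ?thesis unfolding s d by (rule Delta_star_config[where e = e, OF wf w]) (rule e)
qed

section \<open>Parity of the number of orbits\<close>

text \<open>With constant labels and no arcs \<open>coll\<close> has one member per orbit, so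
  invariance of collections under isomorphism counts orbits.\<close>

lemma card_orbits_conj:
  assumes p: "perm_on p Y" and b: "bij_betw b Y Y'" and bp: "\<And>x. x \<in> Y \<Longrightarrow> b (p x) = p' (b x)"
  shows "card (orbit p' ` Y') = card (orbit p ` Y)"
proof -
  let ?l = "\<lambda>_. ((), None)"
  have "coll p' ?l Y' = coll p ?l Y"
    by (rule coll_iso(3)[OF p _ b bp]) (simp_all add: coherent_def)
  then show ?thesis by (metis size_coll)
qed

lemma card_orbits_cong:
  assumes "perm_on p Y" "\<And>x. x \<in> Y \<Longrightarrow> p x = p' x"
  shows "card (orbit p' ` Y) = card (orbit p ` Y)"
  by (rule card_orbits_conj[OF assms(1) bij_betw_id]) (simp add: assms(2))

lemma card_orbits_bypass:
  assumes "perm_on p Y" "x \<in> Y" "p x \<noteq> x"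
  shows "card (orbit (bypass x p) ` (Y - {x})) = card (orbit p ` Y)"
  using bij_betw_same_card[OF orbits_bypass(1)[OF assms]] by simp

lemma orbit_fixpoint: "p x = x \<Longrightarrow> orbit p x = {x}"
  by (rule iterates_eqI(2)[of "[x]", simplified]) auto

lemma card_orbits_insert_fixpoint:
  assumes p: "perm_on p Y" and x: "p x = x" "x \<notin> Y"
  shows "card (orbit p ` insert x Y) = Suc (card (orbit p ` Y))"
proof -
  have "{x} \<notin> orbit p ` Y" using orbit_subset_perm_on[OF p] x(2) by blast
  then show ?thesis using p by (simp add: orbit_fixpoint[of p x, OF x(1)] perm_on_def)
qed

text \<open>The exponent is usually the number of points minus the number of cycles; the sum has the
  same parity. Points are removed one at a time.\<close>

lemma sign_perm_restrict:
  assumes "perm_on p Y"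
  shows "sign (perm_restrict p Y) = (- 1) ^ (card Y + card (orbit p ` Y))"
  using assms
proof (induction "card Y" arbitrary: p Y)
  case 0
  then have Y: "Y = {}" by (simp add: perm_on_def)
  have "perm_restrict p Y = id" by (rule ext) (simp add: Y perm_restrict_def)
  then show ?case by (simp add: Y sign_id)
next
  case (Suc n)
  note p = Suc.prems
  have finY: "finite Y" using p by (simp add: perm_on_def)
  then obtain x where x: "x \<in> Y" using Suc.hyps(2) by fastforce
  have card: "n = card (Y - {x})" using Suc.hyps(2) x by simp
  have cY: "card Y = Suc (card (Y - {x}))" using Suc.hyps(2) card by simp
  show ?case
  proof (cases "p x = x")
    case True
    have p': "perm_on p (Y - {x})"
    proof (rule perm_on_subset[OF p])
      fix y assume "y \<in> Y - {x}"
      then show "p y \<in> Y - {x}" using perm_on_in[OF p, of y] perm_on_inj[OF p, of y x] x True by auto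
    qed auto
    have "perm_restrict p Y = perm_restrict p (Y - {x})"
      by (rule ext) (simp add: perm_restrict_def True)
    then have "sign (perm_restrict p Y) = (- 1) ^ (card (Y - {x}) + card (orbit p ` (Y - {x})))"
      using Suc.hyps(1)[OF card p'] by simp
    moreover have "card (orbit p ` Y) = Suc (card (orbit p ` (Y - {x})))"
      using card_orbits_insert_fixpoint[OF p' True] unfolding insert_Diff[OF x] by simp
    ultimately show ?thesis by (simp add: cY)
  next
    case False
    have p': "perm_on (bypass x p) (Y - {x})" by (rule perm_on_bypass[OF p x False])
    \<comment> \<open>Deleting a moved point composes with one transposition: the sign changes, the
      number of orbits does not.\<close>
    have "perm_restrict (bypass x p) (Y - {x}) = Transposition.transpose x (p x) \<circ> perm_restrict p Y"
    proof
      fix y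
      consider "y = x" | "y \<in> Y" "y \<noteq> x" | "y \<notin> Y" by blast
      then show "perm_restrict (bypass x p) (Y - {x}) y = (Transposition.transpose x (p x) \<circ> perm_restrict p Y) y"
      proof cases
        case 1
        then show ?thesis using x by (simp add: perm_restrict_def)
      next
        case 2
        then have "p y \<noteq> p x" using perm_on_inj[OF p] x by blast
        then show ?thesis using 2 by (simp add: perm_restrict_def bypass_def transpose_def)
      next
        case 3
        then have "y \<noteq> x" "y \<noteq> p x" using x perm_on_in[OF p x] by auto
        then show ?thesis using 3 by (simp add: perm_restrict_def transpose_def)
      qed
    qed
    then have "sign (perm_restrict (bypass x p) (Y - {x})) = - sign (perm_restrict p Y)"
      using False by (simp add: sign_compose[OF permutation_swap_id permutation_perm_restrict[OF p]] sign_swap_id)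
    then show ?thesis
      using Suc.hyps(1)[OF card p'] card_orbits_bypass[OF p x False] by (simp add: cY)
  qed
qed

text \<open>Multiplicativity of the sign, rewritten in terms of numbers of orbits.\<close>

lemma parity_orbits_comp:
  assumes p: "perm_on p Y" and q: "perm_on q Y"
  shows "(- 1 :: int) ^ card (orbit (q \<circ> p) ` Y) = (- 1) ^ (card Y + card (orbit q ` Y)) * (- 1) ^ card (orbit p ` Y)"
proof -
  have pq: "perm_on (q \<circ> p) Y" using p q by (auto simp: perm_on_def intro: bij_betw_trans)
  have "perm_restrict (q \<circ> p) Y = perm_restrict q Y \<circ> perm_restrict p Y"
    by (rule ext) (simp add: perm_restrict_def perm_on_in[OF p])
  then have "sign (perm_restrict (q \<circ> p) Y) = sign (perm_restrict q Y) * sign (perm_restrict p Y)"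
    by (simp add: sign_compose permutation_perm_restrict[OF p] permutation_perm_restrict[OF q])
  then have "(- 1 :: int) ^ (card Y + card (orbit (q \<circ> p) ` Y)) = (- 1) ^ (card Y + card (orbit q ` Y)) * (- 1) ^ (card Y + card (orbit p ` Y))"
    unfolding sign_perm_restrict[OF p] sign_perm_restrict[OF q] sign_perm_restrict[OF pq] .
  then show ?thesis by (simp add: power_add)
qed

section \<open>Cancellation in the antipode\<close>

text \<open>Once the weights rule out matched points of equal colour, the set of pairs contracted by the
  coproduct is determined by the colouring \<open>c\<close>, and the glued permutation is \<open>colour_step\<close>.\<close>

definition balanced :: "('x \<Rightarrow> 'x) \<Rightarrow> ('x \<Rightarrow> 'x) \<Rightarrow> 'x set \<Rightarrow> ('x \<Rightarrow> nat) set" where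
  "balanced f \<tau> X = {c \<in> X \<rightarrow>\<^sub>E {1, 2}. \<forall>x\<in>X.
     (\<tau> x \<noteq> x \<longrightarrow> c (\<tau> x) \<noteq> c x \<and> c (f (\<tau> x)) \<noteq> c (f x)) \<and> (\<tau> x = x \<longrightarrow> c (f x) = c x)}"

definition colour_step :: "('x \<Rightarrow> 'x) \<Rightarrow> ('x \<Rightarrow> 'x) \<Rightarrow> ('x \<Rightarrow> nat) \<Rightarrow> 'x \<Rightarrow> 'x" where
  "colour_step f \<tau> c x = (if c (f x) = c x then f x else f (\<tau> x))"

text \<open>The signs of all pairs, whichever step contracts them, times the sign of the antipode on
  the first tensor factor, whose members are the cycles of colour 1.\<close>

definition antipode_weight :: "('x \<Rightarrow> 'x) \<Rightarrow> ('x \<Rightarrow> 'x) \<Rightarrow> 'x set \<Rightarrow> 'x set \<Rightarrow> ('x \<Rightarrow> nat) \<Rightarrow> int" where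
  "antipode_weight f \<tau> F X c = (\<Prod>x\<in>F. sg c x (\<tau> x)) * (- 1) ^ card (orbit (colour_step f \<tau> c) ` {x \<in> X. c x = 1})"

lemma balancedD:
  assumes "c \<in> balanced f \<tau> X" "x \<in> X"
  shows "c x = 1 \<or> c x = 2" "\<tau> x \<noteq> x \<Longrightarrow> c (\<tau> x) \<noteq> c x" "\<tau> x \<noteq> x \<Longrightarrow> c (f (\<tau> x)) \<noteq> c (f x)"
    "\<tau> x = x \<Longrightarrow> c (f x) = c x"
  using assms by (auto simp: balanced_def PiE_iff)

lemma balanced_arb: "c \<in> balanced f \<tau> X \<Longrightarrow> x \<notin> X \<Longrightarrow> c x = undefined"
  by (auto simp: balanced_def PiE_iff extensional_def)

lemma sg_flip:
  assumes "c x = 1 \<or> c x = 2" "c y = 1 \<or> c y = 2"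
  shows "sg (\<lambda>x. 3 - c x) x y = - sg c x y"
  using assms by (auto simp: sg_def)

lemma sum_sign_reversing:
  fixes w :: "'a \<Rightarrow> int"
  assumes "\<And>a. a \<in> A \<Longrightarrow> h a \<in> A" "\<And>a. a \<in> A \<Longrightarrow> h (h a) = a" "\<And>a. a \<in> A \<Longrightarrow> w (h a) = - w a"
  shows "sum w A = 0"
proof -
  have "sum w A = (\<Sum>a\<in>A. - w a)"
    by (rule sum.reindex_bij_witness[where i = h and j = h]) (use assms in auto)
  then show ?thesis by (simp add: sum_negf)
qed

context
  fixes f \<tau> :: "'x \<Rightarrow> 'x" and lab :: "'x \<Rightarrow> 'v \<times> 'e darc option" and X
  assumes p: "perm_on f X" and \<tau>: "\<tau> \<in> matchings lab X"
begin

text \<open>There are two colours only: if \<open>f x\<close> has the wrong one, then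
  \<open>f (\<tau> x)\<close>, which differs from it in colour, has the right one.\<close>

lemma colour_step_colour:
  assumes c: "c \<in> balanced f \<tau> X" and x: "x \<in> X"
  shows "colour_step f \<tau> c x \<in> X" "c (colour_step f \<tau> c x) = c x"
proof -
  have in_X: "f x \<in> X" "\<tau> x \<in> X" "f (\<tau> x) \<in> X"
    using x matchingsD(4)[OF \<tau>] perm_on_in[OF p] by blast+
  then show "colour_step f \<tau> c x \<in> X" by (simp add: colour_step_def)
  show "c (colour_step f \<tau> c x) = c x"
  proof (cases "c (f x) = c x")
    case False
    then have "\<tau> x \<noteq> x" using balancedD(4)[OF c x] by blast
    then have "c (f (\<tau> x)) \<noteq> c (f x)" by (rule balancedD(3)[OF c x])
    then have "c (f (\<tau> x)) = c x"
      using False balancedD(1)[OF c in_X(1)] balancedD(1)[OF c in_X(3)] balancedD(1)[OF c x] by auto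
    then show ?thesis using False by (simp add: colour_step_def)
  qed (simp add: colour_step_def)
qed

lemma perm_on_colour_step:
  assumes c: "c \<in> balanced f \<tau> X"
  shows "perm_on (colour_step f \<tau> c) {x \<in> X. c x = k}"
proof (rule perm_onI)
  show "finite {x \<in> X. c x = k}" using p by (simp add: perm_on_def)
next
  fix x assume "x \<in> {x \<in> X. c x = k}"
  then show "colour_step f \<tau> c x \<in> {x \<in> X. c x = k}" using colour_step_colour[OF c] by simp
next
  fix x y assume xy: "x \<in> {x \<in> X. c x = k}" "y \<in> {x \<in> X. c x = k}" and eq: "colour_step f \<tau> c x = colour_step f \<tau> c y"
  have X: "x \<in> X" "y \<in> X" "\<tau> x \<in> X" "\<tau> y \<in> X" using xy matchingsD(4)[OF \<tau>] by auto
  note inj = perm_on_inj[OF p]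
  \<comment> \<open>A collision between the two branches would make \<open>a\<close> the partner of
    \<open>b\<close>, and partners differ in colour.\<close>
  have cross: "a = b" if ab: "a \<in> X" "b \<in> X" "c a = c b" "f a = f (\<tau> b)" for a b
  proof -
    have "a = \<tau> b" using ab inj[OF ab(1) matchingsD(4)[OF \<tau> ab(2)]] by simp
    then show ?thesis using balancedD(2)[OF c ab(2)] ab(3) by (cases "\<tau> b = b") auto
  qed
  consider "f x = f y" | "f x = f (\<tau> y)" | "f y = f (\<tau> x)" | "f (\<tau> x) = f (\<tau> y)"
    using eq by (auto simp: colour_step_def split: if_splits)
  then show "x = y"
  proof cases
    case 1 then show ?thesis using inj X by blast
  next
    case 2 then show ?thesis using cross[OF X(1,2)] xy by simp
  next
    case 3 then show ?thesis using cross[OF X(2,1)] xy by simp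
  next
    case 4 then show ?thesis using inj X matching_inj[OF \<tau>] by blast
  qed
qed

text \<open>\<open>U\<close> is the set of pairs contracted by the coproduct, the other pairs of
  \<open>\<tau>\<close> being left to the product. Once vanishing terms are dropped, one term per
  balanced colouring remains.\<close>

lemma sum_balanced:
  "(\<Sum>U\<in>Pow (fwd_points lab X \<tau>). \<Sum>c\<in>colourings {1, 2} (f \<circ> part \<tau> U) X.
      (\<Prod>x\<in>fwd_points lab X \<tau>. sg c x (\<tau> x)) * (- 1) ^ card (orbit (f \<circ> part \<tau> U) ` {x \<in> X. c x = 1}))
    = (\<Sum>c\<in>balanced f \<tau> X. antipode_weight f \<tau> (fwd_points lab X \<tau>) X c)"
proof -
  let ?F = "fwd_points lab X \<tau>"
  have finX: "finite X" using p by (simp add: perm_on_def)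
  have finF: "finite ?F" using finX by (simp add: fwd_points_def)
  have finc: "finite (colourings {1, 2} h X)" for h
    unfolding colourings_def using finX by (simp add: finite_PiE)
  note \<tau>X = matchingsD(4)[OF \<tau>] and \<tau>\<tau> = matchingsD(2)[OF \<tau>]
  have F_moved: "\<tau> x \<noteq> x \<and> x \<in> X \<and> \<tau> x \<notin> ?F" if "x \<in> ?F" for x
    using that is_fwd_partner[OF \<tau>, of x] by (auto simp: fwd_points_def)
  have moved_F: "x \<in> ?F \<or> \<tau> x \<in> ?F" if "\<tau> x \<noteq> x" for x
    using that is_fwd_partner[OF \<tau>, of x] matchingsD(3)[OF \<tau>, of x] \<tau>\<tau>[of x] by (auto simp: fwd_points_def)
  let ?S = "SIGMA U:Pow ?F. colourings {1, 2} (f \<circ> part \<tau> U) X"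
  let ?w = "\<lambda>U c. (\<Prod>x\<in>?F. sg c x (\<tau> x)) * (- 1) ^ card (orbit (f \<circ> part \<tau> U) ` {x \<in> X. c x = 1}) :: int"
  let ?proper = "\<lambda>c. \<forall>x\<in>?F. c (\<tau> x) \<noteq> c x"
  \<comment> \<open>The coproduct must have contracted exactly the pairs at which following
    \<open>f\<close> would change the colour.\<close>
  let ?U = "\<lambda>c. {x \<in> ?F. c (f x) \<noteq> c x}"
  have "(\<Sum>U\<in>Pow ?F. \<Sum>c\<in>colourings {1, 2} (f \<circ> part \<tau> U) X. ?w U c) = (\<Sum>(U, c)\<in>?S. ?w U c)"
    by (rule sum.Sigma) (use finF finc in auto)
  also have "\<dots> = (\<Sum>(U, c)\<in>{q \<in> ?S. ?proper (snd q)}. ?w U c)"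
  proof (rule sum.mono_neutral_right)
    show "finite ?S" using finF finc by (intro finite_SigmaI) auto
    show "\<forall>q\<in>?S - {q \<in> ?S. ?proper (snd q)}. (case q of (U, c) \<Rightarrow> ?w U c) = 0"
    proof
      fix q assume "q \<in> ?S - {q \<in> ?S. ?proper (snd q)}"
      then obtain U c x where q: "q = (U, c)" and x: "x \<in> ?F" "c (\<tau> x) = c x" by (cases q) auto
      have "(\<Prod>x\<in>?F. sg c x (\<tau> x)) = (0 :: int)"
        by (rule prod_zero[OF finF], rule bexI[OF _ x(1)]) (simp add: sg_def x(2))
      then show "(case q of (U, c) \<Rightarrow> ?w U c) = 0" by (simp add: q)
    qed
  qed auto
  also have "\<dots> = (\<Sum>c\<in>balanced f \<tau> X. antipode_weight f \<tau> ?F X c)"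
  proof (rule sum.reindex_bij_witness[where j = snd and i = "\<lambda>c. (?U c, c)"])
    fix q assume "q \<in> {q \<in> ?S. ?proper (snd q)}"
    then obtain U c where q: "q = (U, c)" and U: "U \<subseteq> ?F" and cE: "c \<in> X \<rightarrow>\<^sub>E {1, 2}"
      and inv: "\<And>x. x \<in> X \<Longrightarrow> c (f (part \<tau> U x)) = c x" and pr: "\<And>x. x \<in> ?F \<Longrightarrow> c (\<tau> x) \<noteq> c x"
      by (cases q) (auto simp: colourings_def)
    have pr': "c (\<tau> x) \<noteq> c x" if "\<tau> x \<noteq> x" for x using moved_F[OF that] pr[of x] pr[of "\<tau> x"] \<tau>\<tau>[of x] by auto
    \<comment> \<open>The members of a pair are both redirected or both not, so \<open>f x\<close>
      and \<open>f (\<tau> x)\<close> get the colours of \<open>x\<close> and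
      \<open>\<tau> x\<close> in one order or the other.\<close>
    have not: "c (f (\<tau> x)) \<noteq> c (f x)" if x: "x \<in> X" "\<tau> x \<noteq> x" for x
      using inv[OF x(1)] inv[OF \<tau>X[OF x(1)]] pr'[OF x(2)] \<tau>\<tau>[of x] by (auto simp: part_def split: if_splits)
    have unmoved: "c (f x) = c x" if x: "x \<in> X" "\<tau> x = x" for x
      using inv[OF x(1)] x(2) by (simp add: part_def split: if_splits)
    have cb: "c \<in> balanced f \<tau> X"
      unfolding balanced_def mem_Collect_eq using cE pr' not unmoved by blast
    have "U = ?U c"
    proof (intro equalityI subsetI)
      fix x assume x: "x \<in> U"
      then have xF: "x \<in> ?F" using U by blast
      then have "c (f (\<tau> x)) = c x" using inv[of x] F_moved[OF xF] x by (simp add: part_def)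
      then show "x \<in> ?U c" using xF not[of x] F_moved[OF xF] by auto
    next
      fix x assume x: "x \<in> ?U c"
      show "x \<in> U"
      proof (rule ccontr)
        assume "x \<notin> U"
        moreover have "\<tau> x \<notin> U" using x F_moved[of x] U by blast
        ultimately have "part \<tau> U x = x" by (simp add: part_def)
        then show False using inv[of x] x F_moved[of x] by simp
      qed
    qed
    then show "(?U (snd q), snd q) = q" by (simp add: q)
    show "snd q \<in> balanced f \<tau> X" using cb by (simp add: q)
    have step: "(f \<circ> part \<tau> U) x = colour_step f \<tau> c x" if x: "x \<in> X" for x
    proof (cases "\<tau> x = x")
      case True
      then show ?thesis using unmoved[OF x] by (simp add: part_def colour_step_def)
    next
      case False
      show ?thesis using inv[OF x] not[OF x False] by (auto simp: part_def colour_step_def)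
    qed
    have "card (orbit (f \<circ> part \<tau> U) ` {x \<in> X. c x = 1}) = card (orbit (colour_step f \<tau> c) ` {x \<in> X. c x = 1})"
      by (rule card_orbits_cong[OF perm_on_colour_step[OF cb]]) (use step in simp)
    then show "antipode_weight f \<tau> ?F X (snd q) = (case q of (U, c) \<Rightarrow> ?w U c)"
      by (simp add: q antipode_weight_def)
  next
    fix c assume c: "c \<in> balanced f \<tau> X"
    show "snd (?U c, c) = c" by simp
    have "c (f (part \<tau> (?U c) x)) = c x" if x: "x \<in> X" for x
    proof (cases "\<tau> x = x")
      case True
      then show ?thesis using balancedD(4)[OF c x] by (simp add: part_def)
    next
      case False
      have in_X: "\<tau> x \<in> X" "f x \<in> X" "f (\<tau> x) \<in> X" using x \<tau>X perm_on_in[OF p] by blast+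
      note b = balancedD(1)[OF c x] balancedD(1)[OF c in_X(1)] balancedD(1)[OF c in_X(2)] balancedD(1)[OF c in_X(3)]
        balancedD(2)[OF c x False] balancedD(3)[OF c x False]
      \<comment> \<open>\<open>?U\<close> tests only the forward member of a pair; with two colours
        the test at its partner has the same outcome.\<close>
      have "part \<tau> (?U c) x = (if c (f x) = c x then x else \<tau> x)"
      proof (cases "x \<in> ?F")
        case True
        then show ?thesis using F_moved[OF True] by (auto simp: part_def)
      next
        case nF: False
        then have "\<tau> x \<in> ?F" using moved_F[OF False] by blast
        moreover have "c (f (\<tau> x)) = c (\<tau> x) \<longleftrightarrow> c (f x) = c x" using b by auto
        ultimately show ?thesis using nF by (auto simp: part_def)
      qed
      then show ?thesis using b by auto
    qed
    moreover have "c \<in> X \<rightarrow>\<^sub>E {1, 2}" using c by (simp add: balanced_def)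
    moreover have "c (\<tau> x) \<noteq> c x" if "x \<in> ?F" for x using balancedD(2)[OF c] F_moved[OF that] by blast
    ultimately show "(?U c, c) \<in> {q \<in> ?S. ?proper (snd q)}" by (auto simp: colourings_def)
  qed
  finally show ?thesis .
qed


text \<open>An unmatched fixed point is a cycle by itself. Recolouring it changes the number of
  cycles of colour 1 by one and no sign of a pair, so the terms cancel in twos.\<close>

lemma sum_antipode_weight_fixed:
  assumes x: "x \<in> X" "\<tau> x = x" "f x = x"
  shows "(\<Sum>c\<in>balanced f \<tau> X. antipode_weight f \<tau> (fwd_points lab X \<tau>) X c) = 0"
proof (rule sum_sign_reversing[where h = "\<lambda>c. c(x := 3 - c x)"])
  let ?F = "fwd_points lab X \<tau>"
  let ?h = "\<lambda>c. c(x := 3 - c x)"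
  have f_neq: "f y \<noteq> x" if "y \<in> X" "y \<noteq> x" for y using perm_on_inj[OF p that(1) x(1)] that x(3) by auto
  have \<tau>_neq: "\<tau> y \<noteq> x" if "y \<noteq> x" for y using that x(2) matching_inj[OF \<tau>, of y x] by auto
  show hb: "?h c \<in> balanced f \<tau> X" if c: "c \<in> balanced f \<tau> X" for c
    unfolding balanced_def mem_Collect_eq
  proof (intro conjI ballI)
    show "?h c \<in> X \<rightarrow>\<^sub>E {1, 2}"
    proof (rule PiE_I)
      fix y assume "y \<in> X"
      then show "?h c y \<in> {1, 2}" using balancedD(1)[OF c] x(1) by fastforce
    next
      fix y assume "y \<notin> X"
      then show "?h c y = undefined" using balanced_arb[OF c] x(1) by auto
    qed
    fix y assume y: "y \<in> X"
    show "\<tau> y \<noteq> y \<longrightarrow> ?h c (\<tau> y) \<noteq> ?h c y \<and> ?h c (f (\<tau> y)) \<noteq> ?h c (f y)"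
    proof
      assume m: "\<tau> y \<noteq> y"
      then have "y \<noteq> x" using x(2) by auto
      then show "?h c (\<tau> y) \<noteq> ?h c y \<and> ?h c (f (\<tau> y)) \<noteq> ?h c (f y)"
        using balancedD(2,3)[OF c y m] \<tau>_neq f_neq[OF y] f_neq[OF matchingsD(4)[OF \<tau> y]] by simp
    qed
    show "\<tau> y = y \<longrightarrow> ?h c (f y) = ?h c y"
      using balancedD(4)[OF c y] f_neq[OF y] x(3) by (cases "y = x") auto
  qed
  show hh: "?h (?h c) = c" if "c \<in> balanced f \<tau> X" for c
    using balancedD(1)[OF that x(1)] by (auto simp: fun_eq_iff)
  have one: "antipode_weight f \<tau> ?F X (?h c) = - antipode_weight f \<tau> ?F X c" if c: "c \<in> balanced f \<tau> X" and c1: "c x = 1" for c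
  proof -
    let ?Y = "{y \<in> X. ?h c y = 1}"
    have Y: "{y \<in> X. c y = 1} = insert x ?Y" "x \<notin> ?Y" using x(1) c1 by auto
    have "(\<Prod>y\<in>?F. sg (?h c) y (\<tau> y)) = (\<Prod>y\<in>?F. sg c y (\<tau> y) :: int)"
    proof (rule prod.cong[OF refl])
      fix y assume "y \<in> ?F"
      then have "y \<noteq> x" using x(2) by (auto simp: fwd_points_def)
      then have "\<tau> y \<noteq> x" by (rule \<tau>_neq)
      with \<open>y \<noteq> x\<close> show "sg (?h c) y (\<tau> y) = (sg c y (\<tau> y) :: int)" by (simp add: sg_def)
    qed
    moreover have "card (orbit (colour_step f \<tau> c) ` {y \<in> X. c y = 1}) = Suc (card (orbit (colour_step f \<tau> (?h c)) ` ?Y))"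
    proof -
      have "card (orbit (colour_step f \<tau> (?h c)) ` {y \<in> X. c y = 1}) = card (orbit (colour_step f \<tau> c) ` {y \<in> X. c y = 1})"
      proof (rule card_orbits_cong[OF perm_on_colour_step[OF c]])
        fix y assume "y \<in> {y \<in> X. c y = 1}"
        then show "colour_step f \<tau> c y = colour_step f \<tau> (?h c) y"
          using f_neq[of y] x(2,3) by (cases "y = x") (simp_all add: colour_step_def)
      qed
      moreover have "card (orbit (colour_step f \<tau> (?h c)) ` insert x ?Y) = Suc (card (orbit (colour_step f \<tau> (?h c)) ` ?Y))"
        by (rule card_orbits_insert_fixpoint[OF perm_on_colour_step[OF hb[OF c]] _ Y(2)]) (simp add: colour_step_def x)
      ultimately show ?thesis unfolding Y(1) by linarith
    qed
    ultimately show ?thesis by (simp add: antipode_weight_def)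
  qed
  show "antipode_weight f \<tau> ?F X (?h c) = - antipode_weight f \<tau> ?F X c" if c: "c \<in> balanced f \<tau> X" for c
  proof (cases "c x = 1")
    case False
    then have "(?h c) x = 1" using balancedD(1)[OF c x(1)] by auto
    from one[OF hb[OF c] this] show ?thesis unfolding hh[OF c] by linarith
  qed (rule one[OF c])
qed

text \<open>An unmatched point has the colour of its successor. As only signs of pairs and numbers
  of cycles matter, it can be deleted from a longer cycle, with or without an arc. \<open>F\<close>
  is a separate parameter so that both sides can share it.\<close>

lemma sum_antipode_weight_bypass:
  assumes x: "x \<in> X" "\<tau> x = x" "f x \<noteq> x" and F: "F = fwd_points lab X \<tau>"
  shows "(\<Sum>c\<in>balanced f \<tau> X. antipode_weight f \<tau> F X c) = (\<Sum>c\<in>balanced (bypass x f) \<tau> (X - {x}). antipode_weight (bypass x f) \<tau> F (X - {x}) c)"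
proof (rule sum.reindex_bij_witness[where j = "\<lambda>c. restrict c (X - {x})" and i = "\<lambda>c. c(x := c (f x))"])
  let ?f = "bypass x f" let ?X = "X - {x}"
  have p': "perm_on ?f ?X" by (rule perm_on_bypass[OF p x(1,3)])
  have f'X: "?f y \<in> ?X" if "y \<in> ?X" for y by (rule perm_on_in[OF p' that])
  have \<tau>'X: "\<tau> y \<in> ?X" if "y \<in> ?X" for y
    using that x(2) matchingsD(4)[OF \<tau>] matching_inj[OF \<tau>, of y x] by auto
  have skip: "c (?f y) = c (f y)" if "c (f x) = c x" for c :: "'x \<Rightarrow> nat" and y
    using that by (auto simp: bypass_def)
  fix c assume c: "c \<in> balanced f \<tau> X"
  have cx: "c (f x) = c x" by (rule balancedD(4)[OF c x(1,2)])
  let ?c = "restrict c ?X"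
  have c': "?c y = c y" if "y \<in> ?X" for y using that by simp
  show "?c(x := ?c (f x)) = c"
  proof
    fix y
    have "f x \<in> ?X" using perm_on_in[OF p x(1)] x(3) by blast
    then show "(?c(x := ?c (f x))) y = c y" using cx balanced_arb[OF c, of y] by (cases "y = x"; cases "y \<in> X") simp_all
  qed
  show "?c \<in> balanced ?f \<tau> ?X"
    unfolding balanced_def mem_Collect_eq
  proof (intro conjI ballI)
    show "?c \<in> ?X \<rightarrow>\<^sub>E {1, 2}" using balancedD(1)[OF c] by auto
    fix y assume y: "y \<in> ?X"
    then have yX: "y \<in> X" by blast
    show "\<tau> y \<noteq> y \<longrightarrow> ?c (\<tau> y) \<noteq> ?c y \<and> ?c (?f (\<tau> y)) \<noteq> ?c (?f y)"
      unfolding c'[OF y] c'[OF \<tau>'X[OF y]] c'[OF f'X[OF y]] c'[OF f'X[OF \<tau>'X[OF y]]] skip[OF cx]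
      using balancedD(2,3)[OF c yX] by blast
    show "\<tau> y = y \<longrightarrow> ?c (?f y) = ?c y"
      unfolding c'[OF y] c'[OF f'X[OF y]] skip[OF cx] using balancedD(4)[OF c yX] by blast
  qed
  have "(\<Prod>y\<in>F. sg ?c y (\<tau> y)) = (\<Prod>y\<in>F. sg c y (\<tau> y) :: int)"
  proof (rule prod.cong[OF refl])
    fix y assume "y \<in> F"
    then have y: "y \<in> ?X" using x(2) by (auto simp: F fwd_points_def)
    show "sg ?c y (\<tau> y) = (sg c y (\<tau> y) :: int)" unfolding sg_def c'[OF y] c'[OF \<tau>'X[OF y]] ..
  qed
  moreover have "card (orbit (colour_step ?f \<tau> ?c) ` {y \<in> ?X. ?c y = 1}) = card (orbit (colour_step f \<tau> c) ` {y \<in> X. c y = 1})"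
  proof -
    let ?Y = "{y \<in> X. c y = 1}" let ?p = "colour_step f \<tau> c"
    note pY = perm_on_colour_step[OF c, of 1]
    have Y: "{y \<in> ?X. ?c y = 1} = ?Y - {x}" by auto
    have px: "?p x = f x" by (simp add: colour_step_def cx)
    have step: "colour_step ?f \<tau> ?c y = bypass x ?p y" if "y \<in> ?X" for y
      unfolding colour_step_def[of ?f] c'[OF that] c'[OF f'X[OF that]] skip[OF cx] bypass_def[of x ?p] px
      by (cases "f y = x") (auto simp: colour_step_def bypass_def)
    show ?thesis
    proof (cases "x \<in> ?Y")
      case True
      have "card (orbit (colour_step ?f \<tau> ?c) ` (?Y - {x})) = card (orbit (bypass x ?p) ` (?Y - {x}))"
        by (rule card_orbits_cong[OF perm_on_bypass[OF pY True]]) (use step px x(3) in auto)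
      also have "\<dots> = card (orbit ?p ` ?Y)"
        by (rule card_orbits_bypass[OF pY True]) (simp add: px x(3))
      finally show ?thesis unfolding Y .
    next
      case False
      have "?p y = colour_step ?f \<tau> ?c y" if y: "y \<in> ?Y" for y
      proof -
        have "?p y \<noteq> x" using perm_on_in[OF pY y] False by blast
        moreover have "y \<in> ?X" using y False by blast
        ultimately show ?thesis unfolding step[OF \<open>y \<in> ?X\<close>] by (simp add: bypass_def)
      qed
      then have "card (orbit (colour_step ?f \<tau> ?c) ` ?Y) = card (orbit ?p ` ?Y)" by (rule card_orbits_cong[OF pY])
      moreover have "?Y - {x} = ?Y" using False by blast
      ultimately show ?thesis unfolding Y by simp
    qed
  qed
  ultimately show "antipode_weight ?f \<tau> F ?X ?c = antipode_weight f \<tau> F X c"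
    by (simp only: antipode_weight_def)
next
  let ?f = "bypass x f" let ?X = "X - {x}"
  fix c assume c: "c \<in> balanced ?f \<tau> ?X"
  let ?c = "c(x := c (f x))"
  have fx: "f x \<in> ?X" using perm_on_in[OF p x(1)] x(3) by blast
  show "restrict ?c ?X = c"
  proof
    fix y show "restrict ?c ?X y = c y" using balanced_arb[OF c, of y] by (cases "y \<in> ?X") auto
  qed
  have cf: "?c (f y) = c (?f y)" for y using x(3) by (auto simp: bypass_def)
  show "?c \<in> balanced f \<tau> X"
    unfolding balanced_def mem_Collect_eq
  proof (intro conjI ballI)
    show "?c \<in> X \<rightarrow>\<^sub>E {1, 2}"
    proof (rule PiE_I)
      fix y assume "y \<in> X"
      then show "?c y \<in> {1, 2}" using balancedD(1)[OF c, of y] balancedD(1)[OF c fx] by (cases "y = x") auto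
    next
      fix y assume "y \<notin> X"
      then show "?c y = undefined" using x(1) balanced_arb[OF c, of y] by auto
    qed
    fix y assume y: "y \<in> X"
    show "\<tau> y \<noteq> y \<longrightarrow> ?c (\<tau> y) \<noteq> ?c y \<and> ?c (f (\<tau> y)) \<noteq> ?c (f y)"
    proof
      assume m: "\<tau> y \<noteq> y"
      then have "y \<noteq> x" "\<tau> y \<noteq> x" using x(2) matching_inj[OF \<tau>, of y x] by auto
      then show "?c (\<tau> y) \<noteq> ?c y \<and> ?c (f (\<tau> y)) \<noteq> ?c (f y)"
        unfolding cf using balancedD(2,3)[OF c _ m] y by simp
    qed
    show "\<tau> y = y \<longrightarrow> ?c (f y) = ?c y"
    proof (cases "y = x")
      case True
      then show ?thesis using x(3) by simp
    next
      case False
      then show ?thesis unfolding cf using balancedD(4)[OF c, of y] y by simp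
    qed
  qed
qed


end

context
  fixes f \<tau> :: "'x \<Rightarrow> 'x" and lab :: "'x \<Rightarrow> 'v \<times> 'e darc option" and X
  assumes p: "perm_on f X" and \<tau>: "\<tau> \<in> matchings lab X"
begin

text \<open>If every point is matched, let \<open>\<tau>'\<close> be the conjugate of \<open>\<tau>\<close> by \<open>f\<close>. Both reverse colours, so a
  colouring remains balanced when the colours are exchanged on an orbit of the group generated by \<open>\<tau>\<close>
  and \<open>\<tau>'\<close>. If \<open>n\<close> is the length of the corresponding cycle of \<open>\<tau> \<circ> \<tau>'\<close>, then this changes \<open>n\<close> of the
  signs, and the permutation of the first colour class is, up to conjugation, composed with a cycle
  of length \<open>n\<close>, whose sign is \<open>(-1)\<^sup>n\<^sup>-\<^sup>1\<close>.\<close>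

lemma sum_antipode_weight_matched:
  assumes x0: "x0 \<in> X" and moved: "\<And>x. x \<in> X \<Longrightarrow> \<tau> x \<noteq> x"
  shows "(\<Sum>c\<in>balanced f \<tau> X. antipode_weight f \<tau> (fwd_points lab X \<tau>) X c) = 0"
proof -
  let ?F = "fwd_points lab X \<tau>"
  have finX: "finite X" using p by (simp add: perm_on_def)
  have finF: "finite ?F" using finX by (simp add: fwd_points_def)
  note \<tau>X = matchingsD(4)[OF \<tau>] and \<tau>\<tau> = matchingsD(2)[OF \<tau>] and fX = perm_on_in[OF p]
  \<comment> \<open>Pairs \<open>f x\<close> with \<open>f (\<tau> x)\<close>, the other two points
    at which a balanced colouring has to differ.\<close>
  define \<tau>' where "\<tau>' x = f (\<tau> (inv_into X f x))" for x
  have \<tau>'f: "\<tau>' (f x) = f (\<tau> x)" if "x \<in> X" for x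
    using p that by (simp add: \<tau>'_def perm_on_def bij_betw_def inv_into_f_f)
  have \<tau>'X: "\<tau>' x \<in> X" and \<tau>'\<tau>': "\<tau>' (\<tau>' x) = x" if x: "x \<in> X" for x
  proof -
    obtain y where y: "y \<in> X" "f y = x" using perm_on_surj[OF p x] by blast
    have eq: "\<tau>' x = f (\<tau> y)" using \<tau>'f[OF y(1)] y(2) by simp
    show "\<tau>' x \<in> X" unfolding eq by (rule fX[OF \<tau>X[OF y(1)]])
    show "\<tau>' (\<tau>' x) = x" unfolding eq \<tau>'f[OF \<tau>X[OF y(1)]] \<tau>\<tau> by (rule y(2))
  qed
  define \<rho> where "\<rho> x = \<tau> (\<tau>' x)" for x
  have \<rho>: "perm_on \<rho> X"
  proof (rule perm_onI[OF finX])
    fix x y assume xy: "x \<in> X" "y \<in> X" "\<rho> x = \<rho> y"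
    then have "\<tau>' x = \<tau>' y" by (simp add: \<rho>_def matching_inj[OF \<tau>])
    then show "x = y" using \<tau>'\<tau>'[OF xy(1)] \<tau>'\<tau>'[OF xy(2)] by metis
  qed (simp add: \<rho>_def \<tau>X \<tau>'X)
  define C where "C = orbit \<rho> x0"
  have OX: "C \<subseteq> X" unfolding C_def by (rule orbit_subset_perm_on[OF \<rho> x0])
  have \<rho>C: "\<rho> x \<in> C" if "x \<in> C" for x using that unfolding C_def by (rule orbit.step)
  \<comment> \<open>\<open>\<tau>' \<circ> \<tau>\<close> is the inverse of \<open>\<rho>\<close> on
    \<open>X\<close>, and a cycle of \<open>\<rho>\<close> is closed under it.\<close>
  have pred_C: "\<tau>' (\<tau> x) \<in> C" if x: "x \<in> C" for x
  proof -
    have xX: "x \<in> X" using x OX by blast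
    let ?z = "\<tau>' (\<tau> x)"
    have z: "?z \<in> X" by (rule \<tau>'X[OF \<tau>X[OF xX]])
    have \<rho>z: "\<rho> ?z = x" unfolding \<rho>_def \<tau>'\<tau>'[OF \<tau>X[OF xX]] by (rule \<tau>\<tau>)
    have "orbit \<rho> ?z = orbit \<rho> x" using orbit_step_eq[OF \<rho> z] unfolding \<rho>z by simp
    also have "\<dots> = C" using orbit_eq_of_mem[OF \<rho> x0] x unfolding C_def by blast
    finally show ?thesis using self_in_orbit[OF \<rho> z] by simp
  qed
  \<comment> \<open>A dihedral orbit: the cycle \<open>C\<close> of the rotation
    \<open>\<rho>\<close> together with its mirror image under \<open>\<tau>\<close>.\<close>
  define D where "D = C \<union> \<tau> ` C"
  have DX: "D \<subseteq> X" unfolding D_def using OX \<tau>X by blast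
  have \<tau>D0: "\<tau> x \<in> D" if "x \<in> D" for x using that \<tau>\<tau> unfolding D_def by auto
  have \<tau>D: "\<tau> x \<in> D \<longleftrightarrow> x \<in> D" for x using \<tau>D0[of x] \<tau>D0[of "\<tau> x"] \<tau>\<tau>[of x] by auto
  have \<tau>'D0: "\<tau>' x \<in> D" if x: "x \<in> D" for x
  proof (cases "x \<in> C")
    case True
    have "\<tau>' x = \<tau> (\<rho> x)" unfolding \<rho>_def by (simp add: \<tau>\<tau>)
    then show ?thesis unfolding D_def using \<rho>C[OF True] by blast
  next
    case False
    then show ?thesis using x pred_C unfolding D_def by blast
  qed
  \<comment> \<open>The two points are partners under \<open>\<tau>'\<close>, and \<open>D\<close>
    is closed under \<open>\<tau>'\<close>.\<close>
  have fD: "f (\<tau> x) \<in> D \<longleftrightarrow> f x \<in> D" if "x \<in> X" for x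
    using \<tau>'D0[of "f x"] \<tau>'D0[of "f (\<tau> x)"] \<tau>'f[OF that] \<tau>'f[OF \<tau>X[OF that]] \<tau>\<tau>[of x] by auto
  let ?h = "\<lambda>c. \<lambda>x\<in>X. if x \<in> D then 3 - c x else (c x :: nat)"
  have on_D: "?h c x = 3 - c x" if "x \<in> D" for c x using that DX by auto
  have off_D: "?h c x = c x" if "x \<in> X" "x \<notin> D" for c x using that by simp
  have hb: "?h c \<in> balanced f \<tau> X" if c: "c \<in> balanced f \<tau> X" for c
  proof -
    have flip: "?h c a \<noteq> ?h c b" if "a \<in> X" "b \<in> X" "c a \<noteq> c b" "a \<in> D \<longleftrightarrow> b \<in> D" for a b
      using that balancedD(1)[OF c that(1)] balancedD(1)[OF c that(2)] by auto
    show ?thesis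
      unfolding balanced_def mem_Collect_eq
    proof (intro conjI ballI impI)
      show "?h c \<in> X \<rightarrow>\<^sub>E {1, 2}"
      proof (rule PiE_I)
        fix x assume "x \<in> X"
        then show "?h c x \<in> {1, 2}" using balancedD(1)[OF c] by fastforce
      qed simp
      fix x assume x: "x \<in> X"
      show "?h c (\<tau> x) \<noteq> ?h c x" by (rule flip[OF \<tau>X[OF x] x balancedD(2)[OF c x moved[OF x]] \<tau>D])
      show "?h c (f (\<tau> x)) \<noteq> ?h c (f x)"
        by (rule flip[OF fX[OF \<tau>X[OF x]] fX[OF x] balancedD(3)[OF c x moved[OF x]] fD[OF x]])
      show "?h c (f x) = ?h c x" if "\<tau> x = x" using moved[OF x] that by blast
    qed
  qed
  have hh: "?h (?h c) = c" if c: "c \<in> balanced f \<tau> X" for c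
  proof
    fix x show "?h (?h c) x = c x"
      using balancedD(1)[OF c, of x] balanced_arb[OF c, of x] by (cases "x \<in> X"; cases "x \<in> D") auto
  qed
  have one: "antipode_weight f \<tau> ?F X (?h c) = - antipode_weight f \<tau> ?F X c"
    if c: "c \<in> balanced f \<tau> X" and c1: "c x0 = 1" for c
  proof -
    \<comment> \<open>Each of the two involutions reverses colours, so the rotation keeps them:
      \<open>C\<close> has colour 1 throughout and its mirror image colour 2.\<close>
    have c\<rho>: "c (\<rho> x) = c x" if x: "x \<in> X" for x
    proof -
      obtain y where y: "y \<in> X" "f y = x" using perm_on_surj[OF p x] by blast
      have "c (\<tau>' x) \<noteq> c x" using balancedD(3)[OF c y(1) moved[OF y(1)]] \<tau>'f[OF y(1)] y(2) by simp
      moreover have "c (\<rho> x) \<noteq> c (\<tau>' x)"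
        unfolding \<rho>_def by (rule balancedD(2)[OF c \<tau>'X[OF x] moved[OF \<tau>'X[OF x]]])
      ultimately show ?thesis
        using balancedD(1)[OF c x] balancedD(1)[OF c \<tau>'X[OF x]] balancedD(1)[OF c perm_on_in[OF \<rho> x]] by auto
    qed
    have cO: "c x = 1" if "x \<in> C" for x
      using that unfolding C_def
    proof (induction rule: orbit.induct)
      case base
      then show ?case using c\<rho>[OF x0] c1 by simp
    next
      case (step y)
      then show ?case using c\<rho>[of y] OX unfolding C_def by auto
    qed
    have c\<tau>C: "c (\<tau> x) = 2" if "x \<in> C" for x
    proof -
      have x: "x \<in> X" using that OX by blast
      show ?thesis using balancedD(2)[OF c x moved[OF x]] balancedD(1)[OF c \<tau>X[OF x]] cO[OF that] by auto
    qed
    have DO: "x \<in> C" if "x \<in> D" "c x = 1" for x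
      using that c\<tau>C unfolding D_def by fastforce
    let ?n = "card C"
    \<comment> \<open>Each pair in \<open>D\<close> has exactly one member in \<open>C\<close> and
      exactly one forward member, so the number of signs that change is
      \<open>card C\<close>.\<close>
    have "bij_betw (\<lambda>x. if x \<in> ?F then x else \<tau> x) C (?F \<inter> D)"
      unfolding bij_betw_def
    proof
      show "inj_on (\<lambda>x. if x \<in> ?F then x else \<tau> x) C"
      proof (rule inj_onI)
        fix x y assume xy: "x \<in> C" "y \<in> C" "(if x \<in> ?F then x else \<tau> x) = (if y \<in> ?F then y else \<tau> y)"
        then show "x = y"
          using cO[OF xy(1)] cO[OF xy(2)] c\<tau>C[OF xy(1)] c\<tau>C[OF xy(2)] matching_inj[OF \<tau>, of x y]
          by (auto split: if_splits)
      qed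
      show "(\<lambda>x. if x \<in> ?F then x else \<tau> x) ` C = ?F \<inter> D"
      proof (intro equalityI subsetI)
        fix y assume "y \<in> (\<lambda>x. if x \<in> ?F then x else \<tau> x) ` C"
        then obtain x where x: "x \<in> C" "y = (if x \<in> ?F then x else \<tau> x)" by blast
        then have "x \<in> X" "\<tau> x \<noteq> x" using OX moved by auto
        then have "x \<in> ?F \<or> \<tau> x \<in> ?F"
          using is_fwd_partner[OF \<tau>, of x] \<tau>X[of x] \<tau>\<tau>[of x] by (auto simp: fwd_points_def)
        then show "y \<in> ?F \<inter> D" using x unfolding D_def by auto
      next
        fix y assume y: "y \<in> ?F \<inter> D"
        then have "\<tau> y \<notin> ?F" using is_fwd_partner[OF \<tau>, of y] by (auto simp: fwd_points_def)
        moreover have "y \<in> C \<or> \<tau> y \<in> C" using y \<tau>\<tau> unfolding D_def by auto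
        ultimately show "y \<in> (\<lambda>x. if x \<in> ?F then x else \<tau> x) ` C"
          using y \<tau>\<tau>[of y] by (auto intro: image_eqI[of _ _ y] image_eqI[of _ _ "\<tau> y"])
      qed
    qed
    then have n: "card (?F \<inter> D) = ?n" by (simp add: bij_betw_same_card)
    have "(\<Prod>x\<in>?F. sg (?h c) x (\<tau> x)) = (\<Prod>x\<in>?F. (if x \<in> D then - 1 else 1) * sg c x (\<tau> x) :: int)"
    proof (rule prod.cong[OF refl])
      fix x assume "x \<in> ?F"
      then have x: "x \<in> X" by (simp add: fwd_points_def)
      show "sg (?h c) x (\<tau> x) = (if x \<in> D then - 1 else 1) * (sg c x (\<tau> x) :: int)"
      proof (cases "x \<in> D")
        case True
        then have "\<tau> x \<in> D" by (simp add: \<tau>D)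
        have "sg (?h c) x (\<tau> x) = (sg (\<lambda>x. 3 - c x) x (\<tau> x) :: int)"
          unfolding sg_def on_D[OF True] on_D[OF \<open>\<tau> x \<in> D\<close>] ..
        then show ?thesis using True sg_flip[of c x "\<tau> x"] balancedD(1)[OF c x] balancedD(1)[OF c \<tau>X[OF x]] by simp
      next
        case False
        then have "\<tau> x \<notin> D" by (simp add: \<tau>D)
        have "sg (?h c) x (\<tau> x) = (sg c x (\<tau> x) :: int)"
          unfolding sg_def off_D[OF x False] off_D[OF \<tau>X[OF x] \<open>\<tau> x \<notin> D\<close>] ..
        then show ?thesis using False by simp
      qed
    qed
    also have "\<dots> = (- 1) ^ ?n * (\<Prod>x\<in>?F. sg c x (\<tau> x))"
      unfolding prod.distrib by (simp add: prod.If_cases[OF finF] n)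
    finally have prod: "(\<Prod>x\<in>?F. sg (?h c) x (\<tau> x)) = ((- 1) ^ ?n * (\<Prod>x\<in>?F. sg c x (\<tau> x)) :: int)" .
    let ?Y = "{x \<in> X. c x = 1}" and ?Y' = "{x \<in> X. ?h c x = 1}"
    let ?G = "colour_step f \<tau> c" and ?G' = "colour_step f \<tau> (?h c)"
    \<comment> \<open>\<open>?H\<close> is the cycle of length \<open>card C\<close> with which the
      permutation of the first colour class is composed; \<open>?\<kappa>\<close> carries the old
      class to the new one by replacing points of \<open>D\<close> by their partners.\<close>
    let ?H = "\<lambda>x. if x \<in> C then \<rho> x else x" and ?\<kappa> = "\<lambda>x. if x \<in> D then \<tau> x else x"
    have finY: "finite ?Y" using finX by simp
    have OY: "C \<subseteq> ?Y" using OX cO by blast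
    have G: "perm_on ?G ?Y" by (rule perm_on_colour_step[OF p \<tau> c])
    have H: "perm_on ?H ?Y"
    proof (rule perm_onI[OF finY])
      fix x assume "x \<in> ?Y"
      then show "?H x \<in> ?Y" using \<rho>C[of x] OY by (auto simp del: mem_Collect_eq)
    next
      fix x y assume "x \<in> ?Y" "y \<in> ?Y" "?H x = ?H y"
      then show "x = y" using \<rho>C[of x] \<rho>C[of y] perm_on_inj[OF \<rho>, of x y] by (auto split: if_splits)
    qed
    have "orbit ?H ` ?Y = insert C ((\<lambda>x. {x}) ` (?Y - C))"
    proof -
      have 1: "orbit ?H x = C" if x: "x \<in> C" for x
      proof -
        have "orbit ?H x = orbit \<rho> x"
          by (rule orbit_cong0[of _ C]) (use x \<rho>C in auto)
        then show ?thesis using orbit_eq_of_mem[OF \<rho> x0] x unfolding C_def by blast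
      qed
      have 2: "orbit ?H x = {x}" if "x \<notin> C" for x by (rule orbit_fixpoint) (simp add: that)
      have "x0 \<in> C" unfolding C_def by (rule self_in_orbit[OF \<rho> x0])
      then have "?Y = insert x0 C \<union> (?Y - C)" using OY by blast
      then have "orbit ?H ` ?Y = orbit ?H ` insert x0 C \<union> orbit ?H ` (?Y - C)" by (metis image_Un)
      also have "orbit ?H ` insert x0 C = {C}" using 1 \<open>x0 \<in> C\<close> by auto
      also have "orbit ?H ` (?Y - C) = (\<lambda>x. {x}) ` (?Y - C)" using 2 by (intro image_cong) auto
      finally show ?thesis by simp
    qed
    moreover have "C \<notin> (\<lambda>x. {x}) ` (?Y - C)" by blast
    ultimately have "card (orbit ?H ` ?Y) = Suc (card (?Y - C))"
      using finY by (simp add: card_image)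
    \<comment> \<open>The orbits of \<open>?H\<close> are \<open>C\<close> and the single points
      outside it; together with the sign changes the exponent becomes odd.\<close>
    then have "card ?Y + card (orbit ?H ` ?Y) + ?n = Suc (2 * card ?Y)"
      using card_Diff_subset[OF finite_subset[OF OY finY] OY] card_mono[OF finY OY] by simp
    then have "(- 1 :: int) ^ (card ?Y + card (orbit ?H ` ?Y)) * (- 1) ^ ?n = (- 1) ^ Suc (2 * card ?Y)"
      by (simp only: power_add[symmetric])
    then have H_sign: "(- 1 :: int) ^ (card ?Y + card (orbit ?H ` ?Y)) * (- 1) ^ ?n = - 1" by simp
    have "card (orbit ?G' ` ?Y') = card (orbit (?H \<circ> ?G) ` ?Y)"
    proof (rule card_orbits_conj[where b = ?\<kappa>])
      show "perm_on (?H \<circ> ?G) ?Y" using G H by (auto simp: perm_on_def intro: bij_betw_trans)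
      show "bij_betw ?\<kappa> ?Y ?Y'"
      proof (rule bij_betw_byWitness[where f' = ?\<kappa>])
        show "\<forall>x\<in>?Y. ?\<kappa> (?\<kappa> x) = x" "\<forall>x\<in>?Y'. ?\<kappa> (?\<kappa> x) = x" using \<tau>D \<tau>\<tau> by simp_all
        have swap: "c x = 1 \<longleftrightarrow> ?h c (?\<kappa> x) = 1" if x: "x \<in> X" for x
        proof (cases "x \<in> D")
          case True
          then have "\<tau> x \<in> D" by (simp add: \<tau>D)
          have "?h c (?\<kappa> x) = 3 - c (\<tau> x)" using on_D[OF \<open>\<tau> x \<in> D\<close>] True by simp
          then show ?thesis
            using balancedD(1)[OF c x] balancedD(1)[OF c \<tau>X[OF x]] balancedD(2)[OF c x moved[OF x]] by auto
        qed (use x in simp)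
        have \<kappa>X: "?\<kappa> x \<in> X" if "x \<in> X" for x using that \<tau>X by simp
        show "?\<kappa> ` ?Y \<subseteq> ?Y'" using swap \<kappa>X by blast
        have \<kappa>\<kappa>: "?\<kappa> (?\<kappa> x) = x" for x using \<tau>D \<tau>\<tau> by simp
        show "?\<kappa> ` ?Y' \<subseteq> ?Y"
        proof (intro subsetI, elim imageE)
          fix y x assume y: "y = ?\<kappa> x" and x: "x \<in> ?Y'"
          then have "y \<in> X" using \<kappa>X by blast
          moreover have "?h c (?\<kappa> y) = 1" unfolding y \<kappa>\<kappa> using x by blast
          ultimately show "y \<in> ?Y" using swap by blast
        qed
      qed
      fix x assume x: "x \<in> ?Y"
      then have xX: "x \<in> X" and cx: "c x = 1" by auto
      have zY: "?G x \<in> ?Y" by (rule perm_on_in[OF G x])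
      note mX = fX[OF xX] fX[OF \<tau>X[OF xX]]
      have \<kappa>x: "?h c (?\<kappa> x) = 1"
      proof (cases "x \<in> D")
        case True
        then have "\<tau> x \<in> D" by (simp add: \<tau>D)
        then show ?thesis using on_D[of "\<tau> x" c] True c\<tau>C[OF DO[OF True cx]] by simp
      qed (use xX cx in simp)
      have other: "c (f (\<tau> x)) \<noteq> c (f x)" by (rule balancedD(3)[OF c xX moved[OF xX]])
      \<comment> \<open>Of the two candidates \<open>f x\<close> and \<open>f (\<tau> x)\<close>,
        the step selects the one whose new colour is 1.\<close>
      have G': "?G' (?\<kappa> x) = (if ?h c (f x) = 1 then f x else f (\<tau> x))"
      proof (cases "x \<in> D")
        case False
        then show ?thesis using \<kappa>x by (simp add: colour_step_def)
      next
        case True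
        have "?h c (f (\<tau> x)) = 1 \<longleftrightarrow> ?h c (f x) \<noteq> 1"
        proof (cases "f x \<in> D")
          case True
          then have "f (\<tau> x) \<in> D" by (simp add: fD[OF xX])
          show ?thesis unfolding on_D[OF True] on_D[OF \<open>f (\<tau> x) \<in> D\<close>]
            using other balancedD(1)[OF c mX(1)] balancedD(1)[OF c mX(2)] by auto
        next
          case False
          then have "f (\<tau> x) \<notin> D" by (simp add: fD[OF xX])
          show ?thesis unfolding off_D[OF mX(1) False] off_D[OF mX(2) \<open>f (\<tau> x) \<notin> D\<close>]
            using other balancedD(1)[OF c mX(1)] balancedD(1)[OF c mX(2)] by auto
        qed
        moreover have "?\<kappa> x = \<tau> x" using True by simp
        ultimately show ?thesis using \<kappa>x \<tau>\<tau>[of x] unfolding colour_step_def by simp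
      qed
      show "?\<kappa> ((?H \<circ> ?G) x) = ?G' (?\<kappa> x)"
      proof (cases "f x \<in> D")
        case False
        then have f\<tau>: "f (\<tau> x) \<notin> D" by (simp add: fD[OF xX])
        have "?G x \<notin> D" using False f\<tau> by (simp add: colour_step_def)
        moreover have "?G' (?\<kappa> x) = ?G x" unfolding G' off_D[OF mX(1) False] by (simp add: colour_step_def cx)
        ultimately show ?thesis by (simp add: D_def)
      next
        case True
        then have f\<tau>: "f (\<tau> x) \<in> D" by (simp add: fD[OF xX])
        have zD: "?G x \<in> D" using True f\<tau> by (simp add: colour_step_def)
        then have zO: "?G x \<in> C" using DO zY by blast
        have "?\<kappa> ((?H \<circ> ?G) x) = \<tau> (\<rho> (?G x))" using zO \<rho>C[OF zO] by (simp add: D_def)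
        \<comment> \<open>\<open>\<tau> \<circ> \<rho>\<close> is \<open>\<tau>'\<close>: the new
          successor is the \<open>\<tau>'\<close>-partner of the old one.\<close>
        also have "\<dots> = \<tau>' (?G x)" by (simp add: \<rho>_def \<tau>\<tau>)
        also have "\<dots> = ?G' (?\<kappa> x)"
        proof (cases "c (f x) = 1")
          case True
          then have "?G x = f x" by (simp add: colour_step_def cx)
          moreover have "?h c (f x) \<noteq> 1" unfolding on_D[OF \<open>f x \<in> D\<close>] using True by simp
          ultimately show ?thesis unfolding G' using \<tau>'f[OF xX] by simp
        next
          case False
          then have "?G x = f (\<tau> x)" by (simp add: colour_step_def cx)
          moreover have "?h c (f x) = 1" unfolding on_D[OF \<open>f x \<in> D\<close>] using False balancedD(1)[OF c mX(1)] by simp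
          ultimately show ?thesis unfolding G' using \<tau>'f[OF \<tau>X[OF xX]] \<tau>\<tau>[of x] by simp
        qed
        finally show ?thesis .
      qed
    qed
    then have "(- 1 :: int) ^ card (orbit ?G' ` ?Y') = (- 1) ^ (card ?Y + card (orbit ?H ` ?Y)) * (- 1) ^ card (orbit ?G ` ?Y)"
      by (simp only: parity_orbits_comp[OF G H])
    then have "antipode_weight f \<tau> ?F X (?h c) = (- 1) ^ ?n * (\<Prod>x\<in>?F. sg c x (\<tau> x))
        * ((- 1) ^ (card ?Y + card (orbit ?H ` ?Y)) * (- 1) ^ card (orbit ?G ` ?Y))"
      by (simp only: antipode_weight_def prod)
    also have "\<dots> = ((- 1) ^ (card ?Y + card (orbit ?H ` ?Y)) * (- 1) ^ ?n) * antipode_weight f \<tau> ?F X c"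
      by (simp only: antipode_weight_def mult_ac)
    finally show ?thesis unfolding H_sign by simp
  qed
  show ?thesis
  proof (rule sum_sign_reversing[where h = ?h])
    fix c assume c: "c \<in> balanced f \<tau> X"
    show "antipode_weight f \<tau> ?F X (?h c) = - antipode_weight f \<tau> ?F X c"
    proof (cases "c x0 = 1")
      case False
      have "x0 \<in> D" unfolding D_def C_def using self_in_orbit[OF \<rho> x0] by blast
      \<comment> \<open>If \<open>x0\<close> has colour 2, the exchanged colouring is covered by
        \<open>one\<close>, and exchanging again gives back \<open>c\<close>.\<close>
      then have "?h c x0 = 1" using on_D[of x0 c] False balancedD(1)[OF c x0] by simp
      from one[OF hb[OF c] this] show ?thesis unfolding hh[OF c] by linarith
    qed (rule one[OF c])
  qed (fact hb hh)+
qed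

end

text \<open>Unmatched points are removed until one of them is a fixed point or all points are
  matched. The set stays nonempty, as only points on longer cycles are deleted.\<close>

lemma sum_antipode_weight:
  assumes "perm_on f X" "\<tau> \<in> matchings lab X" "X \<noteq> {}"
  shows "(\<Sum>c\<in>balanced f \<tau> X. antipode_weight f \<tau> (fwd_points lab X \<tau>) X c) = 0"
  using assms
proof (induction "card X" arbitrary: f X)
  case 0
  then show ?case by (simp add: perm_on_def)
next
  case (Suc n)
  note p = Suc.prems(1) and \<tau> = Suc.prems(2)
  show ?case
  proof (cases "\<exists>x\<in>X. \<tau> x = x")
    case False
    obtain x0 where "x0 \<in> X" using Suc.prems(3) by blast
    then show ?thesis using False by (intro sum_antipode_weight_matched[OF p \<tau>]) auto
  next
    case True
    then obtain x where x: "x \<in> X" "\<tau> x = x" by blast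
    show ?thesis
    proof (cases "f x = x")
      case True
      then show ?thesis by (rule sum_antipode_weight_fixed[OF p \<tau> x])
    next
      case False
      let ?X = "X - {x}"
      have \<tau>': "\<tau> \<in> matchings lab ?X"
        by (rule matching_restrict[OF \<tau>]) (use matchingsD(3)[OF \<tau>] x(2) in auto)
      have "fwd_points lab X \<tau> = fwd_points lab ?X \<tau>" using x(2) by (auto simp: fwd_points_def)
      then have "(\<Sum>c\<in>balanced f \<tau> X. antipode_weight f \<tau> (fwd_points lab X \<tau>) X c)
          = (\<Sum>c\<in>balanced (bypass x f) \<tau> ?X. antipode_weight (bypass x f) \<tau> (fwd_points lab ?X \<tau>) ?X c)"
        using sum_antipode_weight_bypass[OF p \<tau> x False refl] by simp
      also have "\<dots> = 0"
      proof (rule Suc.hyps(1))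
        show "n = card ?X" using Suc.hyps(2) x(1) p by (simp add: perm_on_def)
        show "perm_on (bypass x f) ?X" by (rule perm_on_bypass[OF p x(1) False])
        show "?X \<noteq> {}" using perm_on_in[OF p x(1)] False by blast
      qed (rule \<tau>')
      finally show ?thesis .
    qed
  qed
qed

section \<open>The antipode\<close>

lemma of_int_sg: "(of_int (sg c x y) :: 'r::comm_ring_1) = sg c x y"
  by (simp add: sg_def)

text \<open>Exchanging the two colours reverses the sign of every pair. This reduces the antipode on
  the second tensor factor to that on the first.\<close>

lemma sum_colourings_flip:
  assumes p: "perm_on h X" and F: "\<And>x. x \<in> F \<Longrightarrow> x \<in> X \<and> \<tau> x \<in> X"
  shows "(\<Sum>c\<in>colourings {1, 2} h X. (\<Prod>x\<in>F. sg c x (\<tau> x)) * (- 1) ^ card (orbit h ` {x \<in> X. c x = 2}))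
    = (- 1) ^ card F * (\<Sum>c\<in>colourings {1, 2} h X. (\<Prod>x\<in>F. sg c x (\<tau> x)) * (- 1) ^ card (orbit h ` {x \<in> X. c x = 1}) :: int)"
  unfolding sum_distrib_left
proof (rule sum.reindex_bij_witness[where i = "\<lambda>c. \<lambda>x\<in>X. 3 - c x" and j = "\<lambda>c. \<lambda>x\<in>X. 3 - c x"])
  fix c :: "'a \<Rightarrow> nat" assume c: "c \<in> colourings {1, 2} h X"
  then have c12: "c x = 1 \<or> c x = 2" if "x \<in> X" for x using that by (auto simp: colourings_def)
  have arb: "c x = undefined" if "x \<notin> X" for x using c that by (auto simp: colourings_def PiE_iff extensional_def)
  let ?c = "\<lambda>x\<in>X. 3 - c x"
  show inv: "(\<lambda>x\<in>X. 3 - ?c x) = c"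
  proof
    fix x show "(\<lambda>x\<in>X. 3 - ?c x) x = c x" using c12[of x] arb[of x] by (cases "x \<in> X") auto
  qed
  then show "(\<lambda>x\<in>X. 3 - ?c x) = c" .
  show "?c \<in> colourings {1, 2} h X"
    using c12 c perm_on_in[OF p] by (fastforce simp: colourings_def)
  then show "?c \<in> colourings {1, 2} h X" .
  have "(\<Prod>x\<in>F. sg ?c x (\<tau> x)) = (\<Prod>x\<in>F. - 1 * sg c x (\<tau> x) :: int)"
  proof (rule prod.cong[OF refl])
    fix x assume "x \<in> F"
    then have x: "x \<in> X" "\<tau> x \<in> X" using F by auto
    have "sg ?c x (\<tau> x) = (sg (\<lambda>x. 3 - c x) x (\<tau> x) :: int)" using x by (simp add: sg_def)
    then show "sg ?c x (\<tau> x) = (- 1 * sg c x (\<tau> x) :: int)" using sg_flip[of c x "\<tau> x"] c12[OF x(1)] c12[OF x(2)] by simp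
  qed
  also have "\<dots> = (- 1) ^ card F * (\<Prod>x\<in>F. sg c x (\<tau> x))" by (simp only: prod.distrib prod_constant)
  finally have prod: "(\<Prod>x\<in>F. sg ?c x (\<tau> x)) = ((- 1) ^ card F * (\<Prod>x\<in>F. sg c x (\<tau> x)) :: int)" .
  have "{x \<in> X. ?c x = 1} = {x \<in> X. c x = 2}" using c12 by fastforce
  then show "(- 1) ^ card F * ((\<Prod>x\<in>F. sg ?c x (\<tau> x)) * (- 1) ^ card (orbit h ` {x \<in> X. ?c x = 1}))
      = ((\<Prod>x\<in>F. sg c x (\<tau> x)) * (- 1) ^ card (orbit h ` {x \<in> X. c x = 2}) :: int)"
    unfolding prod by (simp add: mult.assoc[symmetric] power_add[symmetric])
qed

text \<open>The product multiplies the two tensor factors of the coproduct, so one colouring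
  \<open>c\<close> gives the signs of both contractions. \<open>k\<close> is the tensor factor to
  which the antipode is applied.\<close>

lemma antipode_sum:
  fixes Q :: "('v, 'e) pre_digraph" and f :: "'x \<Rightarrow> 'x"
  assumes w: "wfc Q f lab X" and X: "X \<noteq> {}" and k: "k \<in> {1, 2}"
  shows "(\<Sum>\<theta>\<in>matchings lab X. \<Sum>c\<in>colourings {1, 2} (f \<circ> \<theta>) X.
      scl (wt (sg c) lab X \<theta> * (- 1) ^ card (orbit (f \<circ> \<theta>) ` {x \<in> X. c x = k}))
        (prod_sum (f \<circ> \<theta>) (cut_label \<theta> lab) c X)) = (0 :: _ \<Rightarrow>\<^sub>0 'k::field_char_0 poly)"
proof -
  note p = wfc_perm_on[OF w] and fin = wfc_finite[OF w]
  have finF: "finite (fwd_points lab X \<tau>)" for \<tau> using fin by (simp add: fwd_points_def)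
  let ?s = "\<lambda>\<theta> c. (- 1) ^ card (orbit (f \<circ> \<theta>) ` {x \<in> X. c x = k})"
  let ?b = "\<lambda>\<tau>. basis_vec (coll (f \<circ> \<tau>) (cut_label \<tau> lab) X) :: _ \<Rightarrow>\<^sub>0 'k poly"
  let ?T = "\<lambda>\<theta> \<theta>'. \<Sum>c\<in>colourings {1, 2} (f \<circ> \<theta>) X.
      scl (wt (sg c) lab X \<theta> * ?s \<theta> c * wt (sg c) (cut_label \<theta> lab) X \<theta>') (?b (\<theta> \<circ> \<theta>'))"
  have "(\<Sum>\<theta>\<in>matchings lab X. \<Sum>c\<in>colourings {1, 2} (f \<circ> \<theta>) X.
      scl (wt (sg c) lab X \<theta> * ?s \<theta> c) (prod_sum (f \<circ> \<theta>) (cut_label \<theta> lab) c X))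
    = (\<Sum>\<theta>\<in>matchings lab X. \<Sum>\<theta>'\<in>matchings (cut_label \<theta> lab) X. ?T \<theta> \<theta>')"
  proof (rule sum.cong[OF refl])
    fix \<theta> assume \<theta>: "\<theta> \<in> matchings lab X"
    have "(\<Sum>c\<in>colourings {1, 2} (f \<circ> \<theta>) X. scl (wt (sg c) lab X \<theta> * ?s \<theta> c) (prod_sum (f \<circ> \<theta>) (cut_label \<theta> lab) c X))
      = (\<Sum>c\<in>colourings {1, 2} (f \<circ> \<theta>) X. \<Sum>\<theta>'\<in>matchings (cut_label \<theta> lab) X.
          scl (wt (sg c) lab X \<theta> * ?s \<theta> c * wt (sg c) (cut_label \<theta> lab) X \<theta>') (?b (\<theta> \<circ> \<theta>')))"
      unfolding prod_sum_def scl_sum scl_scl by (intro sum.cong refl) (simp only: matchings_cut(5)[OF \<theta>] comp_assoc)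
    also have "\<dots> = (\<Sum>\<theta>'\<in>matchings (cut_label \<theta> lab) X. ?T \<theta> \<theta>')" by (rule sum.swap)
    finally show "(\<Sum>c\<in>colourings {1, 2} (f \<circ> \<theta>) X. scl (wt (sg c) lab X \<theta> * ?s \<theta> c) (prod_sum (f \<circ> \<theta>) (cut_label \<theta> lab) c X))
      = (\<Sum>\<theta>'\<in>matchings (cut_label \<theta> lab) X. ?T \<theta> \<theta>')" .
  qed
  also have "\<dots> = (\<Sum>\<tau>\<in>matchings lab X. \<Sum>U\<in>Pow (fwd_points lab X \<tau>). ?T (part \<tau> U) (part \<tau> (fwd_points lab X \<tau> - U)))"
    by (rule sum_nested_matchings[OF fin])
  also have "\<dots> = 0"
  proof (rule sum.neutral, rule ballI)
    fix \<tau> assume \<tau>: "\<tau> \<in> matchings lab X"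
    let ?F = "fwd_points lab X \<tau>"
    have F: "x \<in> X \<and> \<tau> x \<in> X" if "x \<in> ?F" for x using that matchingsD(4)[OF \<tau>] by (auto simp: fwd_points_def)
    \<comment> \<open>The contribution of \<open>U\<close> to the coefficient of the composite
      matching \<open>\<tau>\<close>, freed from the power of \<open>h/2\<close>: an integer, for
      which the cancellation has been shown.\<close>
    let ?Z = "\<lambda>k U. \<Sum>c\<in>colourings {1, 2} (f \<circ> part \<tau> U) X.
        (\<Prod>x\<in>?F. sg c x (\<tau> x)) * (- 1) ^ card (orbit (f \<circ> part \<tau> U) ` {x \<in> X. c x = k}) :: int"
    have Z1: "(\<Sum>U\<in>Pow ?F. ?Z 1 U) = 0"
      unfolding sum_balanced[OF p \<tau>] by (rule sum_antipode_weight[OF p \<tau> X])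
    have Zk: "(\<Sum>U\<in>Pow ?F. ?Z k U) = 0"
    proof (cases "k = 1")
      case False
      then have k2: "k = 2" using k by blast
      have "(\<Sum>U\<in>Pow ?F. ?Z 2 U) = (\<Sum>U\<in>Pow ?F. (- 1) ^ card ?F * ?Z 1 U)"
      proof (rule sum.cong[OF refl])
        fix U assume "U \<in> Pow ?F"
        then have "part \<tau> U \<in> matchings lab X" using part_props(1)[OF \<tau>] by blast
        then show "?Z 2 U = (- 1) ^ card ?F * ?Z 1 U"
          by (intro sum_colourings_flip perm_on_glue[OF p] F)
      qed
      then show ?thesis unfolding k2 sum_distrib_left[symmetric] Z1 by simp
    qed (use Z1 in simp)
    have "?T (part \<tau> U) (part \<tau> (?F - U)) = scl (half_h (card ?F) * of_int (?Z k U)) (?b \<tau>)" if "U \<in> Pow ?F" for U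
    proof -
      have U: "U \<subseteq> ?F" using that by blast
      have "wt (sg c) lab X (part \<tau> U) * ?s (part \<tau> U) c * wt (sg c) (cut_label (part \<tau> U) lab) X (part \<tau> (?F - U))
        = (half_h (card ?F) * of_int ((\<Prod>x\<in>?F. sg c x (\<tau> x)) * ?s (part \<tau> U) c) :: 'k poly)" for c
      proof -
        have "wt (sg c) lab X (part \<tau> U) * wt (sg c) (cut_label (part \<tau> U) lab) X (part \<tau> (?F - U))
          = (\<Prod>x\<in>?F. half_h 1 * sg c x (\<tau> x) :: 'k poly)"
          unfolding wt_part[OF \<tau> U] by (subst mult.commute) (rule prod.subset_diff[OF U finF, symmetric])
        also have "\<dots> = half_h (card ?F) * of_int (\<Prod>x\<in>?F. sg c x (\<tau> x))"
          by (simp only: prod.distrib prod_constant half_h_power of_int_prod of_int_sg)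
        finally show ?thesis by (simp add: mult_ac)
      qed
      then show ?thesis
        by (simp only: part_props(5)[OF \<tau> U] scl_sum_left[symmetric] of_int_sum sum_distrib_left)
    qed
    then have "(\<Sum>U\<in>Pow ?F. ?T (part \<tau> U) (part \<tau> (?F - U))) = (\<Sum>U\<in>Pow ?F. scl (half_h (card ?F) * of_int (?Z k U)) (?b \<tau>))"
      by (rule sum.cong[OF refl])
    also have "\<dots> = scl (half_h (card ?F) * of_int (\<Sum>U\<in>Pow ?F. ?Z k U)) (?b \<tau>)"
      by (simp only: scl_sum_left of_int_sum sum_distrib_left)
    finally show "(\<Sum>U\<in>Pow ?F. ?T (part \<tau> U) (part \<tau> (?F - U))) = 0" unfolding Zk by simp
  qed
  finally show ?thesis .
qed

lemma antipode_h_basis: "antipode_h (basis_vec P) = scl ((- 1) ^ size P) (basis_vec P)"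
  by (simp add: antipode_h_def)

lemma antipode_h_antipode_h:
  assumes "p \<in> free_mod B"
  shows "antipode_h (antipode_h p) = p"
proof (rule klinear_basis_eqI[OF _ _ assms])
  have lin: "klinear antipode_h" unfolding antipode_h_def by (rule klinear_lin_ext)
  show "klinear (\<lambda>p. antipode_h (antipode_h p))" by (rule klinear_compose[OF lin lin])
  show "antipode_h (antipode_h (basis_vec P)) = basis_vec P" for P
    by (simp add: antipode_h_basis klinearD(2)[OF lin] power_add[symmetric])
qed (rule klinear_id)

text \<open>The size of a tensor factor is the number of cycles of its colour, which brings the sums
  into the form of \<open>antipode_sum\<close>. The empty collection, which has no points, is
  treated apart.\<close>

lemma antipode_h_identity:
  fixes Q :: "('v, 'e) pre_digraph"
  assumes wf: "wf_digraph Q" and P: "P \<in> collections Q"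
  shows "mult_map (star_h Q) (tensor_map antipode_h id (Delta_h_basis Q P)) = scl (if P = {#} then 1 else 0) (basis_vec {#} :: _ \<Rightarrow>\<^sub>0 'k::field_char_0 poly)"
    and "mult_map (star_h Q) (tensor_map id antipode_h (Delta_h_basis Q P)) = scl (if P = {#} then 1 else 0) (basis_vec {#} :: _ \<Rightarrow>\<^sub>0 'k poly)"
proof -
  have mult_basis: "mult_map (star_h Q) (tensor_map antipode_h id (basis_vec (a, b))) = scl ((- 1) ^ size a) (star_h_basis Q a b :: _ \<Rightarrow>\<^sub>0 'k poly)"
    "mult_map (star_h Q) (tensor_map id antipode_h (basis_vec (a, b))) = scl ((- 1) ^ size b) (star_h_basis Q a b :: _ \<Rightarrow>\<^sub>0 'k poly)" for a b
    by (simp_all add: mult_map_def tensor_map_def antipode_h_basis klinearD(2)[OF klinear_tensor(1)] klinearD(2)[OF klinear_tensor(2)]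
        lin_ext_scl star_h_def)
  note lin = klinear_compose[OF klinear_mult_map klinear_tensor_map]
  have "mult_map (star_h Q) (tensor_map antipode_h id (Delta_h_basis Q P)) = scl (if P = {#} then 1 else 0) (basis_vec {#} :: _ \<Rightarrow>\<^sub>0 'k poly)
    \<and> mult_map (star_h Q) (tensor_map id antipode_h (Delta_h_basis Q P)) = scl (if P = {#} then 1 else 0) (basis_vec {#} :: _ \<Rightarrow>\<^sub>0 'k poly)"
  proof (cases "P = {#}")
    case True
    then show ?thesis
      by (simp add: Delta_h_basis_unit[OF wf] mult_basis star_h_basis_unit[OF wf empty_in_collections])
  next
    case False
    obtain f :: "nat \<times> nat \<Rightarrow> nat \<times> nat" and lab X where w: "wfc Q f lab X" and c: "coll f lab X = P"
      by (rule configuration_of_one[OF wf P]) (rule that; assumption)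
    have X: "X \<noteq> {}" using False c by auto
    let ?G = "\<lambda>\<theta> c k. coll (f \<circ> \<theta>) (cut_label \<theta> lab) {x \<in> X. c x = (k::nat)}"
    have D: "(Delta_h_basis Q P :: _ \<Rightarrow>\<^sub>0 'k poly) = (\<Sum>\<theta>\<in>matchings lab X. \<Sum>c\<in>colourings {1, 2} (f \<circ> \<theta>) X.
        scl (wt (sg c) lab X \<theta>) (basis_vec (?G \<theta> c 1, ?G \<theta> c 2)))"
      unfolding c[symmetric] Delta_h_basis_coll[OF wf w] cop_sum_def ..
    have state: "(\<Sum>\<theta>\<in>matchings lab X. \<Sum>c\<in>colourings {1, 2} (f \<circ> \<theta>) X. scl (wt (sg c) lab X \<theta>)
        (scl ((- 1) ^ size (?G \<theta> c k)) (star_h_basis Q (?G \<theta> c 1) (?G \<theta> c 2)))) = (0 :: _ \<Rightarrow>\<^sub>0 'k poly)"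
      if k: "k \<in> {1, 2}" for k
    proof -
      have "(\<Sum>\<theta>\<in>matchings lab X. \<Sum>c\<in>colourings {1, 2} (f \<circ> \<theta>) X. scl (wt (sg c) lab X \<theta>)
          (scl ((- 1) ^ size (?G \<theta> c k)) (star_h_basis Q (?G \<theta> c 1) (?G \<theta> c 2))))
        = (\<Sum>\<theta>\<in>matchings lab X. \<Sum>c\<in>colourings {1, 2} (f \<circ> \<theta>) X.
            scl (wt (sg c) lab X \<theta> * (- 1) ^ card (orbit (f \<circ> \<theta>) ` {x \<in> X. c x = k}))
              (prod_sum (f \<circ> \<theta>) (cut_label \<theta> lab) c X :: _ \<Rightarrow>\<^sub>0 'k poly))"
      proof (intro sum.cong refl)
        fix \<theta> c assume \<theta>: "\<theta> \<in> matchings lab X" and c: "c \<in> colourings {1, 2} (f \<circ> \<theta>) X"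
        have cX: "c x \<in> {1, 2} \<and> c ((f \<circ> \<theta>) x) = c x" if "x \<in> X" for x
          using c that by (auto simp: colourings_def)
        have star: "star_h_basis Q (?G \<theta> c 1) (?G \<theta> c 2) = (prod_sum (f \<circ> \<theta>) (cut_label \<theta> lab) c X :: _ \<Rightarrow>\<^sub>0 'k poly)"
          by (rule star_h_basis_coll[where e = c and X = X, OF wf wfc_glue[OF w \<theta>]]) (rule cX)
        show "scl (wt (sg c) lab X \<theta>) (scl ((- 1) ^ size (?G \<theta> c k)) (star_h_basis Q (?G \<theta> c 1) (?G \<theta> c 2)))
          = scl (wt (sg c) lab X \<theta> * (- 1) ^ card (orbit (f \<circ> \<theta>) ` {x \<in> X. c x = k}))
              (prod_sum (f \<circ> \<theta>) (cut_label \<theta> lab) c X :: _ \<Rightarrow>\<^sub>0 'k poly)"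
          unfolding star size_coll scl_scl ..
      qed
      also have "\<dots> = 0" by (rule antipode_sum[OF w X k])
      finally show ?thesis .
    qed
    have "mult_map (star_h Q) (tensor_map antipode_h id (Delta_h_basis Q P)) = (0 :: _ \<Rightarrow>\<^sub>0 'k poly)"
      unfolding D klinear_sum[OF lin] klinearD(2)[OF lin] mult_basis by (rule state) simp
    moreover have "mult_map (star_h Q) (tensor_map id antipode_h (Delta_h_basis Q P)) = (0 :: _ \<Rightarrow>\<^sub>0 'k poly)"
      unfolding D klinear_sum[OF lin] klinearD(2)[OF lin] mult_basis by (rule state) simp
    ultimately show ?thesis using False by simp
  qed
  then show "mult_map (star_h Q) (tensor_map antipode_h id (Delta_h_basis Q P)) = scl (if P = {#} then 1 else 0) (basis_vec {#} :: _ \<Rightarrow>\<^sub>0 'k poly)"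
    and "mult_map (star_h Q) (tensor_map id antipode_h (Delta_h_basis Q P)) = scl (if P = {#} then 1 else 0) (basis_vec {#} :: _ \<Rightarrow>\<^sub>0 'k poly)"
    by blast+
qed

theorem mainTheorem8:
  fixes Q :: "('v, 'e) pre_digraph"
  assumes "wf_digraph Q"
  shows "free_hopf_algebra_on (collections Q)
           (star_h Q :: (('v, 'e) collection \<Rightarrow>\<^sub>0 'k::field_char_0 poly) \<Rightarrow> _)
           unit_h (Delta_h Q) counit_h antipode_h
       \<and> (\<forall>p \<in> free_mod (collections Q).
             antipode_h (antipode_h (p :: ('v, 'e) collection \<Rightarrow>\<^sub>0 'k poly)) = p)"
proof (intro conjI ballI antipode_h_antipode_h)
  note wf = assms
  have counit: "counit_h = (\<lambda>p :: ('v, 'e) collection \<Rightarrow>\<^sub>0 'k poly. \<Sum>b\<in>Poly_Mapping.keys p. Poly_Mapping.lookup p b * (if b = {#} then 1 else 0))"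
    by (rule ext) (simp only: counit_h_def)
  show "free_hopf_algebra_on (collections Q)
           (star_h Q :: (('v, 'e) collection \<Rightarrow>\<^sub>0 'k::field_char_0 poly) \<Rightarrow> _)
           unit_h (Delta_h Q) counit_h antipode_h"
    unfolding counit unit_h_def star_h_def Delta_h_def antipode_h_def
  proof (rule free_hopf_algebra_on_basisI, fold star_h_def Delta_h_def antipode_h_def)
    fix a b c :: "('v, 'e) collection" assume a: "a \<in> collections Q" and b: "b \<in> collections Q" and c: "c \<in> collections Q"
    show "star_h Q (star_h_basis Q a b) (basis_vec c) = star_h Q (basis_vec a) (star_h_basis Q b c :: _ \<Rightarrow>\<^sub>0 'k poly)"
      unfolding star_h_def bilin_ext_def by (simp add: star_h_basis_assoc[OF wf a b c])
  next
    fix a b assume "a \<in> collections Q" "b \<in> collections Q"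
    then show "Delta_h Q (star_h_basis Q a b) = (tensor_mult (star_h Q) (Delta_h_basis Q a) (Delta_h_basis Q b) :: _ \<Rightarrow>\<^sub>0 'k poly)"
      unfolding Delta_h_def by (rule Delta_h_basis_star[OF wf])
  next
    fix a assume a: "a \<in> collections Q"
    show "scl ((- 1) ^ size a) (basis_vec a) \<in> free_mod (collections Q)"
      by (rule scl_in_free_mod[OF basis_in_free_mod[OF a]])
  qed (use wf in \<open>simp_all only: empty_in_collections star_h_basis_closed star_h_basis_unit Delta_h_basis_closed
      Delta_h_basis_coassoc Delta_h_basis_counit Delta_h_basis_unit star_h_basis_counit if_True refl
      Delta_h_basis_star antipode_h_identity Delta_h_def[symmetric]\<close>)
qed

end
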